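(* Let $n\geq2$, let $p$ be an integer with $0\leq p\leq\frac n2$, and let $2-n+2p<a<1$. Then for $f\in\dot{H}^{\frac{1-a}{2},p}(\mathbb{R}^{n-1})$ with $$\widehat f(\xi')=\widehat f_{\rm I}(\xi')+\widehat{\xi}'\wedge\widehat f_{\rm II}(\xi')$$ we have $$\begin{aligned}\widehat{P_{a,p}f}(\xi',\xi_n)={}&\frac{\sqrt2\,\Gamma(\frac{2-a}{2})}{(n-2p-a)\Gamma(\frac{1-a}{2})}|\xi'|^{1-a}|\xi|^{a-4}\Big[(n-2p-a)|\xi|^2\widehat f_{\rm I}(\xi')\\&+\big[(n-2p-a+2)|\xi'|^2+(n-2p+a-2)\xi_n^2\big]\widehat{\xi}'\wedge\widehat f_{\rm II}(\xi')\\&+2(2-a)\xi_n|\xi'|\,e_n\wedge\widehat f_{\rm II}(\xi')\Big].\end{aligned}$$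
   Context: Smooth $p$-forms on $\mathbb{R}^m$ are identified with $C^\infty(\mathbb{R}^m)\otimes\bigwedge^p\mathbb{C}^m$ ($e_j\leftrightarrow dx_j$). $\varepsilon_x$ and $i_x$ denote exterior and interior multiplication by $x$. We write $x=(x',x_n)$, $\xi=(\xi',\xi_n)\in\mathbb{R}^n$ with $x',\xi'\in\mathbb{R}^{n-1}$, identify $\mathbb{R}^{n-1}$ with $\{x_n=0\}\subseteq\mathbb{R}^n$, and $\bigwedge^p\mathbb{C}^{n-1}\subseteq\bigwedge^p\mathbb{C}^n$. The symbol $\widehat{\xi}'$ denotes the unit vector $\xi'/|\xi'|$, and $\widehat f_{\rm I}(\xi')\in\bigwedge^p\mathbb{C}^{n-1}$, $\widehat f_{\rm II}(\xi')\in\bigwedge^{p-1}\mathbb{C}^{n-1}$ are the unique components in the decomposition of $\widehat f(\xi')$ with $i_{\xi'}\widehat f_{\rm I}(\xi')=0$ and $i_{\xi'}\widehat f_{\rm II}(\xi')=0$. Fourier transform: $\widehat u(\xi)=(2\pi)^{-m/2}\int_{\mathbb{R}^m}e^{-ix\cdot\xi}u(x)\,dx$ on $\mathbb{R}^m$, extended to tempered distributions. Sobolev spaces: $$\dot{H}^{s,p}(\mathbb{R}^m)=\Big\{u\in\mathcal{S}'(\mathbb{R}^m)\otimes\textstyle\bigwedge^p\mathbb{C}^m:\int_{\mathbb{R}^m}|\xi|^{2s}\|\widehat u(\xi)\|^2\,d\xi<\infty\Big\},$$ where $\|\cdot\|$ is the standard Hermitian norm on $\bigwedge^p\mathbb{C}^m$.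 Poisson transform: for bounded $f:\mathbb{R}^{n-1}\to\bigwedge^p\mathbb{C}^{n-1}$, $$P_{a,p}f(x)=c_{a,p}\int_{\mathbb{R}^{n-1}}\frac{|x_n|^{1-a}}{(|x'-y|^2+x_n^2)^{\frac{n-a+2}{2}}}\big(i_{x-y}\varepsilon_{x-y}-\varepsilon_{x-y}i_{x-y}\big)f(y)\,dy,\qquad c_{a,p}=\frac{2\,\Gamma(\frac{n-a+2}{2})}{\pi^{\frac{n-1}{2}}\,\Gamma(\frac{1-a}{2})\,(n-2p-a)},$$ and $P_{a,p}$ also denotes its continuous extension (from Schwartz forms) $\dot{H}^{\frac{1-a}{2},p}(\mathbb{R}^{n-1})\to\dot{H}^{\frac{2-a}{2},p}(\mathbb{R}^n)$. *)

theory Defs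
  imports "HOL-Analysis.Analysis" "HOL-Library.Option_ord"
begin

section \<open>The exterior algebra of a coordinate space\<close>

text \<open>
  The complexified exterior algebra on the coordinates \<open>'k\<close> is \<open>complex ^ ('k set)\<close>: the coordinate
  at \<open>I = {i\<^sub>1 < \<dots> < i\<^sub>r}\<close> is the coefficient of the basis vector
  \<open>e\<^sub>I = e\<^bsub>i\<^sub>1\<^esub> \<and> \<dots> \<and> e\<^bsub>i\<^sub>r\<^esub>\<close>. The vectors \<open>e\<^sub>I\<close> are orthonormal for the standard Hermitian
  structure, so the library norm on this type is the standard Hermitian norm. The order on \<open>'k\<close>
  only fixes the signs of the basis vectors \<open>e\<^sub>I\<close>.
\<close>

text \<open>The degree is an integer, so that forms of degree \<open>-1\<close> vanish.\<close>

definition ext_deg :: "int \<Rightarrow> (complex ^ ('k::finite set)) set" where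
  "ext_deg p = {w. \<forall>I. w $ I \<noteq> 0 \<longrightarrow> int (card I) = p}"

text \<open>
  Both multiplications are read off from \<open>e\<^sub>j \<and> e\<^sub>K = \<sigma> e\<^bsub>K \<union> {j}\<^esub>\<close> for \<open>j \<notin> K\<close> and
  \<open>i\<^bsub>e\<^sub>j\<^esub> e\<^sub>K = \<sigma> e\<^bsub>K - {j}\<^esub>\<close> for \<open>j \<in> K\<close>, with \<open>\<sigma> = ext_sign j K\<close>; note that
  \<open>ext_sign j\<close> does not depend on whether \<open>j\<close> belongs to the set.
\<close>

definition ext_sign :: "'k::{finite,linorder} \<Rightarrow> 'k set \<Rightarrow> real" where
  "ext_sign j I = (- 1) ^ card {i \<in> I. i < j}"

definition ext_mult ::
    "real ^ ('k::{finite,linorder}) \<Rightarrow> complex ^ ('k set) \<Rightarrow> complex ^ ('k set)" where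
  "ext_mult x w = (\<chi> I. \<Sum>j\<in>I. (x $ j * ext_sign j I) *\<^sub>R w $ (I - {j}))"

definition int_mult ::
    "real ^ ('k::{finite,linorder}) \<Rightarrow> complex ^ ('k set) \<Rightarrow> complex ^ ('k set)" where
  "int_mult x w = (\<chi> I. \<Sum>j\<in>- I. (x $ j * ext_sign j I) *\<^sub>R w $ (insert j I))"

text \<open>
  With \<open>n - 1 = CARD('m)\<close>, the space \<open>\<real>\<^sup>n\<close> is represented by pairs \<open>(x', x\<^sub>n)\<close> of type
  \<open>(real ^ 'm) \<times> real\<close>. Its coordinates are indexed by \<open>'m option\<close>: \<open>Some j\<close> for the coordinates of
  \<open>x'\<close> and \<open>None\<close> for \<open>x\<^sub>n\<close>. (In the library order \<open>None\<close> is the least element, so in the basis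
  \<open>e\<^sub>I\<close> the factor \<open>e\<^sub>n\<close> is written first.)
\<close>

definition coords :: "(real ^ 'm) \<times> real \<Rightarrow> real ^ ('m::finite option)" where
  "coords x = (\<chi> i. case i of None \<Rightarrow> snd x | Some j \<Rightarrow> fst x $ j)"

definition e_last :: "real ^ ('m::finite option)" where
  "e_last = axis None 1"

text \<open>The inclusion of the exterior algebra in \<open>n - 1\<close> variables, \<open>e\<^sub>I \<mapsto> e\<^bsub>Some ` I\<^esub>\<close>.\<close>

definition ext_incl :: "complex ^ ('m::finite set) \<Rightarrow> complex ^ ('m option set)" where
  "ext_incl w = (\<chi> J. if None \<in> J then 0 else w $ (Some -` J))"


section \<open>Schwartz functions and tempered distributions\<close>

definition dir_deriv ::
    "'a::euclidean_space \<Rightarrow> ('a \<Rightarrow> 'b::real_normed_vector) \<Rightarrow> 'a \<Rightarrow> 'b" where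
  "dir_deriv b f = (\<lambda>x. frechet_derivative f (at x) b)"

definition iter_deriv ::
    "'a::euclidean_space list \<Rightarrow> ('a \<Rightarrow> 'b::real_normed_vector) \<Rightarrow> 'a \<Rightarrow> 'b" where
  "iter_deriv bs f = foldr dir_deriv bs f"

definition schwartz :: "('a::euclidean_space \<Rightarrow> 'b::real_normed_vector) set" where
  "schwartz = {f. \<forall>bs. set bs \<subseteq> Basis \<longrightarrow>
     (\<forall>x. iter_deriv bs f differentiable (at x)) \<and>
     (\<forall>k::nat. bounded (range (\<lambda>x. norm x ^ k *\<^sub>R iter_deriv bs f x)))}"

definition schwartz_norm ::
    "nat \<Rightarrow> ('a::euclidean_space \<Rightarrow> 'b::real_normed_vector) \<Rightarrow> real" where
  "schwartz_norm N f =
     (\<Sum>bs | set bs \<subseteq> Basis \<and> length bs \<le> N. SUP x. (1 + norm x) ^ N * norm (iter_deriv bs f x))"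

text \<open>
  Tempered distributions with values in a complex subspace \<open>V\<close> are the continuous complex-linear
  maps from the scalar Schwartz functions to \<open>V\<close>. As HOL functions are total, they are normalised
  to vanish off the Schwartz space, so that equality of functions is equality of distributions.
\<close>

definition tempered ::
    "(complex ^ 'i) set \<Rightarrow> (('a::euclidean_space \<Rightarrow> complex) \<Rightarrow> complex ^ ('i::finite)) set" where
  "tempered V = {u.
     (\<forall>\<phi>. \<phi> \<notin> schwartz \<longrightarrow> u \<phi> = 0) \<and>
     (\<forall>\<phi>\<in>schwartz. u \<phi> \<in> V) \<and>
     (\<forall>\<phi>\<in>schwartz. \<forall>\<psi>\<in>schwartz. u (\<lambda>x. \<phi> x + \<psi> x) = u \<phi> + u \<psi>) \<and>
     (\<forall>c. \<forall>\<phi>\<in>schwartz. u (\<lambda>x. c * \<phi> x) = c *s u \<phi>) \<and>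
     (\<exists>N C. \<forall>\<phi>\<in>schwartz. norm (u \<phi>) \<le> C * schwartz_norm N \<phi>)}"

definition fun_dist ::
    "('a::euclidean_space \<Rightarrow> complex ^ 'i) \<Rightarrow> ('a \<Rightarrow> complex) \<Rightarrow> complex ^ ('i::finite)" where
  "fun_dist g \<phi> = (if \<phi> \<in> schwartz then LINT x|lebesgue. \<phi> x *s g x else 0)"

text \<open>
  The distribution \<open>u\<close> is given by the measurable function \<open>g\<close>. Integrability is required
  explicitly because the library integral of a non-integrable function is \<open>0\<close>.
\<close>

definition represented_by ::
    "(('a::euclidean_space \<Rightarrow> complex) \<Rightarrow> complex ^ 'i) \<Rightarrow> ('a \<Rightarrow> complex ^ ('i::finite)) \<Rightarrow> bool" where
  "represented_by u g \<longleftrightarrow>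
     g \<in> borel_measurable lebesgue \<and>
     (\<forall>\<phi>\<in>schwartz. integrable lebesgue (\<lambda>x. \<phi> x *s g x)) \<and>
     u = fun_dist g"

definition fourier :: "('a::euclidean_space \<Rightarrow> complex) \<Rightarrow> 'a \<Rightarrow> complex" where
  "fourier \<phi> \<xi> = of_real ((2 * pi) powr (- real DIM('a) / 2)) *
     (LINT x|lebesgue. exp (- (\<i> * of_real (x \<bullet> \<xi>))) * \<phi> x)"

definition fourier_dist ::
    "(('a::euclidean_space \<Rightarrow> complex) \<Rightarrow> complex ^ 'i) \<Rightarrow> ('a \<Rightarrow> complex) \<Rightarrow> complex ^ ('i::finite)" where
  "fourier_dist u \<phi> = (if \<phi> \<in> schwartz then u (fourier \<phi>) else 0)"


section \<open>Homogeneous Sobolev spaces\<close>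

text \<open>
  The finiteness condition presupposes that the Fourier transform is a function. On an
  \<open>m\<close>-dimensional space it is used for \<open>0 < s < m/2\<close>, where every measurable function with finite
  weighted integral is integrable against all Schwartz functions.
\<close>

definition hdot ::
    "real \<Rightarrow> (complex ^ 'i) set \<Rightarrow> (('a::euclidean_space \<Rightarrow> complex) \<Rightarrow> complex ^ ('i::finite)) set" where
  "hdot s V = {u \<in> tempered V. \<exists>g. represented_by (fourier_dist u) g \<and>
     (\<integral>\<^sup>+ \<xi>. ennreal (norm \<xi> powr (2 * s) * (norm (g \<xi>))\<^sup>2) \<partial>lebesgue) < \<infinity>}"

text \<open>A function representing the Fourier transform (when there is one), unique up to null sets.\<close>

definition fourier_fun ::
    "(('a::euclidean_space \<Rightarrow> complex) \<Rightarrow> complex ^ 'i) \<Rightarrow> 'a \<Rightarrow> complex ^ ('i::finite)" where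
  "fourier_fun u = (SOME g. represented_by (fourier_dist u) g)"

definition hdot_dist ::
    "real \<Rightarrow> (('a::euclidean_space \<Rightarrow> complex) \<Rightarrow> complex ^ 'i)
      \<Rightarrow> (('a \<Rightarrow> complex) \<Rightarrow> complex ^ ('i::finite)) \<Rightarrow> real" where
  "hdot_dist s u v = sqrt (LINT \<xi>|lebesgue.
     norm \<xi> powr (2 * s) * (norm (fourier_fun u \<xi> - fourier_fun v \<xi>))\<^sup>2)"


section \<open>The Poisson transform\<close>

definition poisson_const :: "nat \<Rightarrow> real \<Rightarrow> int \<Rightarrow> real" where
  "poisson_const n a p =
     2 * Gamma ((real n - a + 2) / 2) /
     (pi powr ((real n - 1) / 2) * Gamma ((1 - a) / 2) * (real n - 2 * real_of_int p - a))"

definition poisson_integral ::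
    "real \<Rightarrow> int \<Rightarrow> (real ^ ('m::{finite,linorder}) \<Rightarrow> complex ^ ('m set))
      \<Rightarrow> (real ^ ('m::{finite,linorder})) \<times> real \<Rightarrow> complex ^ ('m option set)" where
  "poisson_integral a p f x =
     (let n = CARD('m) + 1 in
      poisson_const n a p *\<^sub>R
      (LINT y|lebesgue.
        (let z = coords (x - (y, 0)); w = ext_incl (f y) in
         (\<bar>snd x\<bar> powr (1 - a) /
            ((norm (fst x - y))\<^sup>2 + (snd x)\<^sup>2) powr ((real n - a + 2) / 2)) *\<^sub>R
         (int_mult z (ext_mult z w) - ext_mult z (int_mult z w)))))"

text \<open>
  A continuous map between the homogeneous Sobolev spaces that extends the Poisson transform of
  Schwartz forms. Its values on the Sobolev space are unique by density of the Schwartz forms.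
\<close>

definition is_poisson_extension ::
    "real \<Rightarrow> int \<Rightarrow> (((real ^ ('m::{finite,linorder}) \<Rightarrow> complex) \<Rightarrow> complex ^ ('m set))
      \<Rightarrow> (((real ^ ('m::{finite,linorder})) \<times> real \<Rightarrow> complex) \<Rightarrow> complex ^ ('m option set))) \<Rightarrow> bool" where
  "is_poisson_extension a p P \<longleftrightarrow>
     (\<forall>u \<in> hdot ((1 - a) / 2) (ext_deg p). P u \<in> hdot ((2 - a) / 2) (ext_deg p)) \<and>
     (\<forall>u \<in> hdot ((1 - a) / 2) (ext_deg p). \<forall>\<epsilon>>0. \<exists>\<delta>>0. \<forall>v \<in> hdot ((1 - a) / 2) (ext_deg p).
        hdot_dist ((1 - a) / 2) v u < \<delta> \<longrightarrow> hdot_dist ((2 - a) / 2) (P v) (P u) < \<epsilon>) \<and>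
     (\<forall>f \<in> schwartz. (\<forall>y. f y \<in> ext_deg p) \<longrightarrow>
        represented_by (P (fun_dist f)) (poisson_integral a p f))"

definition poisson ::
    "real \<Rightarrow> int \<Rightarrow> ((real ^ ('m::{finite,linorder}) \<Rightarrow> complex) \<Rightarrow> complex ^ ('m set))
      \<Rightarrow> (((real ^ ('m::{finite,linorder})) \<times> real \<Rightarrow> complex) \<Rightarrow> complex ^ ('m option set))" where
  "poisson a p = (SOME P. is_poisson_extension a p P)"

end

theory Submission
  imports Defs "HOL-Probability.Characteristic_Functions" "HOL-Real_Asymp.Real_Asymp"
begin

text \<open>
  For a Schwartz form \<open>f\<close> and fixed \<open>x\<^sub>n \<noteq> 0\<close> the Poisson integral is a convolution in \<open>x'\<close>. Writing
  \<open>w powr -b\<close> as a Gamma integral of Gaussians turns the Fourier transform of its kernel into a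
  modified Bessel function of \<open>|x\<^sub>n| |\<xi>'|\<close>; the quadratic numerator \<open>i\<^sub>x \<epsilon>\<^sub>x - \<epsilon>\<^sub>x i\<^sub>x\<close> produces the terms
  \<open>\<xi>' \<and> i\<^bsub>\<xi>'\<^esub>\<close> and \<open>e\<^sub>n \<and> i\<^bsub>\<xi>'\<^esub>\<close>, because \<open>\<Sum>\<^sub>j e\<^sub>j \<and> i\<^bsub>e\<^sub>j\<^esub>\<close> is multiplication by \<open>p\<close> on \<open>p\<close>-forms. The same
  Gamma integral, read with \<open>x\<^sub>n\<close> and \<open>|\<xi>'|\<close> exchanged, shows that these Bessel functions are the
  transforms in \<open>\<xi>\<^sub>n\<close> of powers of \<open>|\<xi>'|\<^sup>2 + \<xi>\<^sub>n\<^sup>2\<close>. Hence \<open>P f\<close> is the inverse Fourier transform of an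
  explicit multiplier \<open>T\<close> applied to the transform of \<open>f\<close>.

  The multiplier is bounded by a constant times \<open>|\<xi>'| powr (1 - a) * |\<xi>| powr (a - 2)\<close>, and integrating the square
  against \<open>|\<xi>| powr (2 - a)\<close> over \<open>\<xi>\<^sub>n\<close> gives back \<open>|\<xi>'| powr (1 - a)\<close>. So \<open>T\<close> defines a continuous extension
  on the whole Sobolev space. Schwartz forms are dense, so every continuous extension has the same
  Fourier transform almost everywhere, and the theorem is \<open>T\<close> evaluated on \<open>f\<^sub>I + \<xi>' / |\<xi>'| \<and> f\<^bsub>II\<^esub>\<close>.
\<close>

section \<open>Exterior algebra\<close>

text \<open>\<open>poisson\<close> is a choice, so nothing is known about it until some continuous
  extension exists. Existence and uniqueness are therefore separate tasks, both settled on the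
  Fourier side, where Sobolev norms are weighted square integrals. Put nu = (1 - a)/2 and beta = (2
  - a)/2 = nu + 1/2. A kernel transform lowers the exponent by half the dimension; in the n - 1
  variables x' and in the single variable xi_n it ends at the same order nu. This coincidence, with
  the scaling law that leaves a Bessel integral depending on |x_n| |xi'| only, allows the exchange.
  The condition a < 1 says nu > 0 and gives integrable kernels. The denominator n - 2p - a arises as
  2 (b - p) with b = (n - 1)/2 + nu: the term |x|^2 of the numerator contributes b, the trace of the
  quadratic term takes away p. Order nu - 1 occurs as well and may be zero or negative; its integral
  is controlled only at nonzero frequency, so the identities that involve it leave out the origin, a
  null set.\<close>

lemma vec_scaleR_eq_scale: "r *\<^sub>R (w :: complex ^ 'i) = complex_of_real r *s w"
  by (simp add: vec_eq_iff) (simp add: scaleR_conv_of_real)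

lemma norm_vector_scalar_mult_complex: "norm (c *s (w :: complex ^ 'i::finite)) = cmod c * norm w"
  by (simp add: norm_vec_def norm_mult L2_set_right_distrib)

section \<open>Signs, the Clifford relation and the counting of degrees\<close>

lemma ext_sign_square [simp]: "ext_sign j I * ext_sign j I = 1"
  by (simp add: ext_sign_def flip: power_mult_distrib)

lemma ext_sign_remove:
  fixes j k :: "'k::{finite,linorder}"
  assumes "j \<in> I"
  shows "ext_sign k (I - {j}) = (if j < k then - ext_sign k I else ext_sign k I)"
proof (cases "j < k")
  case True
  have "{i \<in> I. i < k} = insert j {i \<in> I - {j}. i < k}"
    using True assms by auto
  then have "card {i \<in> I. i < k} = Suc (card {i \<in> I - {j}. i < k})"
    by simp
  then show ?thesis
    using True by (simp add: ext_sign_def)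
next
  case False
  then have "{i \<in> I. i < k} = {i \<in> I - {j}. i < k}"
    by auto
  then show ?thesis
    using False by (simp add: ext_sign_def)
qed

lemma ext_sign_insert:
  fixes j k :: "'k::{finite,linorder}"
  assumes "j \<notin> I"
  shows "ext_sign k (insert j I) = (if j < k then - ext_sign k I else ext_sign k I)"
  using ext_sign_remove[of j "insert j I" k] assms by (auto split: if_splits)

lemma bilinear_ext_mult: "bilinear (ext_mult :: real ^ 'k::{finite,linorder} \<Rightarrow> _)"
  unfolding bilinear_def
  by (intro conjI allI linearI)
     (simp_all add: ext_mult_def vec_eq_iff sum.distrib scaleR_sum_right algebra_simps)

lemma bilinear_int_mult: "bilinear (int_mult :: real ^ 'k::{finite,linorder} \<Rightarrow> _)"
  unfolding bilinear_def
  by (intro conjI allI linearI)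
     (simp_all add: int_mult_def vec_eq_iff sum.distrib scaleR_sum_right algebra_simps)

interpretation ext_mult: bounded_bilinear "ext_mult :: real ^ 'k::{finite,linorder} \<Rightarrow> _"
  using bilinear_ext_mult by (simp add: bilinear_conv_bounded_bilinear)

interpretation int_mult: bounded_bilinear "int_mult :: real ^ 'k::{finite,linorder} \<Rightarrow> _"
  using bilinear_int_mult by (simp add: bilinear_conv_bounded_bilinear)

lemma linear_ext_incl: "linear ext_incl"
  by (intro linearI) (simp_all add: ext_incl_def vec_eq_iff)

lemma bounded_linear_ext_incl: "bounded_linear ext_incl"
  using linear_ext_incl by (rule linear_conv_bounded_linear[THEN iffD1])

lemmas ext_incl_add = linear_add[OF linear_ext_incl]
  and ext_incl_diff = linear_diff[OF linear_ext_incl]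
  and ext_incl_scaleR = linear_cmul[OF linear_ext_incl]
  and ext_incl_0 = linear_0[OF linear_ext_incl]
  and ext_incl_sum = linear_sum[OF linear_ext_incl]

lemma ext_mult_vector_scalar_mult: "ext_mult x (c *s w) = c *s ext_mult x w"
  by (simp add: ext_mult_def vec_eq_iff sum_distrib_left)

lemma int_mult_vector_scalar_mult: "int_mult x (c *s w) = c *s int_mult x w"
  by (simp add: int_mult_def vec_eq_iff sum_distrib_left)

lemma ext_incl_vector_scalar_mult: "ext_incl (c *s w) = c *s ext_incl w"
  by (simp add: ext_incl_def vec_eq_iff)

text \<open>This is the Clifford relation. Terms that exchange an index \<open>j\<close> in
  \<open>I\<close> for an index \<open>k\<close> outside \<open>I\<close> occur in both orders of
  multiplication with opposite signs: either \<open>j\<close> alters the sign of \<open>k\<close> or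
  \<open>k\<close> that of \<open>j\<close>, according to which is smaller, so exactly one flip
  happens. The diagonal terms remain; the indices in \<open>I\<close> come from one order, those
  outside from the other, and together they give the full inner product.\<close>

lemma ext_int_anticommute:
  fixes x y :: "real ^ 'k::{finite,linorder}"
  shows "ext_mult x (int_mult y w) + int_mult y (ext_mult x w) = (x \<bullet> y) *\<^sub>R w"
proof (subst vec_eq_iff, rule allI)
  fix I :: "'k set"
  let ?s = "\<lambda>j. ext_sign j I"
  have 1: "ext_mult x (int_mult y w) $ I =
      (\<Sum>j\<in>I. \<Sum>k\<in>-I. (x$j * ?s j * y$k * ext_sign k (I - {j})) *\<^sub>R w $ (insert k (I - {j})))
      + (\<Sum>j\<in>I. (x$j * y$j) *\<^sub>R w $ I)" (is "_ = ?A + ?B")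
  proof -
    have "ext_mult x (int_mult y w) $ I =
      (\<Sum>j\<in>I. (x$j * ?s j) *\<^sub>R (\<Sum>k\<in>-(I-{j}). (y$k * ext_sign k (I - {j})) *\<^sub>R w $ (insert k (I - {j}))))"
      by (simp add: ext_mult_def int_mult_def)
    also have "\<dots> = (\<Sum>j\<in>I. (\<Sum>k\<in>-I. (x$j * ?s j * y$k * ext_sign k (I - {j})) *\<^sub>R w $ (insert k (I - {j})))
         + (x$j * y$j) *\<^sub>R w $ I)"
    proof (intro sum.cong refl)
      fix j assume j: "j \<in> I"
      then have "- (I - {j}) = insert j (-I)" "j \<notin> - I" by auto
      moreover have "x$j * ?s j * (y$j * ext_sign j (I - {j})) = x$j * y$j * (?s j * ?s j)"
        using j by (subst ext_sign_remove) auto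
      ultimately show "(x$j * ?s j) *\<^sub>R (\<Sum>k\<in>-(I-{j}). (y$k * ext_sign k (I - {j})) *\<^sub>R w $ (insert k (I - {j})))
        = (\<Sum>k\<in>-I. (x$j * ?s j * y$k * ext_sign k (I - {j})) *\<^sub>R w $ (insert k (I - {j})))
         + (x$j * y$j) *\<^sub>R w $ I"
        using j by (simp add: scaleR_add_right scaleR_sum_right mult.assoc insert_absorb)
    qed
    finally show ?thesis by (simp add: sum.distrib)
  qed
  have 2: "int_mult y (ext_mult x w) $ I =
      (\<Sum>k\<in>-I. \<Sum>j\<in>I. (y$k * ?s k * x$j * ext_sign j (insert k I)) *\<^sub>R w $ (insert k I - {j}))
      + (\<Sum>k\<in>-I. (x$k * y$k) *\<^sub>R w $ I)" (is "_ = ?C + ?D")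
  proof -
    have "int_mult y (ext_mult x w) $ I =
      (\<Sum>k\<in>-I. (y$k * ?s k) *\<^sub>R (\<Sum>j\<in>insert k I. (x$j * ext_sign j (insert k I)) *\<^sub>R w $ (insert k I - {j})))"
      by (simp add: ext_mult_def int_mult_def)
    also have "\<dots> = (\<Sum>k\<in>-I. (\<Sum>j\<in>I. (y$k * ?s k * x$j * ext_sign j (insert k I)) *\<^sub>R w $ (insert k I - {j}))
         + (x$k * y$k) *\<^sub>R w $ I)"
    proof (intro sum.cong refl)
      fix k assume k: "k \<in> - I"
      moreover have "y$k * ?s k * (x$k * ext_sign k (insert k I)) = x$k * y$k * (?s k * ?s k)"
        using k by (subst ext_sign_insert) auto
      ultimately show "(y$k * ?s k) *\<^sub>R (\<Sum>j\<in>insert k I. (x$j * ext_sign j (insert k I)) *\<^sub>R w $ (insert k I - {j}))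
        = (\<Sum>j\<in>I. (y$k * ?s k * x$j * ext_sign j (insert k I)) *\<^sub>R w $ (insert k I - {j}))
         + (x$k * y$k) *\<^sub>R w $ I"
        by (simp add: scaleR_add_right scaleR_sum_right mult.assoc)
    qed
    finally show ?thesis by (simp add: sum.distrib)
  qed
  have "?A = (\<Sum>k\<in>-I. \<Sum>j\<in>I. (x$j * ?s j * y$k * ext_sign k (I - {j})) *\<^sub>R w $ (insert k (I - {j})))"
    by (rule sum.swap)
  also have "\<dots> = (\<Sum>k\<in>-I. \<Sum>j\<in>I. - ((y$k * ?s k * x$j * ext_sign j (insert k I)) *\<^sub>R w $ (insert k I - {j})))"
  proof (intro sum.cong refl)
    fix k j assume kj: "k \<in> - I" "j \<in> I"
    then have ne: "k \<noteq> j" by auto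
    then have "insert k (I - {j}) = insert k I - {j}" by auto
    moreover have "x$j * ?s j * y$k * ext_sign k (I - {j}) = - (y$k * ?s k * x$j * ext_sign j (insert k I))"
      using kj ne by (cases j k rule: linorder_cases) (simp_all add: ext_sign_remove ext_sign_insert)
    ultimately show "(x$j * ?s j * y$k * ext_sign k (I - {j})) *\<^sub>R w $ (insert k (I - {j}))
      = - ((y$k * ?s k * x$j * ext_sign j (insert k I)) *\<^sub>R w $ (insert k I - {j}))"
      by simp
  qed
  also have "\<dots> = - ?C" by (simp add: sum_negf)
  finally have AC: "?A + ?C = 0" by simp
  have "?B + ?D = (\<Sum>j\<in>I \<union> -I. (x$j * y$j) *\<^sub>R w $ I)"
    by (subst sum.union_disjoint) auto
  also have "\<dots> = ((x \<bullet> y) *\<^sub>R w) $ I"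
    by (simp add: inner_vec_def scaleR_sum_left Compl_partition)
  finally show "(ext_mult x (int_mult y w) + int_mult y (ext_mult x w)) $ I = ((x \<bullet> y) *\<^sub>R w) $ I"
    using AC 1 2 by (simp add: algebra_simps)
qed

text \<open>Each summand is the projection onto the basis vectors whose index set contains
  \<open>j\<close>, so the basis vector of \<open>I\<close> is counted \<open>card I\<close> times.
  The sum is the trace part of the quadratic numerator and accounts for the degree in the
  normalising constant.\<close>

lemma sum_ext_int_axis:
  fixes w :: "complex ^ ('k::{finite,linorder} set)"
  assumes "w \<in> ext_deg p"
  shows "(\<Sum>j\<in>UNIV. ext_mult (axis j 1) (int_mult (axis j 1) w)) = real_of_int p *\<^sub>R w"
proof (subst vec_eq_iff, rule allI)
  fix I :: "'k set"
  have *: "ext_mult (axis j 1) (int_mult (axis j 1) w) $ I = (if j \<in> I then w $ I else 0)" for j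
  proof -
    have "ext_mult (axis j 1) (int_mult (axis j 1) w) $ I
       = (\<Sum>i\<in>I. if i = j then ext_sign j I *\<^sub>R int_mult (axis j 1) w $ (I - {j}) else 0)"
      unfolding ext_mult_def vec_lambda_beta by (intro sum.cong refl) (simp add: axis_def)
    also have "\<dots> = (if j \<in> I then ext_sign j I *\<^sub>R int_mult (axis j 1) w $ (I - {j}) else 0)"
      by simp
    also have "int_mult (axis j 1) w $ (I - {j}) =
       (\<Sum>i\<in>-(I-{j}). if i = j then ext_sign j (I-{j}) *\<^sub>R w $ insert j (I - {j}) else 0)"
      unfolding int_mult_def vec_lambda_beta by (intro sum.cong refl) (simp add: axis_def)
    finally show ?thesis
      by (auto simp: ext_sign_remove insert_absorb)
  qed
  have "(\<Sum>j\<in>UNIV. ext_mult (axis j 1) (int_mult (axis j 1) w)) $ I = of_nat (card I) * w $ I"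
    by (simp add: * sum.If_cases)
  also have "\<dots> = (real_of_int p *\<^sub>R w) $ I"
  proof (cases "w $ I = 0")
    case False
    then have "real_of_int p = real (card I)"
      using assms by (auto simp: ext_deg_def)
    then show ?thesis
      by (simp only: vector_scaleR_component) (simp only: scaleR_conv_of_real of_real_of_nat_eq)
  qed simp
  finally show "(\<Sum>j\<in>UNIV. ext_mult (axis j 1) (int_mult (axis j 1) w)) $ I = (real_of_int p *\<^sub>R w) $ I" .
qed

lemma ext_mult_expand: "ext_mult x w = (\<Sum>j\<in>UNIV. x $ j *\<^sub>R ext_mult (axis j 1) w)"
  by (subst (1) basis_expansion[of x, symmetric, unfolded scalar_mult_eq_scaleR])
     (simp add: ext_mult.sum_left ext_mult.scaleR_left)

lemma int_mult_expand: "int_mult x w = (\<Sum>j\<in>UNIV. x $ j *\<^sub>R int_mult (axis j 1) w)"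
  by (subst (1) basis_expansion[of x, symmetric, unfolded scalar_mult_eq_scaleR])
     (simp add: int_mult.sum_left int_mult.scaleR_left)

section \<open>Degrees of forms\<close>

lemma ext_deg_add: "v \<in> ext_deg p \<Longrightarrow> w \<in> ext_deg p \<Longrightarrow> v + w \<in> ext_deg p"
  by (auto simp: ext_deg_def) (metis add.right_neutral)

lemma ext_deg_scaleR: "w \<in> ext_deg p \<Longrightarrow> r *\<^sub>R w \<in> ext_deg p"
  by (auto simp: ext_deg_def)

lemma ext_deg_ext_mult:
  assumes "w \<in> ext_deg p"
  shows "ext_mult x w \<in> ext_deg (p + 1)"
  unfolding ext_deg_def
proof (intro CollectI allI impI)
  fix I assume "ext_mult x w $ I \<noteq> 0"
  then obtain j where j: "j \<in> I" "w $ (I - {j}) \<noteq> 0"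
    by (auto simp: ext_mult_def elim!: sum.not_neutral_contains_not_neutral)
  then show "int (card I) = p + 1"
    using assms card.remove[of I j] by (auto simp: ext_deg_def)
qed

lemma ext_deg_int_mult:
  assumes "w \<in> ext_deg p"
  shows "int_mult x w \<in> ext_deg (p - 1)"
  unfolding ext_deg_def
proof (intro CollectI allI impI)
  fix I assume "int_mult x w $ I \<noteq> 0"
  then obtain j where j: "j \<notin> I" "w $ (insert j I) \<noteq> 0"
    by (auto simp: int_mult_def elim!: sum.not_neutral_contains_not_neutral)
  then show "int (card I) = p - 1"
    using assms by (fastforce simp: ext_deg_def)
qed

section \<open>Forms in n - 1 variables inside forms in n variables\<close>

lemma image_Some_vimage: "None \<notin> J \<Longrightarrow> Some ` (Some -` J) = J"
  by (rule image_vimage_eq[THEN trans]) (auto simp: image_iff, metis not_Some_eq)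

lemma card_vimage_Some: "None \<notin> J \<Longrightarrow> card (Some -` J) = card J"
  by (metis card_image image_Some_vimage inj_Some)

lemma ext_deg_ext_incl: "w \<in> ext_deg p \<Longrightarrow> ext_incl w \<in> ext_deg p"
  by (auto simp: ext_deg_def ext_incl_def card_vimage_Some split: if_splits)

lemma ext_sign_Some:
  fixes j :: "'m::{finite,linorder}"
  assumes "None \<notin> J"
  shows "ext_sign (Some j) J = ext_sign j (Some -` J)"
proof -
  have "{i \<in> J. i < Some j} = Some ` {i \<in> Some -` J. i < j}"
  proof (intro equalityI subsetI)
    fix i assume "i \<in> {i \<in> J. i < Some j}"
    then show "i \<in> Some ` {i \<in> Some -` J. i < j}"
      using assms by (cases i) auto
  qed auto
  then have "card {i \<in> J. i < Some j} = card {i \<in> Some -` J. i < j}"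
    by (simp add: card_image)
  then show ?thesis by (simp add: ext_sign_def)
qed

lemma sum_option_set:
  assumes "None \<notin> J"
  shows "(\<Sum>i\<in>J. h i) = (\<Sum>j\<in>Some -` J. h (Some j))"
proof -
  have "(\<Sum>i\<in>J. h i) = sum h (Some ` (Some -` J))"
    unfolding image_Some_vimage[OF assms] by (rule refl)
  then show ?thesis by (simp only: sum.reindex[OF inj_Some] o_def)
qed

lemma coords_Some [simp]: "coords x $ Some j = fst x $ j" and coords_None [simp]: "coords x $ None = snd x"
  by (simp_all add: coords_def)

lemma ext_mult_coords_incl:
  fixes z :: "real ^ 'm::{finite,linorder}"
  shows "ext_mult (coords (z, 0)) (ext_incl w) = ext_incl (ext_mult z w)"
proof (subst vec_eq_iff, rule allI)
  fix J :: "'m option set"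
  show "ext_mult (coords (z, 0)) (ext_incl w) $ J = ext_incl (ext_mult z w) $ J"
  proof (cases "None \<in> J")
    case True
    \<comment> \<open>Either \<open>i\<close> is \<open>None\<close>, where the last coordinate is
      0, or \<open>None\<close> stays in \<open>J - {i}\<close>, where the included form
      vanishes.\<close>
    then have "((coords (z, 0)) $ i * ext_sign i J) *\<^sub>R ext_incl w $ (J - {i}) = 0" for i
      by (cases i) (auto simp: ext_incl_def)
    with True show ?thesis by (simp only: ext_mult_def vec_lambda_beta sum.neutral) (simp add: ext_incl_def)
  next
    case False
    have "Some -` (J - {Some j}) = Some -` J - {j}" for j by auto
    with False show ?thesis
      by (simp add: ext_mult_def ext_incl_def sum_option_set ext_sign_Some)
  qed
qed

lemma coords_split: "coords (z, t) = coords (z, 0) + t *\<^sub>R e_last"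
  by (auto simp: coords_def e_last_def axis_def vec_eq_iff split: option.split)

lemma ext_mult_coords: "ext_mult (coords (z, t)) (ext_incl w) =
    ext_incl (ext_mult z w) + t *\<^sub>R ext_mult e_last (ext_incl w)"
  by (subst coords_split) (simp add: ext_mult.add_left ext_mult.scaleR_left ext_mult_coords_incl)

text \<open>The height \<open>t\<close> drops out because an included form has no factor
  \<open>e_last\<close> that interior multiplication could remove.\<close>

lemma int_mult_coords:
  fixes z :: "real ^ 'm::{finite,linorder}"
  shows "int_mult (coords (z, t)) (ext_incl w) = ext_incl (int_mult z w)"
proof (subst vec_eq_iff, rule allI)
  fix J :: "'m option set"
  show "int_mult (coords (z, t)) (ext_incl w) $ J = ext_incl (int_mult z w) $ J"
  proof (cases "None \<in> J")
    case True
    then show ?thesis by (simp add: int_mult_def ext_incl_def)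
  next
    case False
    let ?h = "\<lambda>i. ((coords (z, t)) $ i * ext_sign i J) *\<^sub>R ext_incl w $ (insert i J)"
    have "(\<Sum>i\<in>-J. ?h i) = ?h None + (\<Sum>i\<in>-J - {None}. ?h i)"
      using False by (intro sum.remove) auto
    also have "?h None = 0" by (simp add: ext_incl_def)
    also have "(\<Sum>i\<in>-J - {None}. ?h i) = (\<Sum>j\<in>Some -` (-J - {None}). ?h (Some j))"
      by (rule sum_option_set) simp
    also have "Some -` (-J - {None}) = - (Some -` J)" by auto
    also have "(\<Sum>j\<in>- (Some -` J). ?h (Some j)) = int_mult z w $ (Some -` J)"
    proof -
      have "Some -` (insert (Some j) J) = insert j (Some -` J)" for j by auto
      then show ?thesis
        using False by (simp add: int_mult_def ext_incl_def ext_sign_Some)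
    qed
    finally show ?thesis using False by (simp add: int_mult_def ext_incl_def)
  qed
qed

lemma inner_coords: "coords (z, t) \<bullet> coords (z, t) = (norm z)\<^sup>2 + t\<^sup>2"
proof -
  have "coords (z, t) \<bullet> coords (z, t) = (\<Sum>i\<in>UNIV. (coords (z,t) $ i)\<^sup>2)"
    by (simp add: inner_vec_def power2_eq_square)
  also have "\<dots> = (\<Sum>i\<in>insert None (range Some). (coords (z,t) $ i)\<^sup>2)"
    by (simp add: UNIV_option_conv)
  also have "\<dots> = (\<Sum>i\<in>UNIV. (z $ i)\<^sup>2) + t\<^sup>2"
    by (subst sum.insert) (auto simp: sum.reindex)
  also have "(\<Sum>i\<in>UNIV. (z $ i)\<^sup>2) = (norm z)\<^sup>2"
    by (simp only: power2_norm_eq_inner inner_vec_def) (simp add: power2_eq_square)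
  finally show ?thesis .
qed

text \<open>The Clifford relation turns the numerator of the kernel into the squared length minus
  twice exterior after interior multiplication. The interior factor does not see the height, so the
  height enters through the exterior one alone and gives a single term that is linear in
  \<open>t\<close>.\<close>

lemma int_ext_minus_ext_int_coords:
  fixes z :: "real ^ 'm::{finite,linorder}"
  shows "int_mult (coords (z, t)) (ext_mult (coords (z, t)) (ext_incl w))
     - ext_mult (coords (z, t)) (int_mult (coords (z, t)) (ext_incl w)) =
   ((norm z)\<^sup>2 + t\<^sup>2) *\<^sub>R ext_incl w - 2 *\<^sub>R ext_incl (ext_mult z (int_mult z w))
     - (2 * t) *\<^sub>R ext_mult e_last (ext_incl (int_mult z w))"
proof -
  let ?x = "coords (z, t)" let ?w = "ext_incl w"
  have "int_mult ?x (ext_mult ?x ?w) - ext_mult ?x (int_mult ?x ?w) =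
     (?x \<bullet> ?x) *\<^sub>R ?w - 2 *\<^sub>R ext_mult ?x (int_mult ?x ?w)"
    unfolding ext_int_anticommute[of ?x ?x ?w, symmetric] by (simp add: scaleR_2)
  then show ?thesis
    by (simp add: inner_coords int_mult_coords ext_mult_coords scaleR_add_right)
qed

text \<open>By the Clifford relation and \<open>int_mult \<xi> v = 0\<close>, contracting the second
  summand returns \<open>v\<close> up to the length of \<open>\<xi>\<close>. These are the two
  operators through which the multiplier sees a form.\<close>

lemma ext_int_of_decomposition:
  assumes "int_mult \<xi> u = 0" "int_mult \<xi> v = 0" "\<xi> \<noteq> 0" "g = u + ext_mult (\<xi> /\<^sub>R norm \<xi>) v"
  shows "int_mult \<xi> g = norm \<xi> *\<^sub>R v"
    and "ext_mult \<xi> (int_mult \<xi> g) = (norm \<xi>)\<^sup>2 *\<^sub>R ext_mult (\<xi> /\<^sub>R norm \<xi>) v"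
proof -
  have "int_mult \<xi> g = int_mult \<xi> (ext_mult (\<xi> /\<^sub>R norm \<xi>) v)"
    using assms by (simp add: int_mult.add_right)
  also have "\<dots> = ((\<xi> /\<^sub>R norm \<xi>) \<bullet> \<xi>) *\<^sub>R v"
    using ext_int_anticommute[of "\<xi> /\<^sub>R norm \<xi>" \<xi> v] assms by (simp add: ext_mult.zero_right)
  finally show *: "int_mult \<xi> g = norm \<xi> *\<^sub>R v"
    using assms by (simp add: dot_square_norm power2_eq_square)
  show "ext_mult \<xi> (int_mult \<xi> g) = (norm \<xi>)\<^sup>2 *\<^sub>R ext_mult (\<xi> /\<^sub>R norm \<xi>) v"
    unfolding * using assms by (simp add: ext_mult.scaleR_left ext_mult.scaleR_right power2_eq_square)
qed

section \<open>Schwartz functions\<close>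

lemma iter_deriv_Nil [simp]: "iter_deriv [] f = f"
  and iter_deriv_Cons: "iter_deriv (b # bs) f = dir_deriv b (iter_deriv bs f)"
  and iter_deriv_append: "iter_deriv (bs @ cs) f = iter_deriv bs (iter_deriv cs f)"
  by (simp_all add: iter_deriv_def)

lemma dir_deriv_eq: "(f has_derivative D) (at x) \<Longrightarrow> dir_deriv b f x = D b"
  unfolding dir_deriv_def by (metis frechet_derivative_at)

text \<open>A coinductive reading of the definition: it suffices to exhibit a family closed under
  the basis derivatives whose members are differentiable and decay. The closure lemmas take as
  family all results of the operation in question.\<close>

lemma schwartz_coinduct:
  assumes "f \<in> S"
    and "\<And>g x. g \<in> S \<Longrightarrow> g differentiable (at x)"
    and "\<And>g k. g \<in> S \<Longrightarrow> bounded (range (\<lambda>x. norm x ^ k *\<^sub>R g x))"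
    and "\<And>g b. g \<in> S \<Longrightarrow> b \<in> Basis \<Longrightarrow> dir_deriv b g \<in> S"
  shows "f \<in> schwartz"
proof -
  have "iter_deriv bs f \<in> S" if "set bs \<subseteq> Basis" for bs
    using that by (induction bs) (simp_all add: assms iter_deriv_Cons)
  with assms(2,3) show ?thesis unfolding schwartz_def by blast
qed

lemma schwartz_iter_deriv: "f \<in> schwartz \<Longrightarrow> set bs \<subseteq> Basis \<Longrightarrow> iter_deriv bs f \<in> schwartz"
  unfolding schwartz_def by (auto simp flip: iter_deriv_append)

lemma schwartz_dir_deriv: "f \<in> schwartz \<Longrightarrow> b \<in> Basis \<Longrightarrow> dir_deriv b f \<in> schwartz"
  using schwartz_iter_deriv[of f "[b]"] by (simp add: iter_deriv_Cons)

lemma schwartz_differentiable: "f \<in> schwartz \<Longrightarrow> f differentiable (at x)"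
  unfolding schwartz_def by (auto dest: spec[of _ "[]"])

lemma schwartz_has_derivative: "f \<in> schwartz \<Longrightarrow> (f has_derivative frechet_derivative f (at x)) (at x)"
  using schwartz_differentiable frechet_derivative_works by blast

lemma schwartz_continuous: "f \<in> schwartz \<Longrightarrow> continuous_on A f"
  by (meson continuous_at_imp_continuous_on differentiable_imp_continuous_within schwartz_differentiable)

lemma schwartz_measurable: "f \<in> schwartz \<Longrightarrow> f \<in> borel_measurable borel"
  by (intro borel_measurable_continuous_onI schwartz_continuous)

lemma power_one_plus_le: "(1 + r) ^ k \<le> 2 ^ k * (1 + r ^ k)" if "0 \<le> r" for r :: real
proof (cases "r \<le> 1")
  case True
  then have "(1 + r) ^ k \<le> 2 ^ k" using that by (intro power_mono) auto
  also have "\<dots> \<le> 2 ^ k * (1 + r ^ k)" using that by simp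
  finally show ?thesis .
next
  case False
  then have "(1 + r) ^ k \<le> (2 * r) ^ k" by (intro power_mono) auto
  also have "\<dots> \<le> 2 ^ k * (1 + r ^ k)" by (simp add: power_mult_distrib)
  finally show ?thesis .
qed

lemma schwartz_bounded: "f \<in> schwartz \<Longrightarrow> bounded (range (\<lambda>x. norm x ^ k *\<^sub>R f x))"
  unfolding schwartz_def by (auto dest: spec[of _ "[]"])

lemma bounded_decay_imp_weighted:
  fixes f :: "'a::real_normed_vector \<Rightarrow> 'b::real_normed_vector"
  assumes "\<And>k. bounded (range (\<lambda>x. norm x ^ k *\<^sub>R f x))"
  obtains C where "0 \<le> C" "\<And>x. (1 + norm x) ^ k * norm (f x) \<le> C"
proof -
  obtain A where A: "\<And>x. norm (norm x ^ 0 *\<^sub>R f x) \<le> A"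
    using assms[of 0] unfolding bounded_iff by auto
  obtain B where B: "\<And>x. norm (norm x ^ k *\<^sub>R f x) \<le> B"
    using assms[of k] unfolding bounded_iff by auto
  have "(1 + norm x) ^ k * norm (f x) \<le> 2 ^ k * (A + B)" for x
  proof -
    have "(1 + norm x) ^ k * norm (f x) \<le> 2 ^ k * (1 + norm x ^ k) * norm (f x)"
      by (intro mult_right_mono power_one_plus_le) auto
    also have "\<dots> = 2 ^ k * (norm (f x) + norm x ^ k * norm (f x))" by (simp add: algebra_simps)
    also have "\<dots> \<le> 2 ^ k * (A + B)"
      using A[of x] B[of x] by (intro mult_left_mono add_mono) auto
    finally show ?thesis .
  qed
  moreover have "0 \<le> 2 ^ k * (A + B)"
    using norm_ge_zero[THEN order_trans, OF A] norm_ge_zero[THEN order_trans, OF B] by simp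
  ultimately show ?thesis using that by blast
qed

lemma schwartz_decay:
  assumes "f \<in> schwartz"
  obtains C where "0 \<le> C" "\<And>x. (1 + norm x) ^ k * norm (f x) \<le> C"
  using bounded_decay_imp_weighted[of f k] schwartz_bounded[OF assms] by blast

lemma boundedI_decay:
  fixes f :: "'a::real_normed_vector \<Rightarrow> 'b::real_normed_vector"
  assumes "\<And>x. norm x ^ k * norm (f x) \<le> C"
  shows "bounded (range (\<lambda>x. norm x ^ k *\<^sub>R f x))"
  using assms unfolding bounded_iff by auto

section \<open>Closure properties and seminorms of Schwartz functions\<close>

lemma schwartz_add:
  assumes "f \<in> schwartz" "g \<in> schwartz"
  shows "(\<lambda>x. f x + g x) \<in> schwartz"
proof (rule schwartz_coinduct[where S = "{(\<lambda>x. f x + g x) |f g. f \<in> schwartz \<and> g \<in> schwartz}"])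
  fix h assume "h \<in> {(\<lambda>x. f x + g x) |f g. f \<in> schwartz \<and> g \<in> schwartz}"
  then obtain f g where h: "h = (\<lambda>x. f x + g x)" and fg: "f \<in> schwartz" "g \<in> schwartz" by blast
  note D = fg[THEN schwartz_has_derivative]
  show "h differentiable (at x)" for x
    unfolding h by (intro differentiable_add fg[THEN schwartz_differentiable])
  show "bounded (range (\<lambda>x. norm x ^ k *\<^sub>R h x))" for k
    using bounded_plus_comp[OF fg[THEN schwartz_bounded[of _ k]]] by (simp add: h scaleR_add_right)
  show "dir_deriv b h \<in> {(\<lambda>x. f x + g x) |f g. f \<in> schwartz \<and> g \<in> schwartz}" if "b \<in> Basis" for b
  proof -
    have "dir_deriv b h = (\<lambda>x. dir_deriv b f x + dir_deriv b g x)"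
      unfolding h by (rule ext, subst dir_deriv_eq[OF has_derivative_add[OF D]]) (simp add: dir_deriv_def)
    then show ?thesis using fg[THEN schwartz_dir_deriv[OF _ that]] by blast
  qed
qed (use assms in blast)

lemma schwartz_bounded_linear:
  assumes L: "bounded_linear L" and "f \<in> schwartz"
  shows "(\<lambda>x. L (f x)) \<in> schwartz"
proof (rule schwartz_coinduct[where S = "{(\<lambda>x. L (f x)) |f. f \<in> schwartz}"])
  fix h assume "h \<in> {(\<lambda>x. L (f x)) |f. f \<in> schwartz}"
  then obtain f where h: "h = (\<lambda>x. L (f x))" and f: "f \<in> schwartz" by blast
  note D = bounded_linear.has_derivative[OF L f[THEN schwartz_has_derivative]]
  show "h differentiable (at x)" for x
    unfolding h using D differentiableI by blast
  obtain K where K: "\<And>x. norm (L x) \<le> norm x * K" "0 \<le> K"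
    using bounded_linear.nonneg_bounded[OF L] by blast
  show "bounded (range (\<lambda>x. norm x ^ k *\<^sub>R h x))" for k
    using bounded_linear_image[OF schwartz_bounded[OF f, of k] L]
    by (simp add: h image_image linear_cmul[OF bounded_linear.linear[OF L]])
  show "dir_deriv b h \<in> {(\<lambda>x. L (f x)) |f. f \<in> schwartz}" if "b \<in> Basis" for b
  proof -
    have "dir_deriv b h = (\<lambda>x. L (dir_deriv b f x))"
      unfolding h by (rule ext, subst dir_deriv_eq[OF D]) (simp add: dir_deriv_def)
    then show ?thesis using f[THEN schwartz_dir_deriv[OF _ that]] by blast
  qed
qed (use assms in blast)

lemma schwartz_zero [simp]: "(\<lambda>x. 0) \<in> schwartz"
proof (rule schwartz_coinduct[where S = "{\<lambda>x. 0}"])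
  show "dir_deriv b g \<in> {\<lambda>x. 0}" if "g \<in> {\<lambda>x. 0}" for g :: "'a \<Rightarrow> 'b" and b
    using that by (auto simp: dir_deriv_eq[OF has_derivative_const])
qed (auto simp: bounded_iff)

lemma schwartz_cmult: "f \<in> schwartz \<Longrightarrow> (\<lambda>x. c * f x :: 'b::real_normed_algebra) \<in> schwartz"
  by (rule schwartz_bounded_linear[OF bounded_linear_mult_right])

lemma schwartz_uminus: "f \<in> schwartz \<Longrightarrow> (\<lambda>x. - f x) \<in> schwartz"
  by (rule schwartz_bounded_linear) (auto intro: bounded_linear_minus bounded_linear_ident)

lemma schwartz_sum: "(\<And>i. i \<in> A \<Longrightarrow> f i \<in> schwartz) \<Longrightarrow> (\<lambda>x. \<Sum>i\<in>A. f i x) \<in> schwartz"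
  by (induction A rule: infinite_finite_induct) (auto intro: schwartz_add)

lemma schwartz_component: "f \<in> schwartz \<Longrightarrow> (\<lambda>x. f x $ i) \<in> schwartz"
  by (rule schwartz_bounded_linear[OF bounded_linear_vec_nth])

lemma schwartz_vec:
  fixes f :: "'a::euclidean_space \<Rightarrow> complex ^ 'i::finite"
  assumes "\<And>i. (\<lambda>x. f x $ i) \<in> schwartz"
  shows "f \<in> schwartz"
proof -
  have "linear (axis i :: complex \<Rightarrow> complex ^ 'i)" for i
    by (intro linearI) (auto simp: axis_def vec_eq_iff)
  then have "(\<lambda>x. \<Sum>i\<in>UNIV. axis i (f x $ i)) \<in> schwartz"
    by (intro schwartz_sum schwartz_bounded_linear[OF _ assms]) (rule linear_conv_bounded_linear[THEN iffD1])
  moreover have "(\<Sum>i\<in>UNIV. axis i (w $ i)) = w" for w :: "complex ^ 'i"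
    by (simp add: vec_eq_iff axis_def)
  ultimately show ?thesis by simp
qed

text \<open>The product rule leaves a term without the linear factor, so the products alone are not
  closed under derivatives. The family carries an additional Schwartz summand that absorbs
  it.\<close>

lemma schwartz_inner_scaleR:
  fixes f :: "'a::euclidean_space \<Rightarrow> 'b::real_normed_vector"
  assumes "f \<in> schwartz"
  shows "(\<lambda>x. (x \<bullet> u) *\<^sub>R f x) \<in> schwartz"
proof -
  let ?S = "{(\<lambda>x. (x \<bullet> u) *\<^sub>R f x + g x) |f g. f \<in> (schwartz :: ('a \<Rightarrow> 'b) set) \<and> g \<in> schwartz}"
  have "(\<lambda>x. (x \<bullet> u) *\<^sub>R f x + 0) \<in> schwartz"
  proof (rule schwartz_coinduct[where S = ?S])
    fix h assume "h \<in> ?S"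
    then obtain f :: "'a \<Rightarrow> 'b" and g where h: "h = (\<lambda>x. (x \<bullet> u) *\<^sub>R f x + g x)"
      and fg: "f \<in> schwartz" "g \<in> schwartz" by blast
    note Df = fg(1)[THEN schwartz_has_derivative]
      and Dg = fg(2)[THEN schwartz_has_derivative]
    have D: "(h has_derivative (\<lambda>d. ((x \<bullet> u) *\<^sub>R frechet_derivative f (at x) d + (d \<bullet> u) *\<^sub>R f x)
        + frechet_derivative g (at x) d)) (at x)" for x
      unfolding h by (rule has_derivative_add[OF has_derivative_scaleR[OF has_derivative_inner_left[OF has_derivative_ident] Df] Dg])
    show "h differentiable (at x)" for x
      using D differentiableI by blast
    show "bounded (range (\<lambda>x. norm x ^ k *\<^sub>R h x))" for k
    proof -
      obtain A where A: "\<And>x. norm (norm x ^ Suc k *\<^sub>R f x) \<le> A"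
        using schwartz_bounded[OF fg(1), of "Suc k"] unfolding bounded_iff by auto
      obtain B where B: "\<And>x. norm (norm x ^ k *\<^sub>R g x) \<le> B"
        using schwartz_bounded[OF fg(2), of k] unfolding bounded_iff by auto
      have "norm x ^ k * norm (h x) \<le> norm u * A + B" for x
      proof -
        have "norm (h x) \<le> norm x * norm u * norm (f x) + norm (g x)"
          unfolding h by (rule norm_triangle_le) (auto intro!: mult_right_mono Cauchy_Schwarz_ineq2)
        then have "norm x ^ k * norm (h x) \<le> norm x ^ k * (norm x * norm u * norm (f x) + norm (g x))"
          by (rule mult_left_mono) auto
        also have "\<dots> = norm u * norm (norm x ^ Suc k *\<^sub>R f x) + norm (norm x ^ k *\<^sub>R g x)"
          by (simp add: algebra_simps)
        also have "\<dots> \<le> norm u * A + B"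
          by (intro add_mono mult_left_mono A B) auto
        finally show ?thesis .
      qed
      then show ?thesis by (rule boundedI_decay)
    qed
    show "dir_deriv b h \<in> ?S" if "b \<in> Basis" for b
    proof -
      have "dir_deriv b h = (\<lambda>x. (x \<bullet> u) *\<^sub>R dir_deriv b f x + ((b \<bullet> u) *\<^sub>R f x + dir_deriv b g x))"
        by (rule ext, subst dir_deriv_eq[OF D]) (simp add: dir_deriv_def)
      moreover have "(\<lambda>x. (b \<bullet> u) *\<^sub>R f x + dir_deriv b g x) \<in> schwartz"
        using fg by (intro schwartz_add schwartz_dir_deriv that schwartz_bounded_linear[OF bounded_linear_scaleR_right])
      moreover have "dir_deriv b f \<in> schwartz"
        using fg(1) that by (rule schwartz_dir_deriv)
      ultimately show ?thesis
        by (intro CollectI exI[of _ "dir_deriv b f"] exI[of _ "\<lambda>x. (b \<bullet> u) *\<^sub>R f x + dir_deriv b g x"]) simp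
    qed
  next
    show "(\<lambda>x. (x \<bullet> u) *\<^sub>R f x + 0) \<in> ?S"
      using assms schwartz_zero by (intro CollectI exI[of _ f] exI[of _ "\<lambda>x. 0"]) auto
  qed
  then show ?thesis by simp
qed

text \<open>Every weighted derivative lies below one summand of the seminorm. Decay enters because a
  supremum over an unbounded set would carry no information.\<close>

lemma schwartz_norm_ge:
  fixes f :: "'a::euclidean_space \<Rightarrow> 'b::real_normed_vector"
  assumes f: "f \<in> schwartz" and bs: "set bs \<subseteq> Basis" "length bs \<le> N" and k: "k \<le> N"
  shows "(1 + norm x) ^ k * norm (iter_deriv bs f x) \<le> schwartz_norm N f"
proof -
  let ?s = "\<lambda>bs. SUP x. (1 + norm x) ^ N * norm (iter_deriv bs f x)"
  have fin: "finite {bs. set bs \<subseteq> (Basis :: 'a set) \<and> length bs \<le> N}"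
    by (rule finite_lists_length_le) simp
  have le: "(1 + norm x) ^ N * norm (iter_deriv bs f x) \<le> ?s bs" if cs: "set bs \<subseteq> Basis" for bs x
  proof -
    obtain C where "\<And>x. (1 + norm x) ^ N * norm (iter_deriv bs f x) \<le> C"
      using schwartz_decay[OF schwartz_iter_deriv[OF f cs], of N] by blast
    then have "bdd_above (range (\<lambda>x. (1 + norm x) ^ N * norm (iter_deriv bs f x)))"
      by (auto simp: bdd_above_def)
    then show ?thesis by (rule cSUP_upper[OF UNIV_I])
  qed
  have "(1 + norm x) ^ k * norm (iter_deriv bs f x) \<le> (1 + norm x) ^ N * norm (iter_deriv bs f x)"
    using k by (intro mult_right_mono power_increasing) auto
  also have "\<dots> \<le> ?s bs" using bs(1) by (rule le)
  also have "\<dots> \<le> schwartz_norm N f"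
    unfolding schwartz_norm_def
  proof (rule member_le_sum)
    show "0 \<le> ?s cs" if "cs \<in> {bs. set bs \<subseteq> Basis \<and> length bs \<le> N} - {bs}" for cs
    proof -
      have "0 \<le> (1 + norm (0::'a)) ^ N * norm (iter_deriv cs f 0)" by simp
      also have "\<dots> \<le> ?s cs" using that by (intro le) auto
      finally show ?thesis .
    qed
  qed (use bs fin in auto)
  finally show ?thesis .
qed

section \<open>Gaussian integrals\<close>

lemma norm_integral_le:
  fixes f :: "'a \<Rightarrow> 'b::{banach, second_countable_topology}"
  assumes "integrable M g" "\<And>x. norm (f x) \<le> g x"
  shows "norm (integral\<^sup>L M f) \<le> integral\<^sup>L M g"
proof -
  have "norm (integral\<^sup>L M f) \<le> (\<integral>x. norm (f x) \<partial>M)"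
    by (rule integral_norm_bound)
  also have "\<dots> \<le> integral\<^sup>L M g"
    by (rule integral_mono') (use assms order_trans[OF norm_ge_zero] in auto)
  finally show ?thesis .
qed

lemma exp_minus_ii_eq_cis: "exp (- (\<i> * of_real r)) = cis (- r)"
  by (simp add: cis_conv_exp)

lemma cis_measurable [measurable]: "cis \<in> borel_measurable borel"
  by (intro borel_measurable_continuous_onI continuous_intros)

text \<open>\<open>lborel\<close> is the image of a product of one-dimensional measures under the
  basis expansion, which makes the integral factor.\<close>

lemma has_bochner_integral_lborel_prod:
  fixes f :: "'a::euclidean_space \<Rightarrow> real \<Rightarrow> complex"
  assumes f: "\<And>b. b \<in> Basis \<Longrightarrow> has_bochner_integral lborel (f b) (g b)"
  shows "has_bochner_integral lborel (\<lambda>x. \<Prod>b\<in>Basis. f b (x \<bullet> b)) (\<Prod>b\<in>Basis. g b)"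
proof -
  interpret product_sigma_finite "\<lambda>_::'a. lborel :: real measure" ..
  have [measurable]: "\<And>b. b \<in> Basis \<Longrightarrow> f b \<in> borel_measurable borel"
    using f[THEN borel_measurable_has_bochner_integral] by simp
  have eq: "(\<Prod>b\<in>Basis. f b ((\<Sum>c\<in>Basis. h c *\<^sub>R c) \<bullet> b)) = (\<Prod>b\<in>Basis. f b (h b))" for h :: "'a \<Rightarrow> real"
    by (intro prod.cong refl) (simp add: inner_sum_left inner_Basis if_distrib[of "(*) _"] cong: if_cong)
  have "has_bochner_integral (\<Pi>\<^sub>M b\<in>Basis. lborel) (\<lambda>h. \<Prod>b\<in>Basis. f b (h b)) (\<Prod>b\<in>Basis. g b)"
    using f by (auto simp: has_bochner_integral_iff product_integral_prod product_integrable_prod)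
  then show ?thesis
    by (subst lborel_eq) (intro has_bochner_integral_distr; simp add: eq)
qed

text \<open>A rescaled form of the characteristic function of the standard normal
  distribution.\<close>

lemma fourier_gauss_real:
  fixes t \<eta> :: real
  assumes t: "0 < t"
  shows "has_bochner_integral lborel (\<lambda>x. cis (- (x * \<eta>)) * of_real (exp (- t * x\<^sup>2)))
    (of_real (sqrt (pi / t) * exp (- \<eta>\<^sup>2 / (4 * t))))"
proof -
  \<comment> \<open>With this \<open>r\<close> the exponent of the normal density at
    \<open>r * x\<close>, namely half of \<open>(r * x)\<^sup>2\<close>, becomes
    \<open>t * x\<^sup>2\<close>.\<close>
  define r where "r = sqrt (2 * t)"
  have r: "r > 0" "r\<^sup>2 = 2 * t" using t by (auto simp: r_def)
  have "integrable lborel (\<lambda>x. cis (- \<eta> / r * x) * of_real (std_normal_density x))"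
  proof (rule Bochner_Integration.integrable_bound)
    show "integrable lborel std_normal_density"
      using integrable_std_normal_moment[of 0] by simp
  qed (measurable, auto simp: norm_mult)
  moreover have "(LINT x|lborel. cis (- \<eta> / r * x) * of_real (std_normal_density x)) = of_real (exp (- (\<eta> / r)\<^sup>2 / 2))"
  proof -
    have "char std_normal_distribution (- \<eta> / r) = of_real (exp (- (\<eta> / r)\<^sup>2 / 2))"
      by (simp add: char_std_normal_distribution power_divide)
    then show ?thesis
      unfolding char_def
      by (subst (asm) integral_density) (auto simp: cis_conv_exp scaleR_conv_of_real mult_ac normal_density_nonneg)
  qed
  ultimately have "has_bochner_integral lborel (\<lambda>x. cis (- \<eta> / r * x) * of_real (std_normal_density x))
      (of_real (exp (- (\<eta> / r)\<^sup>2 / 2)))"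
    by (simp add: has_bochner_integral_iff)
  then have "has_bochner_integral lborel (\<lambda>x. cis (- \<eta> / r * (0 + r * x)) * of_real (std_normal_density (0 + r * x)))
      (of_real (exp (- (\<eta> / r)\<^sup>2 / 2)) /\<^sub>R \<bar>r\<bar>)"
    using r by (subst (asm) lborel_has_bochner_integral_real_affine_iff[of r _ _ 0]) auto
  then have "has_bochner_integral lborel (\<lambda>x. of_real (sqrt (2 * pi)) * (cis (- \<eta> / r * (0 + r * x)) * of_real (std_normal_density (0 + r * x))))
      (of_real (sqrt (2 * pi)) * (of_real (exp (- (\<eta> / r)\<^sup>2 / 2)) /\<^sub>R \<bar>r\<bar>))"
    by (rule has_bochner_integral_mult_right)
  moreover have "of_real (sqrt (2 * pi)) * (cis (- \<eta> / r * (0 + r * x)) * of_real (std_normal_density (0 + r * x)))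
      = cis (- (x * \<eta>)) * of_real (exp (- t * x\<^sup>2))" for x
    using r by (simp add: std_normal_density_def power_mult_distrib mult_ac)
  moreover have "of_real (sqrt (2 * pi)) * (of_real (exp (- (\<eta> / r)\<^sup>2 / 2)) /\<^sub>R \<bar>r\<bar>)
      = complex_of_real (sqrt (pi / t) * exp (- \<eta>\<^sup>2 / (4 * t)))"
  proof -
    have "sqrt (2 * pi) / r = sqrt (pi / t)"
      by (simp add: r_def real_sqrt_mult real_sqrt_divide)
    moreover have "- (\<eta> / r)\<^sup>2 / 2 = - \<eta>\<^sup>2 / (4 * t)"
      using r t by (simp add: power_divide)
    ultimately show ?thesis
      using r by (simp add: scaleR_conv_of_real divide_simps flip: of_real_mult of_real_inverse)
  qed
  ultimately show ?thesis by simp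
qed

lemma sum_cis: "finite A \<Longrightarrow> cis (\<Sum>i\<in>A. f i) = (\<Prod>i\<in>A. cis (f i))"
  by (induction A rule: finite_induct) (auto simp flip: cis_mult)

lemma fourier_gauss:
  fixes \<eta> :: "'a::euclidean_space"
  assumes t: "0 < t"
  shows "has_bochner_integral lborel (\<lambda>z. cis (- (z \<bullet> \<eta>)) * of_real (exp (- t * (norm z)\<^sup>2)))
    (of_real ((pi / t) powr (DIM('a) / 2) * exp (- (norm \<eta>)\<^sup>2 / (4 * t))))"
proof -
  have norm2: "(norm x)\<^sup>2 = (\<Sum>b\<in>Basis. (x \<bullet> b)\<^sup>2)" for x :: 'a
    unfolding power2_norm_eq_inner by (subst euclidean_inner) (simp add: power2_eq_square)
  have "has_bochner_integral lborel (\<lambda>z::'a. \<Prod>b\<in>Basis. cis (- ((z \<bullet> b) * (\<eta> \<bullet> b))) * of_real (exp (- t * (z \<bullet> b)\<^sup>2)))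
     (\<Prod>b\<in>Basis. of_real (sqrt (pi / t) * exp (- (\<eta> \<bullet> b)\<^sup>2 / (4 * t))))"
    by (intro has_bochner_integral_lborel_prod fourier_gauss_real t)
  moreover have "(\<Prod>b\<in>Basis. cis (- ((z \<bullet> b) * (\<eta> \<bullet> b))) * of_real (exp (- t * (z \<bullet> b)\<^sup>2)))
     = cis (- (z \<bullet> \<eta>)) * complex_of_real (exp (- t * (norm z)\<^sup>2))" for z
    by (subst (2) euclidean_inner)
       (simp add: prod.distrib norm2 sum_distrib_left exp_sum sum_negf[symmetric] sum_cis)
  moreover have "(\<Prod>b\<in>(Basis :: 'a set). of_real (sqrt (pi / t) * exp (- (\<eta> \<bullet> b)\<^sup>2 / (4 * t))))
     = complex_of_real ((pi / t) powr (DIM('a) / 2) * exp (- (norm \<eta>)\<^sup>2 / (4 * t)))"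
  proof -
    have "(\<Prod>b\<in>(Basis :: 'a set). sqrt (pi / t) * exp (- (\<eta> \<bullet> b)\<^sup>2 / (4 * t)))
       = sqrt (pi / t) ^ DIM('a) * exp (- (norm \<eta>)\<^sup>2 / (4 * t))"
      by (simp add: prod.distrib norm2 exp_sum[symmetric] sum_divide_distrib sum_negf)
    also have "sqrt (pi / t) ^ DIM('a) = (pi / t) powr (DIM('a) / 2)"
      using t by (simp add: powr_half_sqrt[symmetric] powr_realpow[symmetric] powr_powr)
    finally show ?thesis by (simp only: of_real_prod[symmetric])
  qed
  ultimately show ?thesis by simp
qed

text \<open>Differentiation under the integral without a limit theorem: the linearised exponential
  has a quadratic remainder, so the error is at most the second absolute moment times
  \<open>(norm h)\<^sup>2\<close>. The first moment is dominated by the zeroth and the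
  second.\<close>

lemma fourier_integral_has_derivative:
  fixes f :: "'a::euclidean_space \<Rightarrow> complex"
  assumes f: "integrable lborel f" and f2: "integrable lborel (\<lambda>x. of_real ((norm x)\<^sup>2) * f x)"
  shows "((\<lambda>\<eta>. LINT x|lborel. cis (- (x \<bullet> \<eta>)) * f x) has_derivative
     (\<lambda>h. LINT x|lborel. cis (- (x \<bullet> \<eta>)) * (- \<i> * of_real (x \<bullet> h) * f x))) (at \<eta>)"
proof -
  have [measurable]: "f \<in> borel_measurable borel"
    using f borel_measurable_integrable by simp
  have n1: "integrable lborel (\<lambda>x. norm x * norm (f x))"
  proof (rule Bochner_Integration.integrable_bound)
    show "integrable lborel (\<lambda>x. norm (f x) + norm (of_real ((norm x)\<^sup>2) * f x))"
      by (intro Bochner_Integration.integrable_add integrable_norm f f2)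
    show "AE x in lborel. norm (norm x * norm (f x)) \<le> norm (norm (f x) + norm (of_real ((norm x)\<^sup>2) * f x))"
    proof (intro AE_I2)
      fix x :: 'a
      have "norm x \<le> 1 + (norm x)\<^sup>2"
        using sum_squares_bound[of "norm x" 1] norm_ge_zero[of x] by (simp only: mult_1_right one_power2)
      then have "norm x * norm (f x) \<le> (1 + (norm x)\<^sup>2) * norm (f x)"
        by (rule mult_right_mono) simp
      then show "norm (norm x * norm (f x)) \<le> norm (norm (f x) + norm (of_real ((norm x)\<^sup>2) * f x))"
        by (simp add: norm_mult norm_power algebra_simps)
    qed
  qed measurable
  have i0: "integrable lborel (\<lambda>x. cis (- (x \<bullet> \<eta>)) * f x)" for \<eta>
    by (rule Bochner_Integration.integrable_bound[OF f]) (auto simp: norm_mult)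
  have i1: "integrable lborel (\<lambda>x. cis (- (x \<bullet> \<eta>)) * (- \<i> * of_real (x \<bullet> h) * f x))" for h
  proof (rule Bochner_Integration.integrable_bound)
    show "integrable lborel (\<lambda>x. norm h * (norm x * norm (f x)))"
      by (intro integrable_mult_right n1)
    show "AE x in lborel. norm (cis (- (x \<bullet> \<eta>)) * (- \<i> * of_real (x \<bullet> h) * f x)) \<le> norm (norm h * (norm x * norm (f x)))"
    proof (intro AE_I2)
      fix x :: 'a
      have "\<bar>x \<bullet> h\<bar> * norm (f x) \<le> norm x * norm h * norm (f x)"
        by (intro mult_right_mono Cauchy_Schwarz_ineq2) simp
      then show "norm (cis (- (x \<bullet> \<eta>)) * (- \<i> * of_real (x \<bullet> h) * f x)) \<le> norm (norm h * (norm x * norm (f x)))"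
        by (simp add: norm_mult mult_ac)
    qed
  qed measurable
  let ?K = "LINT x|lborel. norm (of_real ((norm x)\<^sup>2) * f x)"
  let ?F = "\<lambda>\<eta>. LINT x|lborel. cis (- (x \<bullet> \<eta>)) * f x"
  let ?D = "\<lambda>h. LINT x|lborel. cis (- (x \<bullet> \<eta>)) * (- \<i> * of_real (x \<bullet> h) * f x)"
  have lin: "linear ?D"
  proof (rule linearI)
    show "?D (a + b) = ?D a + ?D b" for a b
      unfolding Bochner_Integration.integral_add[OF i1 i1, symmetric]
      by (intro Bochner_Integration.integral_cong) (auto simp: inner_add_right algebra_simps)
    show "?D (c *\<^sub>R b) = c *\<^sub>R ?D b" for c b
      unfolding integral_scaleR_right[symmetric]
      by (intro Bochner_Integration.integral_cong) (auto simp: scaleR_conv_of_real algebra_simps)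
  qed
  have cis_bound: "norm (cis (- y) - 1 + \<i> * of_real y) \<le> y\<^sup>2" for y :: real
  proof -
    have "norm (cis (- y) - 1 + \<i> * of_real y) \<le> y\<^sup>2 / 2"
      using iexp_approx1[of "- y" 1] by (simp add: cis_conv_exp power2_eq_square algebra_simps)
    also have "\<dots> \<le> y\<^sup>2" by simp
    finally show ?thesis .
  qed
  have est: "norm (?F (\<eta> + h) - ?F \<eta> - ?D h) \<le> ?K * (norm h)\<^sup>2" for h
  proof -
    have "?F (\<eta> + h) - ?F \<eta> - ?D h = (LINT x|lborel. cis (- (x \<bullet> (\<eta> + h))) * f x - cis (- (x \<bullet> \<eta>)) * f x
         - cis (- (x \<bullet> \<eta>)) * (- \<i> * of_real (x \<bullet> h) * f x))"
      using i0[of "\<eta> + h"] i0[of \<eta>] i1[of h] by simp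
    also have "\<dots> = (LINT x|lborel. cis (- (x \<bullet> \<eta>)) * (cis (- (x \<bullet> h)) - 1 + \<i> * of_real (x \<bullet> h)) * f x)"
      by (intro Bochner_Integration.integral_cong) (auto simp: inner_add_right algebra_simps cis_mult)
    also have "norm \<dots> \<le> (LINT x|lborel. norm (of_real ((norm x)\<^sup>2) * f x) * (norm h)\<^sup>2)"
    proof (rule norm_integral_le)
      show "integrable lborel (\<lambda>x. norm (of_real ((norm x)\<^sup>2) * f x) * (norm h)\<^sup>2)"
        by (intro integrable_mult_left integrable_norm f2)
      show "norm (cis (- (x \<bullet> \<eta>)) * (cis (- (x \<bullet> h)) - 1 + \<i> * of_real (x \<bullet> h)) * f x)
         \<le> norm (of_real ((norm x)\<^sup>2) * f x) * (norm h)\<^sup>2" for x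
      proof -
        have "norm (cis (- (x \<bullet> h)) - 1 + \<i> * of_real (x \<bullet> h)) \<le> (norm x * norm h)\<^sup>2"
          by (rule order_trans[OF cis_bound]) (simp add: abs_le_square_iff[symmetric] Cauchy_Schwarz_ineq2)
        then have "norm (cis (- (x \<bullet> h)) - 1 + \<i> * of_real (x \<bullet> h)) * norm (f x) \<le> (norm x * norm h)\<^sup>2 * norm (f x)"
          by (rule mult_right_mono) simp
        then show ?thesis by (simp add: norm_mult power_mult_distrib mult_ac norm_power)
      qed
    qed
    also have "\<dots> = ?K * (norm h)\<^sup>2" by (rule integral_mult_left_zero)
    finally show ?thesis .
  qed
  have K0: "?K \<ge> 0" by simp
  show ?thesis
    unfolding has_derivative_at
  proof (intro conjI)
    show "bounded_linear ?D" using lin by (rule linear_conv_bounded_linear[THEN iffD1])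
    show "(\<lambda>h. norm (?F (\<eta> + h) - ?F \<eta> - ?D h) / norm h) \<midarrow>0\<rightarrow> 0"
    proof (rule tendsto_sandwich[of "\<lambda>_. 0" _ _ "\<lambda>h. ?K * norm h"])
      show "\<forall>\<^sub>F h in at 0. norm (?F (\<eta> + h) - ?F \<eta> - ?D h) / norm h \<le> ?K * norm h"
        using est by (intro always_eventually allI) (simp add: divide_le_eq power2_eq_square mult.assoc)
      show "(\<lambda>h. ?K * norm h) \<midarrow>0\<rightarrow> 0"
        by (auto intro!: tendsto_eq_intros)
    qed auto
  qed
qed

section \<open>Fourier transforms of inverse powers\<close>

lemma power_le_fact_exp: "x ^ k \<le> fact k * exp x" if "0 \<le> x" for x :: real
proof -
  have "(\<Sum>n\<in>{k}. x ^ n /\<^sub>R fact n) \<le> (\<Sum>n. x ^ n /\<^sub>R fact n)"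
    using that by (intro sum_le_suminf summable_exp_generic) auto
  then show ?thesis by (simp add: exp_def field_simps)
qed

lemma integrable_gauss:
  "0 < t \<Longrightarrow> integrable lborel (\<lambda>z::'a::euclidean_space. exp (- t * (norm z)\<^sup>2))"
  using fourier_gauss[of t "0::'a"] by (simp add: has_bochner_integral_iff complex_of_real_integrable_eq)

lemma integral_gauss:
  "0 < t \<Longrightarrow> (LINT z|lborel. exp (- t * (norm (z::'a::euclidean_space))\<^sup>2)) = (pi / t) powr (DIM('a) / 2)"
  using fourier_gauss[of t "0::'a"] by (simp add: has_bochner_integral_iff del: of_real_exp flip: of_real_mult)

lemma integrable_power_gauss:
  assumes t: "0 < t"
  shows "integrable lborel (\<lambda>z::'a::euclidean_space. norm z ^ k * exp (- t * (norm z)\<^sup>2))"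
proof (rule Bochner_Integration.integrable_bound)
  \<comment> \<open>Half of the exponent is kept for integrability; the other half absorbs the power
    through \<open>power_le_fact_exp\<close> at \<open>t / 2 * (norm z)\<^sup>2\<close>. The plain
    Gaussian covers the region where \<open>norm z\<close> is at most 1.\<close>
  show "integrable lborel (\<lambda>z::'a. exp (- t * (norm z)\<^sup>2) + (2 / t) ^ k * fact k * exp (- (t / 2) * (norm z)\<^sup>2))"
    using t by (intro Bochner_Integration.integrable_add integrable_mult_right integrable_gauss) auto
  show "AE z::'a in lborel. norm (norm z ^ k * exp (- t * (norm z)\<^sup>2)) \<le>
     norm (exp (- t * (norm z)\<^sup>2) + (2 / t) ^ k * fact k * exp (- (t / 2) * (norm z)\<^sup>2))"
  proof (intro AE_I2)
    fix z :: 'a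
    let ?r = "norm z"
    have "?r ^ k \<le> 1 + (?r\<^sup>2) ^ k"
    proof (cases "?r \<le> 1")
      case True
      then have "?r ^ k \<le> 1" by (simp add: power_le_one)
      then show ?thesis by (simp add: add_increasing2)
    next
      case False
      then have "?r ^ k \<le> ?r ^ (2 * k)" by (intro power_increasing) auto
      then show ?thesis by (simp add: power_mult)
    qed
    also have "(?r\<^sup>2) ^ k = (2 / t) ^ k * (t / 2 * ?r\<^sup>2) ^ k"
      using t by (simp flip: power_mult_distrib)
    also have "\<dots> \<le> (2 / t) ^ k * (fact k * exp (t / 2 * ?r\<^sup>2))"
      using t by (intro mult_left_mono power_le_fact_exp) auto
    finally have "?r ^ k * exp (- t * ?r\<^sup>2) \<le> (1 + (2 / t) ^ k * (fact k * exp (t / 2 * ?r\<^sup>2))) * exp (- t * ?r\<^sup>2)"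
      by (rule mult_right_mono) auto
    also have "\<dots> = exp (- t * ?r\<^sup>2) + (2 / t) ^ k * fact k * (exp (t / 2 * ?r\<^sup>2) * exp (- t * ?r\<^sup>2))"
      by (simp add: algebra_simps)
    also have "exp (t / 2 * ?r\<^sup>2) * exp (- t * ?r\<^sup>2) = exp (- (t / 2) * ?r\<^sup>2)"
      by (simp flip: exp_add)
    finally show "norm (?r ^ k * exp (- t * ?r\<^sup>2)) \<le>
       norm (exp (- t * ?r\<^sup>2) + (2 / t) ^ k * fact k * exp (- (t / 2) * ?r\<^sup>2))"
      using t by simp
  qed
qed measurable

lemma integrable_gauss_le:
  fixes q :: "'a::euclidean_space \<Rightarrow> complex"
  assumes "0 < t" and [measurable]: "q \<in> borel_measurable borel" and q: "\<And>z. norm (q z) \<le> C * norm z ^ k"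
  shows "integrable lborel (\<lambda>z. q z * of_real (exp (- t * (norm z)\<^sup>2)))"
proof (rule Bochner_Integration.integrable_bound[OF integrable_mult_right[OF integrable_power_gauss[OF assms(1)]]])
  show "AE z in lborel. norm (q z * of_real (exp (- t * (norm z)\<^sup>2))) \<le> norm (C * (norm z ^ k * exp (- t * (norm z)\<^sup>2)))"
  proof (intro AE_I2)
    fix z :: 'a
    have "norm (q z) * exp (- t * (norm z)\<^sup>2) \<le> C * norm z ^ k * exp (- t * (norm z)\<^sup>2)"
      by (rule mult_right_mono[OF q]) simp
    also have "\<dots> \<le> \<bar>\<dots>\<bar>" by (rule abs_ge_self)
    finally show "norm (q z * of_real (exp (- t * (norm z)\<^sup>2))) \<le> norm (C * (norm z ^ k * exp (- t * (norm z)\<^sup>2)))"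
      by (simp add: norm_mult mult_ac)
  qed
qed measurable

lemma gauss_transform_has_derivative:
  fixes \<eta> :: "'a::euclidean_space"
  assumes "0 < t"
  shows "((\<lambda>\<eta>. complex_of_real (c * exp (- (norm \<eta>)\<^sup>2 / (4 * t)))) has_derivative
    (\<lambda>h. of_real (- (\<eta> \<bullet> h) / (2 * t) * (c * exp (- (norm \<eta>)\<^sup>2 / (4 * t)))))) (at \<eta>)"
  unfolding power2_norm_eq_inner using assms
  by (intro has_derivative_of_real) (auto intro!: derivative_eq_intros simp: inner_commute field_simps)

text \<open>A linear factor is \<open>\<i>\<close> times a derivative of the transform in the
  frequency. Uniqueness of derivatives compares this with the derivative of the explicit Gaussian
  transform.\<close>

lemma fourier_gauss_linear:
  fixes \<eta> u :: "'a::euclidean_space"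
  assumes t: "0 < t"
  shows "(LINT z|lborel. cis (- (z \<bullet> \<eta>)) * (of_real (z \<bullet> u) * of_real (exp (- t * (norm z)\<^sup>2))))
    = - \<i> * of_real ((\<eta> \<bullet> u) / (2 * t) * ((pi / t) powr (DIM('a) / 2) * exp (- (norm \<eta>)\<^sup>2 / (4 * t))))"
proof -
  let ?f = "\<lambda>z::'a. complex_of_real (exp (- t * (norm z)\<^sup>2))"
  let ?c = "(pi / t) powr (DIM('a) / 2)"
  have i: "integrable lborel ?f" "integrable lborel (\<lambda>x. of_real ((norm x)\<^sup>2) * ?f x)"
    using integrable_gauss_le[OF t, of "\<lambda>_. 1" 1 0] integrable_gauss_le[OF t, of "\<lambda>x. of_real ((norm x)\<^sup>2)" 1 2]
    by (simp_all add: norm_power)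
  have eq: "(LINT x|lborel. cis (- (x \<bullet> \<eta>)) * ?f x) = of_real (?c * exp (- (norm \<eta>)\<^sup>2 / (4 * t)))" for \<eta>
    using fourier_gauss[OF t, of \<eta>] by (simp add: has_bochner_integral_iff)
  note D = fourier_integral_has_derivative[OF i, of \<eta>, unfolded eq]
  have "(LINT x|lborel. cis (- (x \<bullet> \<eta>)) * (- \<i> * of_real (x \<bullet> u) * ?f x))
     = of_real (- (\<eta> \<bullet> u) / (2 * t) * (?c * exp (- (norm \<eta>)\<^sup>2 / (4 * t))))"
    using has_derivative_unique[OF D gauss_transform_has_derivative[OF t]] by (rule fun_cong)
  moreover have "(LINT x|lborel. cis (- (x \<bullet> \<eta>)) * (- \<i> * of_real (x \<bullet> u) * ?f x))
     = - \<i> * (LINT x|lborel. cis (- (x \<bullet> \<eta>)) * (of_real (x \<bullet> u) * ?f x))"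
    by (subst integral_mult_right_zero[symmetric]) (simp add: algebra_simps)
  ultimately have "\<i> * (- \<i> * (LINT x|lborel. cis (- (x \<bullet> \<eta>)) * (of_real (x \<bullet> u) * ?f x)))
     = \<i> * of_real (- (\<eta> \<bullet> u) / (2 * t) * (?c * exp (- (norm \<eta>)\<^sup>2 / (4 * t))))"
    by (simp only:)
  then show ?thesis by simp
qed

lemma norm_inner_le: "norm (complex_of_real (z \<bullet> u)) \<le> norm u * norm z"
  using Cauchy_Schwarz_ineq2[of z u] by (simp add: mult.commute)

text \<open>One more derivative, now along \<open>v\<close>. It also hits the linear factor of the
  previous transform, which creates the term with \<open>u \<bullet> v\<close>; for coordinate
  vectors this is the source of the trace.\<close>

lemma fourier_gauss_quadratic:
  fixes \<eta> u v :: "'a::euclidean_space"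
  assumes t: "0 < t"
  shows "(LINT z|lborel. cis (- (z \<bullet> \<eta>)) * (of_real ((z \<bullet> u) * (z \<bullet> v)) * of_real (exp (- t * (norm z)\<^sup>2))))
    = of_real (((u \<bullet> v) / (2 * t) - (\<eta> \<bullet> u) * (\<eta> \<bullet> v) / (4 * t\<^sup>2)) *
        ((pi / t) powr (DIM('a) / 2) * exp (- (norm \<eta>)\<^sup>2 / (4 * t))))"
proof -
  let ?g = "\<lambda>z::'a. complex_of_real (exp (- t * (norm z)\<^sup>2))"
  let ?f = "\<lambda>z. of_real (z \<bullet> u) * ?g z"
  let ?c = "(pi / t) powr (DIM('a) / 2)"
  let ?G = "\<lambda>\<eta>::'a. ?c * exp (- (norm \<eta>)\<^sup>2 / (4 * t))"
  have i1: "integrable lborel ?f"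
    by (rule integrable_gauss_le[OF t, where k = 1 and C = "norm u"]) (use norm_inner_le in auto)
  have i2: "integrable lborel (\<lambda>x. of_real ((norm x)\<^sup>2) * ?f x)"
  proof -
    have "integrable lborel (\<lambda>x. (of_real ((norm x)\<^sup>2) * of_real (x \<bullet> u)) * ?g x)"
    proof (rule integrable_gauss_le[OF t, where k = 3 and C = "norm u"])
      show "norm (of_real ((norm z)\<^sup>2) * complex_of_real (z \<bullet> u)) \<le> norm u * norm z ^ 3" for z
        using mult_left_mono[OF norm_inner_le[of z u], of "(norm z)\<^sup>2"]
        by (simp add: norm_mult norm_power power3_eq_cube power2_eq_square mult_ac)
    qed auto
    then show ?thesis by (simp add: mult.assoc)
  qed
  have eq: "(LINT x|lborel. cis (- (x \<bullet> \<eta>)) * ?f x) = - \<i> * of_real ((\<eta> \<bullet> u) / (2 * t) * ?G \<eta>)" for \<eta>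
    using fourier_gauss_linear[OF t] by simp
  note D = fourier_integral_has_derivative[OF i1 i2, of \<eta>, unfolded eq]
  have D': "((\<lambda>\<eta>. - \<i> * complex_of_real ((\<eta> \<bullet> u) / (2 * t) * ?G \<eta>)) has_derivative
     (\<lambda>h. - \<i> * of_real ((\<eta> \<bullet> u) / (2 * t) * (- (\<eta> \<bullet> h) / (2 * t) * ?G \<eta>) + (h \<bullet> u) / (2 * t) * ?G \<eta>))) (at \<eta>)"
    unfolding power2_norm_eq_inner using t
    by (intro has_derivative_mult_right has_derivative_of_real)
       (auto intro!: derivative_eq_intros simp: inner_commute field_simps)
  have "(LINT x|lborel. cis (- (x \<bullet> \<eta>)) * (- \<i> * of_real (x \<bullet> v) * ?f x))
     = - \<i> * of_real ((\<eta> \<bullet> u) / (2 * t) * (- (\<eta> \<bullet> v) / (2 * t) * ?G \<eta>) + (v \<bullet> u) / (2 * t) * ?G \<eta>)"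
    using has_derivative_unique[OF D D'] by (rule fun_cong)
  moreover have "(LINT x|lborel. cis (- (x \<bullet> \<eta>)) * (- \<i> * of_real (x \<bullet> v) * ?f x))
     = - \<i> * (LINT x|lborel. cis (- (x \<bullet> \<eta>)) * (of_real ((x \<bullet> u) * (x \<bullet> v)) * ?g x))"
    by (subst integral_mult_right_zero[symmetric]) (simp add: algebra_simps)
  ultimately have "(LINT x|lborel. cis (- (x \<bullet> \<eta>)) * (of_real ((x \<bullet> u) * (x \<bullet> v)) * ?g x))
     = of_real ((\<eta> \<bullet> u) / (2 * t) * (- (\<eta> \<bullet> v) / (2 * t) * ?G \<eta>) + (v \<bullet> u) / (2 * t) * ?G \<eta>)"
    using mult_left_cancel[of "- \<i>"] by (simp only: neg_equal_0_iff_equal complex_i_not_zero not_False_eq_True)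
  also have "(\<eta> \<bullet> u) / (2 * t) * (- (\<eta> \<bullet> v) / (2 * t) * ?G \<eta>) + (v \<bullet> u) / (2 * t) * ?G \<eta>
     = ((u \<bullet> v) / (2 * t) - (\<eta> \<bullet> u) * (\<eta> \<bullet> v) / (4 * t\<^sup>2)) * ?G \<eta>"
    using t by (simp add: inner_commute power2_eq_square field_simps)
  finally show ?thesis .
qed

lemma has_bochner_integral_Gamma:
  fixes \<beta> r :: real
  assumes \<beta>: "0 < \<beta>" and r: "0 < r"
  shows "has_bochner_integral lborel (\<lambda>t. indicator {0<..} t * (t powr (\<beta> - 1) * exp (- t * r))) (Gamma \<beta> * r powr (- \<beta>))"
proof -
  have "has_bochner_integral lborel (\<lambda>t::real. indicator {0<..} t * (t powr (\<beta> - 1) * exp (- t))) (Gamma \<beta>)"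
  proof (rule has_bochner_integral_nn_integral)
    show "(\<integral>\<^sup>+ t. ennreal (indicator {0<..} t * (t powr (\<beta> - 1) * exp (- t))) \<partial>lborel) = ennreal (Gamma \<beta>)"
      unfolding Gamma_conv_nn_integral_real[OF \<beta>]
      by (intro nn_integral_cong arg_cong[where f = ennreal]) (auto simp: indicator_def exp_minus divide_simps)
  qed (use \<beta> in \<open>auto simp: Gamma_real_pos less_imp_le\<close>)
  then have "has_bochner_integral lborel (\<lambda>t::real. indicator {0<..} (0 + r * t) * ((0 + r * t) powr (\<beta> - 1) * exp (- (0 + r * t)))) (Gamma \<beta> /\<^sub>R \<bar>r\<bar>)"
    using r by (subst (asm) lborel_has_bochner_integral_real_affine_iff[of r _ _ 0]) auto
  then have "has_bochner_integral lborel (\<lambda>t::real. r powr (1 - \<beta>) * (indicator {0<..} (0 + r * t) * ((0 + r * t) powr (\<beta> - 1) * exp (- (0 + r * t)))))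
     (r powr (1 - \<beta>) * (Gamma \<beta> /\<^sub>R \<bar>r\<bar>))"
    by (rule has_bochner_integral_mult_right)
  moreover have "r powr (1 - \<beta>) * (indicator {0<..} (0 + r * t) * ((0 + r * t) powr (\<beta> - 1) * exp (- (0 + r * t))))
    = indicator {0<..} t * (t powr (\<beta> - 1) * exp (- t * r))" for t
  proof (cases "0 < t")
    case True
    have "r powr (1 - \<beta>) * r powr (\<beta> - 1) = 1"
      using r by (simp flip: powr_add)
    with True r show ?thesis
      by (simp add: powr_mult mult_ac)
  qed (use r in \<open>simp add: zero_less_mult_iff\<close>)
  moreover have "r powr (1 - \<beta>) * (Gamma \<beta> /\<^sub>R \<bar>r\<bar>) = Gamma \<beta> * r powr (- \<beta>)"
    using r by (simp add: powr_diff powr_minus field_simps)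
  ultimately show ?thesis by (simp only:)
qed

lemma exp_mult_add_split: "exp (- t * (a + b)) = exp (- t * b) * exp (- t * (a :: real))"
  by (simp add: exp_add[symmetric] algebra_simps)

lemma kernel_pos: "0 < s \<Longrightarrow> 0 < (norm z)\<^sup>2 + (s::real)\<^sup>2"
  by (simp add: add_nonneg_pos)

text \<open>Write the power as a Gamma integral of Gaussians and integrate over \<open>z\<close>
  first. What remains is \<open>t powr (\<beta> - DIM('a) / 2 - 1) * exp (- t * s\<^sup>2)\<close>,
  integrable at 0 because \<open>\<beta>\<close> exceeds half the dimension.\<close>

lemma integrable_kernel:
  fixes \<beta> s :: real
  assumes \<beta>: "DIM('a) / 2 < \<beta>" and s: "0 < s"
  shows "integrable lborel (\<lambda>z::'a::euclidean_space. ((norm z)\<^sup>2 + s\<^sup>2) powr (- \<beta>))"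
proof -
  let ?f = "\<lambda>t (z::'a). indicator {0<..} t * (t powr (\<beta> - 1) * exp (- t * ((norm z)\<^sup>2 + s\<^sup>2)))"
  have \<beta>0: "0 < \<beta>" using \<beta> by (rule le_less_trans[rotated]) simp
  have split: "?f t z = indicator {0<..} t * (t powr (\<beta> - 1) * exp (- t * s\<^sup>2)) * exp (- t * (norm z)\<^sup>2)" for t z
    unfolding exp_mult_add_split by (simp only: mult.assoc)
  have "integrable (lborel \<Otimes>\<^sub>M lborel) (case_prod ?f)"
  proof (rule lborel_pair.Fubini_integrable)
    show "AE t in lborel. integrable lborel (\<lambda>z. case_prod ?f (t, z))"
    proof (intro AE_I2)
      fix t :: real
      show "integrable lborel (\<lambda>z. case_prod ?f (t, z))"
        by (cases "0 < t") (simp_all only: split prod.case integrable_mult_right integrable_gauss, simp)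
    qed
    have "(LINT z|lborel. norm (case_prod ?f (t, z))) =
       pi powr (DIM('a) / 2) * (indicator {0<..} t * (t powr (\<beta> - DIM('a) / 2 - 1) * exp (- t * s\<^sup>2)))" for t
    proof (cases "0 < t")
      case True
      have "(LINT z|lborel. norm (case_prod ?f (t, z))) = (LINT z|lborel. (t powr (\<beta> - 1) * exp (- t * s\<^sup>2)) * exp (- t * (norm (z::'a))\<^sup>2))"
        using True by (simp only: split prod.case) (simp add: abs_mult)
      also have "\<dots> = t powr (\<beta> - 1) * exp (- t * s\<^sup>2) * (pi / t) powr (DIM('a) / 2)"
        by (simp only: integral_mult_right_zero integral_gauss[OF True])
      also have "(pi / t) powr (DIM('a) / 2) = pi powr (DIM('a) / 2) * t powr (- (DIM('a) / 2))"
        using True by (simp add: powr_divide powr_minus_divide)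
      also have "t powr (\<beta> - 1) * exp (- t * s\<^sup>2) * (pi powr (DIM('a) / 2) * t powr (- (DIM('a) / 2)))
         = pi powr (DIM('a) / 2) * (t powr (\<beta> - 1) * t powr (- (DIM('a) / 2)) * exp (- t * s\<^sup>2))"
        by simp
      also have "t powr (\<beta> - 1) * t powr (- (DIM('a) / 2)) = t powr (\<beta> - DIM('a) / 2 - 1)"
        by (subst powr_add[symmetric]) (simp add: algebra_simps)
      finally show ?thesis using True by simp
    qed simp
    moreover have "integrable lborel (\<lambda>t. pi powr (DIM('a) / 2) * (indicator {0<..} t * (t powr (\<beta> - DIM('a) / 2 - 1) * exp (- t * s\<^sup>2))))"
      by (intro integrable_mult_right) (use has_bochner_integral_Gamma[of "\<beta> - DIM('a) / 2" "s\<^sup>2"] \<beta> s in \<open>simp add: has_bochner_integral_iff\<close>)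
    ultimately show "integrable lborel (\<lambda>t. LINT z|lborel. norm (case_prod ?f (t, z)))"
      by (simp only:)
  qed measurable
  then have "integrable lborel (\<lambda>z. LINT t|lborel. ?f t z)"
    by (rule lborel_pair.integrable_snd)
  moreover have "(LINT t|lborel. ?f t z) = Gamma \<beta> * ((norm z)\<^sup>2 + s\<^sup>2) powr (- \<beta>)" for z
    using has_bochner_integral_Gamma[OF \<beta>0 kernel_pos[OF s, of z]] by (rule has_bochner_integral_integral_eq)
  ultimately have "integrable lborel (\<lambda>z::'a. Gamma \<beta> * ((norm z)\<^sup>2 + s\<^sup>2) powr (- \<beta>))"
    by (simp only:)
  then show ?thesis
    using Gamma_real_pos[OF \<beta>0] by simp
qed

text \<open>Subordination: the kernel is a positive superposition of Gaussians, so its transform is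
  the same superposition of theirs. The factor \<open>q\<close> stands for numerators of degree 0, 1
  and 2; integrability against the kernel itself justifies the use of Fubini.\<close>

lemma fourier_kernel_laplace:
  fixes \<beta> s :: real and q :: "'a::euclidean_space \<Rightarrow> complex"
  assumes \<beta>: "0 < \<beta>" and s: "0 < s" and [measurable]: "q \<in> borel_measurable borel"
    and int: "integrable lborel (\<lambda>z. q z * of_real (((norm z)\<^sup>2 + s\<^sup>2) powr (- \<beta>)))"
  shows "(LINT z|lborel. cis (- (z \<bullet> \<eta>)) * (q z * of_real (((norm z)\<^sup>2 + s\<^sup>2) powr (- \<beta>)))) =
    of_real (1 / Gamma \<beta>) * (LINT t|lborel. of_real (indicator {0<..} t * (t powr (\<beta> - 1) * exp (- t * s\<^sup>2))) *
        (LINT z|lborel. cis (- (z \<bullet> \<eta>)) * (q z * of_real (exp (- t * (norm z)\<^sup>2)))))"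
proof -
  let ?g = "\<lambda>z t. indicator {0<..} t * (t powr (\<beta> - 1) * exp (- t * ((norm (z::'a))\<^sup>2 + s\<^sup>2)))"
  let ?f = "\<lambda>z t. cis (- (z \<bullet> \<eta>)) * q z * of_real (?g z t)"
  have G: "has_bochner_integral lborel (?g z) (Gamma \<beta> * ((norm z)\<^sup>2 + s\<^sup>2) powr (- \<beta>))" for z
    using has_bochner_integral_Gamma[OF \<beta> kernel_pos[OF s]] .
  have Gi: "integrable lborel (?g z)" and Ge: "(LINT t|lborel. ?g z t) = Gamma \<beta> * ((norm z)\<^sup>2 + s\<^sup>2) powr (- \<beta>)" for z
    using G[of z] by (simp_all only: has_bochner_integral_iff)
  have "integrable (lborel \<Otimes>\<^sub>M lborel) (case_prod ?f)"
  proof (rule lborel_pair.Fubini_integrable)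
    show "AE z in lborel. integrable lborel (\<lambda>t. case_prod ?f (z, t))"
      unfolding prod.case by (intro AE_I2 integrable_mult_right) (rule integrable_of_real[OF Gi])
    have "(LINT t|lborel. norm (case_prod ?f (z, t))) = Gamma \<beta> * norm (q z * of_real (((norm z)\<^sup>2 + s\<^sup>2) powr (- \<beta>)))" for z
    proof -
      have "norm (case_prod ?f (z, t)) = norm (q z) * ?g z t" for t
        by (simp add: norm_mult abs_mult)
      then have "(LINT t|lborel. norm (case_prod ?f (z, t))) = norm (q z) * (LINT t|lborel. ?g z t)"
        by (simp only: integral_mult_right_zero)
      then show ?thesis unfolding Ge by (simp add: norm_mult)
    qed
    moreover have "integrable lborel (\<lambda>z. Gamma \<beta> * norm (q z * of_real (((norm z)\<^sup>2 + s\<^sup>2) powr (- \<beta>))))"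
      by (intro integrable_mult_right integrable_norm int)
    ultimately show "integrable lborel (\<lambda>z. LINT t|lborel. norm (case_prod ?f (z, t)))"
      by (simp only:)
  qed measurable
  then have "(LINT t|lborel. LINT z|lborel. ?f z t) = (LINT z|lborel. LINT t|lborel. ?f z t)"
    by (rule lborel_pair.Fubini_integral)
  moreover have "(LINT t|lborel. ?f z t) = of_real (Gamma \<beta>) * (cis (- (z \<bullet> \<eta>)) * (q z * of_real (((norm z)\<^sup>2 + s\<^sup>2) powr (- \<beta>))))" for z
  proof -
    have "(LINT t|lborel. ?f z t) = cis (- (z \<bullet> \<eta>)) * q z * (LINT t|lborel. of_real (?g z t))"
      by (rule integral_mult_right_zero)
    also have "(LINT t|lborel. complex_of_real (?g z t)) = of_real (LINT t|lborel. ?g z t)"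
      by (rule integral_of_real[OF Gi])
    finally show ?thesis unfolding Ge by (simp add: mult_ac)
  qed
  moreover have "(LINT z|lborel. ?f z t) = of_real (indicator {0<..} t * (t powr (\<beta> - 1) * exp (- t * s\<^sup>2))) *
        (LINT z|lborel. cis (- (z \<bullet> \<eta>)) * (q z * of_real (exp (- t * (norm z)\<^sup>2))))" for t
    unfolding integral_mult_right_zero[symmetric]
    unfolding exp_mult_add_split by (intro Bochner_Integration.integral_cong refl) (simp add: mult_ac)
  ultimately have "(LINT t|lborel. of_real (indicator {0<..} t * (t powr (\<beta> - 1) * exp (- t * s\<^sup>2))) *
        (LINT z|lborel. cis (- (z \<bullet> \<eta>)) * (q z * of_real (exp (- t * (norm z)\<^sup>2)))))
     = of_real (Gamma \<beta>) * (LINT z|lborel. cis (- (z \<bullet> \<eta>)) * (q z * of_real (((norm z)\<^sup>2 + s\<^sup>2) powr (- \<beta>))))"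
    by (simp only: integral_mult_right_zero)
  then show ?thesis
    using Gamma_real_pos[OF \<beta>] by simp
qed

section \<open>Bessel integrals\<close>

lemma exp_diff_eq_mult: "exp (a - b :: real) = exp a * exp (- b)"
  by (simp add: exp_add[symmetric])

text \<open>In the applications \<open>s\<close> is the parameter of the kernel and \<open>r\<close>
  the length of the frequency; the part of the exponent with \<open>r\<close> is that of a Gaussian
  transform. The indicator places the half-line integral on all of \<open>lborel\<close>, as in
  \<open>has_bochner_integral_Gamma\<close>.\<close>

definition bessel_integrand :: "real \<Rightarrow> real \<Rightarrow> real \<Rightarrow> real \<Rightarrow> real" where
  "bessel_integrand \<nu> s r t = indicator {0<..} t * (t powr (\<nu> - 1) * exp (- t * s\<^sup>2 - r\<^sup>2 / (4 * t)))"

text \<open>Up to elementary factors \<open>bessel \<nu> s r\<close> is the modified Bessel function \<open>K\<^sub>\<nu>\<close> at \<open>s r\<close>.\<close>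

definition bessel :: "real \<Rightarrow> real \<Rightarrow> real \<Rightarrow> real" where
  "bessel \<nu> s r = (LINT t|lborel. bessel_integrand \<nu> s r t)"

lemma bessel_integrand_measurable [measurable]: "bessel_integrand \<nu> s r \<in> borel_measurable borel"
  unfolding bessel_integrand_def by measurable

lemma integrable_bessel:
  assumes "0 < \<nu>" "0 < s"
  shows "integrable lborel (bessel_integrand \<nu> s r)"
proof (rule Bochner_Integration.integrable_bound)
  show "integrable lborel (\<lambda>t. indicator {0<..} t * (t powr (\<nu> - 1) * exp (- t * s\<^sup>2)))"
    using has_bochner_integral_Gamma[of \<nu> "s\<^sup>2"] assms by (simp add: has_bochner_integral_iff)
  show "AE t in lborel. norm (bessel_integrand \<nu> s r t) \<le> norm (indicator {0<..} t * (t powr (\<nu> - 1) * exp (- t * s\<^sup>2)))"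
    by (intro AE_I2) (auto simp: bessel_integrand_def indicator_def intro!: mult_left_mono)
qed measurable

text \<open>The order \<open>\<nu> - 1\<close> may be zero or negative, and then the power alone is
  not integrable at 0. The exponential with \<open>r\<close> repairs this:
  \<open>x * exp (- x) \<le> 1\<close> at \<open>x = r\<^sup>2 / (4 * t)\<close> bounds it by
  \<open>4 * t / r\<^sup>2\<close>, which raises the order by one.\<close>

lemma integrable_bessel_pred:
  assumes \<nu>: "0 < \<nu>" and s: "0 < s" and r: "r \<noteq> 0"
  shows "integrable lborel (bessel_integrand (\<nu> - 1) s r)"
proof (rule Bochner_Integration.integrable_bound)
  show "integrable lborel (\<lambda>t. 4 / r\<^sup>2 * (indicator {0<..} t * (t powr (\<nu> - 1) * exp (- t * s\<^sup>2))))"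
    using has_bochner_integral_Gamma[of \<nu> "s\<^sup>2"] \<nu> s
    by (intro integrable_mult_right) (simp add: has_bochner_integral_iff)
  show "AE t in lborel. norm (bessel_integrand (\<nu> - 1) s r t)
     \<le> norm (4 / r\<^sup>2 * (indicator {0<..} t * (t powr (\<nu> - 1) * exp (- t * s\<^sup>2))))"
  proof (intro AE_I2)
    fix t :: real
    show "norm (bessel_integrand (\<nu> - 1) s r t) \<le> norm (4 / r\<^sup>2 * (indicator {0<..} t * (t powr (\<nu> - 1) * exp (- t * s\<^sup>2))))"
    proof (cases "0 < t")
      case True
      let ?x = "r\<^sup>2 / (4 * t)"
      have "?x \<le> exp ?x" using exp_ge_add_one_self[of ?x] by linarith
      then have "?x * exp (- ?x) \<le> exp ?x * exp (- ?x)" by (rule mult_right_mono) simp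
      also have "\<dots> = 1" by (simp flip: exp_add)
      finally have "?x * exp (- ?x) \<le> 1" .
      then have "exp (- ?x) / t \<le> 4 / r\<^sup>2"
        using True r by (simp add: field_simps)
      then have "exp (- ?x) / t * (t powr (\<nu> - 1) * exp (- t * s\<^sup>2)) \<le> 4 / r\<^sup>2 * (t powr (\<nu> - 1) * exp (- t * s\<^sup>2))"
        by (rule mult_right_mono) simp
      moreover have "t powr (\<nu> - 1 - 1) * exp (- t * s\<^sup>2 - ?x) = exp (- ?x) / t * (t powr (\<nu> - 1) * exp (- t * s\<^sup>2))"
      proof -
        have "t powr (\<nu> - 1 - 1) = t powr (\<nu> - 1) / t"
          using True by (subst powr_diff) simp
        then show ?thesis unfolding exp_diff_eq_mult by simp
      qed
      ultimately show ?thesis using True by (simp add: bessel_integrand_def abs_mult)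
    qed (simp add: bessel_integrand_def)
  qed
qed measurable

text \<open>Substitute \<open>s\<^sup>2 * t\<close> for \<open>t\<close>. Since only the product of
  \<open>s\<close> and \<open>r\<close> is left on the right, the two parameters may be exchanged at
  the price of a power; this is what lets the height and the tangential frequency trade
  places.\<close>

lemma bessel_scale:
  assumes s: "0 < s"
  shows "s powr (2 * \<nu>) * bessel \<nu> s r = bessel \<nu> 1 (s * r)"
proof -
  have s2: "s\<^sup>2 > 0" using s by simp
  have "bessel \<nu> 1 (s * r) = \<bar>s\<^sup>2\<bar> *\<^sub>R (LINT t|lborel. bessel_integrand \<nu> 1 (s * r) (0 + s\<^sup>2 * t))"
    unfolding bessel_def using s by (intro lborel_integral_real_affine) simp
  also have "(LINT t|lborel. bessel_integrand \<nu> 1 (s * r) (0 + s\<^sup>2 * t)) = (LINT t|lborel. (s\<^sup>2) powr (\<nu> - 1) * bessel_integrand \<nu> s r t)"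
  proof (intro Bochner_Integration.integral_cong refl)
    fix t :: real
    show "bessel_integrand \<nu> 1 (s * r) (0 + s\<^sup>2 * t) = (s\<^sup>2) powr (\<nu> - 1) * bessel_integrand \<nu> s r t"
    proof (cases "0 < t")
      case True
      have "- (s\<^sup>2 * t) * 1\<^sup>2 - (s * r)\<^sup>2 / (4 * (s\<^sup>2 * t)) = - t * s\<^sup>2 - r\<^sup>2 / (4 * t)"
        using s True by (simp add: power_mult_distrib mult_ac)
      then show ?thesis
        using True s2 by (simp add: bessel_integrand_def powr_mult)
    next
      case False
      then have "\<not> 0 < s\<^sup>2 * t" using s2 by (simp add: zero_less_mult_iff)
      with False show ?thesis by (simp add: bessel_integrand_def)
    qed
  qed
  also have "\<bar>s\<^sup>2\<bar> *\<^sub>R (LINT t|lborel. (s\<^sup>2) powr (\<nu> - 1) * bessel_integrand \<nu> s r t) = s\<^sup>2 * (s\<^sup>2) powr (\<nu> - 1) * bessel \<nu> s r"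
    by (simp add: bessel_def)
  also have "s\<^sup>2 * (s\<^sup>2) powr (\<nu> - 1) = s powr (2 * \<nu>)"
  proof -
    have "s\<^sup>2 * (s\<^sup>2) powr (\<nu> - 1) = (s\<^sup>2) powr \<nu>"
      using s2 by (simp add: powr_diff)
    moreover have "s\<^sup>2 = s powr 2" using s by simp
    then have "(s\<^sup>2) powr \<nu> = s powr (2 * \<nu>)" by (simp only: powr_powr)
    with \<open>s\<^sup>2 * (s\<^sup>2) powr (\<nu> - 1) = (s\<^sup>2) powr \<nu>\<close> show ?thesis by simp
  qed
  finally show ?thesis by simp
qed

section \<open>Transforms of the kernels with numerators of degree 0, 1 and 2\<close>

lemma powr_pi_div: "0 < t \<Longrightarrow> t powr (\<beta> - 1) * (pi / t) powr d = pi powr d * t powr (\<beta> - d - 1)"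
  by (simp add: powr_divide powr_diff mult_ac)

text \<open>The Gaussian transform contributes \<open>(pi / t) powr (DIM('a) / 2)\<close> and
  thereby lowers the order of the Gamma integral by half the dimension.\<close>

lemma fourier_kernel_0:
  fixes \<beta> s :: real and \<eta> :: "'a::euclidean_space"
  assumes \<beta>: "DIM('a) / 2 < \<beta>" and s: "0 < s"
  shows "(LINT z|lborel. cis (- (z \<bullet> \<eta>)) * of_real (((norm z)\<^sup>2 + s\<^sup>2) powr (- \<beta>))) =
    of_real (pi powr (DIM('a) / 2) / Gamma \<beta> * bessel (\<beta> - DIM('a) / 2) s (norm \<eta>))"
proof -
  have \<beta>0: "0 < \<beta>" using \<beta> by (rule le_less_trans[rotated]) simp
  have "of_real (indicator {0<..} t * (t powr (\<beta> - 1) * exp (- t * s\<^sup>2))) *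
        (LINT z|lborel. cis (- (z \<bullet> \<eta>)) * (1 * of_real (exp (- t * (norm z)\<^sup>2))))
      = complex_of_real (pi powr (DIM('a) / 2) * bessel_integrand (\<beta> - DIM('a) / 2) s (norm \<eta>) t)" for t
  proof (cases "0 < t")
    case True
    have "(LINT z|lborel. cis (- (z \<bullet> \<eta>)) * (1 * of_real (exp (- t * (norm z)\<^sup>2))))
       = of_real ((pi / t) powr (DIM('a) / 2) * exp (- (norm \<eta>)\<^sup>2 / (4 * t)))"
      using fourier_gauss[OF True, of \<eta>] by (simp add: has_bochner_integral_iff)
    moreover have "(t powr (\<beta> - 1) * exp (- t * s\<^sup>2)) * ((pi / t) powr (DIM('a) / 2) * exp (- (norm \<eta>)\<^sup>2 / (4 * t)))
       = (t powr (\<beta> - 1) * (pi / t) powr (DIM('a) / 2)) * exp (- t * s\<^sup>2 - (norm \<eta>)\<^sup>2 / (4 * t))"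
      unfolding exp_diff_eq_mult by simp
    ultimately show ?thesis
      unfolding powr_pi_div[OF True]
      using True by (simp only: of_real_mult[symmetric]) (simp add: bessel_integrand_def)
  qed (simp add: bessel_integrand_def)
  moreover have "integrable lborel (\<lambda>z::'a. 1 * complex_of_real (((norm z)\<^sup>2 + s\<^sup>2) powr (- \<beta>)))"
    unfolding mult_1 by (intro integrable_of_real integrable_kernel[OF \<beta> s])
  ultimately show ?thesis
    using fourier_kernel_laplace[OF \<beta>0 s, of "\<lambda>_. 1" \<eta>]
    by (simp add: bessel_def)
qed

lemma integrable_kernel_quadratic:
  fixes \<beta> s :: real and q :: "'a::euclidean_space \<Rightarrow> complex"
  assumes \<beta>: "DIM('a) / 2 < \<beta>" and s: "0 < s" and [measurable]: "q \<in> borel_measurable borel"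
    and q: "\<And>z. norm (q z) \<le> C * ((norm z)\<^sup>2 + s\<^sup>2)"
  shows "integrable lborel (\<lambda>z. q z * of_real (((norm z)\<^sup>2 + s\<^sup>2) powr (- (\<beta> + 1))))"
proof (rule Bochner_Integration.integrable_bound[OF integrable_mult_right[OF integrable_kernel[OF \<beta> s]]])
  show "AE z in lborel. norm (q z * of_real (((norm z)\<^sup>2 + s\<^sup>2) powr (- (\<beta> + 1)))) \<le> norm (C * ((norm z)\<^sup>2 + s\<^sup>2) powr (- \<beta>))"
  proof (intro AE_I2)
    fix z :: 'a
    let ?w = "(norm z)\<^sup>2 + s\<^sup>2"
    have w: "0 < ?w" using kernel_pos[OF s] .
    have "norm (q z) * ?w powr (- (\<beta> + 1)) \<le> C * ?w * ?w powr (- (\<beta> + 1))"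
      by (rule mult_right_mono[OF q]) simp
    also have "\<dots> = C * ?w powr (- \<beta>)"
      using w by (simp add: powr_mult_base mult.assoc)
    also have "\<dots> \<le> \<bar>\<dots>\<bar>" by (rule abs_ge_self)
    finally show "norm (q z * of_real (?w powr (- (\<beta> + 1)))) \<le> norm (C * ?w powr (- \<beta>))"
      by (simp add: norm_mult)
  qed
qed measurable

lemma norm_inner_le_kernel:
  assumes "0 < s"
  shows "norm (complex_of_real (z \<bullet> u)) \<le> norm u / s * ((norm z)\<^sup>2 + s\<^sup>2)"
proof -
  have "norm z * s \<le> (norm z)\<^sup>2 + s\<^sup>2"
    using sum_squares_bound[of "norm z" s] mult_nonneg_nonneg[OF norm_ge_zero less_imp_le[OF assms], of z] by linarith
  then have "norm z \<le> ((norm z)\<^sup>2 + s\<^sup>2) / s" using assms by (simp add: field_simps)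
  then have "norm u * norm z \<le> norm u * (((norm z)\<^sup>2 + s\<^sup>2) / s)" by (rule mult_left_mono) simp
  then show ?thesis using norm_inner_le[of z u] by simp
qed

text \<open>The exponent is \<open>\<beta> + 1\<close> because the linear factor brings
  \<open>1 / (2 * t)\<close>. The Bessel order is then the same as for a constant numerator over the
  exponent \<open>\<beta>\<close>.\<close>

lemma fourier_kernel_1:
  fixes \<beta> s :: real and \<eta> u :: "'a::euclidean_space"
  assumes \<beta>: "DIM('a) / 2 < \<beta>" and s: "0 < s"
  shows "(LINT z|lborel. cis (- (z \<bullet> \<eta>)) * (of_real (z \<bullet> u) * of_real (((norm z)\<^sup>2 + s\<^sup>2) powr (- (\<beta> + 1))))) =
    - \<i> * of_real (pi powr (DIM('a) / 2) / Gamma (\<beta> + 1) * ((\<eta> \<bullet> u) / 2) * bessel (\<beta> - DIM('a) / 2) s (norm \<eta>))"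
proof -
  have "0 \<le> real DIM('a) / 2" by simp
  then have \<beta>0: "0 < \<beta> + 1" using \<beta> by linarith
  have "of_real (indicator {0<..} t * (t powr (\<beta> + 1 - 1) * exp (- t * s\<^sup>2))) *
        (LINT z|lborel. cis (- (z \<bullet> \<eta>)) * (of_real (z \<bullet> u) * of_real (exp (- t * (norm z)\<^sup>2))))
      = - \<i> * of_real (pi powr (DIM('a) / 2) * ((\<eta> \<bullet> u) / 2)) * complex_of_real (bessel_integrand (\<beta> - DIM('a) / 2) s (norm \<eta>) t)" for t
  proof (cases "0 < t")
    case True
    have "(t powr (\<beta> + 1 - 1) * exp (- t * s\<^sup>2)) * ((\<eta> \<bullet> u) / (2 * t) * ((pi / t) powr (DIM('a) / 2) * exp (- (norm \<eta>)\<^sup>2 / (4 * t))))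
       = (t powr (\<beta> - 1) * (pi / t) powr (DIM('a) / 2)) * ((\<eta> \<bullet> u) / 2) * exp (- t * s\<^sup>2 - (norm \<eta>)\<^sup>2 / (4 * t))"
    proof -
      have "t powr (\<beta> + 1 - 1) = t * t powr (\<beta> - 1)"
        using True by (simp add: powr_mult_base)
      then show ?thesis unfolding exp_diff_eq_mult using True by simp
    qed
    then have "(t powr (\<beta> + 1 - 1) * exp (- t * s\<^sup>2)) * ((\<eta> \<bullet> u) / (2 * t) * ((pi / t) powr (DIM('a) / 2) * exp (- (norm \<eta>)\<^sup>2 / (4 * t))))
       = (pi powr (DIM('a) / 2) * ((\<eta> \<bullet> u) / 2)) * bessel_integrand (\<beta> - DIM('a) / 2) s (norm \<eta>) t"
      unfolding powr_pi_div[OF True] using True by (simp add: bessel_integrand_def)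
    from arg_cong[OF this, of "\<lambda>x. - \<i> * complex_of_real x"] True show ?thesis
      unfolding fourier_gauss_linear[OF True] by (simp add: mult_ac)
  qed (simp add: bessel_integrand_def)
  moreover have "integrable lborel (\<lambda>z::'a. complex_of_real (z \<bullet> u) * complex_of_real (((norm z)\<^sup>2 + s\<^sup>2) powr (- (\<beta> + 1))))"
    by (rule integrable_kernel_quadratic[OF \<beta> s _ norm_inner_le_kernel[OF s]]) simp
  ultimately show ?thesis
    using fourier_kernel_laplace[OF \<beta>0 s, of "\<lambda>z. of_real (z \<bullet> u)" \<eta>]
    by (simp only: integral_mult_right_zero integral_of_real) (simp add: bessel_def mult_ac)
qed

lemma norm_inner_inner_le_kernel:
  "norm (complex_of_real ((z \<bullet> u) * (z \<bullet> v))) \<le> norm u * norm v * ((norm z)\<^sup>2 + s\<^sup>2)"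
proof -
  have "norm (complex_of_real ((z \<bullet> u) * (z \<bullet> v))) \<le> (norm u * norm z) * (norm v * norm z)"
    unfolding of_real_mult norm_mult by (intro mult_mono norm_inner_le) auto
  also have "\<dots> = norm u * norm v * (norm z)\<^sup>2" by (simp add: power2_eq_square)
  also have "\<dots> \<le> norm u * norm v * ((norm z)\<^sup>2 + s\<^sup>2)"
    by (intro mult_left_mono) auto
  finally show ?thesis .
qed

text \<open>The two terms of the quadratic Gaussian transform carry \<open>1 / t\<close> and
  \<open>1 / t\<^sup>2\<close>, which gives two consecutive Bessel orders. The lower one is the
  reason to ask for \<open>\<eta> \<noteq> 0\<close>.\<close>

lemma fourier_kernel_2:
  fixes \<beta> s :: real and \<eta> u v :: "'a::euclidean_space"
  assumes \<beta>: "DIM('a) / 2 < \<beta>" and s: "0 < s" and \<eta>: "\<eta> \<noteq> 0"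
  shows "(LINT z|lborel. cis (- (z \<bullet> \<eta>)) * (of_real ((z \<bullet> u) * (z \<bullet> v)) * of_real (((norm z)\<^sup>2 + s\<^sup>2) powr (- (\<beta> + 1))))) =
    of_real (pi powr (DIM('a) / 2) / Gamma (\<beta> + 1) *
      ((u \<bullet> v) / 2 * bessel (\<beta> - DIM('a) / 2) s (norm \<eta>)
       - (\<eta> \<bullet> u) * (\<eta> \<bullet> v) / 4 * bessel (\<beta> - DIM('a) / 2 - 1) s (norm \<eta>)))"
proof -
  let ?\<nu> = "\<beta> - DIM('a) / 2"
  have "0 \<le> real DIM('a) / 2" by simp
  then have \<beta>0: "0 < \<beta> + 1" using \<beta> by linarith
  have \<nu>: "0 < ?\<nu>" using \<beta> by simp
  let ?b = "\<lambda>t. (u \<bullet> v) / 2 * bessel_integrand ?\<nu> s (norm \<eta>) t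
       - (\<eta> \<bullet> u) * (\<eta> \<bullet> v) / 4 * bessel_integrand (?\<nu> - 1) s (norm \<eta>) t"
  have I: "of_real (indicator {0<..} t * (t powr (\<beta> + 1 - 1) * exp (- t * s\<^sup>2))) *
        (LINT z|lborel. cis (- (z \<bullet> \<eta>)) * (of_real ((z \<bullet> u) * (z \<bullet> v)) * of_real (exp (- t * (norm z)\<^sup>2))))
      = complex_of_real (pi powr (DIM('a) / 2) * ?b t)" for t
  proof (cases "0 < t")
    case True
    let ?E = "exp (- t * s\<^sup>2 - (norm \<eta>)\<^sup>2 / (4 * t))" and ?P = "(pi / t) powr (DIM('a) / 2)"
    have "(t powr (\<beta> + 1 - 1) * exp (- t * s\<^sup>2)) * (((u \<bullet> v) / (2 * t) - (\<eta> \<bullet> u) * (\<eta> \<bullet> v) / (4 * t\<^sup>2)) * (?P * exp (- (norm \<eta>)\<^sup>2 / (4 * t))))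
       = ((u \<bullet> v) / (2 * t) - (\<eta> \<bullet> u) * (\<eta> \<bullet> v) / (4 * t\<^sup>2)) * t powr \<beta> * ?P * (exp (- t * s\<^sup>2) * exp (- (norm \<eta>)\<^sup>2 / (4 * t)))"
      by simp
    also have "exp (- t * s\<^sup>2) * exp (- (norm \<eta>)\<^sup>2 / (4 * t)) = ?E"
      by (simp add: exp_add[symmetric])
    also have "((u \<bullet> v) / (2 * t) - (\<eta> \<bullet> u) * (\<eta> \<bullet> v) / (4 * t\<^sup>2)) * t powr \<beta> * ?P * ?E
       = (u \<bullet> v) / 2 * (t powr (\<beta> - 1) * ?P) * ?E - (\<eta> \<bullet> u) * (\<eta> \<bullet> v) / 4 * (t powr (\<beta> - 1 - 1) * ?P) * ?E"
    proof -
      have "t powr \<beta> = t * t powr (\<beta> - 1)" "t powr (\<beta> - 1) = t * t powr (\<beta> - 1 - 1)"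
        using True by (simp_all add: powr_mult_base)
      then have *: "t powr \<beta> / t = t powr (\<beta> - 1)" "t powr \<beta> / t\<^sup>2 = t powr (\<beta> - 1 - 1)"
        using True by (simp_all add: power2_eq_square)
      have "((u \<bullet> v) / (2 * t) - (\<eta> \<bullet> u) * (\<eta> \<bullet> v) / (4 * t\<^sup>2)) * T * P * E
          = (u \<bullet> v) / 2 * (T / t * P) * E - (\<eta> \<bullet> u) * (\<eta> \<bullet> v) / 4 * (T / t\<^sup>2 * P) * E" for T P E :: real
        by (simp add: algebra_simps)
      from this[of "t powr \<beta>" ?P ?E] show ?thesis by (simp only: *)
    qed
    also have "\<dots> = pi powr (DIM('a) / 2) * ?b t"
      unfolding powr_pi_div[OF True] using True by (simp add: bessel_integrand_def algebra_simps)
    finally show ?thesis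
      unfolding fourier_gauss_quadratic[OF True] using True by (simp only: of_real_mult[symmetric]) simp
  qed (simp add: bessel_integrand_def)
  have J: "integrable lborel (\<lambda>z::'a. complex_of_real ((z \<bullet> u) * (z \<bullet> v)) * complex_of_real (((norm z)\<^sup>2 + s\<^sup>2) powr (- (\<beta> + 1))))"
    by (rule integrable_kernel_quadratic[OF \<beta> s]) (use norm_inner_inner_le_kernel in auto)
  have B: "(LINT t|lborel. ?b t) = (u \<bullet> v) / 2 * bessel ?\<nu> s (norm \<eta>)
       - (\<eta> \<bullet> u) * (\<eta> \<bullet> v) / 4 * bessel (?\<nu> - 1) s (norm \<eta>)"
    unfolding bessel_def using integrable_bessel[OF \<nu> s] integrable_bessel_pred[OF \<nu> s] \<eta> by simp
  have Bi: "integrable lborel (\<lambda>t. pi powr (DIM('a) / 2) * ?b t)"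
    using integrable_bessel[OF \<nu> s] integrable_bessel_pred[OF \<nu> s] \<eta> by simp
  have "(LINT z|lborel. cis (- (z \<bullet> \<eta>)) * (of_real ((z \<bullet> u) * (z \<bullet> v)) * of_real (((norm z)\<^sup>2 + s\<^sup>2) powr (- (\<beta> + 1)))))
     = of_real (1 / Gamma (\<beta> + 1)) * (LINT t|lborel. complex_of_real (pi powr (DIM('a) / 2) * ?b t))"
    using J by (subst fourier_kernel_laplace[OF \<beta>0 s]) (simp_all only: I, measurable)
  also have "(LINT t|lborel. complex_of_real (pi powr (DIM('a) / 2) * ?b t)) = of_real (pi powr (DIM('a) / 2) * (LINT t|lborel. ?b t))"
    by (simp only: integral_of_real[OF Bi] integral_mult_right_zero)
  finally show ?thesis unfolding B by (simp only: of_real_mult[symmetric]) simp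
qed

section \<open>The Fourier transform on Schwartz functions\<close>

text \<open>Used with \<open>c = 1\<close> for translations and with \<open>c = -1\<close> for
  reflections.\<close>

lemma lborel_integral_affine:
  fixes f :: "'a::euclidean_space \<Rightarrow> 'b::{banach, second_countable_topology}"
  assumes f: "f \<in> borel_measurable borel" and c: "\<bar>c\<bar> = 1"
  shows "integrable lborel (\<lambda>x. f (t + c *\<^sub>R x)) \<longleftrightarrow> integrable lborel f"
    and "(LINT x|lborel. f (t + c *\<^sub>R x)) = integral\<^sup>L lborel f"
proof -
  have c0: "c \<noteq> 0" using c by auto
  have *: "(lborel :: 'a measure) = distr lborel borel (\<lambda>x. t + c *\<^sub>R x)"
    using lborel_affine[OF c0, of t] c by (simp add: density_1)
  show "integrable lborel (\<lambda>x. f (t + c *\<^sub>R x)) \<longleftrightarrow> integrable lborel f"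
    by (subst (2) *) (simp add: integrable_distr_eq f)
  show "(LINT x|lborel. f (t + c *\<^sub>R x)) = integral\<^sup>L lborel f"
    by (subst (2) *) (simp add: integral_distr f)
qed

text \<open>The kernel with \<open>s = 1\<close> and exponent \<open>DIM('a)\<close>, twice the
  critical value, dominates this weight.\<close>

lemma integrable_weight:
  "integrable lborel (\<lambda>x::'a::euclidean_space. 1 / (1 + norm x) ^ (2 * DIM('a)))"
proof (rule Bochner_Integration.integrable_bound)
  show "integrable lborel (\<lambda>x::'a. ((norm x)\<^sup>2 + 1\<^sup>2) powr (- real DIM('a)))"
    by (rule integrable_kernel) (simp_all add: DIM_positive)
  show "AE x::'a in lborel. norm (1 / (1 + norm x) ^ (2 * DIM('a))) \<le> norm (((norm x)\<^sup>2 + 1\<^sup>2) powr (- real DIM('a)))"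
  proof (intro AE_I2)
    fix x :: 'a
    have "(norm x)\<^sup>2 + 1\<^sup>2 \<le> (1 + norm x)\<^sup>2" by (simp add: power2_sum)
    then have "((norm x)\<^sup>2 + 1\<^sup>2) ^ DIM('a) \<le> ((1 + norm x)\<^sup>2) ^ DIM('a)"
      by (rule power_mono) simp
    then have "1 / ((1 + norm x)\<^sup>2) ^ DIM('a) \<le> 1 / ((norm x)\<^sup>2 + 1\<^sup>2) ^ DIM('a)"
      using kernel_pos[of 1 x] by (intro divide_left_mono mult_pos_pos zero_less_power) (auto simp: add_pos_nonneg)
    moreover have "((norm x)\<^sup>2 + 1\<^sup>2) powr (- real DIM('a)) = 1 / ((norm x)\<^sup>2 + 1\<^sup>2) ^ DIM('a)"
      using kernel_pos[of 1 x] by (simp add: powr_minus_divide powr_realpow)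
    ultimately show "norm (1 / (1 + norm x) ^ (2 * DIM('a))) \<le> norm (((norm x)\<^sup>2 + 1\<^sup>2) powr (- real DIM('a)))"
      by (simp add: power_mult)
  qed
qed measurable

lemma weight_le_iff: "(1 + norm x) ^ m * r \<le> C \<longleftrightarrow> r \<le> C * (1 / (1 + norm x) ^ m)"
  using zero_less_power[of "1 + norm x" m] by (simp add: pos_le_divide_eq mult.commute add_pos_nonneg)

text \<open>The second estimate keeps the constant explicit, so that it can later be a Schwartz
  seminorm.\<close>

lemma integrable_weight_bound:
  fixes f :: "'a::euclidean_space \<Rightarrow> 'b::{banach, second_countable_topology}"
  assumes [measurable]: "f \<in> borel_measurable borel"
    and f: "\<And>x. (1 + norm x) ^ (2 * DIM('a)) * norm (f x) \<le> C"
  shows "integrable lborel f"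
    and "(LINT x|lborel. norm (f x)) \<le> C * (LINT x|lborel. 1 / (1 + norm (x::'a)) ^ (2 * DIM('a)))"
proof -
  have le: "norm (f x) \<le> C * (1 / (1 + norm x) ^ (2 * DIM('a)))" for x
    using f[of x] unfolding weight_le_iff .
  note int = integrable_mult_right[OF integrable_weight, of C]
  have "norm (f x) \<le> norm (C * (1 / (1 + norm x) ^ (2 * DIM('a))))" for x
    unfolding real_norm_def by (rule order_trans[OF le abs_ge_self])
  then show i: "integrable lborel f"
    by (intro Bochner_Integration.integrable_bound[OF int]) auto
  show "(LINT x|lborel. norm (f x)) \<le> C * (LINT x|lborel. 1 / (1 + norm (x::'a)) ^ (2 * DIM('a)))"
    unfolding integral_mult_right_zero[symmetric] by (intro integral_mono integrable_norm i int le)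
qed

lemma schwartz_integrable:
  fixes f :: "'a::euclidean_space \<Rightarrow> 'b::{banach, second_countable_topology}"
  assumes "f \<in> schwartz"
  shows "integrable lborel f"
  using schwartz_decay[OF assms, of "2 * DIM('a)"] integrable_weight_bound(1)[OF schwartz_measurable[OF assms]] by metis

lemma schwartz_integrable_norm_sq:
  fixes f :: "'a::euclidean_space \<Rightarrow> complex"
  assumes "f \<in> schwartz"
  shows "integrable lborel (\<lambda>x. of_real ((norm x)\<^sup>2) * f x)"
proof -
  have "(norm x)\<^sup>2 = (\<Sum>b\<in>Basis. (x \<bullet> b) * (x \<bullet> b))" for x :: 'a
    unfolding power2_norm_eq_inner by (rule euclidean_inner)
  then have "(\<lambda>x. of_real ((norm x)\<^sup>2) * f x) = (\<lambda>x. \<Sum>b\<in>Basis. (x \<bullet> b) *\<^sub>R (x \<bullet> b) *\<^sub>R f x)"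
    by (simp add: scaleR_conv_of_real sum_distrib_right sum_distrib_left mult_ac)
  also have "\<dots> \<in> schwartz"
    by (intro schwartz_sum schwartz_inner_scaleR assms)
  finally show ?thesis by (rule schwartz_integrable)
qed

lemma fourier_eq:
  fixes f :: "'a::euclidean_space \<Rightarrow> complex"
  assumes [measurable]: "f \<in> borel_measurable borel"
  shows "fourier f \<xi> = of_real ((2 * pi) powr (- real DIM('a) / 2)) * (LINT x|lborel. cis (- (x \<bullet> \<xi>)) * f x)"
  unfolding fourier_def exp_minus_ii_eq_cis by (subst integral_completion) simp_all

lemma norm_fourier_le:
  fixes f :: "'a::euclidean_space \<Rightarrow> complex"
  assumes "integrable lborel f"
  shows "norm (fourier f \<xi>) \<le> (2 * pi) powr (- real DIM('a) / 2) * (LINT x|lborel. norm (f x))"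
proof -
  have [measurable]: "f \<in> borel_measurable borel" using borel_measurable_integrable[OF assms] by simp
  show ?thesis
    unfolding fourier_eq[OF \<open>f \<in> borel_measurable borel\<close>]
    by (simp add: norm_mult, intro mult_left_mono norm_integral_le) (auto simp: norm_mult assms)
qed

section \<open>Transforms of derivatives and continuity of the Fourier transform\<close>

lemma schwartz_lipschitz_dir:
  fixes f :: "'a::euclidean_space \<Rightarrow> complex"
  assumes f: "f \<in> schwartz" and b: "b \<in> Basis"
    and B: "\<And>s. s \<in> {0..h} \<Longrightarrow> norm (dir_deriv b f (x + s *\<^sub>R b)) \<le> B" and h: "0 \<le> h"
  shows "norm (f (x + h *\<^sub>R b) - f x) \<le> h * B"
proof -
  have D: "((\<lambda>s. f (x + s *\<^sub>R b)) has_derivative (\<lambda>r. r *\<^sub>R dir_deriv b f (x + s *\<^sub>R b))) (at s within {0..h})" for s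
  proof -
    have "((\<lambda>s. f (x + s *\<^sub>R b)) has_derivative (\<lambda>r. frechet_derivative f (at (x + s *\<^sub>R b)) (r *\<^sub>R b))) (at s within {0..h})"
      by (rule has_derivative_compose[OF _ schwartz_has_derivative[OF f], unfolded o_def])
         (auto intro!: derivative_eq_intros)
    moreover have "frechet_derivative f (at (x + s *\<^sub>R b)) (r *\<^sub>R b) = r *\<^sub>R dir_deriv b f (x + s *\<^sub>R b)" for r
      unfolding dir_deriv_def
      by (rule linear_cmul[OF has_derivative_linear[OF schwartz_has_derivative[OF f]]])
    ultimately show ?thesis by (simp only:)
  qed
  have "norm (f (x + h *\<^sub>R b) - f (x + 0 *\<^sub>R b)) \<le> B * norm (h - 0)"
  proof (rule differentiable_bound[OF _ D])
    show "onorm (\<lambda>r. r *\<^sub>R dir_deriv b f (x + s *\<^sub>R b)) \<le> B" if "s \<in> {0..h}" for s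
      by (rule onorm_le) (use mult_right_mono[OF B[OF that], of "\<bar>r\<bar>" for r] in \<open>simp add: mult.commute\<close>)
  qed (use h in auto)
  then show ?thesis using h by (simp add: mult.commute)
qed

text \<open>The remainder uses a bound on the segment alone, so that \<open>B\<close> can depend on
  the base point and be integrable in it.\<close>

lemma schwartz_taylor_dir:
  fixes f :: "'a::euclidean_space \<Rightarrow> complex"
  assumes f: "f \<in> schwartz" and b: "b \<in> Basis"
    and B: "\<And>s. s \<in> {0..h} \<Longrightarrow> norm (dir_deriv b (dir_deriv b f) (x + s *\<^sub>R b)) \<le> B" and h: "0 \<le> h"
  shows "norm (f (x + h *\<^sub>R b) - f x - h *\<^sub>R dir_deriv b f x) \<le> h * (h * B)"
proof -
  have D: "((\<lambda>s. f (x + s *\<^sub>R b)) has_vector_derivative dir_deriv b f (x + s *\<^sub>R b)) (at s within {0..h})" for s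
  proof -
    have "((\<lambda>s. f (x + s *\<^sub>R b)) has_derivative (\<lambda>r. frechet_derivative f (at (x + s *\<^sub>R b)) (r *\<^sub>R b))) (at s within {0..h})"
      by (rule has_derivative_compose[OF _ schwartz_has_derivative[OF f], unfolded o_def])
         (auto intro!: derivative_eq_intros)
    moreover have "frechet_derivative f (at (x + s *\<^sub>R b)) (r *\<^sub>R b) = r *\<^sub>R dir_deriv b f (x + s *\<^sub>R b)" for r
      unfolding dir_deriv_def
      by (rule linear_cmul[OF has_derivative_linear[OF schwartz_has_derivative[OF f]]])
    ultimately show ?thesis by (simp only: has_vector_derivative_def)
  qed
  have B0: "0 \<le> B" using order_trans[OF norm_ge_zero B[of 0]] h by simp
  have "norm (f (x + h *\<^sub>R b) - f (x + 0 *\<^sub>R b) - (h - 0) *\<^sub>R dir_deriv b f (x + 0 *\<^sub>R b)) \<le> norm (h - 0) * (h * B)"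
  proof (rule vector_differentiable_bound_linearization[where S = "{0..h}"])
    fix s assume s: "s \<in> {0..h}"
    have "norm (dir_deriv b f (x + s *\<^sub>R b) - dir_deriv b f x) \<le> s * B"
      by (rule schwartz_lipschitz_dir[OF schwartz_dir_deriv[OF f b] b B]) (use s in auto)
    also have "\<dots> \<le> h * B" using s B0 by (intro mult_right_mono) auto
    finally show "norm (dir_deriv b f (x + s *\<^sub>R b) - dir_deriv b f (x + 0 *\<^sub>R b)) \<le> h * B" by simp
  qed (use h D in \<open>auto simp: closed_segment_eq_real_ivl\<close>)
  then show ?thesis using h by simp
qed

lemma norm_cis_linearization: "norm (cis y - 1 - \<i> * of_real y) \<le> y\<^sup>2"
proof -
  have "norm (cis y - 1 - \<i> * of_real y) \<le> y\<^sup>2 / 2"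
    using iexp_approx1[of y 1] by (simp add: cis_conv_exp power2_eq_square algebra_simps)
  also have "\<dots> \<le> y\<^sup>2" by simp
  finally show ?thesis .
qed

lemma eq_zero_if_norm_le_mult:
  fixes z :: "'a::real_normed_vector"
  assumes "\<And>h. 0 < h \<Longrightarrow> h \<le> 1 \<Longrightarrow> norm z \<le> h * K"
  shows "z = 0"
proof (rule ccontr)
  assume z: "z \<noteq> 0"
  have K: "norm z \<le> K" using assms[of 1] by simp
  with z have K0: "0 < K" by (smt (verit) zero_less_norm_iff)
  let ?h = "norm z / (2 * K)"
  have "norm z \<le> ?h * K" using z K K0 by (intro assms) auto
  also have "\<dots> = norm z / 2" using K0 by simp
  finally show False using z by simp
qed

text \<open>In place of integration by parts, the transform of a difference is computed twice.
  Translation by \<open>h *\<^sub>R b\<close> multiplies the transform by a phase, while Taylor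
  expansion gives \<open>h\<close> times the derivative with an error quadratic in \<open>h\<close>
  and integrable in \<open>x\<close>. Dividing by \<open>h\<close> and letting it shrink identifies
  the two.\<close>

lemma fourier_integral_dir_deriv:
  fixes f :: "'a::euclidean_space \<Rightarrow> complex"
  assumes f: "f \<in> schwartz" and b: "b \<in> Basis"
  shows "(LINT x|lborel. cis (- (x \<bullet> \<xi>)) * dir_deriv b f x) = \<i> * of_real (\<xi> \<bullet> b) * (LINT x|lborel. cis (- (x \<bullet> \<xi>)) * f x)"
proof -
  define m where "m = 2 * DIM('a)"
  define w where "w = (\<lambda>x::'a. 1 / (1 + norm x) ^ m)"
  let ?F = "LINT x|lborel. cis (- (x \<bullet> \<xi>)) * f x" and ?G = "LINT x|lborel. cis (- (x \<bullet> \<xi>)) * dir_deriv b f x"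
  let ?c = "\<xi> \<bullet> b"
  note f' = schwartz_dir_deriv[OF f b]
  note [measurable] = schwartz_measurable[OF f] schwartz_measurable[OF f']
  obtain C where C0: "0 \<le> C" and C: "\<And>x. (1 + norm x) ^ m * norm (dir_deriv b (dir_deriv b f) x) \<le> C"
    using schwartz_decay[OF schwartz_dir_deriv[OF f' b]] by blast
  have wi: "integrable lborel w" unfolding w_def m_def by (rule integrable_weight)
  have fi: "integrable lborel (\<lambda>x. cis (- (x \<bullet> \<xi>)) * g x)" if "g \<in> schwartz" for g
    using schwartz_measurable[OF that]
    by (intro Bochner_Integration.integrable_bound[OF schwartz_integrable[OF that]]) (auto simp: norm_mult)
  \<comment> \<open>A shift by at most 1 changes \<open>1 + norm x\<close> by at most the factor 2,
    so the decay of the second derivative holds along the whole segment at the price of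
    \<open>2 ^ m\<close>.\<close>
  have bound: "norm (dir_deriv b (dir_deriv b f) (x + s *\<^sub>R b)) \<le> C * 2 ^ m * w x" if "0 \<le> s" "s \<le> 1" for x s
  proof -
    let ?y = "x + s *\<^sub>R b"
    have "1 + p \<le> 2 * (1 + q)" if "p \<le> q + r" "r \<le> 1" "0 \<le> q" for p q r :: real
      using that by simp
    moreover have "norm x \<le> norm ?y + norm (s *\<^sub>R b)" using norm_triangle_ineq4[of ?y "s *\<^sub>R b"] by simp
    moreover have "norm (s *\<^sub>R b) \<le> 1" using that b by simp
    ultimately have "1 + norm x \<le> 2 * (1 + norm ?y)" using norm_ge_zero by blast
    then have le: "(1 + norm x) ^ m \<le> 2 ^ m * (1 + norm ?y) ^ m"
      unfolding power_mult_distrib[symmetric] by (rule power_mono) simp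
    have "(1 + norm x) ^ m * norm (dir_deriv b (dir_deriv b f) ?y) \<le> 2 ^ m * ((1 + norm ?y) ^ m * norm (dir_deriv b (dir_deriv b f) ?y))"
      using mult_right_mono[OF le norm_ge_zero] by (simp add: mult.assoc)
    also have "\<dots> \<le> 2 ^ m * C" by (intro mult_left_mono C) simp
    finally show ?thesis unfolding weight_le_iff by (simp add: w_def mult_ac)
  qed
  have shift: "(LINT x|lborel. cis (- (x \<bullet> \<xi>)) * f (x + h *\<^sub>R b)) = cis (h * ?c) * ?F" for h
  proof -
    have "(LINT x|lborel. cis (- (x \<bullet> \<xi>)) * f (x + h *\<^sub>R b))
        = (LINT x|lborel. cis (h * ?c) * (cis (- ((h *\<^sub>R b + 1 *\<^sub>R x) \<bullet> \<xi>)) * f (h *\<^sub>R b + 1 *\<^sub>R x)))"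
      by (intro Bochner_Integration.integral_cong) (simp_all add: cis_mult mult.assoc[symmetric] inner_add_left inner_add_right inner_commute add.commute)
    also have "\<dots> = cis (h * ?c) * (LINT x|lborel. cis (- ((h *\<^sub>R b + 1 *\<^sub>R x) \<bullet> \<xi>)) * f (h *\<^sub>R b + 1 *\<^sub>R x))"
      by (rule integral_mult_right_zero)
    also have "(LINT x|lborel. cis (- ((h *\<^sub>R b + 1 *\<^sub>R x) \<bullet> \<xi>)) * f (h *\<^sub>R b + 1 *\<^sub>R x)) = ?F"
      by (rule lborel_integral_affine(2)[of "\<lambda>x. cis (- (x \<bullet> \<xi>)) * f x" 1 "h *\<^sub>R b"]) simp_all
    finally show ?thesis .
  qed
  have shift_i: "integrable lborel (\<lambda>x. cis (- (x \<bullet> \<xi>)) * f (x + h *\<^sub>R b))" for h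
  proof (rule Bochner_Integration.integrable_bound)
    show "integrable lborel (\<lambda>x. f (h *\<^sub>R b + 1 *\<^sub>R x))"
      by (subst lborel_integral_affine(1)) (simp_all add: schwartz_integrable[OF f])
  qed (auto simp: norm_mult add.commute)
  have est: "norm ((cis (h * ?c) - 1) * ?F - of_real h * ?G) \<le> h * (h * (C * 2 ^ m * integral\<^sup>L lborel w))"
    if h: "0 < h" "h \<le> 1" for h
  proof -
    have diff: "(cis (h * ?c) - 1) * ?F - of_real h * ?G
       = (LINT x|lborel. cis (- (x \<bullet> \<xi>)) * f (x + h *\<^sub>R b) - cis (- (x \<bullet> \<xi>)) * f x - of_real h * (cis (- (x \<bullet> \<xi>)) * dir_deriv b f x))"
      using shift_i fi[OF f] fi[OF f']
      by (simp only: Bochner_Integration.integral_diff integrable_mult_right Bochner_Integration.integrable_diff integral_mult_right_zero shift)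
        (simp add: algebra_simps)
    have "norm ((cis (h * ?c) - 1) * ?F - of_real h * ?G) \<le> (LINT x|lborel. h * (h * (C * 2 ^ m * w x)))"
      unfolding diff
    proof (rule norm_integral_le)
      show "integrable lborel (\<lambda>x. h * (h * (C * 2 ^ m * w x)))"
        by (intro integrable_mult_right wi)
      fix x
      have "cis (- (x \<bullet> \<xi>)) * f (x + h *\<^sub>R b) - cis (- (x \<bullet> \<xi>)) * f x - of_real h * (cis (- (x \<bullet> \<xi>)) * dir_deriv b f x)
         = cis (- (x \<bullet> \<xi>)) * (f (x + h *\<^sub>R b) - f x - h *\<^sub>R dir_deriv b f x)"
        by (simp add: scaleR_conv_of_real algebra_simps)
      moreover have "norm (f (x + h *\<^sub>R b) - f x - h *\<^sub>R dir_deriv b f x) \<le> h * (h * (C * 2 ^ m * w x))"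
        by (rule schwartz_taylor_dir[OF f b bound]) (use h in auto)
      ultimately show "norm (cis (- (x \<bullet> \<xi>)) * f (x + h *\<^sub>R b) - cis (- (x \<bullet> \<xi>)) * f x - of_real h * (cis (- (x \<bullet> \<xi>)) * dir_deriv b f x))
         \<le> h * (h * (C * 2 ^ m * w x))"
        by (simp add: norm_mult)
    qed
    then show ?thesis by simp
  qed
  have "\<i> * of_real ?c * ?F - ?G = 0"
  proof (rule eq_zero_if_norm_le_mult)
    fix h :: real assume h: "0 < h" "h \<le> 1"
    let ?K = "C * 2 ^ m * integral\<^sup>L lborel w"
    have "of_real h * (\<i> * of_real ?c * ?F - ?G) = ((cis (h * ?c) - 1) * ?F - of_real h * ?G) - (cis (h * ?c) - 1 - \<i> * of_real (h * ?c)) * ?F"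
      by (simp add: algebra_simps)
    also have "norm \<dots> \<le> h * (h * ?K) + (h * ?c)\<^sup>2 * norm ?F"
      using est[OF h] mult_right_mono[OF norm_cis_linearization[of "h * ?c"] norm_ge_zero[of ?F]]
      by (intro norm_triangle_le_diff) (auto simp: norm_mult intro!: add_mono)
    also have "\<dots> = h * (h * (?K + ?c\<^sup>2 * norm ?F))"
      by (simp add: algebra_simps power2_eq_square)
    finally have "h * norm (\<i> * of_real ?c * ?F - ?G) \<le> h * (h * (?K + ?c\<^sup>2 * norm ?F))"
      using h by (simp add: norm_mult)
    then show "norm (\<i> * of_real ?c * ?F - ?G) \<le> h * (?K + ?c\<^sup>2 * norm ?F)"
      using h by simp
  qed
  then show ?thesis by simp
qed

lemma fourier_dir_deriv:
  fixes f :: "'a::euclidean_space \<Rightarrow> complex"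
  assumes f: "f \<in> schwartz" and b: "b \<in> Basis"
  shows "fourier (dir_deriv b f) \<xi> = \<i> * of_real (\<xi> \<bullet> b) * fourier f \<xi>"
  unfolding fourier_eq[OF schwartz_measurable[OF f]] fourier_eq[OF schwartz_measurable[OF schwartz_dir_deriv[OF f b]]]
    fourier_integral_dir_deriv[OF f b] by (simp add: mult_ac)

lemma fourier_iter_deriv:
  fixes f :: "'a::euclidean_space \<Rightarrow> complex"
  assumes f: "f \<in> schwartz" and b: "b \<in> Basis"
  shows "fourier (iter_deriv (replicate k b) f) \<xi> = (\<i> * of_real (\<xi> \<bullet> b)) ^ k * fourier f \<xi>"
proof (induction k)
  case (Suc k)
  have "iter_deriv (replicate k b) f \<in> schwartz"
    using b by (intro schwartz_iter_deriv[OF f]) auto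
  then show ?case by (simp add: iter_deriv_Cons fourier_dir_deriv[OF _ b] Suc)
qed simp

lemma norm_le_basis:
  fixes \<xi> :: "'a::euclidean_space"
  obtains b where "b \<in> Basis" "norm \<xi> \<le> DIM('a) * \<bar>\<xi> \<bullet> b\<bar>"
proof -
  let ?M = "Max ((\<lambda>b. \<bar>\<xi> \<bullet> b\<bar>) ` Basis)"
  have fin: "finite ((\<lambda>b. \<bar>\<xi> \<bullet> b\<bar>) ` Basis)" and ne: "(\<lambda>b. \<bar>\<xi> \<bullet> b\<bar>) ` Basis \<noteq> {}" by auto
  from Max_in[OF fin ne] obtain b where b: "b \<in> Basis" "?M = \<bar>\<xi> \<bullet> b\<bar>"
    unfolding image_iff by blast
  have "norm \<xi> \<le> (\<Sum>b\<in>Basis. \<bar>\<xi> \<bullet> b\<bar>)" by (rule norm_le_l1)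
  also have "\<dots> \<le> real (card (Basis :: 'a set)) * ?M"
    by (rule sum_bounded_above) (use fin in auto)
  finally show ?thesis using b that by simp
qed

text \<open>Decay of order \<open>k\<close> of the transform costs \<open>k\<close> derivatives.
  Comparing \<open>\<xi>\<close> with its largest coordinate makes derivatives in a single direction
  sufficient, and the weight of order \<open>2 * DIM('a)\<close> makes them integrable. Since
  \<open>K\<close> is chosen before \<open>f\<close>, this is continuity of the transform for the
  Schwartz seminorms.\<close>

lemma fourier_schwartz_norm:
  fixes k :: nat
  obtains K where "0 \<le> K" "\<And>(f :: 'a::euclidean_space \<Rightarrow> complex) \<xi>. f \<in> schwartz \<Longrightarrow>
    (1 + norm \<xi>) ^ k * norm (fourier f \<xi>) \<le> K * schwartz_norm (max k (2 * DIM('a))) f"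
proof -
  let ?N = "max k (2 * DIM('a))"
  let ?c = "(2 * pi) powr (- real DIM('a) / 2) * (LINT x|lborel. 1 / (1 + norm (x::'a)) ^ (2 * DIM('a)))"
  have c0: "0 \<le> ?c" by simp
  have key: "norm (fourier (iter_deriv (replicate j b) f) \<xi>) \<le> ?c * schwartz_norm ?N f"
    if f: "f \<in> schwartz" and b: "b \<in> Basis" and j: "j \<le> k" for f :: "'a \<Rightarrow> complex" and b j \<xi>
  proof -
    let ?g = "iter_deriv (replicate j b) f"
    have bs: "set (replicate j b) \<subseteq> Basis" using b by auto
    have g: "?g \<in> schwartz" by (rule schwartz_iter_deriv[OF f bs])
    have "norm (fourier ?g \<xi>) \<le> (2 * pi) powr (- real DIM('a) / 2) * (LINT x|lborel. norm (?g x))"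
      by (rule norm_fourier_le[OF schwartz_integrable[OF g]])
    also have "\<dots> \<le> (2 * pi) powr (- real DIM('a) / 2) * (schwartz_norm ?N f * (LINT x|lborel. 1 / (1 + norm (x::'a)) ^ (2 * DIM('a))))"
      by (intro mult_left_mono integrable_weight_bound(2)[OF schwartz_measurable[OF g]] schwartz_norm_ge[OF f bs]) (use j in auto)
    finally show ?thesis by (simp add: mult_ac)
  qed
  have "(1 + norm \<xi>) ^ k * norm (fourier f \<xi>) \<le> (2 ^ k * (1 + DIM('a) ^ k) * ?c) * schwartz_norm ?N f"
    if f: "f \<in> schwartz" for f :: "'a \<Rightarrow> complex" and \<xi>
  proof -
    obtain b where b: "b \<in> Basis" "norm \<xi> \<le> DIM('a) * \<bar>\<xi> \<bullet> b\<bar>" by (rule norm_le_basis)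
    have "norm \<xi> ^ k \<le> (DIM('a) * \<bar>\<xi> \<bullet> b\<bar>) ^ k" using b(2) by (rule power_mono) simp
    then have "norm \<xi> ^ k * norm (fourier f \<xi>) \<le> DIM('a) ^ k * (\<bar>\<xi> \<bullet> b\<bar> ^ k * norm (fourier f \<xi>))"
      using mult_right_mono[OF _ norm_ge_zero] by (simp add: power_mult_distrib flip: mult.assoc)
    also have "\<bar>\<xi> \<bullet> b\<bar> ^ k * norm (fourier f \<xi>) = norm (fourier (iter_deriv (replicate k b) f) \<xi>)"
      unfolding fourier_iter_deriv[OF f b(1)] by (simp add: norm_mult norm_power)
    also have "real (DIM('a) ^ k) * \<dots> \<le> DIM('a) ^ k * (?c * schwartz_norm ?N f)"
      by (intro mult_left_mono key f b) auto
    finally have 1: "norm \<xi> ^ k * norm (fourier f \<xi>) \<le> DIM('a) ^ k * (?c * schwartz_norm ?N f)" .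
    have 2: "norm (fourier f \<xi>) \<le> ?c * schwartz_norm ?N f"
      using key[OF f b(1), of 0] by simp
    have "(1 + norm \<xi>) ^ k * norm (fourier f \<xi>) \<le> 2 ^ k * (1 + norm \<xi> ^ k) * norm (fourier f \<xi>)"
      by (intro mult_right_mono power_one_plus_le) auto
    also have "\<dots> = 2 ^ k * (norm (fourier f \<xi>) + norm \<xi> ^ k * norm (fourier f \<xi>))" by (simp add: algebra_simps)
    also have "\<dots> \<le> 2 ^ k * (?c * schwartz_norm ?N f + DIM('a) ^ k * (?c * schwartz_norm ?N f))"
      by (intro mult_left_mono add_mono 1 2) auto
    also have "\<dots> = (2 ^ k * (1 + DIM('a) ^ k) * ?c) * schwartz_norm ?N f" by (simp add: algebra_simps)
    finally show ?thesis .
  qed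
  from that[OF mult_nonneg_nonneg[OF of_nat_0_le_iff c0] this] show ?thesis .
qed

lemma fourier_has_derivative:
  fixes f :: "'a::euclidean_space \<Rightarrow> complex"
  assumes f: "f \<in> schwartz"
  shows "(fourier f has_derivative (\<lambda>h. fourier (\<lambda>x. - \<i> * ((x \<bullet> h) *\<^sub>R f x)) \<xi>)) (at \<xi>)"
proof -
  have m: "(\<lambda>x. - \<i> * ((x \<bullet> h) *\<^sub>R f x)) \<in> borel_measurable borel" for h
    by (intro schwartz_measurable schwartz_cmult schwartz_inner_scaleR f)
  have "fourier f = (\<lambda>\<xi>. of_real ((2 * pi) powr (- real DIM('a) / 2)) * (LINT x|lborel. cis (- (x \<bullet> \<xi>)) * f x))"
    by (rule ext) (rule fourier_eq[OF schwartz_measurable[OF f]])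
  then show ?thesis
    using has_derivative_mult_right[OF fourier_integral_has_derivative[OF schwartz_integrable[OF f] schwartz_integrable_norm_sq[OF f], of \<xi>],
       of "of_real ((2 * pi) powr (- real DIM('a) / 2))"]
    unfolding fourier_eq[OF m] by (simp add: scaleR_conv_of_real mult.assoc)
qed

text \<open>The family of all transforms is closed under derivatives, because a derivative of
  \<open>fourier f\<close> is, up to a constant, the transform of \<open>f\<close> times a linear
  factor.\<close>

lemma fourier_schwartz:
  fixes f :: "'a::euclidean_space \<Rightarrow> complex"
  assumes f: "f \<in> schwartz"
  shows "fourier f \<in> schwartz"
proof (rule schwartz_coinduct[where S = "fourier ` schwartz"])
  fix g :: "'a \<Rightarrow> complex" assume "g \<in> fourier ` schwartz"
  then obtain f where f: "f \<in> schwartz" and g: "g = fourier f" by auto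
  show "g differentiable (at x)" for x
    unfolding g using fourier_has_derivative[OF f] differentiableI by blast
  show "bounded (range (\<lambda>x. norm x ^ k *\<^sub>R g x))" for k
  proof -
    obtain K where K: "\<And>(f :: 'a \<Rightarrow> complex) \<xi>. f \<in> schwartz \<Longrightarrow>
      (1 + norm \<xi>) ^ k * norm (fourier f \<xi>) \<le> K * schwartz_norm (max k (2 * DIM('a))) f"
      using fourier_schwartz_norm[of k] by blast
    have "norm \<xi> ^ k * norm (g \<xi>) \<le> K * schwartz_norm (max k (2 * DIM('a))) f" for \<xi>
    proof -
      have "norm \<xi> ^ k * norm (g \<xi>) \<le> (1 + norm \<xi>) ^ k * norm (g \<xi>)"
        by (intro mult_right_mono power_mono) auto
      also have "\<dots> \<le> K * schwartz_norm (max k (2 * DIM('a))) f" unfolding g by (rule K[OF f])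
      finally show ?thesis .
    qed
    then show ?thesis by (rule boundedI_decay)
  qed
  show "dir_deriv b g \<in> fourier ` schwartz" if "b \<in> Basis" for b
  proof -
    have "dir_deriv b g = fourier (\<lambda>x. - \<i> * ((x \<bullet> b) *\<^sub>R f x))"
      unfolding g by (rule ext) (rule dir_deriv_eq[OF fourier_has_derivative[OF f]])
    then show ?thesis
      by (simp only:) (intro imageI schwartz_cmult schwartz_inner_scaleR f)
  qed
qed (use f in blast)

section \<open>Fourier inversion\<close>

lemma schwartz_reflect:
  assumes "f \<in> schwartz"
  shows "(\<lambda>x. f (- x)) \<in> schwartz"
proof (rule schwartz_coinduct[where S = "{(\<lambda>x. f (- x)) |f. f \<in> schwartz}"])
  fix h assume "h \<in> {(\<lambda>x. f (- x)) |f. f \<in> schwartz}"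
  then obtain f where h: "h = (\<lambda>x. f (- x))" and f: "f \<in> schwartz" by blast
  have D: "(h has_derivative (\<lambda>d. frechet_derivative f (at (- x)) (- d))) (at x)" for x
    unfolding h by (rule has_derivative_compose[OF _ schwartz_has_derivative[OF f], unfolded o_def])
         (auto intro!: derivative_eq_intros)
  show "h differentiable (at x)" for x
    using D differentiableI by blast
  show "bounded (range (\<lambda>x. norm x ^ k *\<^sub>R h x))" for k
  proof -
    obtain B where B: "\<And>x. norm (norm x ^ k *\<^sub>R f x) \<le> B"
      using schwartz_bounded[OF f, of k] unfolding bounded_iff by auto
    have "norm x ^ k * norm (h x) \<le> B" for x
      using B[of "- x"] by (simp add: h)
    then show ?thesis by (rule boundedI_decay)
  qed
  show "dir_deriv b h \<in> {(\<lambda>x. f (- x)) |f. f \<in> schwartz}" if b: "b \<in> Basis" for b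
  proof -
    have "frechet_derivative f (at (- x)) (- b) = - frechet_derivative f (at (- x)) b" for x
      by (rule linear_neg[OF has_derivative_linear[OF schwartz_has_derivative[OF f]]])
    then have "dir_deriv b h = (\<lambda>x. - dir_deriv b f (- x))"
      using dir_deriv_eq[OF D] by (auto simp: dir_deriv_def)
    then show ?thesis using schwartz_uminus[OF schwartz_dir_deriv[OF f b]]
      by (intro CollectI exI[of _ "\<lambda>x. - dir_deriv b f x"]) simp
  qed
qed (use assms in blast)

text \<open>This gives the rate of continuity for Gaussian averages in the inversion
  formula.\<close>

lemma schwartz_lipschitz:
  fixes f :: "'a::euclidean_space \<Rightarrow> complex"
  assumes f: "f \<in> schwartz"
  obtains L where "0 \<le> L" "\<And>x y. norm (f x - f y) \<le> L * norm (x - y)"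
proof -
  have "\<exists>B. \<forall>x. norm (dir_deriv b f x) \<le> B" if b: "b \<in> Basis" for b
  proof -
    obtain B where "\<And>x. (1 + norm x) ^ 0 * norm (dir_deriv b f x) \<le> B"
      using schwartz_decay[OF schwartz_dir_deriv[OF f b], of 0] by blast
    then show ?thesis by auto
  qed
  then obtain B where B: "\<And>b x. b \<in> Basis \<Longrightarrow> norm (dir_deriv b f x) \<le> B b" by metis
  let ?L = "\<Sum>b\<in>Basis. B b"
  have "norm (f x - f y) \<le> ?L * norm (x - y)" for x y
  proof (rule differentiable_bound[OF convex_UNIV schwartz_has_derivative[OF f]])
    fix x :: 'a
    note lin = has_derivative_linear[OF schwartz_has_derivative[OF f], of x]
    show "onorm (frechet_derivative f (at x)) \<le> ?L"
    proof (rule onorm_le)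
      fix d :: 'a
      have "frechet_derivative f (at x) d = (\<Sum>b\<in>Basis. (d \<bullet> b) *\<^sub>R dir_deriv b f x)"
        unfolding dir_deriv_def
        by (subst (1) euclidean_representation[of d, symmetric]) (simp add: linear_sum[OF lin] linear_cmul[OF lin])
      also have "norm \<dots> \<le> (\<Sum>b\<in>Basis. norm d * B b)"
        by (rule sum_norm_le) (auto intro!: mult_mono B Basis_le_norm)
      finally show "norm (frechet_derivative f (at x) d) \<le> ?L * norm d"
        by (simp add: sum_distrib_left sum_distrib_right mult.commute)
    qed
  qed simp_all
  moreover have "0 \<le> ?L"
    by (intro sum_nonneg order_trans[OF norm_ge_zero B])
  ultimately show ?thesis using that by blast
qed

lemma integral_gauss_norm_sq:
  assumes t: "0 < t"
  shows "(LINT z|lborel. (norm (z::'a::euclidean_space))\<^sup>2 * exp (- t * (norm z)\<^sup>2)) = DIM('a) / (2 * t) * (pi / t) powr (DIM('a) / 2)"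
proof -
  have i: "integrable lborel (\<lambda>z::'a. (z \<bullet> b) * (z \<bullet> b) * exp (- t * (norm z)\<^sup>2))" if "b \<in> Basis" for b
  proof (rule Bochner_Integration.integrable_bound[OF integrable_power_gauss[OF t, of 2]])
    have "\<bar>z \<bullet> b\<bar> * \<bar>z \<bullet> b\<bar> \<le> norm z * norm z" for z
      using Basis_le_norm[OF that] by (intro mult_mono) auto
    then show "AE z in lborel. norm ((z \<bullet> b) * (z \<bullet> b) * exp (- t * (norm z)\<^sup>2)) \<le> norm ((norm z)\<^sup>2 * exp (- t * (norm z)\<^sup>2))"
      by (auto simp: abs_mult power2_eq_square intro!: mult_right_mono)
  qed measurable
  have e: "(LINT z|lborel. (z \<bullet> b) * (z \<bullet> b) * exp (- t * (norm z)\<^sup>2)) = 1 / (2 * t) * (pi / t) powr (DIM('a) / 2)"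
    if "b \<in> Basis" for b :: 'a
  proof -
    have "complex_of_real (LINT z|lborel. (z \<bullet> b) * (z \<bullet> b) * exp (- t * (norm z)\<^sup>2)) = of_real (1 / (2 * t) * (pi / t) powr (DIM('a) / 2))"
      using fourier_gauss_quadratic[OF t, of 0 b b] that i[OF that]
      by (simp del: of_real_mult add: of_real_mult[symmetric])
    then show ?thesis by (simp only: of_real_eq_iff)
  qed
  have "(norm z)\<^sup>2 * exp (- t * (norm z)\<^sup>2) = (\<Sum>b\<in>Basis. (z \<bullet> b) * (z \<bullet> b) * exp (- t * (norm z)\<^sup>2))" for z :: 'a
    unfolding power2_norm_eq_inner by (subst (1) euclidean_inner) (simp add: sum_distrib_right)
  then have "(LINT z|lborel. (norm (z::'a))\<^sup>2 * exp (- t * (norm z)\<^sup>2)) = (\<Sum>b\<in>(Basis::'a set). LINT z|lborel. (z \<bullet> b) * (z \<bullet> b) * exp (- t * (norm z)\<^sup>2))"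
    using i by simp
  also have "\<dots> = (\<Sum>b\<in>(Basis::'a set). 1 / (2 * t) * (pi / t) powr (DIM('a) / 2))"
    by (intro sum.cong refl e)
  also have "\<dots> = DIM('a) / (2 * t) * (pi / t) powr (DIM('a) / 2)" by simp
  finally show ?thesis .
qed

text \<open>Gaussian summability: regularise by \<open>exp (- t |\<xi>|\<^sup>2)\<close> and let \<open>t\<close> tend to \<open>0\<close>.\<close>

lemma fourier_integral_inversion:
  fixes f :: "'a::euclidean_space \<Rightarrow> complex"
  assumes f: "f \<in> schwartz"
  defines "F \<equiv> \<lambda>\<xi>. LINT y|lborel. cis (- (y \<bullet> \<xi>)) * f y"
  shows "(LINT \<xi>|lborel. cis (x \<bullet> \<xi>) * F \<xi>) = of_real ((2 * pi) ^ DIM('a)) * f x"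
proof -
  let ?d = "DIM('a)"
  note [measurable] = schwartz_measurable[OF f]
  note fi = schwartz_integrable[OF f]
  have Fm [measurable]: "F \<in> borel_measurable borel"
    unfolding F_def by measurable
  have F_eq: "F \<xi> = of_real ((2 * pi) powr (real ?d / 2)) * fourier f \<xi>" for \<xi>
    unfolding fourier_eq[OF schwartz_measurable[OF f]] F_def
    by (simp add: powr_minus flip: of_real_mult mult.assoc)
  have Fi: "integrable lborel F"
    unfolding F_eq by (intro integrable_mult_right schwartz_integrable fourier_schwartz f)
  let ?I = "\<lambda>t. LINT \<xi>|lborel. cis (x \<bullet> \<xi>) * F \<xi> * of_real (exp (- t * (norm \<xi>)\<^sup>2))"
  obtain L where L0: "0 \<le> L" and L: "\<And>x y. norm (f x - f y) \<le> L * norm (x - y)"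
    using schwartz_lipschitz[OF f] by blast
  \<comment> \<open>By Fubini the regularised inversion integral is an average of \<open>f\<close>
    around \<open>x\<close>, up to a constant factor, against a Gaussian of width of order
    \<open>sqrt t\<close>.\<close>
  have I_eq: "?I t = (LINT z|lborel. f (x + z) * of_real ((pi / t) powr (?d / 2) * exp (- (1 / (4 * t)) * (norm z)\<^sup>2)))"
    if t: "0 < t" for t
  proof -
    let ?H = "\<lambda>\<xi> y. f y * (cis (- (\<xi> \<bullet> (y - x))) * of_real (exp (- t * (norm \<xi>)\<^sup>2)))"
    have "integrable (lborel \<Otimes>\<^sub>M lborel) (case_prod ?H)"
    proof (rule lborel_pair.Fubini_integrable)
      show "AE \<xi> in lborel. integrable lborel (\<lambda>y. case_prod ?H (\<xi>, y))"
        unfolding prod.case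
        using t by (intro AE_I2 Bochner_Integration.integrable_bound[OF fi])
           (auto simp: norm_mult intro!: mult_left_le)
      have "integrable lborel (\<lambda>\<xi>::'a. (LINT y|lborel. norm (f y)) * exp (- t * (norm \<xi>)\<^sup>2))"
        by (intro integrable_mult_right integrable_gauss t)
      then show "integrable lborel (\<lambda>\<xi>. LINT y|lborel. norm (case_prod ?H (\<xi>, y)))"
        by (simp add: norm_mult)
    qed measurable
    then have "(LINT y|lborel. LINT \<xi>|lborel. ?H \<xi> y) = (LINT \<xi>|lborel. LINT y|lborel. ?H \<xi> y)"
      by (rule lborel_pair.Fubini_integral)
    also have "\<dots> = ?I t"
    proof (intro Bochner_Integration.integral_cong refl)
      fix \<xi> :: 'a
      have H: "?H \<xi> y = (cis (x \<bullet> \<xi>) * of_real (exp (- t * (norm \<xi>)\<^sup>2))) * (cis (- (y \<bullet> \<xi>)) * f y)" for y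
      proof -
        have "cis (- (\<xi> \<bullet> (y - x))) = cis (x \<bullet> \<xi>) * cis (- (y \<bullet> \<xi>))"
          by (simp add: cis_mult inner_diff_right inner_commute)
        then show ?thesis by (simp only: mult_ac)
      qed
      then show "(LINT y|lborel. ?H \<xi> y) = cis (x \<bullet> \<xi>) * F \<xi> * of_real (exp (- t * (norm \<xi>)\<^sup>2))"
        by (simp only: H integral_mult_right_zero F_def) (simp only: mult_ac)
    qed
    finally have "?I t = (LINT y|lborel. LINT \<xi>|lborel. ?H \<xi> y)" by simp
    also have "\<dots> = (LINT y|lborel. f y * of_real ((pi / t) powr (?d / 2) * exp (- (norm (y - x))\<^sup>2 / (4 * t))))"
      using fourier_gauss[OF t, where ?'a = 'a] by (simp add: has_bochner_integral_iff)
    also have "\<dots> = (LINT z|lborel. f (x + 1 *\<^sub>R z) * of_real ((pi / t) powr (?d / 2) * exp (- (norm (x + 1 *\<^sub>R z - x))\<^sup>2 / (4 * t))))"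
      by (rule lborel_integral_affine(2)[symmetric, of "\<lambda>y. f y * of_real ((pi / t) powr (?d / 2) * exp (- (norm (y - x))\<^sup>2 / (4 * t)))"]) simp_all
    finally show ?thesis by simp
  qed
  have const: "(pi / t) powr (?d / 2) * (4 * pi * t) powr (?d / 2) = (2 * pi) ^ ?d" if t: "0 < t" for t
  proof -
    have "(pi / t) powr (?d / 2) * (4 * pi * t) powr (?d / 2) = ((2 * pi) ^ 2) powr (?d / 2)"
      using t by (subst powr_mult[symmetric]) (auto simp: power2_eq_square mult_ac)
    also have "\<dots> = (2 * pi) powr (2 * (?d / 2))"
    proof -
      have "(2 * pi) ^ 2 = (2 * pi) powr 2" by simp
      then show ?thesis by (simp only: powr_powr)
    qed
    also have "\<dots> = (2 * pi) powr (real ?d)" by simp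
    also have "\<dots> = (2 * pi) ^ ?d" by (rule powr_realpow) simp
    finally show ?thesis .
  qed
  \<comment> \<open>The error of the average is controlled by the Lipschitz constant times the mean
    distance from \<open>x\<close>, which is of order \<open>sqrt t\<close>.\<close>
  have est: "norm (?I t - of_real ((2 * pi) ^ ?d) * f x) \<le> sqrt t * (L * (2 * pi) ^ ?d * (1 + 2 * ?d))" if t: "0 < t" for t
  proof -
    let ?P = "(pi / t) powr (?d / 2)" and ?a = "1 / (4 * t)"
    have a: "0 < ?a" using t by simp
    have pa: "pi / ?a = 4 * pi * t" by simp
    note gi = integrable_gauss[OF a, where ?'a = 'a]
    have i0: "integrable lborel (\<lambda>z. f (x + z) * of_real (?P * exp (- ?a * (norm z)\<^sup>2)))"
    proof -
      have "integrable lborel (\<lambda>z. f (x + 1 *\<^sub>R z))"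
        by (subst lborel_integral_affine(1)) (simp_all add: fi)
      from integrable_mult_right[OF this, of "of_real ?P"] show ?thesis
        by (rule Bochner_Integration.integrable_bound)
           (use t in \<open>auto simp: norm_mult mult_ac intro!: AE_I2 mult_left_mono mult_left_le\<close>)
    qed
    have "of_real ((2 * pi) ^ ?d) * f x = (LINT z|lborel. f x * of_real (?P * exp (- ?a * (norm (z::'a))\<^sup>2)))"
      using integral_gauss[OF a, where ?'a = 'a] const[OF t]
      unfolding pa by (simp flip: of_real_mult)
    then have diff: "?I t - of_real ((2 * pi) ^ ?d) * f x = (LINT z|lborel. f (x + z) * of_real (?P * exp (- ?a * (norm z)\<^sup>2)) - f x * of_real (?P * exp (- ?a * (norm z)\<^sup>2)))"
      unfolding I_eq[OF t] using i0 gi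
      by (subst Bochner_Integration.integral_diff) (auto intro!: integrable_mult_right integrable_of_real simp del: of_real_mult)
    have "norm (?I t - of_real ((2 * pi) ^ ?d) * f x) \<le> (LINT z|lborel. L * sqrt t * ?P * (exp (- ?a * (norm (z::'a))\<^sup>2) + 1 / t * ((norm z)\<^sup>2 * exp (- ?a * (norm z)\<^sup>2))))"
      unfolding diff
    proof (rule norm_integral_le)
      show "integrable lborel (\<lambda>z::'a. L * sqrt t * ?P * (exp (- ?a * (norm z)\<^sup>2) + 1 / t * ((norm z)\<^sup>2 * exp (- ?a * (norm z)\<^sup>2))))"
        by (intro integrable_mult_right Bochner_Integration.integrable_add gi integrable_power_gauss a)
      fix z :: 'a
      \<comment> \<open>This replaces the distance by even moments of the Gaussian, whose integrals
        are explicit; the scale \<open>sqrt t\<close> gives both summands the same order.\<close>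
      have "norm z \<le> sqrt t * (1 + (norm z)\<^sup>2 / t)"
      proof -
        have "2 * (norm z / sqrt t) \<le> (norm z / sqrt t)\<^sup>2 + 1"
          using sum_squares_bound[of "norm z / sqrt t" 1] by simp
        moreover have "0 \<le> norm z / sqrt t" using t by simp
        moreover have "(norm z / sqrt t)\<^sup>2 = (norm z)\<^sup>2 / t" using t by (simp add: power_divide)
        ultimately have "norm z / sqrt t \<le> 1 + (norm z)\<^sup>2 / t" by linarith
        then show ?thesis using t by (simp add: field_simps)
      qed
      then have "L * norm z \<le> L * (sqrt t * (1 + (norm z)\<^sup>2 / t))"
        using L0 by (rule mult_left_mono)
      then have "norm (f (x + z) - f x) \<le> L * (sqrt t * (1 + (norm z)\<^sup>2 / t))"
        using L[of "x + z" x] by simp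
      then have le: "norm (f (x + z) - f x) * (?P * exp (- ?a * (norm z)\<^sup>2)) \<le> L * (sqrt t * (1 + (norm z)\<^sup>2 / t)) * (?P * exp (- ?a * (norm z)\<^sup>2))"
        by (rule mult_right_mono) simp
      have eq: "f (x + z) * of_real (?P * exp (- ?a * (norm z)\<^sup>2)) - f x * of_real (?P * exp (- ?a * (norm z)\<^sup>2))
         = (f (x + z) - f x) * of_real (?P * exp (- ?a * (norm z)\<^sup>2))"
        by (simp only: left_diff_distrib)
      have "norm (f (x + z) * of_real (?P * exp (- ?a * (norm z)\<^sup>2)) - f x * of_real (?P * exp (- ?a * (norm z)\<^sup>2)))
        = norm (f (x + z) - f x) * (?P * exp (- ?a * (norm z)\<^sup>2))"
        unfolding eq norm_mult by (simp add: norm_mult)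
      also note le
      also have "L * (sqrt t * (1 + (norm z)\<^sup>2 / t)) * (?P * exp (- ?a * (norm z)\<^sup>2))
        = L * sqrt t * ?P * (exp (- ?a * (norm z)\<^sup>2) + 1 / t * ((norm z)\<^sup>2 * exp (- ?a * (norm z)\<^sup>2)))"
        by (simp add: algebra_simps)
      finally show "norm (f (x + z) * of_real (?P * exp (- ?a * (norm z)\<^sup>2)) - f x * of_real (?P * exp (- ?a * (norm z)\<^sup>2)))
        \<le> L * sqrt t * ?P * (exp (- ?a * (norm z)\<^sup>2) + 1 / t * ((norm z)\<^sup>2 * exp (- ?a * (norm z)\<^sup>2)))" .
    qed
    also have "\<dots> = L * sqrt t * ?P * ((4 * pi * t) powr (?d / 2) + 1 / t * (?d / (2 * ?a) * (4 * pi * t) powr (?d / 2)))"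
      unfolding integral_mult_right_zero
        Bochner_Integration.integral_add[OF gi integrable_mult_right[OF integrable_power_gauss[OF a, of 2, where ?'a = 'a]]]
        integral_gauss[OF a, where ?'a = 'a] integral_gauss_norm_sq[OF a, where ?'a = 'a] pa
      by (rule refl)
    also have "\<dots> = sqrt t * (L * (?P * (4 * pi * t) powr (?d / 2)) * (1 + 2 * ?d))"
      using t by (simp add: algebra_simps)
    finally show ?thesis unfolding const[OF t] .
  qed
  let ?t = "\<lambda>n::nat. 1 / real (Suc n)"
  have lim1: "(\<lambda>n. ?I (?t n)) \<longlonglongrightarrow> (LINT \<xi>|lborel. cis (x \<bullet> \<xi>) * F \<xi>)"
  proof (rule integral_dominated_convergence[where w = "\<lambda>\<xi>. norm (F \<xi>)"])
    show "AE \<xi> in lborel. (\<lambda>n. cis (x \<bullet> \<xi>) * F \<xi> * of_real (exp (- ?t n * (norm \<xi>)\<^sup>2))) \<longlonglongrightarrow> cis (x \<bullet> \<xi>) * F \<xi>"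
    proof (intro AE_I2)
      fix \<xi> :: 'a
      have "(\<lambda>n. - ?t n * (norm \<xi>)\<^sup>2) \<longlonglongrightarrow> 0"
        by real_asymp
      then have "(\<lambda>n. cis (x \<bullet> \<xi>) * F \<xi> * of_real (exp (- ?t n * (norm \<xi>)\<^sup>2))) \<longlonglongrightarrow> cis (x \<bullet> \<xi>) * F \<xi> * of_real (exp 0)"
        by (intro tendsto_intros)
      then show "(\<lambda>n. cis (x \<bullet> \<xi>) * F \<xi> * of_real (exp (- ?t n * (norm \<xi>)\<^sup>2))) \<longlonglongrightarrow> cis (x \<bullet> \<xi>) * F \<xi>" by simp
    qed
    show "AE \<xi> in lborel. norm (cis (x \<bullet> \<xi>) * F \<xi> * of_real (exp (- ?t n * (norm \<xi>)\<^sup>2))) \<le> norm (F \<xi>)" for n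
      by (intro AE_I2) (auto simp: norm_mult intro!: mult_left_le)
  qed (use Fi in \<open>auto intro: integrable_norm\<close>)
  have lim2: "(\<lambda>n. ?I (?t n)) \<longlonglongrightarrow> of_real ((2 * pi) ^ ?d) * f x"
  proof (rule LIM_zero_cancel, rule Lim_null_comparison)
    show "\<forall>\<^sub>F n in sequentially. norm (?I (?t n) - of_real ((2 * pi) ^ ?d) * f x) \<le> sqrt (?t n) * (L * (2 * pi) ^ ?d * (1 + 2 * ?d))"
      by (intro always_eventually allI est) simp
    have "(\<lambda>n. sqrt (?t n)) \<longlonglongrightarrow> 0" by real_asymp
    from tendsto_mult_left[OF this, of "L * (2 * pi) ^ ?d * (1 + 2 * ?d)"]
    show "(\<lambda>n. sqrt (?t n) * (L * (2 * pi) ^ ?d * (1 + 2 * ?d))) \<longlonglongrightarrow> 0" by (simp add: mult.commute)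
  qed
  show ?thesis using LIMSEQ_unique[OF lim1 lim2] .
qed

lemma fourier_fourier:
  fixes f :: "'a::euclidean_space \<Rightarrow> complex"
  assumes f: "f \<in> schwartz"
  shows "fourier (fourier f) (- x) = f x"
proof -
  let ?c = "(2 * pi) powr (- real DIM('a) / 2)"
  have "fourier (fourier f) (- x) = of_real ?c * (LINT \<xi>|lborel. of_real ?c * (cis (x \<bullet> \<xi>) * (LINT y|lborel. cis (- (y \<bullet> \<xi>)) * f y)))"
    by (simp add: fourier_eq[OF schwartz_measurable[OF fourier_schwartz[OF f]]] fourier_eq[OF schwartz_measurable[OF f]] mult_ac inner_commute)
  also have "\<dots> = of_real (?c * ?c * (2 * pi) ^ DIM('a)) * f x"
    using fourier_integral_inversion[OF f, of x] by simp
  also have "?c * ?c * (2 * pi) ^ DIM('a) = 1"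
  proof -
    have "?c * ?c = (2 * pi) powr (- real DIM('a))" by (simp flip: powr_add)
    also have "\<dots> = inverse ((2 * pi) ^ DIM('a))" by (simp add: powr_minus powr_realpow)
    finally have "?c * ?c * (2 * pi) ^ DIM('a) = inverse ((2 * pi) ^ DIM('a)) * (2 * pi) ^ DIM('a)"
      by (simp only:)
    also have "\<dots> = 1" by (rule left_inverse) simp
    finally show ?thesis .
  qed
  finally show ?thesis by simp
qed

lemma fourier_reflect:
  fixes f :: "'a::euclidean_space \<Rightarrow> complex"
  assumes [measurable]: "f \<in> borel_measurable borel"
  shows "fourier (\<lambda>x. f (- x)) \<xi> = fourier f (- \<xi>)"
proof -
  have "(LINT x|lborel. cis (- (x \<bullet> - \<xi>)) * f x) = (LINT x|lborel. cis (- ((0 + (-1) *\<^sub>R x) \<bullet> - \<xi>)) * f (0 + (-1) *\<^sub>R x))"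
    by (rule lborel_integral_affine(2)[symmetric, of "\<lambda>x. cis (- (x \<bullet> - \<xi>)) * f x"]) simp_all
  then show ?thesis by (simp add: fourier_eq)
qed

text \<open>This provides Schwartz preimages, so that an approximation made on the Fourier side can
  be transported back.\<close>

lemma fourier_surj_schwartz:
  fixes h :: "'a::euclidean_space \<Rightarrow> complex"
  assumes h: "h \<in> schwartz"
  shows "(\<lambda>x. fourier h (- x)) \<in> schwartz" "fourier (\<lambda>x. fourier h (- x)) = h"
  using fourier_schwartz[OF h] fourier_fourier[OF h]
  by (auto simp: schwartz_reflect fourier_reflect schwartz_measurable)

text \<open>Fubini for absolutely integrable functions. It identifies transforms of distributions
  that are functions, and it also yields the convolution formula.\<close>

lemma fourier_multiplication:
  fixes f g :: "'a::euclidean_space \<Rightarrow> complex"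
  assumes f: "integrable lborel f" and g: "integrable lborel g"
  shows "(LINT x|lborel. fourier f x * g x) = (LINT x|lborel. f x * fourier g x)"
proof -
  have [measurable]: "f \<in> borel_measurable borel" "g \<in> borel_measurable borel"
    using f g borel_measurable_integrable by auto
  let ?H = "\<lambda>x y. cis (- (x \<bullet> y)) * f y * g x"
  have "integrable (lborel \<Otimes>\<^sub>M lborel) (case_prod ?H)"
  proof (rule lborel_pair.Fubini_integrable)
    show "AE x in lborel. integrable lborel (\<lambda>y. case_prod ?H (x, y))"
      unfolding prod.case
      by (intro AE_I2 integrable_mult_left Bochner_Integration.integrable_bound[OF f]) (auto simp: norm_mult)
    have "integrable lborel (\<lambda>x. (LINT y|lborel. norm (f y)) * norm (g x))"
      by (intro integrable_mult_right integrable_norm g)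
    then show "integrable lborel (\<lambda>x. LINT y|lborel. norm (case_prod ?H (x, y)))"
      by (simp add: norm_mult)
  qed measurable
  then have "(LINT y|lborel. LINT x|lborel. ?H x y) = (LINT x|lborel. LINT y|lborel. ?H x y)"
    by (rule lborel_pair.Fubini_integral)
  moreover have "(LINT x|lborel. ?H x y) = f y * (LINT x|lborel. cis (- (x \<bullet> y)) * g x)" for y
    unfolding integral_mult_right_zero[symmetric] by (simp add: mult_ac)
  moreover have "(LINT y|lborel. ?H x y) = (LINT y|lborel. cis (- (y \<bullet> x)) * f y) * g x" for x
    by (simp add: inner_commute)
  ultimately have "(LINT y|lborel. f y * (LINT x|lborel. cis (- (x \<bullet> y)) * g x)) = (LINT x|lborel. (LINT y|lborel. cis (- (y \<bullet> x)) * f y) * g x)"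
    by (simp only:)
  then show ?thesis
    by (simp add: fourier_eq mult.assoc mult.left_commute[of _ "of_real _"])
qed

section \<open>Approximation by Schwartz functions\<close>

lemma real_polynomial_function_has_derivative:
  fixes P :: "'a::real_normed_vector \<Rightarrow> real"
  assumes "real_polynomial_function P"
  obtains D where "\<And>x. (P has_derivative D x) (at x)" "\<And>b. real_polynomial_function (\<lambda>x. D x b)"
proof -
  from assms have "\<exists>D. (\<forall>x. (P has_derivative D x) (at x)) \<and> (\<forall>b. real_polynomial_function (\<lambda>x. D x b))"
  proof induction
    case (linear f)
    then show ?case
      by (intro exI[of _ "\<lambda>x. f"]) (auto intro: bounded_linear.has_derivative[OF linear has_derivative_ident])
  next
    case (const c)
    then show ?case by (intro exI[of _ "\<lambda>x h. 0"]) auto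
  next
    case (add f g)
    then obtain D E where "\<And>x. (f has_derivative D x) (at x)" "\<And>b. real_polynomial_function (\<lambda>x. D x b)"
      "\<And>x. (g has_derivative E x) (at x)" "\<And>b. real_polynomial_function (\<lambda>x. E x b)" by blast
    then show ?case
      by (intro exI[of _ "\<lambda>x h. D x h + E x h"]) (auto intro!: has_derivative_add)
  next
    case (mult f g)
    then obtain D E where "\<And>x. (f has_derivative D x) (at x)" "\<And>b. real_polynomial_function (\<lambda>x. D x b)"
      "\<And>x. (g has_derivative E x) (at x)" "\<And>b. real_polynomial_function (\<lambda>x. E x b)" by blast
    with mult.hyps show ?case
      by (intro exI[of _ "\<lambda>x h. f x * E x h + D x h * g x"] conjI allI has_derivative_mult
          real_polynomial_function.intros(3) real_polynomial_function.intros(4))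
  qed
  with that show ?thesis by blast
qed

text \<open>The family, with \<open>P\<close> a polynomial, is closed under derivatives, also across the sphere.\<close>

definition bump :: "real \<Rightarrow> real \<Rightarrow> nat \<Rightarrow> ('a::euclidean_space \<Rightarrow> real) \<Rightarrow> 'a \<Rightarrow> real" where
  "bump R c k P x = (if norm x < R then P x / (R\<^sup>2 - (norm x)\<^sup>2) ^ k * exp (- c / (R\<^sup>2 - (norm x)\<^sup>2)) else 0)"

lemma bump_gap_pos: "norm x < R \<Longrightarrow> 0 < R\<^sup>2 - (norm x)\<^sup>2"
  by (simp add: power_strict_mono)

text \<open>The exponential beats every pole: the exponent \<open>k + 2\<close> in
  \<open>power_le_fact_exp\<close> cancels the denominator and leaves the square of the gap. This
  second-order vanishing is what makes the derivative zero on the sphere.\<close>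

lemma bump_bound:
  fixes P :: "'a::euclidean_space \<Rightarrow> real"
  assumes c: "0 < c" and P: "real_polynomial_function P"
  obtains K where "0 \<le> K" "\<And>x. norm x < R \<Longrightarrow> \<bar>bump R c k P x\<bar> \<le> K * (R\<^sup>2 - (norm x)\<^sup>2)\<^sup>2"
proof -
  have "compact ((\<lambda>x. P x) ` cball 0 R)"
    by (intro compact_continuous_image compact_cball continuous_on_polymonial_function)
       (use P in \<open>simp add: real_polynomial_function_eq\<close>)
  from compact_imp_bounded[OF this] obtain B where "\<forall>y\<in>P ` cball 0 R. norm y \<le> B"
    unfolding bounded_iff by blast
  then have B: "\<And>x. x \<in> cball 0 R \<Longrightarrow> norm (P x) \<le> B" by blast
  let ?K = "\<bar>B\<bar> * (fact (k + 2) / c ^ (k + 2))"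
  have "\<bar>bump R c k P x\<bar> \<le> ?K * (R\<^sup>2 - (norm x)\<^sup>2)\<^sup>2" if x: "norm x < R" for x
  proof -
    let ?r = "R\<^sup>2 - (norm x)\<^sup>2"
    have r: "0 < ?r" using bump_gap_pos[OF x] .
    have "(c / ?r) ^ (k + 2) \<le> fact (k + 2) * exp (c / ?r)"
      using c r by (intro power_le_fact_exp) auto
    then have "(c / ?r) ^ (k + 2) * exp (- (c / ?r)) \<le> fact (k + 2) * exp (c / ?r) * exp (- (c / ?r))"
      by (rule mult_right_mono) simp
    also have "\<dots> = fact (k + 2)" by (simp only: mult.assoc exp_add[symmetric]) simp
    finally have "c ^ (k + 2) * exp (- (c / ?r)) \<le> fact (k + 2) * ?r ^ (k + 2)"
      using r by (simp only: power_divide) (simp add: divide_le_eq del: power_Suc power_Suc2)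
    then have "exp (- (c / ?r)) \<le> fact (k + 2) / c ^ (k + 2) * ?r ^ (k + 2)"
      using c by (simp add: pos_le_divide_eq mult_ac del: power_Suc)
    then have "exp (- (c / ?r)) / ?r ^ k \<le> fact (k + 2) / c ^ (k + 2) * ?r ^ (k + 2) / ?r ^ k"
      using r by (intro divide_right_mono) auto
    also have "\<dots> = fact (k + 2) / c ^ (k + 2) * ?r\<^sup>2"
    proof -
      have "?r ^ (k + 2) / ?r ^ k = ?r\<^sup>2" using r by (simp only: power_add) simp
      then show ?thesis by (simp only: times_divide_eq_right[symmetric])
    qed
    finally have e: "exp (- (c / ?r)) / ?r ^ k \<le> fact (k + 2) / c ^ (k + 2) * ?r\<^sup>2" .
    have "\<bar>bump R c k P x\<bar> = \<bar>P x\<bar> * (exp (- (c / ?r)) / ?r ^ k)"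
      using x r by (simp add: bump_def abs_mult)
    also have "\<dots> \<le> \<bar>B\<bar> * (fact (k + 2) / c ^ (k + 2) * ?r\<^sup>2)"
      using B[of x] x c r by (intro mult_mono e) auto
    finally show ?thesis by (simp only: mult.assoc)
  qed
  moreover have "0 \<le> ?K" using c by simp
  ultimately show ?thesis using that by blast
qed

text \<open>All terms are put over the denominator with exponent \<open>k + 2\<close>, so that the
  derivative has the same shape again with a new polynomial.\<close>

lemma bump_has_derivative_inside:
  fixes P :: "'a::euclidean_space \<Rightarrow> real"
  assumes D: "(P has_derivative D) (at x)" and x: "norm x < R"
  shows "(bump R c k P has_derivative
    (\<lambda>h. (D h * (R\<^sup>2 - (norm x)\<^sup>2)\<^sup>2 + 2 * real k * (x \<bullet> h) * P x * (R\<^sup>2 - (norm x)\<^sup>2) - 2 * c * (x \<bullet> h) * P x)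
       / (R\<^sup>2 - (norm x)\<^sup>2) ^ (k + 2) * exp (- c / (R\<^sup>2 - (norm x)\<^sup>2)))) (at x)"
proof -
  let ?r = "R\<^sup>2 - x \<bullet> x"
  have r: "?r \<noteq> 0" using bump_gap_pos[OF x] by (simp add: power2_norm_eq_inner)
  let ?i = "inverse ?r" and ?e = "exp (- c * inverse ?r)"
  have Di: "((\<lambda>x. inverse (R\<^sup>2 - x \<bullet> x)) has_derivative (\<lambda>h. 2 * (x \<bullet> h) * ?i\<^sup>2)) (at x)"
    using r by (auto intro!: derivative_eq_intros simp: inner_commute power2_eq_square)
  have De: "((\<lambda>x. exp (- c * inverse (R\<^sup>2 - x \<bullet> x))) has_derivative (\<lambda>h. ?e * (- c * (2 * (x \<bullet> h) * ?i\<^sup>2)))) (at x)"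
    by (rule has_derivative_eq_rhs[OF has_derivative_exp[OF has_derivative_mult_right[OF Di]]]) (simp only: mult_ac)
  have D0: "((\<lambda>x. P x * inverse (R\<^sup>2 - x \<bullet> x) ^ k * exp (- c * inverse (R\<^sup>2 - x \<bullet> x))) has_derivative
    (\<lambda>h. P x * ?i ^ k * (?e * (- c * (2 * (x \<bullet> h) * ?i\<^sup>2))) +
       (P x * (of_nat k * (2 * (x \<bullet> h) * ?i\<^sup>2) * ?i ^ (k - 1)) + D h * ?i ^ k) * ?e)) (at x)"
    by (intro has_derivative_mult has_derivative_power Di De D)
  have k: "of_nat k * (y * ?i\<^sup>2) * ?i ^ (k - 1) = of_nat k * (y * ?i ^ (k + 1))" for y
    by (cases k) (simp_all add: power2_eq_square mult_ac)
  have rr: "?i ^ k = ?r\<^sup>2 * ?i ^ (k + 2)" "?i ^ (k + 1) = ?r * ?i ^ (k + 2)"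
  proof -
    have "i ^ k = s\<^sup>2 * i ^ (k + 2) \<and> i ^ (k + 1) = s * i ^ (k + 2)" if "s * i = 1" for s i :: real
    proof -
      have "s\<^sup>2 * i ^ (k + 2) = (s * i) * (s * i) * i ^ k" "s * i ^ (k + 2) = (s * i) * i ^ (k + 1)"
        by (simp_all add: power2_eq_square mult_ac)
      then show ?thesis unfolding that by simp
    qed
    from this[of ?r ?i] r show "?i ^ k = ?r\<^sup>2 * ?i ^ (k + 2)" "?i ^ (k + 1) = ?r * ?i ^ (k + 2)" by simp_all
  qed
  \<comment> \<open>Here \<open>I0\<close>, \<open>I1\<close>, \<open>I2\<close> stand for the
    powers \<open>k\<close>, \<open>k + 1\<close>, \<open>k + 2\<close> of the inverse gap and
    \<open>J\<close> for its square. Abstracting them leaves a polynomial identity.\<close>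
  have alg: "P x * I0 * (?e * (- c * (2 * (x \<bullet> h) * J))) + (P x * (of_nat k * (2 * (x \<bullet> h) * I1)) + D h * I0) * ?e
     = (D h * ?r\<^sup>2 + 2 * real k * (x \<bullet> h) * P x * ?r - 2 * c * (x \<bullet> h) * P x) * I2 * ?e"
    if "I0 = ?r\<^sup>2 * I2" "I1 = ?r * I2" "I0 * J = I2" for h I0 I1 I2 J
  proof -
    have "P x * I0 * (?e * (- c * (2 * (x \<bullet> h) * J))) = P x * (?e * (- c * (2 * (x \<bullet> h)))) * (I0 * J)"
      by (simp only: mult_ac)
    then show ?thesis unfolding that(3) unfolding that(1,2) by (simp add: algebra_simps)
  qed
  have "((\<lambda>x. P x / (R\<^sup>2 - x \<bullet> x) ^ k * exp (- c / (R\<^sup>2 - x \<bullet> x))) has_derivative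
    (\<lambda>h. (D h * ?r\<^sup>2 + 2 * real k * (x \<bullet> h) * P x * ?r - 2 * c * (x \<bullet> h) * P x) / ?r ^ (k + 2) * exp (- c / ?r))) (at x)"
    using D0 unfolding k alg[OF rr power_add[symmetric]] unfolding divide_inverse power_inverse .
  then have "((\<lambda>x. P x / (R\<^sup>2 - (norm x)\<^sup>2) ^ k * exp (- c / (R\<^sup>2 - (norm x)\<^sup>2))) has_derivative
    (\<lambda>h. (D h * (R\<^sup>2 - (norm x)\<^sup>2)\<^sup>2 + 2 * real k * (x \<bullet> h) * P x * (R\<^sup>2 - (norm x)\<^sup>2) - 2 * c * (x \<bullet> h) * P x)
       / (R\<^sup>2 - (norm x)\<^sup>2) ^ (k + 2) * exp (- c / (R\<^sup>2 - (norm x)\<^sup>2)))) (at x)"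
    unfolding power2_norm_eq_inner .
  then show ?thesis
    by (rule has_derivative_transform_within_open[where s = "ball 0 R"]) (use x in \<open>auto simp: bump_def\<close>)
qed

text \<open>The sphere itself is included. A point within \<open>norm h\<close> of \<open>x\<close>
  lies at most that deep inside the ball, so its gap is of order \<open>norm h\<close> and the
  function, bounded by the squared gap, is of second order.\<close>

lemma bump_has_derivative_outside:
  fixes P :: "'a::euclidean_space \<Rightarrow> real"
  assumes c: "0 < c" and P: "real_polynomial_function P" and x: "R \<le> norm x"
  shows "(bump R c k P has_derivative (\<lambda>h. 0)) (at x)"
proof -
  obtain K where K: "0 \<le> K" "\<And>x. norm x < R \<Longrightarrow> \<bar>bump R c k P x\<bar> \<le> K * (R\<^sup>2 - (norm x)\<^sup>2)\<^sup>2"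
    using bump_bound[OF c P] by blast
  let ?M = "K * (2 * R)\<^sup>2"
  have le: "\<bar>bump R c k P (x + h)\<bar> \<le> ?M * (norm h)\<^sup>2" for h
  proof (cases "norm (x + h) < R")
    case True
    let ?y = "x + h"
    have "R - norm ?y \<le> norm h"
      using x norm_triangle_ineq4[of ?y h] by simp
    moreover have "0 \<le> R - norm ?y" "0 \<le> R + norm ?y" "R + norm ?y \<le> 2 * R" using True norm_ge_zero[of ?y] by linarith+
    moreover have "R\<^sup>2 - (norm ?y)\<^sup>2 = (R - norm ?y) * (R + norm ?y)" by (simp add: power2_eq_square algebra_simps)
    ultimately have "R\<^sup>2 - (norm ?y)\<^sup>2 \<le> norm h * (2 * R)"
      by (simp only:) (intro mult_mono, auto)
    then have "(R\<^sup>2 - (norm ?y)\<^sup>2)\<^sup>2 \<le> (norm h * (2 * R))\<^sup>2"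
      using bump_gap_pos[OF True] by (intro power_mono) auto
    then have "K * (R\<^sup>2 - (norm ?y)\<^sup>2)\<^sup>2 \<le> K * (norm h * (2 * R))\<^sup>2"
      using K(1) by (rule mult_left_mono)
    with K(2)[OF True] show ?thesis by (simp add: power_mult_distrib mult_ac)
  qed (use K in \<open>simp add: bump_def\<close>)
  have "bump R c k P x = 0" using x by (simp add: bump_def)
  show ?thesis
    unfolding has_derivative_at
  proof (intro conjI)
    show "(\<lambda>h. norm (bump R c k P (x + h) - bump R c k P x - 0) / norm h) \<midarrow>0\<rightarrow> 0"
    proof (rule tendsto_sandwich[of "\<lambda>_. 0" _ _ "\<lambda>h. ?M * norm h"])
      show "\<forall>\<^sub>F h in at 0. norm (bump R c k P (x + h) - bump R c k P x - 0) / norm h \<le> ?M * norm h"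
        using le \<open>bump R c k P x = 0\<close> K(1)
        by (intro always_eventually allI) (simp add: divide_le_eq power2_eq_square mult.assoc)
      show "(\<lambda>h. ?M * norm h) \<midarrow>0\<rightarrow> 0"
        by (auto intro!: tendsto_eq_intros)
    qed auto
  qed simp
qed

lemma bump_schwartz:
  fixes P :: "'a::euclidean_space \<Rightarrow> real"
  assumes c: "0 < c" and P: "real_polynomial_function P"
  shows "bump R c k P \<in> schwartz"
proof (rule schwartz_coinduct[where S = "{bump R c k P |k P. real_polynomial_function P}"])
  fix g :: "'a \<Rightarrow> real" assume "g \<in> {bump R c k P |k P. real_polynomial_function P}"
  then obtain k P where g: "g = bump R c k P" and P: "real_polynomial_function P" by blast
  obtain D where D: "\<And>x. (P has_derivative D x) (at x)" "\<And>b. real_polynomial_function (\<lambda>x. D x b)"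
    using real_polynomial_function_has_derivative[OF P] by blast
  show "g differentiable (at x)" for x
  proof (cases "norm x < R")
    case True
    show ?thesis unfolding g by (rule differentiableI[OF bump_has_derivative_inside[OF D(1) True]])
  next
    case False
    then show ?thesis unfolding g by (intro differentiableI[OF bump_has_derivative_outside[OF c P]]) simp
  qed
  show "bounded (range (\<lambda>x. norm x ^ j *\<^sub>R g x))" for j
  proof -
    obtain K where K: "0 \<le> K" "\<And>x. norm x < R \<Longrightarrow> \<bar>bump R c k P x\<bar> \<le> K * (R\<^sup>2 - (norm x)\<^sup>2)\<^sup>2"
      using bump_bound[OF c P] by blast
    have "norm x ^ j * norm (g x) \<le> \<bar>R\<bar> ^ j * (K * (R\<^sup>2)\<^sup>2)" for x
    proof (cases "norm x < R")
      case True
      have "(R\<^sup>2 - (norm x)\<^sup>2)\<^sup>2 \<le> (R\<^sup>2)\<^sup>2"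
        using bump_gap_pos[OF True] by (intro power_mono) auto
      then have "K * (R\<^sup>2 - (norm x)\<^sup>2)\<^sup>2 \<le> K * (R\<^sup>2)\<^sup>2" using K(1) by (rule mult_left_mono)
      with K(2)[OF True] have "norm (g x) \<le> K * (R\<^sup>2)\<^sup>2" by (simp add: g)
      with True show ?thesis by (intro mult_mono power_mono) auto
    qed (use K in \<open>simp add: g bump_def\<close>)
    then show ?thesis by (rule boundedI_decay)
  qed
  show "dir_deriv b g \<in> {bump R c k P |k P. real_polynomial_function P}" if "b \<in> Basis" for b
  proof -
    let ?Q = "\<lambda>x. D x b * (R\<^sup>2 - (norm x)\<^sup>2)\<^sup>2 + 2 * real k * (x \<bullet> b) * P x * (R\<^sup>2 - (norm x)\<^sup>2) - 2 * c * (x \<bullet> b) * P x"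
    have "dir_deriv b g = bump R c (k + 2) ?Q"
    proof (rule ext)
      fix x
      show "dir_deriv b g x = bump R c (k + 2) ?Q x"
      proof (cases "norm x < R")
        case True
        then show ?thesis
          unfolding g by (subst dir_deriv_eq[OF bump_has_derivative_inside[OF D(1)]]) (auto simp: bump_def)
      next
        case False
        then show ?thesis
          unfolding g by (subst dir_deriv_eq[OF bump_has_derivative_outside[OF c P]]) (auto simp: bump_def)
      qed
    qed
    moreover have "real_polynomial_function ?Q"
    proof -
      have l: "real_polynomial_function (\<lambda>x::'a. x \<bullet> d)" for d
        by (intro real_polynomial_function.intros(1) bounded_linear_inner_left)
      have "(norm x)\<^sup>2 = (\<Sum>d\<in>Basis. (x \<bullet> d) * (x \<bullet> d))" for x :: 'a
        unfolding power2_norm_eq_inner by (rule euclidean_inner)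
      then have n: "real_polynomial_function (\<lambda>x::'a. (norm x)\<^sup>2)"
        by (simp only:) (intro real_polynomial_function_sum real_polynomial_function.intros(4) l finite_Basis)
      show ?thesis
        by (intro real_polynomial_function_diff real_polynomial_function.intros(3) real_polynomial_function.intros(4)
             real_polynomial_function_power real_polynomial_function.intros(2) l n P D(2))
    qed
    ultimately show ?thesis by blast
  qed
qed (use P in blast)

text \<open>A bounded measurable function is an almost everywhere limit of continuous functions,
  which Stone-Weierstrass replaces on the ball by polynomials. The smooth cutoff does not spoil the
  limit because its parameter \<open>1 / real (Suc n)\<close> tends to 0, so the exponential factor
  tends to 1 at each interior point.\<close>

lemma schwartz_approx_bounded:
  fixes h :: "'a::euclidean_space \<Rightarrow> real"
  assumes h: "h \<in> borel_measurable lebesgue" and B: "\<And>x. \<bar>h x\<bar> \<le> B"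
  obtains \<phi> :: "nat \<Rightarrow> 'a \<Rightarrow> real" where "\<And>n. \<phi> n \<in> schwartz"
    "\<And>n x. \<bar>\<phi> n x\<bar> \<le> (B + 1) * indicator (ball 0 R) x"
    "AE x in lebesgue. (\<lambda>n. \<phi> n x) \<longlonglongrightarrow> indicator (ball 0 R) x * h x"
proof -
  have "h measurable_on UNIV"
    using h by (simp add: measurable_on_iff_borel_measurable)
  then obtain N g where N: "negligible N" and g: "\<And>n. continuous_on UNIV (g n)"
    and lim: "\<And>x. x \<notin> N \<Longrightarrow> (\<lambda>n. g n x) \<longlonglongrightarrow> h x"
    unfolding measurable_on_def by auto
  have B0: "0 \<le> B" using order_trans[OF abs_ge_zero B] .
  \<comment> \<open>Clipping preserves the limit, since \<open>h\<close> obeys the same bound, and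
    makes the approximants uniformly bounded for dominated convergence.\<close>
  define g' where "g' n x = max (- B) (min B (g n x))" for n x
  have g': "continuous_on A (g' n)" for A n
    unfolding g'_def by (intro continuous_intros continuous_on_subset[OF g]) auto
  have lim': "(\<lambda>n. g' n x) \<longlonglongrightarrow> h x" if "x \<notin> N" for x
  proof -
    have "(\<lambda>n. g' n x) \<longlonglongrightarrow> max (- B) (min B (h x))"
      unfolding g'_def by (intro tendsto_intros lim that)
    also have "max (- B) (min B (h x)) = h x" using B[of x] by auto
    finally show ?thesis .
  qed
  have "\<exists>P. real_polynomial_function P \<and> (\<forall>x\<in>cball 0 R. \<bar>g' n x - P x\<bar> < 1 / real (Suc n))" for n
    using Stone_Weierstrass_real_polynomial_function[OF compact_cball g', of "1 / real (Suc n)" 0 R n]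
    by (metis divide_pos_pos of_nat_0_less_iff zero_less_Suc zero_less_one)
  then obtain P where P: "\<And>n. real_polynomial_function (P n)"
    and Pd: "\<And>n x. x \<in> cball 0 R \<Longrightarrow> \<bar>g' n x - P n x\<bar> < 1 / real (Suc n)" by metis
  let ?\<phi> = "\<lambda>n. bump R (1 / real (Suc n)) 0 (P n)"
  show ?thesis
  proof
    show "?\<phi> n \<in> schwartz" for n by (intro bump_schwartz P) simp
    show "\<bar>?\<phi> n x\<bar> \<le> (B + 1) * indicator (ball 0 R) x" for n x
    proof (cases "norm x < R")
      case True
      have "\<bar>g' n x\<bar> \<le> B" using B0 by (auto simp: g'_def)
      moreover have "\<bar>g' n x - P n x\<bar> < 1 / real (Suc n)" using Pd True by simp
      moreover have "1 / real (Suc n) \<le> 1" by simp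
      ultimately have "\<bar>P n x\<bar> \<le> B + 1" by linarith
      moreover have "exp (- (1 / real (Suc n)) / (R\<^sup>2 - (norm x)\<^sup>2)) \<le> 1"
        using bump_gap_pos[OF True] by (simp add: divide_nonpos_pos)
      ultimately have "\<bar>P n x\<bar> * exp (- (1 / real (Suc n)) / (R\<^sup>2 - (norm x)\<^sup>2)) \<le> (B + 1) * 1"
        using B0 by (intro mult_mono) auto
      with True show ?thesis by (simp add: bump_def abs_mult)
    qed (simp add: bump_def)
    have "(\<lambda>n. ?\<phi> n x) \<longlonglongrightarrow> indicator (ball 0 R) x * h x" if x: "x \<notin> N" for x
    proof (cases "norm x < R")
      case True
      have "(\<lambda>n. g' n x - P n x) \<longlonglongrightarrow> 0"
      proof (rule Lim_null_comparison)
        show "\<forall>\<^sub>F n in sequentially. norm (g' n x - P n x) \<le> 1 / real (Suc n)"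
          using Pd[of x] True by (intro always_eventually allI) (simp add: less_imp_le)
        show "(\<lambda>n. 1 / real (Suc n)) \<longlonglongrightarrow> 0" by real_asymp
      qed
      from tendsto_diff[OF lim'[OF x] this] have "(\<lambda>n. P n x) \<longlonglongrightarrow> h x" by simp
      moreover have "(\<lambda>n. exp (- (1 / real (Suc n)) / (R\<^sup>2 - (norm x)\<^sup>2))) \<longlonglongrightarrow> exp 0"
      proof (intro tendsto_exp)
        have "(\<lambda>n. - (1 / real (Suc n))) \<longlonglongrightarrow> 0" by real_asymp
        from tendsto_divide[OF this tendsto_const, of "R\<^sup>2 - (norm x)\<^sup>2"] bump_gap_pos[OF True]
        show "(\<lambda>n. - (1 / real (Suc n)) / (R\<^sup>2 - (norm x)\<^sup>2)) \<longlonglongrightarrow> 0" by simp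
      qed
      ultimately have "(\<lambda>n. P n x * exp (- (1 / real (Suc n)) / (R\<^sup>2 - (norm x)\<^sup>2))) \<longlonglongrightarrow> h x * exp 0"
        by (rule tendsto_mult)
      with True show ?thesis by (simp add: bump_def)
    qed (simp add: bump_def)
    moreover have "AE x in lebesgue. x \<notin> N"
      using N by (simp add: negligible_iff_null_sets AE_not_in)
    ultimately show "AE x in lebesgue. (\<lambda>n. ?\<phi> n x) \<longlonglongrightarrow> indicator (ball 0 R) x * h x"
      by auto
  qed
qed

section \<open>Functions that vanish against all test functions\<close>

lemma schwartz_of_real: "f \<in> schwartz \<Longrightarrow> (\<lambda>x. of_real (f x) :: 'b::real_normed_algebra_1) \<in> schwartz"
  by (rule schwartz_bounded_linear[OF bounded_linear_of_real])

text \<open>Test with a cutoff of the ball of radius \<open>2 * R\<close>, which is bounded below on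
  the ball of radius \<open>R\<close>.\<close>

lemma locally_integrable_if_schwartz_integrable:
  fixes g :: "'a::euclidean_space \<Rightarrow> complex"
  assumes gm [measurable]: "g \<in> borel_measurable lebesgue"
    and g: "\<And>\<phi>. \<phi> \<in> schwartz \<Longrightarrow> integrable lebesgue (\<lambda>x. \<phi> x * g x)"
  shows "integrable lebesgue (\<lambda>x. indicator (ball 0 R) x * norm (g x))"
proof (cases "0 < R")
  case R: True
  have [measurable]: "ball (0::'a) R \<in> sets lebesgue" by simp
  let ?b = "bump (2 * R) 1 0 (\<lambda>x::'a. 1)"
  have "(\<lambda>x. complex_of_real (?b x)) \<in> schwartz"
    by (intro schwartz_of_real bump_schwartz) auto
  \<comment> \<open>On the smaller ball the gap is at least
    \<open>(2 * R)\<^sup>2 - R\<^sup>2 = 3 * R\<^sup>2\<close>, so the cutoff is at least the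
    inverse of this constant.\<close>
  from integrable_mult_right[OF integrable_norm[OF g[OF this]], of "exp (1 / (3 * R\<^sup>2))"]
  show ?thesis
  proof (rule Bochner_Integration.integrable_bound)
    show "(\<lambda>x. indicator (ball 0 R) x * norm (g x)) \<in> borel_measurable lebesgue"
      by measurable
    show "AE x in lebesgue. norm (indicator (ball 0 R) x * norm (g x)) \<le> norm (exp (1 / (3 * R\<^sup>2)) * norm (of_real (?b x) * g x))"
    proof (intro AE_I2)
      fix x :: 'a
      show "norm (indicator (ball 0 R) x * norm (g x)) \<le> norm (exp (1 / (3 * R\<^sup>2)) * norm (of_real (?b x) * g x))"
      proof (cases "norm x < R")
        case True
        have "(norm x)\<^sup>2 \<le> R\<^sup>2" using True by (intro power_mono) auto
        then have le: "3 * R\<^sup>2 \<le> (2 * R)\<^sup>2 - (norm x)\<^sup>2" by (simp add: power_mult_distrib)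
        have p1: "0 < 3 * R\<^sup>2" using R by simp
        then have p2: "0 < (2 * R)\<^sup>2 - (norm x)\<^sup>2" using le by (rule less_le_trans)
        from le p1 p2
        have "1 / ((2 * R)\<^sup>2 - (norm x)\<^sup>2) \<le> 1 / (3 * R\<^sup>2)"
          by (intro divide_left_mono mult_pos_pos) auto
        then have "1 \<le> exp (1 / (3 * R\<^sup>2)) * ?b x"
          using True R by (simp add: bump_def exp_add[symmetric])
        then have "1 * norm (g x) \<le> exp (1 / (3 * R\<^sup>2)) * ?b x * norm (g x)"
          by (rule mult_right_mono) simp
        moreover have "0 \<le> ?b x" by (simp add: bump_def)
        ultimately show ?thesis using True by (simp add: norm_mult mult.assoc)
      qed simp
    qed
  qed
qed (simp add: ball_empty)

text \<open>On a ball, bounded sequences of test functions converge almost everywhere to the parts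
  of the conjugate sign of \<open>g\<close>. Dominated convergence then makes the integral of
  \<open>norm (g x)\<close> over the ball vanish.\<close>

lemma AE_zero_if_schwartz_integrals_zero:
  fixes g :: "'a::euclidean_space \<Rightarrow> complex"
  assumes gm [measurable]: "g \<in> borel_measurable lebesgue"
    and g: "\<And>\<phi>. \<phi> \<in> schwartz \<Longrightarrow> integrable lebesgue (\<lambda>x. \<phi> x * g x)"
    and zero: "\<And>\<phi>. \<phi> \<in> schwartz \<Longrightarrow> (LINT x|lebesgue. \<phi> x * g x) = 0"
  shows "AE x in lebesgue. g x = 0"
proof -
  have "AE x in lebesgue. x \<in> ball 0 R \<longrightarrow> g x = 0" for R
  proof -
    have [measurable]: "ball (0::'a) R \<in> sets lebesgue" by simp
    note loc = locally_integrable_if_schwartz_integrable[OF gm g, of R]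
    have li: "integrable lebesgue (\<lambda>x. of_real (indicator (ball 0 R) x * h x) * g x)"
      if h [measurable]: "h \<in> borel_measurable lebesgue" and b: "\<And>x. \<bar>h x\<bar> \<le> 1" for h
    proof (rule Bochner_Integration.integrable_bound[OF loc])
      show "(\<lambda>x. of_real (indicator (ball 0 R) x * h x) * g x) \<in> borel_measurable lebesgue"
        by measurable
      show "AE x in lebesgue. norm (of_real (indicator (ball 0 R) x * h x) * g x) \<le> norm (indicator (ball 0 R) x * norm (g x))"
        using b by (intro AE_I2) (auto simp: norm_mult indicator_def intro!: mult_left_le_one_le)
    qed
    have lz: "(LINT x|lebesgue. of_real (indicator (ball 0 R) x * h x) * g x) = 0"
      if h [measurable]: "h \<in> borel_measurable lebesgue" and b: "\<And>x. \<bar>h x\<bar> \<le> 1" for h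
    proof -
      obtain \<phi> :: "nat \<Rightarrow> 'a \<Rightarrow> real" where \<phi>: "\<And>n. \<phi> n \<in> schwartz"
        "\<And>n x. \<bar>\<phi> n x\<bar> \<le> (1 + 1) * indicator (ball 0 R) x"
        "AE x in lebesgue. (\<lambda>n. \<phi> n x) \<longlonglongrightarrow> indicator (ball 0 R) x * h x"
        using schwartz_approx_bounded[OF h b, of R] by blast
      have "(\<lambda>n. LINT x|lebesgue. of_real (\<phi> n x) * g x) \<longlonglongrightarrow> (LINT x|lebesgue. of_real (indicator (ball 0 R) x * h x) * g x)"
      proof (rule integral_dominated_convergence)
        show "integrable lebesgue (\<lambda>x. 2 * (indicator (ball 0 R) x * norm (g x)))"
          by (intro integrable_mult_right loc)
        show "(\<lambda>x. of_real (indicator (ball 0 R) x * h x) * g x) \<in> borel_measurable lebesgue"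
          using li[OF h b] by (rule borel_measurable_integrable)
        show "(\<lambda>x. of_real (\<phi> n x) * g x) \<in> borel_measurable lebesgue" for n
          using g[OF schwartz_of_real[OF \<phi>(1)]] by (rule borel_measurable_integrable)
        show "AE x in lebesgue. (\<lambda>n. of_real (\<phi> n x) * g x) \<longlonglongrightarrow> of_real (indicator (ball 0 R) x * h x) * g x"
          using \<phi>(3) by eventually_elim (intro tendsto_intros)
        show "AE x in lebesgue. norm (of_real (\<phi> n x) * g x) \<le> 2 * (indicator (ball 0 R) x * norm (g x))" for n
          using mult_right_mono[OF \<phi>(2) norm_ge_zero] by (intro AE_I2) (simp add: norm_mult mult.assoc)
      qed
      moreover have "(LINT x|lebesgue. of_real (\<phi> n x) * g x) = 0" for n
        by (rule zero[OF schwartz_of_real[OF \<phi>(1)]])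
      ultimately have "(\<lambda>n::nat. 0) \<longlonglongrightarrow> (LINT x|lebesgue. of_real (indicator (ball 0 R) x * h x) * g x)"
        by (simp only:)
      then show ?thesis by (rule LIMSEQ_unique[OF _ tendsto_const])
    qed
    \<comment> \<open>\<open>?s x * g x\<close> equals \<open>norm (g x)\<close>. Real and imaginary
      parts are treated apart because the approximation is stated for real functions.\<close>
    let ?s = "\<lambda>x. cnj (sgn (g x))"
    have sm: "(\<lambda>x. Re (?s x)) \<in> borel_measurable lebesgue" "(\<lambda>x. Im (?s x)) \<in> borel_measurable lebesgue"
      unfolding cnj.sel sgn_div_norm by measurable
    have sb: "\<bar>Re (?s x)\<bar> \<le> 1" "\<bar>Im (?s x)\<bar> \<le> 1" for x
      using abs_Re_le_cmod[of "?s x"] abs_Im_le_cmod[of "?s x"] by (auto simp: norm_sgn split: if_splits)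
    have eq: "complex_of_real (indicator (ball 0 R) x * norm (g x))
        = of_real (indicator (ball 0 R) x * Re (?s x)) * g x + \<i> * (of_real (indicator (ball 0 R) x * Im (?s x)) * g x)" for x
    proof -
      have "complex_of_real (norm (g x)) = ?s x * g x"
        by (cases "g x = 0") (simp_all add: sgn_div_norm scaleR_conv_of_real complex_norm_square[symmetric] mult.commute power2_eq_square field_simps)
      also have "?s x = of_real (Re (?s x)) + \<i> * of_real (Im (?s x))" by (rule complex_eq)
      finally show ?thesis by (simp only: of_real_mult) (simp only: algebra_simps)
    qed
    have "complex_of_real (LINT x|lebesgue. indicator (ball 0 R) x * norm (g x)) = (LINT x|lebesgue. of_real (indicator (ball 0 R) x * norm (g x)))"
      by (rule integral_of_real[OF loc, symmetric])
    also have "\<dots> = 0"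
      unfolding eq Bochner_Integration.integral_add[OF li[OF sm(1) sb(1)] integrable_mult_right[OF li[OF sm(2) sb(2)]]]
        integral_mult_right_zero lz[OF sm(1) sb(1)] lz[OF sm(2) sb(2)] by simp
    finally have "(LINT x|lebesgue. indicator (ball 0 R) x * norm (g x)) = 0" by simp
    then have "AE x in lebesgue. indicator (ball 0 R) x * norm (g x) = 0"
      by (subst (asm) integral_nonneg_eq_0_iff_AE[OF loc]) auto
    then show ?thesis by eventually_elim (auto simp: indicator_def)
  qed
  then have "AE x in lebesgue. \<forall>n::nat. x \<in> ball 0 (real n) \<longrightarrow> g x = 0"
    by (subst AE_all_countable) blast
  then show ?thesis
  proof eventually_elim
    case (elim x)
    obtain n :: nat where "norm x < real n" using reals_Archimedean2 by blast
    with elim show ?case by auto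
  qed
qed

section \<open>Distributions represented by functions\<close>

lemma integrable_component:
  fixes f :: "'a \<Rightarrow> complex ^ 'i::finite"
  shows "integrable M f \<Longrightarrow> integrable M (\<lambda>x. f x $ i)"
  by (rule integrable_bounded_linear[OF bounded_linear_vec_nth])

lemma integral_component:
  fixes f :: "'a \<Rightarrow> complex ^ 'i::finite"
  shows "integrable M f \<Longrightarrow> (\<integral>x. f x \<partial>M) $ i = (\<integral>x. f x $ i \<partial>M)"
  by (rule integral_bounded_linear[OF bounded_linear_vec_nth, symmetric])

lemma bounded_linear_axis: "bounded_linear (axis i :: complex \<Rightarrow> complex ^ 'i::finite)"
  by (rule linear_conv_bounded_linear[THEN iffD1], intro linearI) (auto simp: axis_def vec_eq_iff)

lemma sum_axis: "(\<Sum>i\<in>UNIV. axis i (w $ i)) = (w :: complex ^ 'i::finite)"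
  by (simp add: vec_eq_iff axis_def)

lemma integrable_vec:
  fixes f :: "'a \<Rightarrow> complex ^ 'i::finite"
  assumes "\<And>i. integrable M (\<lambda>x. f x $ i)"
  shows "integrable M f"
proof -
  have "integrable M (\<lambda>x. \<Sum>i\<in>UNIV. axis i (f x $ i))"
    by (intro Bochner_Integration.integrable_sum integrable_bounded_linear[OF bounded_linear_axis] assms)
  then show ?thesis unfolding sum_axis .
qed

lemma measurable_component:
  fixes f :: "'a \<Rightarrow> complex ^ 'i::finite"
  shows "f \<in> borel_measurable M \<Longrightarrow> (\<lambda>x. f x $ i) \<in> borel_measurable M"
  by (rule borel_measurable_continuous_on[of "\<lambda>w. w $ i"]) (intro continuous_intros)

lemma measurable_vec:
  fixes f :: "'a \<Rightarrow> complex ^ 'i::finite"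
  assumes "\<And>i. (\<lambda>x. f x $ i) \<in> borel_measurable M"
  shows "f \<in> borel_measurable M"
proof -
  have "(\<lambda>x. \<Sum>i\<in>UNIV. axis i (f x $ i)) \<in> borel_measurable M"
    by (intro borel_measurable_sum borel_measurable_continuous_on[OF _ assms] linear_continuous_on bounded_linear_axis)
  then show ?thesis unfolding sum_axis .
qed

lemma vector_scalar_mult_measurable [measurable]:
  fixes g :: "'a \<Rightarrow> complex ^ 'i::finite"
  assumes [measurable]: "\<phi> \<in> borel_measurable M" "g \<in> borel_measurable M"
  shows "(\<lambda>x. \<phi> x *s g x) \<in> borel_measurable M"
proof (rule measurable_vec)
  fix i
  have [measurable]: "(\<lambda>x. g x $ i) \<in> borel_measurable M" by (rule measurable_component) measurable
  show "(\<lambda>x. (\<phi> x *s g x) $ i) \<in> borel_measurable M" by simp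
qed

text \<open>Product measures and Fubini are handled on \<open>lborel\<close>; this supplies the
  Borel representatives needed there.\<close>

lemma lebesgue_measurable_ex_borel:
  fixes g :: "'a::euclidean_space \<Rightarrow> 'b::euclidean_space"
  assumes g: "g \<in> borel_measurable lebesgue"
  obtains g' where "g' \<in> borel_measurable borel" "AE x in lebesgue. g x = g' x"
proof -
  have "\<forall>b. \<exists>h. h \<in> borel_measurable borel \<and> (AE x in lborel. g x \<bullet> b = h x)"
  proof
    fix b
    have "\<exists>h\<in>borel_measurable lborel. AE x in lborel. g x \<bullet> b = h x"
      using g by (intro completion_ex_borel_measurable_real) simp
    then show "\<exists>h. h \<in> borel_measurable borel \<and> (AE x in lborel. g x \<bullet> b = h x)" by auto
  qed
  from choice[OF this] obtain h
    where h: "\<And>b. h b \<in> borel_measurable borel" "\<And>b. AE x in lborel. g x \<bullet> b = h b x"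
    by blast
  show ?thesis
  proof
    show "(\<lambda>x. \<Sum>b\<in>Basis. h b x *\<^sub>R b) \<in> borel_measurable borel"
      using h(1) by (intro borel_measurable_sum borel_measurable_scaleR) auto
    have "AE x in lborel. \<forall>b\<in>Basis. g x \<bullet> b = h b x"
      using h(2) by (intro AE_finite_allI) auto
    then have "AE x in lborel. g x = (\<Sum>b\<in>Basis. h b x *\<^sub>R b)"
    proof eventually_elim
      case (elim x)
      have "(\<Sum>b\<in>Basis. h b x *\<^sub>R b) = (\<Sum>b\<in>Basis. (g x \<bullet> b) *\<^sub>R b)"
        using elim by (intro sum.cong) auto
      then show ?case by (simp add: euclidean_representation)
    qed
    then show "AE x in lebesgue. g x = (\<Sum>b\<in>Basis. h b x *\<^sub>R b)"
      by (rule AE_completion)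
  qed
qed

lemma represented_by_AE_unique:
  assumes g: "represented_by u g" and g': "represented_by u g'"
  shows "AE x in lebesgue. g x = g' x"
proof -
  have "AE x in lebesgue. g x $ i - g' x $ i = 0" for i
  proof (rule AE_zero_if_schwartz_integrals_zero)
    have [measurable]: "(\<lambda>x. g x $ i) \<in> borel_measurable lebesgue" "(\<lambda>x. g' x $ i) \<in> borel_measurable lebesgue"
      using g g' by (auto simp: represented_by_def intro: measurable_component)
    show "(\<lambda>x. g x $ i - g' x $ i) \<in> borel_measurable lebesgue" by measurable
    fix \<phi> :: "'a \<Rightarrow> complex" assume \<phi>: "\<phi> \<in> schwartz"
    have v: "integrable lebesgue (\<lambda>x. \<phi> x *s g x)" "integrable lebesgue (\<lambda>x. \<phi> x *s g' x)"
      using g g' \<phi> by (auto simp: represented_by_def)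
    note i = v[THEN integrable_component[where i = i]]
    from Bochner_Integration.integrable_diff[OF i]
    show "integrable lebesgue (\<lambda>x. \<phi> x * (g x $ i - g' x $ i))" by (simp add: right_diff_distrib)
    have "fun_dist g \<phi> $ i = fun_dist g' \<phi> $ i"
      using g g' by (auto simp: represented_by_def)
    then have "(LINT x|lebesgue. (\<phi> x *s g x) $ i) = (LINT x|lebesgue. (\<phi> x *s g' x) $ i)"
      using \<phi> v by (simp add: fun_dist_def integral_component)
    then show "(LINT x|lebesgue. \<phi> x * (g x $ i - g' x $ i)) = 0"
      using Bochner_Integration.integral_diff[OF i] by (simp add: right_diff_distrib)
  qed
  then have "AE x in lebesgue. \<forall>i. g x $ i - g' x $ i = 0"
    by (subst AE_all_countable) blast
  then show ?thesis by eventually_elim (simp add: vec_eq_iff)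
qed

lemma represented_by_cong:
  assumes g: "represented_by u g" and [measurable]: "g' \<in> borel_measurable lebesgue"
    and AE: "AE x in lebesgue. g x = g' x"
  shows "represented_by u g'"
proof -
  have [measurable]: "g \<in> borel_measurable lebesgue" using g by (simp add: represented_by_def)
  have sm [measurable]: "\<phi> \<in> borel_measurable lebesgue" if "\<phi> \<in> schwartz" for \<phi> :: "'a \<Rightarrow> complex"
    using schwartz_measurable[OF that] by (simp add: measurable_completion)
  have ae: "AE x in lebesgue. \<phi> x *s g x = \<phi> x *s g' x" for \<phi>
    using AE by eventually_elim simp
  have "integrable lebesgue (\<lambda>x. \<phi> x *s g' x)" if "\<phi> \<in> schwartz" for \<phi>
    using g that sm[OF that] by (intro integrable_cong_AE_imp[OF _ _ ae]) (auto simp: represented_by_def)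
  moreover have "fun_dist g = fun_dist g'"
  proof
    fix \<phi> :: "'a \<Rightarrow> complex"
    show "fun_dist g \<phi> = fun_dist g' \<phi>"
      unfolding fun_dist_def using sm by (auto intro!: integral_cong_AE ae)
  qed
  ultimately show ?thesis using g by (simp add: represented_by_def)
qed

text \<open>In the unit ball the Sobolev weight may be too small to help, and local integrability
  comes from the test functions. Outside it the weight is at least 1, and
  \<open>x * y \<le> x\<^sup>2 + y\<^sup>2\<close> splits the quotient into the Sobolev density and
  the integrable weight \<open>1 / (1 + norm \<xi>) ^ (2 * DIM('a))\<close>.\<close>

lemma integrable_weight_of_sobolev:
  fixes g :: "'a::euclidean_space \<Rightarrow> complex ^ 'i::finite"
  assumes g: "represented_by u g" and s: "0 \<le> s"
    and fin: "(\<integral>\<^sup>+ \<xi>. ennreal (norm \<xi> powr (2 * s) * (norm (g \<xi>))\<^sup>2) \<partial>lebesgue) < \<infinity>"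
  shows "integrable lebesgue (\<lambda>\<xi>. norm (g \<xi>) / (1 + norm \<xi>) ^ DIM('a))"
proof (rule Bochner_Integration.integrable_bound)
  have [measurable]: "g \<in> borel_measurable lebesgue" using g by (simp add: represented_by_def)
  have [measurable]: "norm \<in> borel_measurable (lebesgue :: 'a measure)"
    by (intro measurable_completion) simp
  show "(\<lambda>\<xi>. norm (g \<xi>) / (1 + norm \<xi>) ^ DIM('a)) \<in> borel_measurable lebesgue" by measurable
  have comp: "integrable lebesgue (\<lambda>x. indicator (ball 0 1) x * norm (g x $ i))" for i
  proof (rule locally_integrable_if_schwartz_integrable)
    show "(\<lambda>x. g x $ i) \<in> borel_measurable lebesgue" by (rule measurable_component) measurable
    show "integrable lebesgue (\<lambda>x. \<phi> x * g x $ i)" if "\<phi> \<in> schwartz" for \<phi>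
      using g that integrable_component[of lebesgue "\<lambda>x. \<phi> x *s g x" i] by (auto simp: represented_by_def)
  qed
  have w: "integrable lebesgue (\<lambda>\<xi>::'a. 1 / (1 + norm \<xi>) ^ (2 * DIM('a)))"
    by (subst integrable_completion) (measurable, rule integrable_weight)
  have q: "integrable lebesgue (\<lambda>\<xi>. norm \<xi> powr (2 * s) * (norm (g \<xi>))\<^sup>2)"
    using fin by (intro integrableI_nonneg) auto
  let ?b = "\<lambda>\<xi>. (\<Sum>i\<in>UNIV. indicator (ball 0 1) \<xi> * norm (g \<xi> $ i)) +
     (norm \<xi> powr (2 * s) * (norm (g \<xi>))\<^sup>2 + 1 / (1 + norm \<xi>) ^ (2 * DIM('a)))"
  show "integrable lebesgue ?b"
    by (intro Bochner_Integration.integrable_add Bochner_Integration.integrable_sum comp w q)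
  show "AE \<xi> in lebesgue. norm (norm (g \<xi>) / (1 + norm \<xi>) ^ DIM('a)) \<le> norm (?b \<xi>)"
  proof (intro AE_I2)
    fix \<xi> :: 'a
    have S0: "0 \<le> (\<Sum>i\<in>UNIV. indicator (ball 0 1) \<xi> * norm (g \<xi> $ i))" by (intro sum_nonneg) auto
    have Q0: "0 \<le> norm \<xi> powr (2 * s) * (norm (g \<xi>))\<^sup>2 + 1 / (1 + norm \<xi>) ^ (2 * DIM('a))" by simp
    let ?W = "(1 + norm \<xi>) ^ DIM('a)"
    have W: "1 \<le> ?W" by (rule one_le_power) simp
    then have W0: "0 < ?W" by (rule less_le_trans[OF zero_less_one])
    have "norm (g \<xi>) / ?W \<le> ?b \<xi>"
    proof (cases "norm \<xi> < 1")
      case True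
      have "norm (g \<xi>) / ?W \<le> norm (g \<xi>) / 1" using W W0 by (intro divide_left_mono mult_pos_pos) auto
      also have "\<dots> \<le> (\<Sum>i\<in>UNIV. norm (g \<xi> $ i))" by (simp add: norm_vec_def L2_set_le_sum)
      also have "\<dots> = (\<Sum>i\<in>UNIV. indicator (ball 0 1) \<xi> * norm (g \<xi> $ i))" using True by simp
      finally show ?thesis by (rule add_increasing2[OF Q0])
    next
      case False
      have "1 \<le> norm \<xi> powr (2 * s)" using False s by (intro ge_one_powr_ge_zero) auto
      then have "(norm (g \<xi>))\<^sup>2 \<le> norm \<xi> powr (2 * s) * (norm (g \<xi>))\<^sup>2" by (simp add: mult_le_cancel_right1)
      moreover have "norm (g \<xi>) / ?W \<le> (norm (g \<xi>))\<^sup>2 + 1 / ?W\<^sup>2"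
      proof -
        have "x * y \<le> x\<^sup>2 + y\<^sup>2" if "0 \<le> x * y" for x y :: real
          using sum_squares_bound[of x y] that by simp
        from this[of "norm (g \<xi>)" "1 / ?W"] show ?thesis using W0 by (simp add: power_divide)
      qed
      moreover have "?W\<^sup>2 = (1 + norm \<xi>) ^ (2 * DIM('a))" by (simp add: power_mult[symmetric] mult.commute)
      ultimately show ?thesis using S0 by simp
    qed
    moreover have "0 \<le> norm (g \<xi>) / ?W" using W by simp
    ultimately show "norm (norm (g \<xi>) / ?W) \<le> norm (?b \<xi>)" by simp
  qed
qed

lemma integrable_schwartz_mult:
  fixes G :: "'a::euclidean_space \<Rightarrow> complex ^ 'i::finite"
  assumes Gm [measurable]: "G \<in> borel_measurable lebesgue" and G: "integrable lebesgue (\<lambda>\<xi>. norm (G \<xi>) / (1 + norm \<xi>) ^ M)"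
    and [measurable]: "\<psi> \<in> borel_measurable borel" and \<psi>: "\<And>\<xi>. (1 + norm \<xi>) ^ M * norm (\<psi> \<xi>) \<le> C"
  shows "integrable lebesgue (\<lambda>\<xi>. \<psi> \<xi> *s G \<xi>)"
    and "norm (LINT \<xi>|lebesgue. \<psi> \<xi> *s G \<xi>) \<le> C * (LINT \<xi>|lebesgue. norm (G \<xi>) / (1 + norm \<xi>) ^ M)"
proof -
  have [measurable]: "\<psi> \<in> borel_measurable lebesgue" by (rule measurable_completion) simp
  have le: "norm (\<psi> \<xi> *s G \<xi>) \<le> C * (norm (G \<xi>) / (1 + norm \<xi>) ^ M)" for \<xi>
    using mult_right_mono[OF \<psi>[of \<xi>, unfolded weight_le_iff] norm_ge_zero[of "G \<xi>"]]
    by (simp add: norm_vector_scalar_mult_complex)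
  note i = integrable_mult_right[OF G, of C]
  show "integrable lebesgue (\<lambda>\<xi>. \<psi> \<xi> *s G \<xi>)"
    by (rule Bochner_Integration.integrable_bound[OF i])
       (measurable, intro AE_I2, unfold real_norm_def, rule order_trans[OF le abs_ge_self])
  show "norm (LINT \<xi>|lebesgue. \<psi> \<xi> *s G \<xi>) \<le> C * (LINT \<xi>|lebesgue. norm (G \<xi>) / (1 + norm \<xi>) ^ M)"
    unfolding integral_mult_right_zero[symmetric] by (rule norm_integral_le[OF i le])
qed

text \<open>The inverse Fourier transform by duality: \<open>fourier \<phi> (- \<xi>)\<close> is the
  inverse transform of the test function.\<close>

definition inv_fourier_dist ::
    "('a::euclidean_space \<Rightarrow> complex ^ 'i) \<Rightarrow> ('a \<Rightarrow> complex) \<Rightarrow> complex ^ ('i::finite)" where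
  "inv_fourier_dist G \<phi> = (if \<phi> \<in> schwartz then LINT \<xi>|lebesgue. fourier \<phi> (- \<xi>) *s G \<xi> else 0)"

lemma fourier_add:
  fixes f g :: "'a::euclidean_space \<Rightarrow> complex"
  assumes f: "f \<in> schwartz" and g: "g \<in> schwartz"
  shows "fourier (\<lambda>x. f x + g x) \<xi> = fourier f \<xi> + fourier g \<xi>"
proof -
  have i: "integrable lborel (\<lambda>x. cis (- (x \<bullet> \<xi>)) * h x)" if "h \<in> schwartz" for h :: "'a \<Rightarrow> complex"
    using schwartz_measurable[OF that]
    by (intro Bochner_Integration.integrable_bound[OF schwartz_integrable[OF that]]) (auto simp: norm_mult)
  show ?thesis
    using i[OF f] i[OF g]
    by (simp add: fourier_eq schwartz_measurable f g schwartz_add distrib_left)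
qed

lemma fourier_cmult:
  fixes f :: "'a::euclidean_space \<Rightarrow> complex"
  assumes f: "f \<in> schwartz"
  shows "fourier (\<lambda>x. c * f x) \<xi> = c * fourier f \<xi>"
proof -
  have "(LINT x|lborel. cis (- (x \<bullet> \<xi>)) * (c * f x)) = c * (LINT x|lborel. cis (- (x \<bullet> \<xi>)) * f x)"
    unfolding integral_mult_right_zero[symmetric] by (simp add: mult_ac)
  then show ?thesis
    by (simp add: fourier_eq schwartz_measurable f schwartz_cmult)
qed

lemma schwartz_reflect_fourier: "f \<in> schwartz \<Longrightarrow> (\<lambda>\<xi>. fourier f (- \<xi>)) \<in> schwartz"
  by (rule fourier_surj_schwartz(1))

text \<open>On the test function \<open>fourier \<phi>\<close> the definition meets the double
  transform at \<open>- \<xi>\<close>, which inversion turns into \<open>\<phi>\<close>.\<close>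

lemma represented_by_inv_fourier_dist:
  fixes G :: "'a::euclidean_space \<Rightarrow> complex ^ 'i::finite"
  assumes Gm: "G \<in> borel_measurable lebesgue" and G: "integrable lebesgue (\<lambda>\<xi>. norm (G \<xi>) / (1 + norm \<xi>) ^ M)"
  shows "represented_by (fourier_dist (inv_fourier_dist G)) G"
  unfolding represented_by_def
proof (intro conjI ballI Gm)
  fix \<phi> :: "'a \<Rightarrow> complex" assume \<phi>: "\<phi> \<in> schwartz"
  obtain C where "\<And>\<xi>. (1 + norm \<xi>) ^ M * norm (\<phi> \<xi>) \<le> C" using schwartz_decay[OF \<phi>] by blast
  then show "integrable lebesgue (\<lambda>\<xi>. \<phi> \<xi> *s G \<xi>)"
    by (rule integrable_schwartz_mult(1)[OF Gm G schwartz_measurable[OF \<phi>]])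
next
  show "fourier_dist (inv_fourier_dist G) = fun_dist G"
    by (auto simp: fourier_dist_def inv_fourier_dist_def fun_dist_def fourier_schwartz fourier_fourier)
qed

text \<open>Continuity is inherited from the Fourier transform on Schwartz functions, where decay of
  order \<open>M\<close> pays for the growth of \<open>G\<close>.\<close>

lemma inv_fourier_dist_tempered:
  fixes G :: "'a::euclidean_space \<Rightarrow> complex ^ ('k::finite set)"
  assumes Gm [measurable]: "G \<in> borel_measurable lebesgue" and G: "integrable lebesgue (\<lambda>\<xi>. norm (G \<xi>) / (1 + norm \<xi>) ^ M)"
    and deg: "AE \<xi> in lebesgue. G \<xi> \<in> ext_deg p"
  shows "inv_fourier_dist G \<in> tempered (ext_deg p)"
proof -
  have int: "integrable lebesgue (\<lambda>\<xi>. fourier \<phi> (- \<xi>) *s G \<xi>)" if \<phi>: "\<phi> \<in> schwartz" for \<phi>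
  proof -
    note r = schwartz_reflect_fourier[OF \<phi>]
    obtain C where "\<And>\<xi>. (1 + norm \<xi>) ^ M * norm (fourier \<phi> (- \<xi>)) \<le> C" using schwartz_decay[OF r] by blast
    then show ?thesis
      by (rule integrable_schwartz_mult(1)[OF Gm G schwartz_measurable[OF r]])
  qed
  have "inv_fourier_dist G \<phi> \<in> ext_deg p" if \<phi>: "\<phi> \<in> schwartz" for \<phi>
    unfolding ext_deg_def
  proof (intro CollectI allI impI)
    fix I assume I: "inv_fourier_dist G \<phi> $ I \<noteq> 0"
    show "int (card I) = p"
    proof (rule ccontr)
      assume ne: "int (card I) \<noteq> p"
      have "inv_fourier_dist G \<phi> $ I = (LINT \<xi>|lebesgue. (fourier \<phi> (- \<xi>) *s G \<xi>) $ I)"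
        using \<phi> by (simp add: inv_fourier_dist_def integral_component int)
      also have "\<dots> = 0"
        using deg ne by (intro integral_eq_zero_AE) (auto simp: ext_deg_def elim!: eventually_mono)
      finally show False using I by simp
    qed
  qed
  moreover have "inv_fourier_dist G (\<lambda>x. \<phi> x + \<psi> x) = inv_fourier_dist G \<phi> + inv_fourier_dist G \<psi>"
    if "\<phi> \<in> schwartz" "\<psi> \<in> schwartz" for \<phi> \<psi>
    using that int by (simp add: inv_fourier_dist_def schwartz_add fourier_add vector_sadd_rdistrib)
  moreover have "inv_fourier_dist G (\<lambda>x. c * \<phi> x) = c *s inv_fourier_dist G \<phi>" if \<phi>: "\<phi> \<in> schwartz" for c \<phi>
  proof -
    have "integrable lebesgue (\<lambda>\<xi>. (c * fourier \<phi> (- \<xi>)) *s G \<xi>)"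
      using int[OF schwartz_cmult[OF \<phi>]] by (simp add: fourier_cmult[OF \<phi>])
    then show ?thesis
      using \<phi> int[OF \<phi>] by (simp add: inv_fourier_dist_def schwartz_cmult fourier_cmult vec_eq_iff integral_component mult.assoc)
  qed
  moreover have "\<exists>N C. \<forall>\<phi>\<in>schwartz. norm (inv_fourier_dist G \<phi>) \<le> C * schwartz_norm N \<phi>"
  proof -
    obtain K where K: "0 \<le> K" "\<And>(f :: 'a \<Rightarrow> complex) \<xi>. f \<in> schwartz \<Longrightarrow>
       (1 + norm \<xi>) ^ M * norm (fourier f \<xi>) \<le> K * schwartz_norm (max M (2 * DIM('a))) f"
      using fourier_schwartz_norm[of M] by blast
    let ?N = "max M (2 * DIM('a))" and ?I = "LINT \<xi>|lebesgue. norm (G \<xi>) / (1 + norm \<xi>) ^ M"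
    have "norm (inv_fourier_dist G \<phi>) \<le> (K * ?I) * schwartz_norm ?N \<phi>" if \<phi>: "\<phi> \<in> schwartz" for \<phi>
    proof -
      have "(1 + norm \<xi>) ^ M * norm (fourier \<phi> (- \<xi>)) \<le> K * schwartz_norm ?N \<phi>" for \<xi>
        using K(2)[OF \<phi>, of "- \<xi>"] by simp
      from integrable_schwartz_mult(2)[OF Gm G schwartz_measurable[OF schwartz_reflect_fourier[OF \<phi>]] this]
      show ?thesis using \<phi> by (simp add: inv_fourier_dist_def mult_ac)
    qed
    then show ?thesis by blast
  qed
  ultimately show ?thesis
    by (auto simp: tempered_def inv_fourier_dist_def)
qed

section \<open>Vector-valued Schwartz functions as distributions\<close>

lemma schwartz_weighted_square_integrable:
  fixes h :: "'a::euclidean_space \<Rightarrow> complex ^ 'i::finite"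
  assumes h: "h \<in> schwartz" and s: "0 \<le> s"
  shows "integrable lborel (\<lambda>\<xi>. norm \<xi> powr (2 * s) * (norm (h \<xi>))\<^sup>2)"
proof -
  note [measurable] = schwartz_measurable[OF h]
  define k where "k = nat \<lceil>2 * s\<rceil>"
  obtain A where A: "0 \<le> A" "\<And>x. (1 + norm x) ^ 0 * norm (h x) \<le> A" using schwartz_decay[OF h] by blast
  obtain B where B: "\<And>x. (1 + norm x) ^ (k + 2 * DIM('a)) * norm (h x) \<le> B" using schwartz_decay[OF h] by blast
  show ?thesis
  proof (rule integrable_weight_bound(1))
    fix \<xi> :: 'a
    let ?x = "1 + norm \<xi>"
    have "norm \<xi> powr (2 * s) \<le> ?x powr (2 * s)" using s by (intro powr_mono2) auto
    also have "\<dots> \<le> ?x powr (real k)" by (rule powr_mono) (use real_nat_ceiling_ge[of "2 * s"] in \<open>simp_all add: k_def\<close>)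
    also have "\<dots> = ?x ^ k" by (rule powr_realpow) (simp add: add_pos_nonneg)
    finally have p: "norm \<xi> powr (2 * s) \<le> ?x ^ k" .
    have "?x ^ (2 * DIM('a)) * (norm \<xi> powr (2 * s) * (norm (h \<xi>))\<^sup>2)
       \<le> ?x ^ (2 * DIM('a)) * (?x ^ k * (norm (h \<xi>))\<^sup>2)"
      by (intro mult_left_mono mult_right_mono p) auto
    also have "\<dots> = (?x ^ (k + 2 * DIM('a)) * norm (h \<xi>)) * norm (h \<xi>)"
      by (simp add: power_add power2_eq_square mult_ac)
    also have "\<dots> \<le> B * A"
      using A B[of \<xi>] order_trans[OF _ B[of \<xi>], of 0] by (intro mult_mono) auto
    finally show "?x ^ (2 * DIM('a)) * norm (norm \<xi> powr (2 * s) * (norm (h \<xi>))\<^sup>2) \<le> B * A" by simp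
  qed measurable
qed

definition vfourier :: "('a::euclidean_space \<Rightarrow> complex ^ 'i) \<Rightarrow> 'a \<Rightarrow> complex ^ ('i::finite)" where
  "vfourier f \<xi> = (\<chi> i. fourier (\<lambda>x. f x $ i) \<xi>)"

lemma vfourier_schwartz: "f \<in> schwartz \<Longrightarrow> vfourier f \<in> schwartz"
  by (rule schwartz_vec) (simp add: vfourier_def fourier_schwartz schwartz_component eta_contract_eq)

lemma vfourier_surj_schwartz:
  fixes h :: "'a::euclidean_space \<Rightarrow> complex ^ 'i::finite"
  assumes h: "h \<in> schwartz"
  shows "(\<lambda>x. vfourier h (- x)) \<in> schwartz" "vfourier (\<lambda>x. vfourier h (- x)) = h"
proof -
  note c = schwartz_component[OF h]
  show "(\<lambda>x. vfourier h (- x)) \<in> schwartz"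
    by (rule schwartz_vec) (simp add: vfourier_def schwartz_reflect_fourier c)
  show "vfourier (\<lambda>x. vfourier h (- x)) = h"
    by (rule ext) (simp add: vfourier_def vec_eq_iff fourier_surj_schwartz(2)[OF c])
qed

lemma vfourier_ext_deg: "(\<And>y. f y \<in> ext_deg p) \<Longrightarrow> vfourier f \<xi> \<in> ext_deg p"
proof -
  assume f: "\<And>y. f y \<in> ext_deg p"
  have "vfourier f \<xi> $ I = 0" if "int (card I) \<noteq> p" for I
  proof -
    have "f y $ I = 0" for y using f[of y] that by (auto simp: ext_deg_def)
    then show ?thesis by (simp add: vfourier_def fourier_def)
  qed
  then show ?thesis by (auto simp: ext_deg_def)
qed

lemma integrable_mult_bounded_schwartz:
  fixes f :: "'a::euclidean_space \<Rightarrow> complex ^ 'i::finite"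
  assumes f: "f \<in> schwartz" and \<phi>: "\<phi> \<in> schwartz"
  shows "integrable lebesgue (\<lambda>x. \<phi> x *s f x)"
    and "norm (LINT x|lebesgue. \<phi> x *s f x) \<le> (LINT x|lborel. norm (f x)) * schwartz_norm 0 \<phi>"
proof -
  have fi: "integrable lebesgue (\<lambda>x. norm (f x) / (1 + norm x) ^ 0)"
    using schwartz_integrable[OF f] schwartz_measurable[OF f] by (simp add: integrable_completion)
  have fm: "f \<in> borel_measurable lebesgue" using schwartz_measurable[OF f] by (simp add: measurable_completion)
  have b: "(1 + norm x) ^ 0 * norm (\<phi> x) \<le> schwartz_norm 0 \<phi>" for x
    using schwartz_norm_ge[OF \<phi>, of "[]" 0 0 x] by simp
  show "integrable lebesgue (\<lambda>x. \<phi> x *s f x)"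
    by (rule integrable_schwartz_mult(1)[OF fm fi schwartz_measurable[OF \<phi>] b])
  show "norm (LINT x|lebesgue. \<phi> x *s f x) \<le> (LINT x|lborel. norm (f x)) * schwartz_norm 0 \<phi>"
    using integrable_schwartz_mult(2)[OF fm fi schwartz_measurable[OF \<phi>] b] schwartz_measurable[OF f]
    by (simp add: integral_completion mult.commute)
qed

text \<open>The multiplication formula, applied in each component, moves the transform from the test
  function to \<open>f\<close>.\<close>

lemma represented_by_vfourier:
  fixes f :: "'a::euclidean_space \<Rightarrow> complex ^ 'i::finite"
  assumes f: "f \<in> schwartz"
  shows "represented_by (fourier_dist (fun_dist f)) (vfourier f)"
  unfolding represented_by_def
proof (intro conjI ballI)
  show "vfourier f \<in> borel_measurable lebesgue"
    using schwartz_measurable[OF vfourier_schwartz[OF f]] by (simp add: measurable_completion)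
  show "integrable lebesgue (\<lambda>x. \<phi> x *s vfourier f x)" if "\<phi> \<in> schwartz" for \<phi>
    by (rule integrable_mult_bounded_schwartz(1)[OF vfourier_schwartz[OF f] that])
  show "fourier_dist (fun_dist f) = fun_dist (vfourier f)"
  proof
    fix \<phi> :: "'a \<Rightarrow> complex"
    show "fourier_dist (fun_dist f) \<phi> = fun_dist (vfourier f) \<phi>"
    proof (cases "\<phi> \<in> schwartz")
      case \<phi>: True
      note F\<phi> = fourier_schwartz[OF \<phi>] and vf = vfourier_schwartz[OF f]
      have "(LINT x|lebesgue. fourier \<phi> x *s f x) $ i = (LINT x|lebesgue. \<phi> x *s vfourier f x) $ i" for i
      proof -
        note fi = schwartz_component[OF f, of i]
        have "(LINT x|lebesgue. fourier \<phi> x *s f x) $ i = (LINT x|lebesgue. fourier \<phi> x * f x $ i)"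
          by (simp add: integral_component integrable_mult_bounded_schwartz(1)[OF f F\<phi>])
        also have "\<dots> = (LINT x|lborel. fourier \<phi> x * f x $ i)"
          using schwartz_measurable[OF fi] schwartz_measurable[OF F\<phi>] by (intro integral_completion) simp
        also have "\<dots> = (LINT x|lborel. \<phi> x * fourier (\<lambda>x. f x $ i) x)"
          by (rule fourier_multiplication[OF schwartz_integrable[OF \<phi>] schwartz_integrable[OF fi]])
        also have "\<dots> = (LINT x|lebesgue. \<phi> x * fourier (\<lambda>x. f x $ i) x)"
          using schwartz_measurable[OF fourier_schwartz[OF fi]] schwartz_measurable[OF \<phi>]
          by (intro integral_completion[symmetric]) simp
        also have "\<dots> = (LINT x|lebesgue. \<phi> x *s vfourier f x) $ i"
          by (subst integral_component[OF integrable_mult_bounded_schwartz(1)[OF vf \<phi>]]) (simp add: vfourier_def)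
        finally show ?thesis .
      qed
      then show ?thesis
        using \<phi> by (simp add: fourier_dist_def fun_dist_def fourier_schwartz vec_eq_iff)
    qed (simp add: fourier_dist_def fun_dist_def)
  qed
qed

lemma fun_dist_hdot:
  fixes f :: "'a::euclidean_space \<Rightarrow> complex ^ ('k::finite set)"
  assumes f: "f \<in> schwartz" and deg: "\<And>y. f y \<in> ext_deg p" and s: "0 \<le> s"
  shows "fun_dist f \<in> hdot s (ext_deg p)"
proof -
  note int = integrable_mult_bounded_schwartz(1)[OF f]
  have "fun_dist f \<phi> \<in> ext_deg p" if \<phi>: "\<phi> \<in> schwartz" for \<phi>
    unfolding ext_deg_def
  proof (intro CollectI allI impI)
    fix I assume I: "fun_dist f \<phi> $ I \<noteq> 0"
    show "int (card I) = p"
    proof (rule ccontr)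
      assume ne: "int (card I) \<noteq> p"
      have "f y $ I = 0" for y using deg[of y] ne by (auto simp: ext_deg_def)
      then show False using I \<phi> by (simp add: fun_dist_def integral_component int)
    qed
  qed
  moreover have "fun_dist f (\<lambda>x. \<phi> x + \<psi> x) = fun_dist f \<phi> + fun_dist f \<psi>"
    if "\<phi> \<in> schwartz" "\<psi> \<in> schwartz" for \<phi> \<psi>
    using that int by (simp add: fun_dist_def schwartz_add vector_sadd_rdistrib)
  moreover have "fun_dist f (\<lambda>x. c * \<phi> x) = c *s fun_dist f \<phi>" if \<phi>: "\<phi> \<in> schwartz" for c \<phi>
    using \<phi> int[OF \<phi>] int[OF schwartz_cmult[OF \<phi>]]
    by (simp add: fun_dist_def schwartz_cmult vec_eq_iff integral_component mult.assoc)
  moreover have "\<exists>N C. \<forall>\<phi>\<in>schwartz. norm (fun_dist f \<phi>) \<le> C * schwartz_norm N \<phi>"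
    using integrable_mult_bounded_schwartz(2)[OF f] by (intro exI ballI) (auto simp: fun_dist_def)
  ultimately have "fun_dist f \<in> tempered (ext_deg p)"
    by (auto simp: tempered_def fun_dist_def)
  moreover have "(\<integral>\<^sup>+ \<xi>. ennreal (norm \<xi> powr (2 * s) * (norm (vfourier f \<xi>))\<^sup>2) \<partial>lebesgue) < \<infinity>"
    using schwartz_weighted_square_integrable[OF vfourier_schwartz[OF f] s]
    by (simp add: nn_integral_completion integrable_iff_bounded)
  ultimately show ?thesis
    using represented_by_vfourier[OF f] by (auto simp: hdot_def)
qed

section \<open>Density in the Sobolev spaces\<close>

lemma norm_diff_square_le: "(norm (a - c))\<^sup>2 \<le> 2 * (norm (a - b))\<^sup>2 + 2 * (norm (b - c))\<^sup>2"
  for a b c :: "'a::real_normed_vector"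
proof -
  have "norm (a - c) \<le> norm (a - b) + norm (b - c)"
    using norm_triangle_ineq[of "a - b" "b - c"] by simp
  then have "(norm (a - c))\<^sup>2 \<le> (norm (a - b) + norm (b - c))\<^sup>2" by (rule power_mono) simp
  also have "\<dots> \<le> 2 * (norm (a - b))\<^sup>2 + 2 * (norm (b - c))\<^sup>2"
    using sum_squares_bound[of "norm (a - b)" "norm (b - c)"] by (simp add: power2_sum)
  finally show ?thesis .
qed

lemma norm_lebesgue_measurable [measurable]: "norm \<in> borel_measurable (lebesgue :: 'a::euclidean_space measure)"
  by (intro measurable_completion) simp

lemma weighted_square_diff:
  fixes f g h :: "'a::euclidean_space \<Rightarrow> 'b::{real_normed_vector, second_countable_topology}"
  assumes [measurable]: "f \<in> borel_measurable lebesgue" "g \<in> borel_measurable lebesgue" "h \<in> borel_measurable lebesgue"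
    and fg: "integrable lebesgue (\<lambda>\<xi>. norm \<xi> powr r * (norm (f \<xi> - g \<xi>))\<^sup>2)"
    and gh: "integrable lebesgue (\<lambda>\<xi>. norm \<xi> powr r * (norm (g \<xi> - h \<xi>))\<^sup>2)"
  shows "integrable lebesgue (\<lambda>\<xi>. norm \<xi> powr r * (norm (f \<xi> - h \<xi>))\<^sup>2)"
    and "(LINT \<xi>|lebesgue. norm \<xi> powr r * (norm (f \<xi> - h \<xi>))\<^sup>2)
      \<le> 2 * (LINT \<xi>|lebesgue. norm \<xi> powr r * (norm (f \<xi> - g \<xi>))\<^sup>2) + 2 * (LINT \<xi>|lebesgue. norm \<xi> powr r * (norm (g \<xi> - h \<xi>))\<^sup>2)"
proof -
  let ?b = "\<lambda>\<xi>. 2 * (norm \<xi> powr r * (norm (f \<xi> - g \<xi>))\<^sup>2) + 2 * (norm \<xi> powr r * (norm (g \<xi> - h \<xi>))\<^sup>2)"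
  have le: "norm \<xi> powr r * (norm (f \<xi> - h \<xi>))\<^sup>2 \<le> ?b \<xi>" for \<xi>
    using mult_left_mono[OF norm_diff_square_le[of "f \<xi>" "h \<xi>" "g \<xi>"], of "norm \<xi> powr r"] by (simp add: algebra_simps)
  have b: "integrable lebesgue ?b"
    by (intro Bochner_Integration.integrable_add integrable_mult_right fg gh)
  show i: "integrable lebesgue (\<lambda>\<xi>. norm \<xi> powr r * (norm (f \<xi> - h \<xi>))\<^sup>2)"
    by (rule Bochner_Integration.integrable_bound[OF b])
       (measurable, intro AE_I2, use order_trans[OF le abs_ge_self] in simp)
  have "(LINT \<xi>|lebesgue. norm \<xi> powr r * (norm (f \<xi> - h \<xi>))\<^sup>2) \<le> (LINT \<xi>|lebesgue. ?b \<xi>)"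
    by (rule integral_mono[OF i b le])
  also have "\<dots> = 2 * (LINT \<xi>|lebesgue. norm \<xi> powr r * (norm (f \<xi> - g \<xi>))\<^sup>2) + 2 * (LINT \<xi>|lebesgue. norm \<xi> powr r * (norm (g \<xi> - h \<xi>))\<^sup>2)"
    unfolding Bochner_Integration.integral_add[OF integrable_mult_right[OF fg] integrable_mult_right[OF gh]] integral_mult_right_zero ..
  finally show "(LINT \<xi>|lebesgue. norm \<xi> powr r * (norm (f \<xi> - h \<xi>))\<^sup>2)
      \<le> 2 * (LINT \<xi>|lebesgue. norm \<xi> powr r * (norm (f \<xi> - g \<xi>))\<^sup>2) + 2 * (LINT \<xi>|lebesgue. norm \<xi> powr r * (norm (g \<xi> - h \<xi>))\<^sup>2)" .
qed

text \<open>A single number bounds both the values and the radius of the support. This fits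
  truncations by one index, and it confines all approximants to one ball, where a constant
  dominates.\<close>

lemma schwartz_dense_bounded:
  fixes g :: "'a::euclidean_space \<Rightarrow> complex"
  assumes [measurable]: "g \<in> borel_measurable lebesgue" and r: "0 \<le> r"
    and b: "\<And>x. norm (g x) \<le> B" and supp: "\<And>x. B \<le> norm x \<Longrightarrow> g x = 0" and \<epsilon>: "0 < \<epsilon>"
  obtains \<phi> where "\<phi> \<in> schwartz" "integrable lebesgue (\<lambda>\<xi>. norm \<xi> powr r * (norm (g \<xi> - \<phi> \<xi>))\<^sup>2)"
    "(LINT \<xi>|lebesgue. norm \<xi> powr r * (norm (g \<xi> - \<phi> \<xi>))\<^sup>2) < \<epsilon>"
proof -
  have B0: "0 \<le> B" using order_trans[OF norm_ge_zero b] .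
  have m: "(\<lambda>x. Re (g x)) \<in> borel_measurable lebesgue" "(\<lambda>x. Im (g x)) \<in> borel_measurable lebesgue" by measurable
  have br: "\<bar>Re (g x)\<bar> \<le> B" "\<bar>Im (g x)\<bar> \<le> B" for x
    using abs_Re_le_cmod[of "g x"] abs_Im_le_cmod[of "g x"] b[of x] by linarith+
  obtain \<phi> :: "nat \<Rightarrow> 'a \<Rightarrow> real" where \<phi>: "\<And>n. \<phi> n \<in> schwartz" "\<And>n x. \<bar>\<phi> n x\<bar> \<le> (B + 1) * indicator (ball 0 B) x"
    "AE x in lebesgue. (\<lambda>n. \<phi> n x) \<longlonglongrightarrow> indicator (ball 0 B) x * Re (g x)"
    using schwartz_approx_bounded[OF m(1) br(1)] by blast
  obtain \<psi> :: "nat \<Rightarrow> 'a \<Rightarrow> real" where \<psi>: "\<And>n. \<psi> n \<in> schwartz" "\<And>n x. \<bar>\<psi> n x\<bar> \<le> (B + 1) * indicator (ball 0 B) x"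
    "AE x in lebesgue. (\<lambda>n. \<psi> n x) \<longlonglongrightarrow> indicator (ball 0 B) x * Im (g x)"
    using schwartz_approx_bounded[OF m(2) br(2)] by blast
  define \<zeta> where "\<zeta> n x = complex_of_real (\<phi> n x) + \<i> * complex_of_real (\<psi> n x)" for n x
  have \<zeta>: "\<zeta> n \<in> schwartz" for n
    unfolding \<zeta>_def by (intro schwartz_add schwartz_cmult schwartz_of_real \<phi>(1) \<psi>(1))
  have [measurable]: "\<zeta> n \<in> borel_measurable lebesgue" for n
    using schwartz_measurable[OF \<zeta>] by (simp add: measurable_completion)
  have g_ind: "complex_of_real (indicator (ball 0 B) x * Re (g x)) + \<i> * complex_of_real (indicator (ball 0 B) x * Im (g x)) = g x" for x
    using supp[of x] by (cases "norm x < B") (simp_all add: complex_eq_iff)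
  let ?F = "\<lambda>n \<xi>. norm \<xi> powr r * (norm (g \<xi> - \<zeta> n \<xi>))\<^sup>2"
  \<comment> \<open>\<open>B\<close> bounds \<open>g\<close>, and \<open>B + 1\<close> bounds each
    of the real and imaginary approximants; their sum is at most \<open>4 * B + 2\<close>.\<close>
  let ?w = "\<lambda>\<xi>::'a. B powr r * (4 * B + 2)\<^sup>2 * indicator (ball 0 B) \<xi>"
  have wi: "integrable lebesgue ?w"
    using lmeasurable_ball[of "0::'a" B]
    by (intro integrable_mult_right integrable_real_indicator) (auto simp: fmeasurable_def)
  have bound: "norm (?F n \<xi>) \<le> ?w \<xi>" for n \<xi>
  proof (cases "norm \<xi> < B")
    case True
    have "norm (\<zeta> n \<xi>) \<le> \<bar>\<phi> n \<xi>\<bar> + \<bar>\<psi> n \<xi>\<bar>"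
      unfolding \<zeta>_def by (rule norm_triangle_le) (simp add: norm_mult)
    then have "norm (g \<xi> - \<zeta> n \<xi>) \<le> 4 * B + 2"
      using norm_triangle_ineq4[of "g \<xi>" "\<zeta> n \<xi>"] b[of \<xi>] \<phi>(2)[of n \<xi>] \<psi>(2)[of n \<xi>] True B0 by simp
    then have "norm \<xi> powr r * (norm (g \<xi> - \<zeta> n \<xi>))\<^sup>2 \<le> B powr r * (4 * B + 2)\<^sup>2"
      using True r by (intro mult_mono powr_mono2 power_mono) auto
    with True show ?thesis by simp
  next
    case False
    then have "\<zeta> n \<xi> = 0" using \<phi>(2)[of n \<xi>] \<psi>(2)[of n \<xi>] by (simp add: \<zeta>_def)
    with False supp[of \<xi>] show ?thesis by simp
  qed
  have "(\<lambda>n. LINT \<xi>|lebesgue. ?F n \<xi>) \<longlonglongrightarrow> (LINT \<xi>|(lebesgue :: 'a measure). 0)"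
  proof (rule integral_dominated_convergence[OF _ _ wi])
    show "AE \<xi> in lebesgue. (\<lambda>n. ?F n \<xi>) \<longlonglongrightarrow> 0"
      using \<phi>(3) \<psi>(3)
    proof eventually_elim
      case (elim \<xi>)
      have "(\<lambda>n. \<zeta> n \<xi>) \<longlonglongrightarrow> complex_of_real (indicator (ball 0 B) \<xi> * Re (g \<xi>)) + \<i> * complex_of_real (indicator (ball 0 B) \<xi> * Im (g \<xi>))"
        unfolding \<zeta>_def by (intro tendsto_intros elim)
      then have "(\<lambda>n. \<zeta> n \<xi>) \<longlonglongrightarrow> g \<xi>" unfolding g_ind .
      then have "(\<lambda>n. ?F n \<xi>) \<longlonglongrightarrow> norm \<xi> powr r * (norm (g \<xi> - g \<xi>))\<^sup>2"
        by (intro tendsto_intros)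
      then show ?case by simp
    qed
    show "AE \<xi> in lebesgue. norm (?F n \<xi>) \<le> ?w \<xi>" for n using bound by (intro AE_I2)
  qed measurable
  then have "(\<lambda>n. LINT \<xi>|lebesgue. ?F n \<xi>) \<longlonglongrightarrow> 0" by simp
  from order_tendstoD(2)[OF this \<epsilon>] obtain n where "(LINT \<xi>|lebesgue. ?F n \<xi>) < \<epsilon>"
    by (auto simp: eventually_sequentially)
  moreover have "integrable lebesgue (?F n)"
    by (rule Bochner_Integration.integrable_bound[OF wi])
       (measurable, intro AE_I2, unfold real_norm_def[of "?w _"], rule order_trans[OF bound abs_ge_self])
  ultimately show ?thesis using that[OF \<zeta>] by blast
qed

text \<open>Truncation in size and radius at once reduces to the bounded case; its error is
  dominated by the given density.\<close>

lemma schwartz_dense_weighted: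
  fixes g :: "'a::euclidean_space \<Rightarrow> complex"
  assumes gm [measurable]: "g \<in> borel_measurable lebesgue" and r: "0 \<le> r"
    and gi: "integrable lebesgue (\<lambda>\<xi>. norm \<xi> powr r * (norm (g \<xi>))\<^sup>2)" and \<epsilon>: "0 < \<epsilon>"
  obtains \<phi> where "\<phi> \<in> schwartz" "integrable lebesgue (\<lambda>\<xi>. norm \<xi> powr r * (norm (g \<xi> - \<phi> \<xi>))\<^sup>2)"
    "(LINT \<xi>|lebesgue. norm \<xi> powr r * (norm (g \<xi> - \<phi> \<xi>))\<^sup>2) < \<epsilon>"
proof -
  define h where "h n \<xi> = (if norm (g \<xi>) \<le> real n \<and> norm \<xi> < real n then g \<xi> else 0)" for n \<xi>
  have [measurable]: "h n \<in> borel_measurable lebesgue" for n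
    unfolding h_def by measurable
  let ?F = "\<lambda>n \<xi>. norm \<xi> powr r * (norm (g \<xi> - h n \<xi>))\<^sup>2"
  have bound: "norm (?F n \<xi>) \<le> norm \<xi> powr r * (norm (g \<xi>))\<^sup>2" for n \<xi>
    by (simp add: h_def)
  have "(\<lambda>n. LINT \<xi>|lebesgue. ?F n \<xi>) \<longlonglongrightarrow> (LINT \<xi>|(lebesgue :: 'a measure). 0)"
  proof (rule integral_dominated_convergence[OF _ _ gi])
    show "AE \<xi> in lebesgue. (\<lambda>n. ?F n \<xi>) \<longlonglongrightarrow> 0"
    proof (intro AE_I2)
      fix \<xi> :: 'a
      obtain N :: nat where N: "max (norm (g \<xi>)) (norm \<xi>) < real N" using reals_Archimedean2 by blast
      have "\<forall>\<^sub>F n in sequentially. ?F n \<xi> = 0"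
        unfolding eventually_sequentially
      proof (intro exI[of _ N] allI impI)
        fix n assume "N \<le> n"
        then have "norm (g \<xi>) \<le> real n" "norm \<xi> < real n" using N by simp_all
        then show "?F n \<xi> = 0" by (simp add: h_def)
      qed
      then show "(\<lambda>n. ?F n \<xi>) \<longlonglongrightarrow> 0" by (rule tendsto_eventually)
    qed
    show "AE \<xi> in lebesgue. norm (?F n \<xi>) \<le> norm \<xi> powr r * (norm (g \<xi>))\<^sup>2" for n using bound by (intro AE_I2)
  qed measurable
  then have "(\<lambda>n. LINT \<xi>|lebesgue. ?F n \<xi>) \<longlonglongrightarrow> 0" by simp
  \<comment> \<open>A quarter for each of the two errors, because the squared triangle inequality
    doubles both.\<close>
  from order_tendstoD(2)[OF this, of "\<epsilon> / 4"] \<epsilon> obtain n where n: "(LINT \<xi>|lebesgue. ?F n \<xi>) < \<epsilon> / 4"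
    by (auto simp: eventually_sequentially)
  have Fi: "integrable lebesgue (?F n)"
    by (rule Bochner_Integration.integrable_bound[OF gi])
       (measurable, intro AE_I2, unfold real_norm_def[of "_ * (norm (g _))\<^sup>2"], rule order_trans[OF bound abs_ge_self])
  have hb: "norm (h n x) \<le> real n" and hs: "real n \<le> norm x \<Longrightarrow> h n x = 0" for x by (auto simp: h_def)
  obtain \<phi> where \<phi>: "\<phi> \<in> schwartz" "integrable lebesgue (\<lambda>\<xi>. norm \<xi> powr r * (norm (h n \<xi> - \<phi> \<xi>))\<^sup>2)"
    "(LINT \<xi>|lebesgue. norm \<xi> powr r * (norm (h n \<xi> - \<phi> \<xi>))\<^sup>2) < \<epsilon> / 4"
    by (rule schwartz_dense_bounded[of "h n" r "real n" "\<epsilon> / 4"]) (use r hb hs \<epsilon> in auto)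
  have [measurable]: "\<phi> \<in> borel_measurable lebesgue"
    using schwartz_measurable[OF \<phi>(1)] by (simp add: measurable_completion)
  have hm: "h n \<in> borel_measurable lebesgue" "\<phi> \<in> borel_measurable lebesgue" by measurable
  note w = weighted_square_diff[OF gm hm Fi \<phi>(2)]
  have "(LINT \<xi>|lebesgue. norm \<xi> powr r * (norm (g \<xi> - \<phi> \<xi>))\<^sup>2) < \<epsilon>"
    using w(2) n \<phi>(3) by linarith
  then show ?thesis using that \<phi>(1) w(1) by blast
qed

text \<open>Components indexed by \<open>Z\<close> are approximated by 0 exactly. With
  \<open>Z\<close> the index sets of the wrong cardinality, the approximant has the right degree at
  every point and not only almost everywhere.\<close>

lemma schwartz_dense_weighted_vec:
  fixes g :: "'a::euclidean_space \<Rightarrow> complex ^ 'i::finite"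
  assumes [measurable]: "g \<in> borel_measurable lebesgue" and r: "0 \<le> r"
    and gi: "integrable lebesgue (\<lambda>\<xi>. norm \<xi> powr r * (norm (g \<xi>))\<^sup>2)" and \<epsilon>: "0 < \<epsilon>"
    and Z: "\<And>i. i \<in> Z \<Longrightarrow> AE \<xi> in lebesgue. g \<xi> $ i = 0"
  obtains \<phi> where "\<phi> \<in> schwartz" "\<And>i \<xi>. i \<in> Z \<Longrightarrow> \<phi> \<xi> $ i = 0"
    "integrable lebesgue (\<lambda>\<xi>. norm \<xi> powr r * (norm (g \<xi> - \<phi> \<xi>))\<^sup>2)"
    "(LINT \<xi>|lebesgue. norm \<xi> powr r * (norm (g \<xi> - \<phi> \<xi>))\<^sup>2) < \<epsilon>"
proof -
  let ?\<delta> = "\<epsilon> / real CARD('i)"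
  have \<delta>: "0 < ?\<delta>" using \<epsilon> by simp
  have gm: "(\<lambda>x. g x $ i) \<in> borel_measurable lebesgue" for i by (rule measurable_component) measurable
  let ?ok = "\<lambda>i \<phi>. \<phi> \<in> schwartz \<and> (i \<in> Z \<longrightarrow> (\<forall>\<xi>. \<phi> \<xi> = 0)) \<and>
     integrable lebesgue (\<lambda>\<xi>. norm \<xi> powr r * (norm (g \<xi> $ i - \<phi> \<xi>))\<^sup>2) \<and>
     (LINT \<xi>|lebesgue. norm \<xi> powr r * (norm (g \<xi> $ i - \<phi> \<xi>))\<^sup>2) < ?\<delta>"
  have "\<exists>\<phi>. ?ok i \<phi>" for i
  proof (cases "i \<in> Z")
    case True
    have ae: "AE \<xi> in lebesgue. norm \<xi> powr r * (norm (g \<xi> $ i - 0))\<^sup>2 = 0"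
      using Z[OF True] by eventually_elim simp
    have [measurable]: "(\<lambda>x. g x $ i) \<in> borel_measurable lebesgue" by (rule gm)
    have "integrable lebesgue (\<lambda>\<xi>. norm \<xi> powr r * (norm (g \<xi> $ i - 0))\<^sup>2)"
      by (rule integrable_cong_AE_imp[of _ "\<lambda>_. 0"]) (use ae in \<open>auto elim: eventually_mono\<close>)
    moreover have "(LINT \<xi>|lebesgue. norm \<xi> powr r * (norm (g \<xi> $ i - 0))\<^sup>2) = 0"
      by (rule integral_eq_zero_AE[OF ae])
    ultimately show ?thesis using \<delta> by (intro exI[of _ "\<lambda>_. 0"]) simp
  next
    case False
    have "integrable lebesgue (\<lambda>\<xi>. norm \<xi> powr r * (norm (g \<xi> $ i))\<^sup>2)"
    proof (rule Bochner_Integration.integrable_bound[OF gi])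
      have [measurable]: "(\<lambda>x. g x $ i) \<in> borel_measurable lebesgue" by (rule gm)
      show "(\<lambda>\<xi>. norm \<xi> powr r * (norm (g \<xi> $ i))\<^sup>2) \<in> borel_measurable lebesgue" by measurable
      show "AE \<xi> in lebesgue. norm (norm \<xi> powr r * (norm (g \<xi> $ i))\<^sup>2) \<le> norm (norm \<xi> powr r * (norm (g \<xi>))\<^sup>2)"
        by (intro AE_I2) (auto intro!: mult_left_mono power_mono Finite_Cartesian_Product.norm_nth_le)
    qed
    from schwartz_dense_weighted[OF gm r this \<delta>] obtain \<phi> where "\<phi> \<in> schwartz"
      "integrable lebesgue (\<lambda>\<xi>. norm \<xi> powr r * (norm (g \<xi> $ i - \<phi> \<xi>))\<^sup>2)"
      "(LINT \<xi>|lebesgue. norm \<xi> powr r * (norm (g \<xi> $ i - \<phi> \<xi>))\<^sup>2) < ?\<delta>" by blast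
    with False show ?thesis by blast
  qed
  then have "\<forall>i. \<exists>\<phi>. ?ok i \<phi>" by blast
  from choice[OF this] obtain \<Phi> where \<Phi>: "\<And>i. ?ok i (\<Phi> i)" by blast
  let ?\<phi> = "\<lambda>\<xi>. \<chi> i. \<Phi> i \<xi>"
  have nsq: "norm \<xi> powr r * (norm (g \<xi> - ?\<phi> \<xi>))\<^sup>2 = (\<Sum>i\<in>UNIV. norm \<xi> powr r * (norm (g \<xi> $ i - \<Phi> i \<xi>))\<^sup>2)" for \<xi>
    by (simp add: norm_vec_def L2_set_def sum_nonneg sum_distrib_left)
  show ?thesis
  proof
    show "?\<phi> \<in> schwartz" by (rule schwartz_vec) (use \<Phi> in \<open>simp add: eta_contract_eq\<close>)
    show "?\<phi> \<xi> $ i = 0" if "i \<in> Z" for i \<xi> using \<Phi>[of i] that by simp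
    show "integrable lebesgue (\<lambda>\<xi>. norm \<xi> powr r * (norm (g \<xi> - ?\<phi> \<xi>))\<^sup>2)"
      unfolding nsq using \<Phi> by (intro Bochner_Integration.integrable_sum) blast
    have "(LINT \<xi>|lebesgue. norm \<xi> powr r * (norm (g \<xi> - ?\<phi> \<xi>))\<^sup>2) = (\<Sum>i\<in>UNIV. LINT \<xi>|lebesgue. norm \<xi> powr r * (norm (g \<xi> $ i - \<Phi> i \<xi>))\<^sup>2)"
      unfolding nsq using \<Phi> by (intro Bochner_Integration.integral_sum) blast
    also have "\<dots> < (\<Sum>i\<in>(UNIV::'i set). ?\<delta>)"
      using \<Phi> by (intro sum_strict_mono) auto
    also have "\<dots> = \<epsilon>" by simp
    finally show "(LINT \<xi>|lebesgue. norm \<xi> powr r * (norm (g \<xi> - ?\<phi> \<xi>))\<^sup>2) < \<epsilon>" .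
  qed
qed

text \<open>The components of the distribution at the other index sets are zero, and testing against
  Schwartz functions transfers this to the representing function.\<close>

lemma represented_by_ext_deg:
  fixes u :: "('a::euclidean_space \<Rightarrow> complex) \<Rightarrow> complex ^ ('k::finite set)"
  assumes u: "u \<in> tempered (ext_deg p)" and g: "represented_by (fourier_dist u) g" and I: "int (card I) \<noteq> p"
  shows "AE \<xi> in lebesgue. g \<xi> $ I = 0"
proof (rule AE_zero_if_schwartz_integrals_zero)
  show "(\<lambda>\<xi>. g \<xi> $ I) \<in> borel_measurable lebesgue"
    using g by (intro measurable_component) (simp add: represented_by_def)
  fix \<phi> :: "'a \<Rightarrow> complex" assume \<phi>: "\<phi> \<in> schwartz"
  have i: "integrable lebesgue (\<lambda>x. \<phi> x *s g x)" using g \<phi> by (auto simp: represented_by_def)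
  from integrable_component[OF i, of I] show "integrable lebesgue (\<lambda>x. \<phi> x * g x $ I)" by simp
  have "(LINT x|lebesgue. \<phi> x * g x $ I) = fun_dist g \<phi> $ I"
    using \<phi> i by (simp add: fun_dist_def integral_component)
  also have "\<dots> = u (fourier \<phi>) $ I"
  proof -
    have "fun_dist g \<phi> = fourier_dist u \<phi>" using g by (simp add: represented_by_def)
    then show ?thesis using \<phi> by (simp add: fourier_dist_def)
  qed
  also have "\<dots> = 0"
    using u fourier_schwartz[OF \<phi>] I by (auto simp: tempered_def ext_deg_def)
  finally show "(LINT x|lebesgue. \<phi> x * g x $ I) = 0" .
qed

section \<open>Sobolev norms and distances through representing functions\<close>

lemma hdot_represented: "u \<in> hdot s V \<Longrightarrow> represented_by (fourier_dist u) (fourier_fun u)"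
  unfolding fourier_fun_def hdot_def by (auto intro: someI[of "represented_by (fourier_dist u)"])

lemma hdot_finite:
  fixes u :: "('a::euclidean_space \<Rightarrow> complex) \<Rightarrow> complex ^ 'i::finite"
  assumes u: "u \<in> hdot s V" and g: "represented_by (fourier_dist u) g"
  shows "(\<integral>\<^sup>+ \<xi>. ennreal (norm \<xi> powr (2 * s) * (norm (g \<xi>))\<^sup>2) \<partial>lebesgue) < \<infinity>"
    and "integrable lebesgue (\<lambda>\<xi>. norm \<xi> powr (2 * s) * (norm (g \<xi>))\<^sup>2)"
proof -
  obtain h where h: "represented_by (fourier_dist u) h"
    "(\<integral>\<^sup>+ \<xi>. ennreal (norm \<xi> powr (2 * s) * (norm (h \<xi>))\<^sup>2) \<partial>lebesgue) < \<infinity>"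
    using u by (auto simp: hdot_def)
  have "(\<integral>\<^sup>+ \<xi>. ennreal (norm \<xi> powr (2 * s) * (norm (g \<xi>))\<^sup>2) \<partial>lebesgue) = (\<integral>\<^sup>+ \<xi>. ennreal (norm \<xi> powr (2 * s) * (norm (h \<xi>))\<^sup>2) \<partial>lebesgue)"
    using represented_by_AE_unique[OF g h(1)] by (intro nn_integral_cong_AE) (auto elim: eventually_mono)
  then show fin: "(\<integral>\<^sup>+ \<xi>. ennreal (norm \<xi> powr (2 * s) * (norm (g \<xi>))\<^sup>2) \<partial>lebesgue) < \<infinity>"
    using h(2) by simp
  have [measurable]: "g \<in> borel_measurable lebesgue" using g by (simp add: represented_by_def)
  show "integrable lebesgue (\<lambda>\<xi>. norm \<xi> powr (2 * s) * (norm (g \<xi>))\<^sup>2)"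
    using fin by (intro integrableI_nonneg) auto
qed

text \<open>\<open>fourier_fun\<close> is a choice; as representatives agree almost everywhere, the
  distance can be computed from any of them.\<close>

lemma hdot_dist_eq:
  fixes u v :: "('a::euclidean_space \<Rightarrow> complex) \<Rightarrow> complex ^ 'i::finite"
  assumes u: "represented_by (fourier_dist u) g" and v: "represented_by (fourier_dist v) h"
  shows "hdot_dist s u v = sqrt (LINT \<xi>|lebesgue. norm \<xi> powr (2 * s) * (norm (g \<xi> - h \<xi>))\<^sup>2)"
proof -
  have u': "represented_by (fourier_dist u) (fourier_fun u)"
    unfolding fourier_fun_def by (rule someI[where P = "represented_by (fourier_dist u)", OF u])
  have v': "represented_by (fourier_dist v) (fourier_fun v)"
    unfolding fourier_fun_def by (rule someI[where P = "represented_by (fourier_dist v)", OF v])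
  have [measurable]: "g \<in> borel_measurable lebesgue" "h \<in> borel_measurable lebesgue"
      "fourier_fun u \<in> borel_measurable lebesgue" "fourier_fun v \<in> borel_measurable lebesgue"
    using u v u' v' by (simp_all add: represented_by_def)
  have "(LINT \<xi>|lebesgue. norm \<xi> powr (2 * s) * (norm (fourier_fun u \<xi> - fourier_fun v \<xi>))\<^sup>2)
      = (LINT \<xi>|lebesgue. norm \<xi> powr (2 * s) * (norm (g \<xi> - h \<xi>))\<^sup>2)"
    using represented_by_AE_unique[OF u u'] represented_by_AE_unique[OF v v']
    by (intro integral_cong_AE) (measurable, auto)
  then show ?thesis by (simp add: hdot_dist_def)
qed

lemma hdot_diff_integrable:
  fixes u v :: "('a::euclidean_space \<Rightarrow> complex) \<Rightarrow> complex ^ 'i::finite"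
  assumes "u \<in> hdot s V" "represented_by (fourier_dist u) g" "v \<in> hdot s V" "represented_by (fourier_dist v) h"
  shows "integrable lebesgue (\<lambda>\<xi>. norm \<xi> powr (2 * s) * (norm (g \<xi> - h \<xi>))\<^sup>2)"
proof (rule weighted_square_diff(1)[of g "\<lambda>_. 0" h])
  show "g \<in> borel_measurable lebesgue" "h \<in> borel_measurable lebesgue"
    using assms by (simp_all add: represented_by_def)
qed (use assms hdot_finite(2) in simp_all)

text \<open>Approximate the Fourier function in the weighted space and pull the approximant back by
  the inverse transform, which acts on components and so preserves the degree.\<close>

lemma hdot_schwartz_dense:
  fixes u :: "('a::euclidean_space \<Rightarrow> complex) \<Rightarrow> complex ^ ('k::finite set)"
  assumes u: "u \<in> hdot s (ext_deg p)" and s: "0 \<le> s" and \<delta>: "0 < \<delta>"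
  obtains f where "f \<in> schwartz" "\<And>y. f y \<in> ext_deg p" "hdot_dist s (fun_dist f) u < \<delta>"
proof -
  let ?g = "fourier_fun u"
  have g: "represented_by (fourier_dist u) ?g" by (rule hdot_represented[OF u])
  have gm: "?g \<in> borel_measurable lebesgue" using g by (simp add: represented_by_def)
  have ut: "u \<in> tempered (ext_deg p)" using u by (simp add: hdot_def)
  have s2: "0 \<le> 2 * s" and d2: "0 < \<delta>\<^sup>2" using s \<delta> by simp_all
  define Z where "Z = {I :: 'k set. int (card I) \<noteq> p}"
  have Z: "AE \<xi> in lebesgue. ?g \<xi> $ I = 0" if "I \<in> Z" for I
    using that by (intro represented_by_ext_deg[OF ut g]) (simp add: Z_def)
  have "\<exists>\<phi>. \<phi> \<in> schwartz \<and> (\<forall>I\<in>Z. \<forall>\<xi>. \<phi> \<xi> $ I = 0) \<and>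
      (LINT \<xi>|lebesgue. norm \<xi> powr (2 * s) * (norm (?g \<xi> - \<phi> \<xi>))\<^sup>2) < \<delta>\<^sup>2"
    by (rule schwartz_dense_weighted_vec[OF gm s2 hdot_finite(2)[OF u g] d2 Z], assumption,
        intro exI conjI ballI allI, assumption, blast, assumption)
  then obtain \<phi> where \<phi>: "\<phi> \<in> schwartz" "\<And>I \<xi>. I \<in> Z \<Longrightarrow> \<phi> \<xi> $ I = 0"
    "(LINT \<xi>|lebesgue. norm \<xi> powr (2 * s) * (norm (?g \<xi> - \<phi> \<xi>))\<^sup>2) < \<delta>\<^sup>2"
    by blast
  let ?f = "\<lambda>x. vfourier \<phi> (- x)"
  have "\<phi> y \<in> ext_deg p" for y using \<phi>(2)[of _ y] by (auto simp: ext_deg_def Z_def)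
  then have "?f y \<in> ext_deg p" for y by (rule vfourier_ext_deg)
  moreover note f = vfourier_surj_schwartz[OF \<phi>(1)]
  moreover have "hdot_dist s (fun_dist ?f) u < \<delta>"
  proof -
    have "hdot_dist s (fun_dist ?f) u = sqrt (LINT \<xi>|lebesgue. norm \<xi> powr (2 * s) * (norm (\<phi> \<xi> - ?g \<xi>))\<^sup>2)"
      using hdot_dist_eq[OF represented_by_vfourier[OF f(1)] g] unfolding f(2) .
    also have "\<dots> < sqrt (\<delta>\<^sup>2)"
      using \<phi>(3) by (subst norm_minus_commute) (rule real_sqrt_less_mono)
    finally show ?thesis using \<delta> by simp
  qed
  ultimately show ?thesis using that by blast
qed

text \<open>The defining SOME in \<open>poisson\<close> picks an unspecified extension; density pins down its values.\<close>

lemma is_poisson_extension_unique: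
  fixes P Q :: "((real ^ ('m::{finite,linorder}) \<Rightarrow> complex) \<Rightarrow> complex ^ ('m set))
      \<Rightarrow> (((real ^ ('m::{finite,linorder})) \<times> real \<Rightarrow> complex) \<Rightarrow> complex ^ ('m option set))"
  assumes P: "is_poisson_extension a p P" and Q: "is_poisson_extension a p Q" and a: "a \<le> 1"
    and u: "u \<in> hdot ((1 - a) / 2) (ext_deg p)"
    and g: "represented_by (fourier_dist (P u)) g" and h: "represented_by (fourier_dist (Q u)) h"
  shows "AE \<xi> in lebesgue. g \<xi> = h \<xi>"
proof -
  let ?s = "(1 - a) / 2" and ?s' = "(2 - a) / 2"
  let ?J = "LINT \<xi>|lebesgue. norm \<xi> powr (2 * ?s') * (norm (g \<xi> - h \<xi>))\<^sup>2"
  have s: "0 \<le> ?s" using a by simp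
  have Pu: "P u \<in> hdot ?s' (ext_deg p)" and Qu: "Q u \<in> hdot ?s' (ext_deg p)"
    using P Q u by (auto simp: is_poisson_extension_def)
  have gm: "g \<in> borel_measurable lebesgue" and hm: "h \<in> borel_measurable lebesgue"
    using g h by (simp_all add: represented_by_def)
  have Ji: "integrable lebesgue (\<lambda>\<xi>. norm \<xi> powr (2 * ?s') * (norm (g \<xi> - h \<xi>))\<^sup>2)"
    by (rule hdot_diff_integrable[OF Pu g Qu h])
  have J: "?J \<le> 4 * \<epsilon>\<^sup>2" if \<epsilon>: "0 < \<epsilon>" for \<epsilon>
  proof -
    obtain \<delta>P where \<delta>P: "0 < \<delta>P" "\<And>v. v \<in> hdot ?s (ext_deg p) \<Longrightarrow> hdot_dist ?s v u < \<delta>P \<Longrightarrow> hdot_dist ?s' (P v) (P u) < \<epsilon>"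
      using P u \<epsilon> unfolding is_poisson_extension_def by blast
    obtain \<delta>Q where \<delta>Q: "0 < \<delta>Q" "\<And>v. v \<in> hdot ?s (ext_deg p) \<Longrightarrow> hdot_dist ?s v u < \<delta>Q \<Longrightarrow> hdot_dist ?s' (Q v) (Q u) < \<epsilon>"
      using Q u \<epsilon> unfolding is_poisson_extension_def by blast
    obtain f where f: "f \<in> schwartz" "\<And>y. f y \<in> ext_deg p" "hdot_dist ?s (fun_dist f) u < min \<delta>P \<delta>Q"
      using hdot_schwartz_dense[OF u s, of "min \<delta>P \<delta>Q"] \<delta>P(1) \<delta>Q(1) by (metis min_less_iff_conj)
    let ?v = "fun_dist f"
    have v: "?v \<in> hdot ?s (ext_deg p)" by (rule fun_dist_hdot[OF f(1,2) s])
    \<comment> \<open>\<open>represented_by\<close> determines the distribution itself, so both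
      extensions take equal values on Schwartz forms.\<close>
    have PQ: "P ?v = Q ?v"
      using P Q f(1,2) by (auto simp: is_poisson_extension_def represented_by_def)
    have Pv: "P ?v \<in> hdot ?s' (ext_deg p)" using P v by (auto simp: is_poisson_extension_def)
    define k where "k = fourier_fun (P ?v)"
    have k: "represented_by (fourier_dist (P ?v)) k" unfolding k_def by (rule hdot_represented[OF Pv])
    have km: "k \<in> borel_measurable lebesgue" using k by (simp add: represented_by_def)
    have "sqrt (LINT \<xi>|lebesgue. norm \<xi> powr (2 * ?s') * (norm (k \<xi> - g \<xi>))\<^sup>2) < \<epsilon>"
      using \<delta>P(2)[OF v] f(3) hdot_dist_eq[OF k g, of ?s'] by simp
    then have A: "(LINT \<xi>|lebesgue. norm \<xi> powr (2 * ?s') * (norm (g \<xi> - k \<xi>))\<^sup>2) \<le> \<epsilon>\<^sup>2"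
      using \<epsilon> by (subst norm_minus_commute) (simp add: sqrt_le_D less_imp_le)
    have "sqrt (LINT \<xi>|lebesgue. norm \<xi> powr (2 * ?s') * (norm (k \<xi> - h \<xi>))\<^sup>2) < \<epsilon>"
      using \<delta>Q(2)[OF v] f(3) hdot_dist_eq[OF k[unfolded PQ] h, of ?s'] by simp
    then have B: "(LINT \<xi>|lebesgue. norm \<xi> powr (2 * ?s') * (norm (k \<xi> - h \<xi>))\<^sup>2) \<le> \<epsilon>\<^sup>2"
      using \<epsilon> by (simp add: sqrt_le_D less_imp_le)
    have "?J \<le> 2 * (LINT \<xi>|lebesgue. norm \<xi> powr (2 * ?s') * (norm (g \<xi> - k \<xi>))\<^sup>2) + 2 * (LINT \<xi>|lebesgue. norm \<xi> powr (2 * ?s') * (norm (k \<xi> - h \<xi>))\<^sup>2)"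
      by (rule weighted_square_diff(2)[OF gm km hm hdot_diff_integrable[OF Pu g Pv k] hdot_diff_integrable[OF Pv k Qu h]])
    then show ?thesis using A B by linarith
  qed
  have "?J \<le> 0"
  proof (rule field_le_epsilon)
    fix e :: real assume e: "0 < e"
    show "?J \<le> 0 + e" using J[of "sqrt (e / 4)"] e by simp
  qed
  moreover have "0 \<le> ?J" by (intro integral_nonneg_AE AE_I2) simp
  ultimately have "?J = 0" by (rule antisym)
  then have "AE \<xi> in lebesgue. norm \<xi> powr (2 * ?s') * (norm (g \<xi> - h \<xi>))\<^sup>2 = 0"
    by (subst (asm) integral_nonneg_eq_0_iff_AE[OF Ji]) auto
  \<comment> \<open>The weight vanishes only at the origin, which is a null set.\<close>
  moreover have "AE \<xi> in lebesgue. \<xi> \<noteq> (0 :: (real ^ 'm::{finite,linorder}) \<times> real)"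
    by (intro AE_completion AE_lborel_singleton)
  ultimately show ?thesis by eventually_elim simp
qed

section \<open>The Poisson integral of a Schwartz form\<close>

text \<open>A convolution formula in which the second function is given as the inverse transform of
  \<open>G\<close>. It is the multiplication formula for the reflected \<open>G\<close> and the
  reflected translate of \<open>k\<close>, whose transform is that of \<open>k\<close> up to a
  phase.\<close>

lemma fourier_convolution_scalar:
  fixes k :: "'a::euclidean_space \<Rightarrow> real" and G :: "'a \<Rightarrow> complex"
  assumes k: "integrable lborel k" and G: "integrable lborel G"
  shows "(LINT y|lborel. of_real (k (x - y)) * fourier G (- y)) =
    of_real ((2 * pi) powr (- real DIM('a) / 2)) *
      (LINT \<xi>|lborel. (cis (x \<bullet> \<xi>) * (LINT z|lborel. cis (- (z \<bullet> \<xi>)) * of_real (k z))) * G \<xi>)"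
proof -
  have km [measurable]: "k \<in> borel_measurable borel" and Gm [measurable]: "G \<in> borel_measurable borel"
    using k G borel_measurable_integrable by auto
  let ?k = "\<lambda>y. complex_of_real (k (x - y))"
  have "integrable lborel (\<lambda>y. complex_of_real (k (x + (-1) *\<^sub>R y)))"
    by (subst lborel_integral_affine(1)[of "\<lambda>y. complex_of_real (k y)"]) (simp_all add: integrable_of_real k)
  then have ki: "integrable lborel ?k" by simp
  have "integrable lborel (\<lambda>y. G (0 + (-1) *\<^sub>R y))"
    by (subst lborel_integral_affine(1)[of G]) (simp_all add: G)
  then have Gi: "integrable lborel (\<lambda>y. G (- y))" by simp
  have [measurable]: "fourier ?k \<in> borel_measurable borel"
    unfolding fourier_eq[of ?k, simplified] by measurable
  have K: "fourier ?k (- \<xi>) = of_real ((2 * pi) powr (- real DIM('a) / 2)) * (cis (x \<bullet> \<xi>) * (LINT z|lborel. cis (- (z \<bullet> \<xi>)) * of_real (k z)))" for \<xi>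
  proof -
    have "(LINT y|lborel. cis (- (y \<bullet> - \<xi>)) * ?k y)
        = (LINT y|lborel. cis ((x - (x + (-1) *\<^sub>R y)) \<bullet> \<xi>) * complex_of_real (k (x + (-1) *\<^sub>R y)))"
      by simp
    also have "\<dots> = (LINT z|lborel. cis ((x - z) \<bullet> \<xi>) * complex_of_real (k z))"
      by (rule lborel_integral_affine(2)[of "\<lambda>z. cis ((x - z) \<bullet> \<xi>) * complex_of_real (k z)"]) simp_all
    also have "\<dots> = (LINT z|lborel. cis (x \<bullet> \<xi>) * (cis (- (z \<bullet> \<xi>)) * complex_of_real (k z)))"
      by (intro Bochner_Integration.integral_cong refl) (simp add: inner_diff_left cis_mult flip: mult.assoc)
    also have "\<dots> = cis (x \<bullet> \<xi>) * (LINT z|lborel. cis (- (z \<bullet> \<xi>)) * of_real (k z))"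
      by (rule integral_mult_right_zero)
    finally show ?thesis by (subst fourier_eq) simp_all
  qed
  have "(LINT y|lborel. ?k y * fourier G (- y)) = (LINT y|lborel. ?k y * fourier (\<lambda>x. G (- x)) y)"
    by (simp add: fourier_reflect)
  also have "\<dots> = (LINT \<xi>|lborel. fourier ?k \<xi> * G (- \<xi>))"
    by (rule fourier_multiplication[OF ki Gi, symmetric])
  also have "\<dots> = (LINT \<xi>|lborel. fourier ?k (0 + (-1) *\<^sub>R \<xi>) * G (- (0 + (-1) *\<^sub>R \<xi>)))"
    by (rule lborel_integral_affine(2)[symmetric, of "\<lambda>\<xi>. fourier ?k \<xi> * G (- \<xi>)"]) simp_all
  also have "\<dots> = (LINT \<xi>|lborel. of_real ((2 * pi) powr (- real DIM('a) / 2)) * ((cis (x \<bullet> \<xi>) * (LINT z|lborel. cis (- (z \<bullet> \<xi>)) * of_real (k z))) * G \<xi>))"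
    by (simp add: K mult.assoc)
  also have "\<dots> = of_real ((2 * pi) powr (- real DIM('a) / 2)) *
      (LINT \<xi>|lborel. (cis (x \<bullet> \<xi>) * (LINT z|lborel. cis (- (z \<bullet> \<xi>)) * of_real (k z))) * G \<xi>)"
    by (rule integral_mult_right_zero)
  finally show ?thesis .
qed

lemma fourier_measurable:
  fixes G :: "'a::euclidean_space \<Rightarrow> complex"
  assumes [measurable]: "G \<in> borel_measurable borel"
  shows "fourier G \<in> borel_measurable borel"
  unfolding fourier_eq[OF assms] by measurable

lemma integrable_bounded_scale_vec:
  fixes F :: "'a::euclidean_space \<Rightarrow> complex ^ 'i::finite"
  assumes F: "integrable lborel F" and [measurable]: "h \<in> borel_measurable borel" and h: "\<And>\<xi>. norm (h \<xi>) \<le> C"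
  shows "integrable lborel (\<lambda>\<xi>. h \<xi> *s F \<xi>)"
proof (rule Bochner_Integration.integrable_bound[OF integrable_mult_right[OF integrable_norm[OF F], of C]])
  have [measurable]: "F \<in> borel_measurable borel" using borel_measurable_integrable[OF F] by simp
  show "(\<lambda>\<xi>. h \<xi> *s F \<xi>) \<in> borel_measurable lborel" by measurable
  have "norm (h \<xi>) * norm (F \<xi>) \<le> \<bar>C * norm (F \<xi>)\<bar>" for \<xi>
    using mult_right_mono[OF h[of \<xi>] norm_ge_zero[of "F \<xi>"]] abs_ge_self order_trans by blast
  then show "AE \<xi> in lborel. norm (h \<xi> *s F \<xi>) \<le> norm (C * norm (F \<xi>))"
    by (intro AE_I2) (simp add: norm_vector_scalar_mult_complex)
qed

text \<open>The constant map \<open>L\<close> is the form-valued coefficient of one scalar kernel,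
  so every coordinate term of the Poisson kernel can be transformed by itself.\<close>

lemma fourier_convolution_linear:
  fixes k :: "'a::euclidean_space \<Rightarrow> real" and F :: "'a \<Rightarrow> complex ^ 'i::finite" and L :: "complex ^ 'i \<Rightarrow> complex ^ 'j::finite" and x :: 'a
  assumes k: "integrable lborel k" and F: "integrable lborel F"
    and L: "bounded_linear L" and Ls: "\<And>c w. L (c *s w) = c *s L w"
  defines "h \<equiv> \<lambda>\<xi>. cis (x \<bullet> \<xi>) * (LINT z|lborel. cis (- (z \<bullet> \<xi>)) * of_real (k z))"
  shows "integrable lborel (\<lambda>y. k (x - y) *\<^sub>R L (vfourier F (- y)))"
    and "integrable lborel (\<lambda>\<xi>. h \<xi> *s L (F \<xi>))"
    and "(LINT y|lborel. k (x - y) *\<^sub>R L (vfourier F (- y))) =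
      of_real ((2 * pi) powr (- real DIM('a) / 2)) *s (LINT \<xi>|lborel. h \<xi> *s L (F \<xi>))"
proof -
  have km [measurable]: "k \<in> borel_measurable borel" using borel_measurable_integrable[OF k] by simp
  note Fi = integrable_component[OF F]
  have Fm [measurable]: "(\<lambda>x. F x $ i) \<in> borel_measurable borel" for i
    using borel_measurable_integrable[OF Fi] by simp
  have [measurable]: "fourier (\<lambda>x. F x $ i) \<in> borel_measurable borel" for i
    by (rule fourier_measurable) measurable
  have "integrable lborel (\<lambda>y. k (x + (-1) *\<^sub>R y))"
    by (subst lborel_integral_affine(1)[of k]) (simp_all add: k)
  then have ki: "integrable lborel (\<lambda>y. k (x - y))" by simp
  have ci: "integrable lborel (\<lambda>y. of_real (k (x - y)) * fourier (\<lambda>x. F x $ i) (- y))" for i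
  proof (rule Bochner_Integration.integrable_bound[OF integrable_mult_left[OF ki]])
    let ?C = "(2 * pi) powr (- real DIM('a) / 2) * (LINT x|lborel. norm (F x $ i))"
    have "0 \<le> ?C" by simp
    then show "AE y in lborel. norm (complex_of_real (k (x - y)) * fourier (\<lambda>x. F x $ i) (- y)) \<le> norm (k (x - y) * ?C)"
      using norm_fourier_le[OF Fi, of i] by (intro AE_I2) (simp only: norm_mult norm_of_real real_norm_def abs_mult abs_of_nonneg, intro mult_left_mono, auto)
  qed measurable
  have v: "integrable lborel (\<lambda>y. k (x - y) *\<^sub>R vfourier F (- y))"
    by (rule integrable_vec) (use ci in \<open>simp add: vfourier_def scaleR_conv_of_real[where 'a = complex]\<close>)
  have Lr: "L (r *\<^sub>R w) = r *\<^sub>R L w" for r w by (rule linear_cmul[OF bounded_linear.linear[OF L]])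
  show "integrable lborel (\<lambda>y. k (x - y) *\<^sub>R L (vfourier F (- y)))"
    using integrable_bounded_linear[OF L v] by (simp only: Lr)
  have hm [measurable]: "h \<in> borel_measurable borel" unfolding h_def by measurable
  have hb: "norm (h \<xi>) \<le> (LINT z|lborel. \<bar>k z\<bar>)" for \<xi>
    unfolding h_def norm_mult norm_cis mult_1_left by (rule norm_integral_le) (auto simp: norm_mult k)
  have hF: "integrable lborel (\<lambda>\<xi>. h \<xi> *s F \<xi>)"
    by (rule integrable_bounded_scale_vec[OF F hm hb])
  show "integrable lborel (\<lambda>\<xi>. h \<xi> *s L (F \<xi>))"
    using integrable_bounded_linear[OF L hF] by (simp only: Ls)
  have eq: "(LINT y|lborel. k (x - y) *\<^sub>R vfourier F (- y)) = of_real ((2 * pi) powr (- real DIM('a) / 2)) *s (LINT \<xi>|lborel. h \<xi> *s F \<xi>)"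
  proof (subst vec_eq_iff, rule allI)
    fix i
    have "(LINT y|lborel. k (x - y) *\<^sub>R vfourier F (- y)) $ i = (LINT y|lborel. of_real (k (x - y)) * fourier (\<lambda>x. F x $ i) (- y))"
      by (subst integral_component[OF v]) (simp add: vfourier_def scaleR_conv_of_real[where 'a = complex])
    also have "\<dots> = of_real ((2 * pi) powr (- real DIM('a) / 2)) * (LINT \<xi>|lborel. h \<xi> * F \<xi> $ i)"
      unfolding h_def by (rule fourier_convolution_scalar[OF k Fi])
    also have "\<dots> = (of_real ((2 * pi) powr (- real DIM('a) / 2)) *s (LINT \<xi>|lborel. h \<xi> *s F \<xi>)) $ i"
      by (simp add: integral_component[OF hF])
    finally show "(LINT y|lborel. k (x - y) *\<^sub>R vfourier F (- y)) $ i = (of_real ((2 * pi) powr (- real DIM('a) / 2)) *s (LINT \<xi>|lborel. h \<xi> *s F \<xi>)) $ i" .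
  qed
  have "(LINT y|lborel. k (x - y) *\<^sub>R L (vfourier F (- y))) = L (LINT y|lborel. k (x - y) *\<^sub>R vfourier F (- y))"
    using integral_bounded_linear[OF L v] by (simp only: Lr)
  also have "\<dots> = of_real ((2 * pi) powr (- real DIM('a) / 2)) *s L (LINT \<xi>|lborel. h \<xi> *s F \<xi>)"
    unfolding eq Ls ..
  also have "L (LINT \<xi>|lborel. h \<xi> *s F \<xi>) = (LINT \<xi>|lborel. h \<xi> *s L (F \<xi>))"
    using integral_bounded_linear[OF L hF] by (simp only: Ls)
  finally show "(LINT y|lborel. k (x - y) *\<^sub>R L (vfourier F (- y))) =
      of_real ((2 * pi) powr (- real DIM('a) / 2)) *s (LINT \<xi>|lborel. h \<xi> *s L (F \<xi>))" .
qed

lemma integral_vector_scalar_mult: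
  fixes f :: "'a \<Rightarrow> complex ^ 'i::finite"
  shows "integrable M f \<Longrightarrow> (\<integral>x. c *s f x \<partial>M) = c *s (\<integral>x. f x \<partial>M)"
  by (rule integral_bounded_linear) (intro linear_conv_bounded_linear[THEN iffD1] linearI, auto simp: vec_eq_iff distrib_left)

text \<open>The Fourier transform in \<open>x'\<close> of the Poisson integral at height \<open>x\<^sub>n = s\<close>.\<close>

definition poisson_profile ::
    "real \<Rightarrow> int \<Rightarrow> real \<Rightarrow> real ^ ('m::{finite,linorder}) \<Rightarrow> complex ^ ('m set) \<Rightarrow> complex ^ ('m option set)" where
  "poisson_profile a p s \<xi> w =
    (let N = real CARD('m) + 1 - 2 * real_of_int p - a; \<nu> = (1 - a) / 2; r = \<bar>s\<bar> * norm \<xi> in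
     of_real (1 / (Gamma \<nu> * N)) *s
      ((N * bessel \<nu> 1 r) *\<^sub>R ext_incl w + (s\<^sup>2 * bessel (\<nu> - 1) 1 r) *\<^sub>R ext_incl (ext_mult \<xi> (int_mult \<xi> w))
        + (2 * \<i> * of_real (s * bessel \<nu> 1 r)) *s ext_mult e_last (ext_incl (int_mult \<xi> w))))"

text \<open>Expanded in coordinates, the numerator splits the Poisson kernel into scalar kernels of
  degree 0, 1 and 2 times constant linear maps. After transforming each one, the diagonal second
  moments sum to \<open>p\<close> times the form by \<open>sum_ext_int_axis\<close>, and the
  remaining products of coordinates rebuild the operators in \<open>\<xi>\<close>.\<close>

lemma poisson_integral_fourier:
  fixes F :: "real ^ ('m::{finite,linorder}) \<Rightarrow> complex ^ ('m set)" and a :: real and p :: int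
  assumes F: "integrable lborel F" and deg: "\<And>\<xi>. F \<xi> \<in> ext_deg p"
    and a: "a < 1" and N: "real CARD('m) + 1 - 2 * real_of_int p - a \<noteq> 0" and s: "s \<noteq> 0"
  shows "poisson_integral a p (\<lambda>y. vfourier F (- y)) (x, s) =
    of_real ((2 * pi) powr (- real CARD('m) / 2)) *s (LINT \<xi>|lborel. cis (x \<bullet> \<xi>) *s poisson_profile a p s \<xi> (F \<xi>))"
proof -
  let ?d = "real CARD('m)"
  let ?N = "?d + 1 - 2 * real_of_int p - a"
  define \<nu> where "\<nu> = (1 - a) / 2"
  \<comment> \<open>With this \<open>b\<close> the exponent of the Poisson kernel is
    \<open>b + 1\<close>, and subtracting half the dimension from \<open>b\<close> leaves the order
    \<open>\<nu>\<close>.\<close>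
  define b where "b = ?d / 2 + \<nu>"
  define \<sigma> where "\<sigma> = \<bar>s\<bar>"
  let ?w = "\<lambda>z::(real, 'm) vec. (norm z)\<^sup>2 + \<sigma>\<^sup>2"
  have \<sigma>: "0 < \<sigma>" and \<sigma>s: "\<sigma>\<^sup>2 = s\<^sup>2" using s by (auto simp: \<sigma>_def)
  have \<nu>: "0 < \<nu>" using a by (simp add: \<nu>_def)
  have b: "DIM((real, 'm) vec) / 2 < b" and b0: "0 < b" and bd: "b - DIM((real, 'm) vec) / 2 = \<nu>" using \<nu> by (simp_all add: b_def add_nonneg_pos)
  have bwp: "?w z * ?w z powr - (b + 1) = ?w z powr - b" for z
    using kernel_pos[OF \<sigma>, of z] by (simp add: powr_mult_base)
  let ?e = "\<lambda>j. axis j 1 :: (real, 'm) vec"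
  \<comment> \<open>The power of the height stays inside the kernels because it is the one that
    \<open>bessel_scale\<close> asks for. In \<open>k0\<close> the squared length in the numerator
    has already lowered the exponent from \<open>b + 1\<close> to \<open>b\<close>.\<close>
  define k0 where "k0 = (\<lambda>z::(real, 'm) vec. \<sigma> powr (2 * \<nu>) * ?w z powr - b)"
  define kq where "kq = (\<lambda>j l (z::(real, 'm) vec). \<sigma> powr (2 * \<nu>) * ((z $ j * z $ l) * ?w z powr - (b + 1)))"
  define kl where "kl = (\<lambda>l (z::(real, 'm) vec). \<sigma> powr (2 * \<nu>) * (z $ l * ?w z powr - (b + 1)))"
  let ?L0 = "ext_incl :: complex ^ ('m set) \<Rightarrow> _"
  define Lq where "Lq = (\<lambda>j l (v :: complex ^ ('m set)). ext_incl (ext_mult (?e j) (int_mult (?e l) v)))"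
  define Ll where "Ll = (\<lambda>l (v :: complex ^ ('m set)). ext_mult e_last (ext_incl (int_mult (?e l) v)))"
  have L0: "bounded_linear ?L0" "\<And>c w. ?L0 (c *s w) = c *s ?L0 w"
    by (rule bounded_linear_ext_incl, rule ext_incl_vector_scalar_mult)
  have Lq: "bounded_linear (Lq j l)" "\<And>c w. Lq j l (c *s w) = c *s Lq j l w" for j l
    unfolding Lq_def
    by (intro bounded_linear_compose[OF bounded_linear_ext_incl] bounded_linear_compose[OF ext_mult.bounded_linear_right]
         int_mult.bounded_linear_right)
       (simp add: int_mult_vector_scalar_mult ext_mult_vector_scalar_mult ext_incl_vector_scalar_mult)
  have Ll: "bounded_linear (Ll l)" "\<And>c w. Ll l (c *s w) = c *s Ll l w" for l
    unfolding Ll_def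
    by (intro bounded_linear_compose[OF ext_mult.bounded_linear_right] bounded_linear_compose[OF bounded_linear_ext_incl]
         int_mult.bounded_linear_right)
       (simp add: int_mult_vector_scalar_mult ext_mult_vector_scalar_mult ext_incl_vector_scalar_mult)
  have inner_e: "z \<bullet> ?e j = z $ j" for z :: "(real, 'm) vec" and j by (simp add: inner_axis)
  have k0i: "integrable lborel k0"
    unfolding k0_def by (intro integrable_mult_right integrable_kernel b \<sigma>)
  have kqi: "integrable lborel (kq j l)" for j l
  proof -
    have "integrable lborel (\<lambda>z::(real, 'm) vec. complex_of_real ((z \<bullet> ?e j) * (z \<bullet> ?e l)) * of_real (?w z powr - (b + 1)))"
      by (rule integrable_kernel_quadratic[OF b \<sigma> _ norm_inner_inner_le_kernel]) measurable
    then have "integrable lborel (\<lambda>z::(real, 'm) vec. complex_of_real ((z $ j * z $ l) * ?w z powr - (b + 1)))"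
      unfolding inner_e by (simp only: of_real_mult[symmetric])
    then show ?thesis unfolding kq_def by (intro integrable_mult_right) (simp only: complex_of_real_integrable_eq)
  qed
  have kli: "integrable lborel (kl l)" for l
  proof -
    have "integrable lborel (\<lambda>z::(real, 'm) vec. complex_of_real (z \<bullet> ?e l) * of_real (?w z powr - (b + 1)))"
      by (rule integrable_kernel_quadratic[OF b \<sigma> _ norm_inner_le_kernel[OF \<sigma>]]) measurable
    then have "integrable lborel (\<lambda>z::(real, 'm) vec. complex_of_real (z $ l * ?w z powr - (b + 1)))"
      unfolding inner_e by (simp only: of_real_mult[symmetric])
    then show ?thesis unfolding kl_def by (intro integrable_mult_right) (simp only: complex_of_real_integrable_eq)
  qed
  let ?f = "\<lambda>y. vfourier F (- y)"
  let ?h = "\<lambda>k \<xi>. cis (x \<bullet> \<xi>) * (LINT z|lborel. cis (- (z \<bullet> \<xi>)) * complex_of_real (k z))"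
  let ?c = "complex_of_real ((2 * pi) powr (- real CARD('m) / 2))"
  note C0 = fourier_convolution_linear[OF k0i F L0, where x = x, simplified]
    and Cq = fourier_convolution_linear[OF kqi F Lq, where x = x, simplified]
    and Cl = fourier_convolution_linear[OF kli F Ll, where x = x, simplified]
  have zq: "ext_incl (ext_mult z (int_mult z v)) = (\<Sum>j\<in>UNIV. \<Sum>l\<in>UNIV. (z $ j * z $ l) *\<^sub>R Lq j l v)" for z v
  proof -
    have a: "ext_incl (ext_mult z u) = (\<Sum>j\<in>UNIV. z $ j *\<^sub>R ext_incl (ext_mult (?e j) u))" for u
      by (subst ext_mult_expand) (simp only: ext_incl_sum ext_incl_scaleR)
    have b: "int_mult z v = (\<Sum>l\<in>UNIV. z $ l *\<^sub>R int_mult (?e l) v)"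
      by (rule int_mult_expand)
    have c: "ext_incl (ext_mult (?e j) (int_mult z v)) = (\<Sum>l\<in>UNIV. z $ l *\<^sub>R Lq j l v)" for j
      unfolding Lq_def b by (simp only: ext_mult.sum_right ext_mult.scaleR_right ext_incl_sum ext_incl_scaleR)
    show ?thesis unfolding a c by (simp only: scaleR_sum_right scaleR_scaleR)
  qed
  have zl: "ext_mult e_last (ext_incl (int_mult z v)) = (\<Sum>l\<in>UNIV. z $ l *\<^sub>R Ll l v)" for z v
  proof -
    have "int_mult z v = (\<Sum>l\<in>UNIV. z $ l *\<^sub>R int_mult (?e l) v)"
      by (rule int_mult_expand)
    then show ?thesis
      unfolding Ll_def
      by (simp only: ext_mult.sum_right ext_mult.scaleR_right ext_incl_sum ext_incl_scaleR)
  qed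
  have integrand: "(let z = coords ((x, s) - (y, 0)); w = ext_incl (?f y) in
         (\<bar>snd (x, s)\<bar> powr (1 - a) / ((norm (fst (x, s) - y))\<^sup>2 + (snd (x, s))\<^sup>2) powr ((real (CARD('m) + 1) - a + 2) / 2)) *\<^sub>R
         (int_mult z (ext_mult z w) - ext_mult z (int_mult z w)))
     = k0 (x - y) *\<^sub>R ?L0 (?f y) - 2 *\<^sub>R (\<Sum>j\<in>UNIV. \<Sum>l\<in>UNIV. kq j l (x - y) *\<^sub>R Lq j l (?f y))
        - (2 * s) *\<^sub>R (\<Sum>l\<in>UNIV. kl l (x - y) *\<^sub>R Ll l (?f y))" for y
  proof -
    let ?z = "x - y"
    have e: "(real (CARD('m) + 1) - a + 2) / 2 = b + 1" by (simp add: b_def \<nu>_def field_simps)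
    have \<kappa>: "\<bar>s\<bar> powr (1 - a) / ((norm ?z)\<^sup>2 + s\<^sup>2) powr (b + 1) = \<sigma> powr (2 * \<nu>) * ?w ?z powr - (b + 1)"
    proof -
      have e2: "1 - a = 2 * \<nu>" by (simp add: \<nu>_def)
      show ?thesis unfolding \<sigma>s[symmetric] e2 \<sigma>_def[symmetric] powr_minus_divide by simp
    qed
    have "(\<sigma> powr (2 * \<nu>) * ?w ?z powr - (b + 1)) *\<^sub>R (?w ?z *\<^sub>R ?L0 (?f y) - 2 *\<^sub>R ext_incl (ext_mult ?z (int_mult ?z (?f y)))
         - (2 * s) *\<^sub>R ext_mult e_last (ext_incl (int_mult ?z (?f y))))
      = (\<sigma> powr (2 * \<nu>) * (?w ?z * ?w ?z powr - (b + 1))) *\<^sub>R ?L0 (?f y)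
        - 2 *\<^sub>R ((\<sigma> powr (2 * \<nu>) * ?w ?z powr - (b + 1)) *\<^sub>R ext_incl (ext_mult ?z (int_mult ?z (?f y))))
        - (2 * s) *\<^sub>R ((\<sigma> powr (2 * \<nu>) * ?w ?z powr - (b + 1)) *\<^sub>R ext_mult e_last (ext_incl (int_mult ?z (?f y))))"
      by (simp add: scaleR_diff_right mult_ac)
    also have "\<dots> = k0 ?z *\<^sub>R ?L0 (?f y) - 2 *\<^sub>R (\<Sum>j\<in>UNIV. \<Sum>l\<in>UNIV. kq j l ?z *\<^sub>R Lq j l (?f y))
        - (2 * s) *\<^sub>R (\<Sum>l\<in>UNIV. kl l ?z *\<^sub>R Ll l (?f y))"
      unfolding bwp zq zl k0_def kq_def kl_def by (simp add: scaleR_sum_right mult_ac)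
    finally show ?thesis
      unfolding Let_def diff_Pair diff_zero fst_conv snd_conv int_ext_minus_ext_int_coords e \<kappa> unfolding \<sigma>s .
  qed
  let ?R = "\<lambda>\<xi>. ?h k0 \<xi> *s ?L0 (F \<xi>) - 2 *\<^sub>R (\<Sum>j\<in>UNIV. \<Sum>l\<in>UNIV. ?h (kq j l) \<xi> *s Lq j l (F \<xi>))
        - (2 * s) *\<^sub>R (\<Sum>l\<in>UNIV. ?h (kl l) \<xi> *s Ll l (F \<xi>))"
  let ?I = "\<lambda>y. k0 (x - y) *\<^sub>R ?L0 (?f y) - 2 *\<^sub>R (\<Sum>j\<in>UNIV. \<Sum>l\<in>UNIV. kq j l (x - y) *\<^sub>R Lq j l (?f y))
        - (2 * s) *\<^sub>R (\<Sum>l\<in>UNIV. kl l (x - y) *\<^sub>R Ll l (?f y))"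
  have Ii: "integrable lborel ?I"
    by (intro Bochner_Integration.integrable_diff integrable_scaleR_right Bochner_Integration.integrable_sum C0(1) Cq(1) Cl(1))
  have Ri: "integrable lborel ?R"
    by (intro Bochner_Integration.integrable_diff integrable_scaleR_right Bochner_Integration.integrable_sum C0(2) Cq(2) Cl(2))
  have sI: "(LINT y|lborel. ?I y) = (LINT y|lborel. k0 (x - y) *\<^sub>R ?L0 (?f y))
      - 2 *\<^sub>R (\<Sum>j\<in>UNIV. \<Sum>l\<in>UNIV. LINT y|lborel. kq j l (x - y) *\<^sub>R Lq j l (?f y))
      - (2 * s) *\<^sub>R (\<Sum>l\<in>UNIV. LINT y|lborel. kl l (x - y) *\<^sub>R Ll l (?f y))"
    using C0(1) Cq(1) Cl(1)
    by (simp only: Bochner_Integration.integral_diff Bochner_Integration.integrable_diff integrable_scaleR_right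
        Bochner_Integration.integrable_sum integral_scaleR_right Bochner_Integration.integral_sum)
  have sR: "(LINT y|lborel. ?R y) = (LINT \<xi>|lborel. ?h k0 \<xi> *s ?L0 (F \<xi>))
      - 2 *\<^sub>R (\<Sum>j\<in>UNIV. \<Sum>l\<in>UNIV. LINT \<xi>|lborel. ?h (kq j l) \<xi> *s Lq j l (F \<xi>))
      - (2 * s) *\<^sub>R (\<Sum>l\<in>UNIV. LINT \<xi>|lborel. ?h (kl l) \<xi> *s Ll l (F \<xi>))"
    using C0(2) Cq(2) Cl(2)
    by (simp only: Bochner_Integration.integral_diff Bochner_Integration.integrable_diff integrable_scaleR_right
        Bochner_Integration.integrable_sum integral_scaleR_right Bochner_Integration.integral_sum)
  have csub: "?c *s A - 2 *\<^sub>R (\<Sum>j\<in>UNIV. \<Sum>l\<in>UNIV. ?c *s B j l) - (2 * s) *\<^sub>R (\<Sum>l\<in>UNIV. ?c *s C l)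
     = ?c *s (A - 2 *\<^sub>R (\<Sum>j\<in>UNIV. \<Sum>l\<in>UNIV. B j l) - (2 * s) *\<^sub>R (\<Sum>l\<in>UNIV. C l))"
    for A :: "complex ^ 'm option set" and B :: "'m \<Rightarrow> 'm \<Rightarrow> complex ^ 'm option set" and C :: "'m \<Rightarrow> complex ^ 'm option set"
    by (simp add: vec_eq_iff sum_distrib_left right_diff_distrib)
  have IR: "(LINT y|lborel. ?I y) = ?c *s (LINT \<xi>|lborel. ?R \<xi>)"
    unfolding sI sR C0(3) Cq(3) Cl(3) minus_divide_left by (rule csub)
  have PR: "poisson_integral a p ?f (x, s) = poisson_const (CARD('m) + 1) a p *\<^sub>R (?c *s (LINT \<xi>|lborel. ?R \<xi>))"
  proof -
    have "(LINT y|lebesgue. ?I y) = (LINT y|lborel. ?I y)"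
      using borel_measurable_integrable[OF Ii] by (intro integral_completion) simp
    then show ?thesis
      unfolding poisson_integral_def Let_def integrand[unfolded Let_def] IR[symmetric] by (simp only:)
  qed
  let ?A = "\<lambda>\<xi>. bessel \<nu> 1 (\<sigma> * norm \<xi>)" and ?B = "\<lambda>\<xi>. bessel (\<nu> - 1) 1 (\<sigma> * norm \<xi>)"
  let ?P = "pi powr (?d / 2)"
  have pc: "poisson_const (CARD('m) + 1) a p = 2 * Gamma (b + 1) / (?P * Gamma \<nu> * ?N)"
  proof -
    have e: "(real (CARD('m) + 1) - a + 2) / 2 = b + 1" "(real (CARD('m) + 1) - 1) / 2 = ?d / 2"
      "real (CARD('m) + 1) - 2 * real_of_int p - a = ?N" by (simp_all add: b_def \<nu>_def field_simps)
    show ?thesis unfolding poisson_const_def e \<nu>_def ..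
  qed
  have pt: "poisson_const (CARD('m) + 1) a p *\<^sub>R ?R \<xi> = cis (x \<bullet> \<xi>) *s poisson_profile a p s \<xi> (F \<xi>)" if \<xi>: "\<xi> \<noteq> 0" for \<xi>
  proof -
    \<comment> \<open>The power of \<open>\<sigma>\<close> matches the order \<open>\<nu>\<close>;
      for the order \<open>\<nu> - 1\<close> it exceeds the scaling power by
      \<open>\<sigma>\<^sup>2\<close>, which becomes the factor \<open>s\<^sup>2\<close> of the
      profile.\<close>
    have sc: "\<sigma> powr (2 * \<nu>) * bessel (\<nu> - 1) \<sigma> (norm \<xi>) = \<sigma>\<^sup>2 * ?B \<xi>"
    proof -
      have "\<sigma> powr (2 * \<nu>) = \<sigma>\<^sup>2 * \<sigma> powr (2 * (\<nu> - 1))"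
        using \<sigma> by (simp add: powr_add[symmetric] algebra_simps flip: powr_numeral)
      then show ?thesis using bessel_scale[OF \<sigma>, of "\<nu> - 1" "norm \<xi>"] by simp
    qed
    note sc0 = bessel_scale[OF \<sigma>, of \<nu> "norm \<xi>"]
    have K0: "(LINT z|lborel. cis (- (z \<bullet> \<xi>)) * complex_of_real (k0 z)) = of_real (?P / Gamma b * ?A \<xi>)"
    proof -
      have "(LINT z|lborel. cis (- (z \<bullet> \<xi>)) * complex_of_real (k0 z)) = of_real (\<sigma> powr (2 * \<nu>)) * (LINT z|lborel. cis (- (z \<bullet> \<xi>)) * of_real (?w z powr - b))"
        unfolding integral_mult_right_zero[symmetric] k0_def by (simp add: mult_ac)
      also have "\<dots> = of_real (\<sigma> powr (2 * \<nu>) * (?P / Gamma b * bessel \<nu> \<sigma> (norm \<xi>)))"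
        unfolding fourier_kernel_0[OF b \<sigma>] bd by simp
      also have "\<sigma> powr (2 * \<nu>) * (?P / Gamma b * bessel \<nu> \<sigma> (norm \<xi>)) = ?P / Gamma b * ?A \<xi>"
        unfolding sc0[symmetric] by simp
      finally show ?thesis .
    qed
    have Kl: "(LINT z|lborel. cis (- (z \<bullet> \<xi>)) * complex_of_real (kl l z)) = - \<i> * of_real (?P / Gamma (b + 1) * (\<xi> $ l / 2) * ?A \<xi>)" for l
    proof -
      have "(LINT z|lborel. cis (- (z \<bullet> \<xi>)) * complex_of_real (kl l z)) = of_real (\<sigma> powr (2 * \<nu>)) *
          (LINT z|lborel. cis (- (z \<bullet> \<xi>)) * (of_real (z \<bullet> ?e l) * of_real (?w z powr - (b + 1))))"
        unfolding integral_mult_right_zero[symmetric] kl_def inner_e by (simp add: mult_ac)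
      also have "\<dots> = - \<i> * of_real (\<sigma> powr (2 * \<nu>) * (?P / Gamma (b + 1) * ((\<xi> \<bullet> ?e l) / 2) * bessel \<nu> \<sigma> (norm \<xi>)))"
        unfolding fourier_kernel_1[OF b \<sigma>] bd by simp
      also have "\<sigma> powr (2 * \<nu>) * (?P / Gamma (b + 1) * ((\<xi> \<bullet> ?e l) / 2) * bessel \<nu> \<sigma> (norm \<xi>)) = ?P / Gamma (b + 1) * (\<xi> $ l / 2) * ?A \<xi>"
        unfolding sc0[symmetric] inner_e by simp
      finally show ?thesis .
    qed
    have Kq: "(LINT z|lborel. cis (- (z \<bullet> \<xi>)) * complex_of_real (kq j l z)) =
        of_real (?P / Gamma (b + 1) * ((if j = l then 1 else 0) / 2 * ?A \<xi> - \<xi> $ j * \<xi> $ l / 4 * (\<sigma>\<^sup>2 * ?B \<xi>)))" for j l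
    proof -
      have "(LINT z|lborel. cis (- (z \<bullet> \<xi>)) * complex_of_real (kq j l z)) = of_real (\<sigma> powr (2 * \<nu>)) *
          (LINT z|lborel. cis (- (z \<bullet> \<xi>)) * (of_real ((z \<bullet> ?e j) * (z \<bullet> ?e l)) * of_real (?w z powr - (b + 1))))"
        unfolding integral_mult_right_zero[symmetric] kq_def inner_e by (simp add: mult_ac)
      also have "\<dots> = of_real (\<sigma> powr (2 * \<nu>) * (?P / Gamma (b + 1) *
          ((?e j \<bullet> ?e l) / 2 * bessel \<nu> \<sigma> (norm \<xi>) - (\<xi> \<bullet> ?e j) * (\<xi> \<bullet> ?e l) / 4 * bessel (\<nu> - 1) \<sigma> (norm \<xi>))))"
        unfolding fourier_kernel_2[OF b \<sigma> \<xi>] bd by (simp del: of_real_diff)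
      also have "\<sigma> powr (2 * \<nu>) * (?P / Gamma (b + 1) *
          ((?e j \<bullet> ?e l) / 2 * bessel \<nu> \<sigma> (norm \<xi>) - (\<xi> \<bullet> ?e j) * (\<xi> \<bullet> ?e l) / 4 * bessel (\<nu> - 1) \<sigma> (norm \<xi>)))
         = ?P / Gamma (b + 1) * ((if j = l then 1 else 0) / 2 * ?A \<xi> - \<xi> $ j * \<xi> $ l / 4 * (\<sigma>\<^sup>2 * ?B \<xi>))"
        unfolding sc0[symmetric] sc[symmetric] inner_e by (simp add: axis_def algebra_simps)
      finally show ?thesis .
    qed
    let ?v = "F \<xi>"
    let ?V0 = "ext_incl ?v" and ?V1 = "ext_incl (ext_mult \<xi> (int_mult \<xi> ?v))" and ?V2 = "ext_mult e_last (ext_incl (int_mult \<xi> ?v))"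
    have "b \<notin> \<int>\<^sub>\<le>\<^sub>0" using b0 by (auto elim!: nonpos_Ints_cases)
    then have Gb: "Gamma (b + 1) = b * Gamma b" "0 < Gamma b" using b0 by (simp_all add: Gamma_plus1 Gamma_real_pos)
    have diag: "(\<Sum>j\<in>UNIV. Lq j j ?v) = real_of_int p *\<^sub>R ?V0"
      unfolding Lq_def ext_incl_sum[symmetric] sum_ext_int_axis[OF deg] by (rule ext_incl_scaleR)
    have q: "(\<Sum>j\<in>UNIV. \<Sum>l\<in>UNIV. of_real (?P / Gamma (b + 1) * ((if j = l then 1 else 0) / 2 * A - \<xi> $ j * \<xi> $ l / 4 * B)) *s Lq j l ?v)
       = (?P / Gamma (b + 1)) *\<^sub>R ((A / 2 * real_of_int p) *\<^sub>R ?V0 - (B / 4) *\<^sub>R ?V1)" for A B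
    proof -
      have "of_real (?P / Gamma (b + 1) * ((if j = l then 1 else 0) / 2 * A - \<xi> $ j * \<xi> $ l / 4 * B)) *s Lq j l ?v
        = (?P / Gamma (b + 1)) *\<^sub>R ((A / 2) *\<^sub>R (if j = l then Lq j l ?v else 0) - (B / 4) *\<^sub>R ((\<xi> $ j * \<xi> $ l) *\<^sub>R Lq j l ?v))" for j l
        unfolding vec_scaleR_eq_scale[symmetric] by (simp add: scaleR_diff_left scaleR_diff_right mult_ac right_diff_distrib)
      then have "(\<Sum>j\<in>UNIV. \<Sum>l\<in>UNIV. of_real (?P / Gamma (b + 1) * ((if j = l then 1 else 0) / 2 * A - \<xi> $ j * \<xi> $ l / 4 * B)) *s Lq j l ?v)
        = (?P / Gamma (b + 1)) *\<^sub>R ((A / 2) *\<^sub>R (\<Sum>j\<in>UNIV. \<Sum>l\<in>UNIV. if j = l then Lq j l ?v else 0) - (B / 4) *\<^sub>R (\<Sum>j\<in>UNIV. \<Sum>l\<in>UNIV. (\<xi> $ j * \<xi> $ l) *\<^sub>R Lq j l ?v))"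
        by (simp only: scaleR_sum_right[symmetric] sum_subtractf)
      then show ?thesis unfolding zq[symmetric] by (simp add: diag)
    qed
    have l: "(\<Sum>l\<in>UNIV. (- \<i> * of_real (?P / Gamma (b + 1) * (\<xi> $ l / 2) * A)) *s Ll l ?v)
       = (- \<i> * of_real (?P / Gamma (b + 1) * (A / 2))) *s ?V2" for A
      unfolding zl by (simp add: vec_eq_iff sum_distrib_left sum_divide_distrib sum_negf scaleR_conv_of_real[where 'a = complex] mult_ac)
    have hs: "(cis (x \<bullet> \<xi>) * c) *s w = cis (x \<bullet> \<xi>) *s (c *s w)" for c and w :: "complex ^ 'm option set"
      by (simp add: vec_eq_iff)
    have R1: "?R \<xi> = cis (x \<bullet> \<xi>) *s (of_real (?P / Gamma b * ?A \<xi>) *s ?V0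
        - 2 *\<^sub>R ((?P / Gamma (b + 1)) *\<^sub>R ((?A \<xi> / 2 * real_of_int p) *\<^sub>R ?V0 - (\<sigma>\<^sup>2 * ?B \<xi> / 4) *\<^sub>R ?V1))
        - (2 * s) *\<^sub>R ((- \<i> * of_real (?P / Gamma (b + 1) * (?A \<xi> / 2))) *s ?V2))"
      unfolding K0 Kq Kl hs unfolding l[symmetric] q[symmetric]
      by (simp add: vec_eq_iff sum_distrib_left right_diff_distrib mult_ac)
    have P: "0 < ?P" by simp
    have G1: "0 < Gamma (b + 1)" using b0 by (intro Gamma_real_pos) simp
    have G\<nu>: "0 < Gamma \<nu>" using \<nu> by (rule Gamma_real_pos)
    \<comment> \<open>Here the normalising constant fits: the constant numerator contributes
      \<open>b\<close>, the trace subtracts \<open>p\<close>, and twice the difference cancels the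
      denominator.\<close>
    have Nb: "?N = 2 * b - 2 * real_of_int p" by (simp add: b_def \<nu>_def field_simps)
    have c1: "2 * Gamma (b + 1) / (?P * Gamma \<nu> * ?N) * (?P / Gamma b * A - 2 * (?P / Gamma (b + 1)) * (A / 2 * real_of_int p)) = 1 / (Gamma \<nu> * ?N) * (?N * A)" for A
    proof -
      have "2 * Gamma (b + 1) / (?P * Gamma \<nu> * ?N) * (?P / Gamma b * A - 2 * (?P / Gamma (b + 1)) * (A / 2 * real_of_int p))
         = 1 / (Gamma \<nu> * ?N) * ((2 * (Gamma (b + 1) / Gamma b) - 2 * real_of_int p) * A)"
      proof -
        have "2 * G1 / (P * Gn * M) * (P / G0 * A - 2 * (P / G1) * (A / 2 * q)) = 1 / (Gn * M) * ((2 * (G1 / G0) - 2 * q) * A)"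
          if "0 < P" "0 < G0" "0 < G1" "0 < Gn" "M \<noteq> 0" for P G0 G1 Gn M q :: real
          using that by (simp add: field_simps)
        then show ?thesis using P Gb(2) G1 G\<nu> N .
      qed
      also have "Gamma (b + 1) / Gamma b = b" using Gb by simp
      finally show ?thesis unfolding Nb .
    qed
    have c2: "2 * Gamma (b + 1) / (?P * Gamma \<nu> * ?N) * (2 * (?P / Gamma (b + 1)) * (B / 4)) = 1 / (Gamma \<nu> * ?N) * B"
      and c3: "2 * Gamma (b + 1) / (?P * Gamma \<nu> * ?N) * (?P / Gamma (b + 1) * (A / 2)) = 1 / (Gamma \<nu> * ?N) * A" for A B
      using P G\<nu> G1 N by simp_all
    have lin: "c *\<^sub>R (of_real u0 *s V0 - 2 *\<^sub>R (q *\<^sub>R (u1 *\<^sub>R V0 - u2 *\<^sub>R V1)) - (2 * s) *\<^sub>R ((- \<i> * of_real u3) *s V2))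
       = of_real (c * (u0 - 2 * q * u1)) *s V0 + of_real (c * (2 * q * u2)) *s V1 + (2 * \<i> * of_real (s * (c * u3))) *s V2"
      for c u0 u1 u2 u3 q :: real and V0 V1 V2 :: "complex ^ 'm option set"
      by (simp add: vec_eq_iff scaleR_conv_of_real[where 'a = complex] algebra_simps)
    have scs: "r *\<^sub>R (c *s w) = c *s (r *\<^sub>R w)" for r c and w :: "complex ^ 'm option set"
      by (simp add: vec_eq_iff scaleR_conv_of_real[where 'a = complex])
    have lin': "of_real g *s (u0 *\<^sub>R V0 + u1 *\<^sub>R V1 + (2 * \<i> * of_real (s * u2)) *s V2)
        = of_real (g * u0) *s V0 + of_real (g * u1) *s V1 + (2 * \<i> * of_real (s * (g * u2))) *s V2"
      for g u0 u1 u2 :: real and V0 V1 V2 :: "complex ^ 'm option set"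
      by (simp add: vec_eq_iff scaleR_conv_of_real[where 'a = complex] algebra_simps)
    have prof: "poisson_profile a p s \<xi> ?v = of_real (1 / (Gamma \<nu> * ?N) * (?N * ?A \<xi>)) *s ?V0
        + of_real (1 / (Gamma \<nu> * ?N) * (\<sigma>\<^sup>2 * ?B \<xi>)) *s ?V1 + (2 * \<i> * of_real (s * (1 / (Gamma \<nu> * ?N) * ?A \<xi>))) *s ?V2"
      unfolding poisson_profile_def Let_def \<nu>_def[symmetric] \<sigma>_def[symmetric] \<sigma>s[symmetric] by (rule lin')
    have "poisson_const (CARD('m) + 1) a p *\<^sub>R ?R \<xi> = cis (x \<bullet> \<xi>) *s (poisson_const (CARD('m) + 1) a p *\<^sub>R
       (of_real (?P / Gamma b * ?A \<xi>) *s ?V0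
        - 2 *\<^sub>R ((?P / Gamma (b + 1)) *\<^sub>R ((?A \<xi> / 2 * real_of_int p) *\<^sub>R ?V0 - (\<sigma>\<^sup>2 * ?B \<xi> / 4) *\<^sub>R ?V1))
        - (2 * s) *\<^sub>R ((- \<i> * of_real (?P / Gamma (b + 1) * (?A \<xi> / 2))) *s ?V2)))"
      unfolding R1 by (rule scs)
    then show ?thesis
      unfolding lin pc c1 c2 c3 prof .
  qed
  \<comment> \<open>The pointwise identity asks for \<open>\<xi> \<noteq> 0\<close> because of the
    Bessel integral of order \<open>\<nu> - 1\<close>; a single point does not affect the
    integral.\<close>
  have ae: "AE \<xi> in lborel. poisson_const (CARD('m) + 1) a p *\<^sub>R ?R \<xi> = cis (x \<bullet> \<xi>) *s poisson_profile a p s \<xi> (F \<xi>)"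
    using AE_lborel_singleton[of "0 :: (real, 'm) vec"] by eventually_elim (rule pt)
  have [measurable]: "bessel \<nu>' 1 \<in> borel_measurable borel" for \<nu>'
    unfolding bessel_def bessel_integrand_def by measurable
  have Fm: "F \<in> borel_measurable borel" using borel_measurable_integrable[OF F] by simp
  have lm: "(\<lambda>\<xi>. L (F \<xi>)) \<in> borel_measurable borel" if "bounded_linear L" for L :: "complex ^ 'm set \<Rightarrow> complex ^ 'm option set"
    by (rule borel_measurable_continuous_on[OF linear_continuous_on[OF that] Fm])
  have [measurable]: "(\<lambda>\<xi>. ?L0 (F \<xi>)) \<in> borel_measurable borel" "(\<lambda>\<xi>. Lq j l (F \<xi>)) \<in> borel_measurable borel"
     "(\<lambda>\<xi>. Ll l (F \<xi>)) \<in> borel_measurable borel" for j l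
    by (rule lm[OF L0(1)], rule lm[OF Lq(1)], rule lm[OF Ll(1)])
  have [measurable]: "(\<lambda>\<xi>::(real, 'm) vec. \<xi> $ j) \<in> borel_measurable borel" for j
    by (intro borel_measurable_continuous_onI continuous_intros)
  have pm: "(\<lambda>\<xi>. cis (x \<bullet> \<xi>) *s poisson_profile a p s \<xi> (F \<xi>)) \<in> borel_measurable borel"
    unfolding poisson_profile_def Let_def zq zl by measurable
  have "poisson_const (CARD('m) + 1) a p *\<^sub>R (?c *s (LINT \<xi>|lborel. ?R \<xi>)) = ?c *s (LINT \<xi>|lborel. poisson_const (CARD('m) + 1) a p *\<^sub>R ?R \<xi>)"
    unfolding integral_scaleR_right by (simp add: vec_eq_iff)
  also have "(LINT \<xi>|lborel. poisson_const (CARD('m) + 1) a p *\<^sub>R ?R \<xi>) = (LINT \<xi>|lborel. cis (x \<bullet> \<xi>) *s poisson_profile a p s \<xi> (F \<xi>))"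
  proof (rule integral_cong_AE[OF _ _ ae])
    show "(\<lambda>\<xi>. poisson_const (CARD('m) + 1) a p *\<^sub>R ?R \<xi>) \<in> borel_measurable lborel"
      by (rule borel_measurable_scaleR[OF borel_measurable_const borel_measurable_integrable[OF Ri]])
    show "(\<lambda>\<xi>. cis (x \<bullet> \<xi>) *s poisson_profile a p s \<xi> (F \<xi>)) \<in> borel_measurable lborel"
      using pm by simp
  qed
  finally show ?thesis unfolding PR .
qed

section \<open>The Poisson multiplier\<close>

text \<open>
  The right-hand side of the theorem at \<open>\<xi>'\<close>, expressed through \<open>v = f\<^sub>I + \<xi>' / |\<xi>'| \<and> f\<^bsub>II\<^esub>\<close> alone: there
  \<open>i\<^bsub>\<xi>'\<^esub> v = |\<xi>'| f\<^bsub>II\<^esub>\<close>, and \<open>\<xi>' \<and> i\<^bsub>\<xi>'\<^esub> v\<close> is \<open>|\<xi>'|\<^sup>2\<close> times the second component. This makes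
  it linear in \<open>v\<close> and measurable without choosing a decomposition.
\<close>

definition poisson_symbol ::
    "real \<Rightarrow> int \<Rightarrow> real ^ ('m::{finite,linorder}) \<Rightarrow> real \<Rightarrow> complex ^ ('m set) \<Rightarrow> complex ^ ('m option set)" where
  "poisson_symbol a p \<xi> t v =
    (let N = real CARD('m) + 1 - 2 * real_of_int p - a; \<beta> = (2 - a) / 2; w = t\<^sup>2 + (norm \<xi>)\<^sup>2 in
     (sqrt 2 * Gamma \<beta> / (N * Gamma ((1 - a) / 2)) * norm \<xi> powr (1 - a)) *\<^sub>R
      ((N * w powr - \<beta>) *\<^sub>R ext_incl v
       + ((2 * w powr - \<beta> - 4 * \<beta> * t\<^sup>2 * w powr - (\<beta> + 1)) / (norm \<xi>)\<^sup>2) *\<^sub>R ext_incl (ext_mult \<xi> (int_mult \<xi> v))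
       + (4 * \<beta> * t * w powr - (\<beta> + 1)) *\<^sub>R ext_mult e_last (ext_incl (int_mult \<xi> v))))"

lemma poisson_symbol_diff: "poisson_symbol a p \<xi> t (u - v) = poisson_symbol a p \<xi> t u - poisson_symbol a p \<xi> t v"
  unfolding poisson_symbol_def Let_def ext_incl_diff int_mult.diff_right ext_mult.diff_right scaleR_diff_right
  by (simp only: scaleR_add_right scaleR_diff_right add_diff_add)

lemma ext_deg_poisson_symbol: "v \<in> ext_deg p \<Longrightarrow> poisson_symbol a p \<xi> t v \<in> ext_deg p"
  unfolding poisson_symbol_def Let_def
  using ext_deg_ext_mult[OF ext_deg_int_mult[of v p \<xi>], of \<xi>]
    ext_deg_ext_mult[OF ext_deg_ext_incl[OF ext_deg_int_mult[of v p \<xi>]], of e_last]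
  by (intro ext_deg_scaleR ext_deg_add ext_deg_ext_incl) simp_all

lemma integrable_mult_bounded_cis:
  fixes f :: "real \<Rightarrow> complex"
  assumes f: "integrable lborel f" and [measurable]: "h \<in> borel_measurable borel"
  shows "integrable lborel (\<lambda>t. cis (h t) * f t)"
proof (rule Bochner_Integration.integrable_bound[OF f])
  have [measurable]: "f \<in> borel_measurable borel" using borel_measurable_integrable[OF f] by simp
  show "(\<lambda>t. cis (h t) * f t) \<in> borel_measurable lborel" by measurable
qed (simp add: norm_mult)

text \<open>The kernel transforms are used in dimension one, with \<open>norm \<xi>\<close> as
  parameter and \<open>s\<close> as frequency. Since \<open>\<beta>\<close> minus one half is
  \<open>\<nu>\<close>, scaling leads to the same Bessel values at
  \<open>\<bar>s\<bar> * norm \<xi>\<close> as in the profile. The factor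
  \<open>sqrt (2 * pi)\<close> is the one-dimensional Fourier normalisation.\<close>

lemma integral_poisson_symbol:
  fixes \<xi> :: "real ^ ('m::{finite,linorder})"
  assumes a: "a < 1" and s: "s \<noteq> 0" and \<xi>: "\<xi> \<noteq> 0"
  shows "(LINT t|lborel. cis (s * t) *s poisson_symbol a p \<xi> t v) = of_real (sqrt (2 * pi)) *s poisson_profile a p s \<xi> v"
proof -
  define \<nu> where "\<nu> = (1 - a) / 2"
  define \<beta> where "\<beta> = (2 - a) / 2"
  define N where "N = real CARD('m) + 1 - 2 * real_of_int p - a"
  define \<sigma> where "\<sigma> = norm \<xi>"
  define C where "C = sqrt 2 * Gamma \<beta> / (N * Gamma \<nu>)"
  have \<nu>: "0 < \<nu>" and \<beta>: "DIM(real) / 2 < \<beta>" and b0: "0 < \<beta>" and bd: "\<beta> - DIM(real) / 2 = \<nu>" and \<nu>2: "1 - a = 2 * \<nu>"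
    using a by (simp_all add: \<nu>_def \<beta>_def field_simps)
  have \<sigma>: "0 < \<sigma>" using \<xi> by (simp add: \<sigma>_def)
  let ?w = "\<lambda>t::real. t\<^sup>2 + \<sigma>\<^sup>2"
  let ?A = "bessel \<nu> 1 (\<bar>s\<bar> * \<sigma>)" and ?B = "bessel (\<nu> - 1) 1 (\<bar>s\<bar> * \<sigma>)"
  define V0 where "V0 = ext_incl v"
  define V1 where "V1 = ext_incl (ext_mult \<xi> (int_mult \<xi> v))"
  define V2 where "V2 = ext_mult e_last (ext_incl (int_mult \<xi> v))"
  define i0 where "i0 = (\<lambda>t. cis (s * t) * complex_of_real (?w t powr - \<beta>))"
  define i1 where "i1 = (\<lambda>t. cis (s * t) * (complex_of_real t * complex_of_real (?w t powr - (\<beta> + 1))))"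
  define i2 where "i2 = (\<lambda>t. cis (s * t) * (complex_of_real (t * t) * complex_of_real (?w t powr - (\<beta> + 1))))"
  have i0i: "integrable lborel i0"
    unfolding i0_def using integrable_kernel[OF \<beta> \<sigma>]
    by (intro integrable_mult_bounded_cis integrable_of_real) simp_all
  have i1i: "integrable lborel i1"
    unfolding i1_def using integrable_kernel_quadratic[OF \<beta> \<sigma> _ norm_inner_le_kernel[OF \<sigma>], of 1]
    by (intro integrable_mult_bounded_cis) simp_all
  have i2i: "integrable lborel i2"
    unfolding i2_def using integrable_kernel_quadratic[OF \<beta> \<sigma> _ norm_inner_inner_le_kernel[of _ 1 1 \<sigma>]]
    by (intro integrable_mult_bounded_cis) simp_all
  have sc0: "\<sigma> powr (2 * \<nu>) * bessel \<nu> \<sigma> \<bar>s\<bar> = ?A" using bessel_scale[OF \<sigma>, of \<nu> "\<bar>s\<bar>"] by (simp add: mult.commute)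
  have sc: "\<sigma> powr (2 * \<nu>) * bessel (\<nu> - 1) \<sigma> \<bar>s\<bar> = \<sigma>\<^sup>2 * ?B"
  proof -
    have "\<sigma> powr (2 * \<nu>) = \<sigma>\<^sup>2 * \<sigma> powr (2 * (\<nu> - 1))"
      using \<sigma> by (simp add: powr_add[symmetric] algebra_simps flip: powr_numeral)
    then show ?thesis using bessel_scale[OF \<sigma>, of "\<nu> - 1" "\<bar>s\<bar>"] by (simp add: mult.commute)
  qed
  let ?P = "pi powr (1 / 2)"
  have "\<beta> \<notin> \<int>\<^sub>\<le>\<^sub>0" using b0 by (auto elim!: nonpos_Ints_cases)
  then have G: "Gamma (\<beta> + 1) = \<beta> * Gamma \<beta>" "0 < Gamma \<beta>" using b0 by (simp_all add: Gamma_plus1 Gamma_real_pos)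
  \<comment> \<open>The exponential has the sign of the inverse transform, hence the frequency
    \<open>- s\<close>; only the linear numerator in \<open>J1\<close> notices it.\<close>
  have J0: "(LINT t|lborel. i0 t) = of_real (?P / Gamma \<beta> * bessel \<nu> \<sigma> \<bar>s\<bar>)"
    using fourier_kernel_0[OF \<beta> \<sigma>, of "- s"] unfolding bd i0_def by (simp add: mult.commute)
  have J1: "(LINT t|lborel. i1 t) = \<i> * of_real (?P / Gamma (\<beta> + 1) * (s / 2) * bessel \<nu> \<sigma> \<bar>s\<bar>)"
    using fourier_kernel_1[OF \<beta> \<sigma>, of "- s" 1] unfolding bd i1_def by (simp add: mult.commute)
  have J2: "(LINT t|lborel. i2 t) = of_real (?P / Gamma (\<beta> + 1) * (1 / 2 * bessel \<nu> \<sigma> \<bar>s\<bar> - s\<^sup>2 / 4 * bessel (\<nu> - 1) \<sigma> \<bar>s\<bar>))"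
    using fourier_kernel_2[OF \<beta> \<sigma>, of "- s" 1 1] s unfolding bd i2_def
    by (simp add: mult.commute power2_eq_square)
  let ?D = "C * \<sigma> powr (2 * \<nu>)"
  have pt: "cis (s * t) *s poisson_symbol a p \<xi> t v =
      (of_real (?D * N) * i0 t) *s V0 + (of_real (?D / \<sigma>\<^sup>2) * (2 * i0 t - of_real (4 * \<beta>) * i2 t)) *s V1
       + (of_real (?D * (4 * \<beta>)) * i1 t) *s V2" for t
  proof -
    have "poisson_symbol a p \<xi> t v = ?D *\<^sub>R ((N * ?w t powr - \<beta>) *\<^sub>R V0
       + ((2 * ?w t powr - \<beta> - 4 * \<beta> * t\<^sup>2 * ?w t powr - (\<beta> + 1)) / \<sigma>\<^sup>2) *\<^sub>R V1
       + (4 * \<beta> * t * ?w t powr - (\<beta> + 1)) *\<^sub>R V2)"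
      unfolding poisson_symbol_def Let_def \<beta>_def[symmetric] N_def[symmetric] \<sigma>_def[symmetric] V0_def[symmetric]
        V1_def[symmetric] V2_def[symmetric] \<nu>_def[symmetric] C_def[symmetric]
      unfolding \<nu>2 ..
    also have "cis (s * t) *s (d *\<^sub>R ((n * w0) *\<^sub>R W0 + ((2 * w0 - 4 * \<beta> * t\<^sup>2 * w1) / q) *\<^sub>R W1 + (4 * \<beta> * t * w1) *\<^sub>R W2))
       = (of_real (d * n) * (cis (s * t) * of_real w0)) *s W0
       + (of_real (d / q) * (2 * (cis (s * t) * of_real w0) - of_real (4 * \<beta>) * (cis (s * t) * (of_real (t * t) * of_real w1)))) *s W1
       + (of_real (d * (4 * \<beta>)) * (cis (s * t) * (of_real t * of_real w1))) *s W2"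
      for d n w0 w1 q and W0 W1 W2 :: "complex ^ 'm option set"
      by (simp add: vec_eq_iff scaleR_conv_of_real[where 'a = complex] power2_eq_square algebra_simps diff_divide_distrib)
    finally show ?thesis unfolding i0_def i1_def i2_def .
  qed
  have sint: "integrable lborel (\<lambda>t. h t *s V)" "(LINT t|lborel. h t *s V) = (LINT t|lborel. h t) *s V"
    if "integrable lborel h" for h :: "real \<Rightarrow> complex" and V :: "complex ^ 'm option set"
  proof -
    show 1: "integrable lborel (\<lambda>t. h t *s V)" by (rule integrable_vec) (use that in simp)
    show "(LINT t|lborel. h t *s V) = (LINT t|lborel. h t) *s V"
      by (subst vec_eq_iff) (simp add: integral_component[OF 1])
  qed
  note j = integrable_mult_right[OF i0i, of "of_real (?D * N)"]
    integrable_mult_right[OF Bochner_Integration.integrable_diff[OF integrable_mult_right[OF i0i, of 2] integrable_mult_right[OF i2i, of "of_real (4 * \<beta>)"]], of "of_real (?D / \<sigma>\<^sup>2)"]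
    integrable_mult_right[OF i1i, of "of_real (?D * (4 * \<beta>))"]
  have "(LINT t|lborel. cis (s * t) *s poisson_symbol a p \<xi> t v) =
      (of_real (?D * N) * (LINT t|lborel. i0 t)) *s V0
      + (of_real (?D / \<sigma>\<^sup>2) * (2 * (LINT t|lborel. i0 t) - of_real (4 * \<beta>) * (LINT t|lborel. i2 t))) *s V1
      + (of_real (?D * (4 * \<beta>)) * (LINT t|lborel. i1 t)) *s V2"
    unfolding pt Bochner_Integration.integral_add[OF Bochner_Integration.integrable_add[OF sint(1)[OF j(1)] sint(1)[OF j(2)]] sint(1)[OF j(3)]]
      Bochner_Integration.integral_add[OF sint(1)[OF j(1)] sint(1)[OF j(2)]] sint(2)[OF j(1)] sint(2)[OF j(2)] sint(2)[OF j(3)]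
      integral_mult_right_zero Bochner_Integration.integral_diff[OF integrable_mult_right[OF i0i, of 2] integrable_mult_right[OF i2i, of "of_real (4 * \<beta>)"]] ..
  also have "of_real (?D * N) * (LINT t|lborel. i0 t) = complex_of_real (sqrt (2 * pi) * (1 / (Gamma \<nu> * N) * (N * ?A)))"
  proof -
    have "?D * N * (?P / Gamma \<beta> * bessel \<nu> \<sigma> \<bar>s\<bar>) = C * ?P / Gamma \<beta> * (N * ?A)"
      unfolding sc0[symmetric] by simp
    \<comment> \<open>The factor \<open>sqrt 2 * Gamma \<beta>\<close> of \<open>C\<close> serves
      this purpose: the kernel transform supplies \<open>sqrt pi / Gamma \<beta>\<close>.\<close>
    also have "C * ?P / Gamma \<beta> = sqrt (2 * pi) * (1 / (Gamma \<nu> * N))"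
      using G by (simp add: C_def real_sqrt_mult powr_half_sqrt)
    finally show ?thesis unfolding J0 of_real_mult[symmetric] by (simp only: mult.assoc)
  qed
  also have "of_real (?D / \<sigma>\<^sup>2) * (2 * (LINT t|lborel. i0 t) - of_real (4 * \<beta>) * (LINT t|lborel. i2 t))
     = complex_of_real (sqrt (2 * pi) * (1 / (Gamma \<nu> * N) * (s\<^sup>2 * ?B)))"
  proof -
    \<comment> \<open>The terms with \<open>b1\<close>, of order \<open>\<nu>\<close>, cancel since
      \<open>Gamma (\<beta> + 1)\<close> is \<open>\<beta> * Gamma \<beta>\<close>. Only the order
      \<open>\<nu> - 1\<close> survives, as in the second term of the profile.\<close>
    have "?D / \<sigma>\<^sup>2 * (2 * (?P / Gamma \<beta> * b1) - 4 * \<beta> * (?P / Gamma (\<beta> + 1) * (1 / 2 * b1 - s\<^sup>2 / 4 * b2)))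
       = C * ?P / Gamma \<beta> * (s\<^sup>2 * (\<sigma> powr (2 * \<nu>) * b2 / \<sigma>\<^sup>2))" for b1 b2
    proof -
      have e: "4 * \<beta> * (?P / (\<beta> * Gamma \<beta>) * X) = 4 * (?P / Gamma \<beta>) * X" for X
        using b0 by simp
      show ?thesis unfolding G(1) e by (simp add: algebra_simps)
    qed
    from this[of "bessel \<nu> \<sigma> \<bar>s\<bar>" "bessel (\<nu> - 1) \<sigma> \<bar>s\<bar>"]
    have "?D / \<sigma>\<^sup>2 * (2 * (?P / Gamma \<beta> * bessel \<nu> \<sigma> \<bar>s\<bar>) - 4 * \<beta> * (?P / Gamma (\<beta> + 1) * (1 / 2 * bessel \<nu> \<sigma> \<bar>s\<bar> - s\<^sup>2 / 4 * bessel (\<nu> - 1) \<sigma> \<bar>s\<bar>)))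
       = C * ?P / Gamma \<beta> * (s\<^sup>2 * ?B)"
      unfolding sc using \<sigma> by simp
    also have "C * ?P / Gamma \<beta> = sqrt (2 * pi) * (1 / (Gamma \<nu> * N))"
      using G by (simp add: C_def real_sqrt_mult powr_half_sqrt)
    finally have *: "?D / \<sigma>\<^sup>2 * (2 * (?P / Gamma \<beta> * bessel \<nu> \<sigma> \<bar>s\<bar>) - 4 * \<beta> * (?P / Gamma (\<beta> + 1) * (1 / 2 * bessel \<nu> \<sigma> \<bar>s\<bar> - s\<^sup>2 / 4 * bessel (\<nu> - 1) \<sigma> \<bar>s\<bar>)))
       = sqrt (2 * pi) * (1 / (Gamma \<nu> * N) * (s\<^sup>2 * ?B))" by (simp only: mult.assoc)
    show ?thesis unfolding J0 J2 unfolding *[symmetric] by (simp only: of_real_mult of_real_diff of_real_numeral)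
  qed
  also have "of_real (?D * (4 * \<beta>)) * (LINT t|lborel. i1 t) = 2 * \<i> * complex_of_real (s * (sqrt (2 * pi) * (1 / (Gamma \<nu> * N) * ?A)))"
  proof -
    have "?D * (4 * \<beta>) * (?P / Gamma (\<beta> + 1) * (s / 2) * bessel \<nu> \<sigma> \<bar>s\<bar>) = 2 * (s * (C * ?P / Gamma \<beta> * ?A))"
      unfolding G(1) sc0[symmetric] using b0 G(2) by simp
    also have "C * ?P / Gamma \<beta> = sqrt (2 * pi) * (1 / (Gamma \<nu> * N))"
      using G by (simp add: C_def real_sqrt_mult powr_half_sqrt)
    finally have "?D * (4 * \<beta>) * (?P / Gamma (\<beta> + 1) * (s / 2) * bessel \<nu> \<sigma> \<bar>s\<bar>) = 2 * (s * (sqrt (2 * pi) * (1 / (Gamma \<nu> * N) * ?A)))"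
      by (simp only: mult.assoc)
    from arg_cong[OF this, of "\<lambda>r. \<i> * complex_of_real r"] show ?thesis
      unfolding J1 by (simp only: of_real_mult of_real_numeral mult_ac)
  qed
  also have "complex_of_real (q * (g * u0)) *s V0 + complex_of_real (q * (g * u1)) *s V1 + (2 * \<i> * complex_of_real (s * (q * (g * u2)))) *s V2
     = of_real q *s (of_real g *s (u0 *\<^sub>R V0 + u1 *\<^sub>R V1 + (2 * \<i> * of_real (s * u2)) *s V2))" for q g u0 u1 u2
    by (simp add: vec_eq_iff scaleR_conv_of_real[where 'a = complex] algebra_simps)
  finally show ?thesis
    unfolding poisson_profile_def Let_def \<nu>_def[symmetric] N_def[symmetric] \<sigma>_def[symmetric] V0_def[symmetric] V1_def[symmetric] V2_def[symmetric] .
qed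

text \<open>Interior and exterior multiplication by \<open>\<xi>\<close> cost a factor
  \<open>norm \<xi>\<close> each. The division by \<open>(norm \<xi>)\<^sup>2\<close> compensates
  for this in the second term; in the third, \<open>\<bar>t\<bar> * norm \<xi>\<close> is at most
  \<open>t\<^sup>2 + (norm \<xi>)\<^sup>2\<close>. So all three terms obey the same bound.\<close>

lemma poisson_symbol_bound:
  fixes a :: real and p :: int
  assumes a: "a < 1"
  obtains K where "0 \<le> K" "\<And>(\<xi> :: real ^ ('m::{finite,linorder})) t v.
    norm (poisson_symbol a p \<xi> t v) \<le> K * (norm \<xi> powr (1 - a) * (t\<^sup>2 + (norm \<xi>)\<^sup>2) powr - ((2 - a) / 2)) * norm v"
proof -
  obtain K1 where K1: "0 \<le> K1" "\<And>v :: complex ^ ('m set). norm (ext_incl v) \<le> norm v * K1"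
    using bounded_linear.nonneg_bounded[OF bounded_linear_ext_incl] by blast
  obtain K2 where K2: "0 \<le> K2" "\<And>x (w :: complex ^ ('m set)). norm (ext_mult x w) \<le> norm x * norm w * K2"
    using ext_mult.nonneg_bounded by blast
  obtain K3 where K3: "0 \<le> K3" "\<And>x (w :: complex ^ ('m set)). norm (int_mult x w) \<le> norm x * norm w * K3"
    using int_mult.nonneg_bounded by blast
  obtain K4 where K4: "0 \<le> K4" "\<And>w :: complex ^ ('m option set). norm (ext_mult e_last w) \<le> norm w * K4"
    using bounded_linear.nonneg_bounded[OF ext_mult.bounded_linear_right] by blast
  define N where "N = real CARD('m) + 1 - 2 * real_of_int p - a"
  define \<beta> where "\<beta> = (2 - a) / 2"
  define C where "C = sqrt 2 * Gamma \<beta> / (N * Gamma ((1 - a) / 2))"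
  have \<beta>: "0 < \<beta>" using a by (simp add: \<beta>_def)
  let ?K = "\<bar>C\<bar> * (\<bar>N\<bar> * K1 + (2 + 4 * \<beta>) * (K3 * K2 * K1) + 4 * \<beta> * (K3 * K1 * K4))"
  have K0: "0 \<le> ?K" using K1 K2 K3 K4 \<beta> by simp
  have "norm (poisson_symbol a p \<xi> t v) \<le> ?K * (norm \<xi> powr (1 - a) * (t\<^sup>2 + (norm \<xi>)\<^sup>2) powr - ((2 - a) / 2)) * norm v"
    for \<xi> :: "(real, 'm) vec" and t v
  proof (cases "\<xi> = 0")
    case True
    then show ?thesis by (simp add: poisson_symbol_def Let_def)
  next
    case False
    define r where "r = norm \<xi>"
    have r: "0 < r" using False by (simp add: r_def)
    let ?w = "t\<^sup>2 + r\<^sup>2"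
    have w: "0 < ?w" using r by (simp add: add_nonneg_pos)
    let ?p = "?w powr - \<beta>" and ?q = "?w powr - (\<beta> + 1)"
    have pq: "?w * ?q = ?p" using w by (simp add: powr_mult_base)
    have t2: "t\<^sup>2 * ?q \<le> ?p"
      unfolding pq[symmetric] by (rule mult_right_mono) auto
    have tr: "\<bar>t\<bar> * r * ?q \<le> ?p"
    proof -
      have "\<bar>t\<bar> * r \<le> t\<^sup>2 + r\<^sup>2"
      proof -
        have "x * y \<le> x\<^sup>2 + y\<^sup>2" if "0 \<le> x * y" for x y :: real
          using sum_squares_bound[of x y] that by simp
        from this[of "\<bar>t\<bar>" r] show ?thesis using r by simp
      qed
      then show ?thesis unfolding pq[symmetric] by (rule mult_right_mono) simp
    qed
    have n0: "norm (ext_incl v) \<le> K1 * norm v" using K1(2)[of v] by (simp add: mult.commute)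
    have n3: "norm (int_mult \<xi> v) \<le> K3 * (r * norm v)" using K3(2)[of \<xi> v] by (simp add: r_def mult_ac)
    have n1: "norm (ext_incl (ext_mult \<xi> (int_mult \<xi> v))) \<le> K3 * K2 * K1 * (r\<^sup>2 * norm v)"
    proof -
      have "norm (ext_mult \<xi> (int_mult \<xi> v)) \<le> r * norm (int_mult \<xi> v) * K2" using K2(2) by (simp add: r_def)
      also have "\<dots> \<le> r * (K3 * (r * norm v)) * K2" using r K2(1) n3 by (intro mult_left_mono mult_right_mono) auto
      finally have "norm (ext_mult \<xi> (int_mult \<xi> v)) * K1 \<le> r * (K3 * (r * norm v)) * K2 * K1" using K1(1) by (rule mult_right_mono)
      with K1(2)[of "ext_mult \<xi> (int_mult \<xi> v)"] show ?thesis by (simp add: power2_eq_square mult_ac)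
    qed
    have n2: "norm (ext_mult e_last (ext_incl (int_mult \<xi> v))) \<le> K3 * K1 * K4 * (r * norm v)"
    proof -
      have "norm (ext_incl (int_mult \<xi> v)) \<le> norm (int_mult \<xi> v) * K1" by (rule K1(2))
      also have "\<dots> \<le> K3 * (r * norm v) * K1" using K1(1) n3 by (intro mult_right_mono)
      finally have "norm (ext_incl (int_mult \<xi> v)) * K4 \<le> K3 * (r * norm v) * K1 * K4" using K4(1) by (rule mult_right_mono)
      with K4(2)[of "ext_incl (int_mult \<xi> v)"] show ?thesis by (simp add: mult_ac)
    qed
    have a0: "norm ((N * ?p) *\<^sub>R ext_incl v) \<le> \<bar>N\<bar> * K1 * (?p * norm v)"
      using mult_left_mono[OF n0, of "\<bar>N\<bar> * ?p"] by (simp add: abs_mult mult_ac)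
    have a1: "norm (((2 * ?p - 4 * \<beta> * t\<^sup>2 * ?q) / r\<^sup>2) *\<^sub>R ext_incl (ext_mult \<xi> (int_mult \<xi> v))) \<le> (2 + 4 * \<beta>) * (K3 * K2 * K1) * (?p * norm v)"
    proof -
      have tq0: "0 \<le> t\<^sup>2 * ?q" by simp
      have "\<bar>2 * ?p - 4 * \<beta> * t\<^sup>2 * ?q\<bar> \<le> 2 * ?p + 4 * \<beta> * (t\<^sup>2 * ?q)"
        using \<beta> by (intro order_trans[OF abs_triangle_ineq4]) (simp add: abs_mult)
      also have "\<dots> \<le> 2 * ?p + 4 * \<beta> * ?p" using \<beta> t2 by (intro add_left_mono mult_left_mono) auto
      finally have "\<bar>2 * ?p - 4 * \<beta> * t\<^sup>2 * ?q\<bar> \<le> (2 + 4 * \<beta>) * ?p" by (simp add: algebra_simps)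
      then have "\<bar>2 * ?p - 4 * \<beta> * t\<^sup>2 * ?q\<bar> / r\<^sup>2 * norm (ext_incl (ext_mult \<xi> (int_mult \<xi> v))) \<le> (2 + 4 * \<beta>) * ?p / r\<^sup>2 * (K3 * K2 * K1 * (r\<^sup>2 * norm v))"
        using r \<beta> n1 by (intro mult_mono divide_right_mono) auto
      then show ?thesis using r by (simp add: mult_ac)
    qed
    have a2: "norm ((4 * \<beta> * t * ?q) *\<^sub>R ext_mult e_last (ext_incl (int_mult \<xi> v))) \<le> 4 * \<beta> * (K3 * K1 * K4) * (?p * norm v)"
    proof -
      have "4 * \<beta> * \<bar>t\<bar> * ?q * norm (ext_mult e_last (ext_incl (int_mult \<xi> v))) \<le> 4 * \<beta> * \<bar>t\<bar> * ?q * (K3 * K1 * K4 * (r * norm v))"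
        using \<beta> n2 by (intro mult_left_mono) auto
      also have "\<dots> = 4 * \<beta> * (K3 * K1 * K4) * ((\<bar>t\<bar> * r * ?q) * norm v)" by simp
      also have "\<dots> \<le> 4 * \<beta> * (K3 * K1 * K4) * (?p * norm v)"
        using \<beta> K1 K3 K4 tr by (intro mult_left_mono mult_right_mono) auto
      finally show ?thesis using \<beta> by (simp add: abs_mult)
    qed
    have "norm ((N * ?p) *\<^sub>R ext_incl v + ((2 * ?p - 4 * \<beta> * t\<^sup>2 * ?q) / r\<^sup>2) *\<^sub>R ext_incl (ext_mult \<xi> (int_mult \<xi> v))
         + (4 * \<beta> * t * ?q) *\<^sub>R ext_mult e_last (ext_incl (int_mult \<xi> v)))
      \<le> (\<bar>N\<bar> * K1 + (2 + 4 * \<beta>) * (K3 * K2 * K1) + 4 * \<beta> * (K3 * K1 * K4)) * (?p * norm v)"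
      using norm_add_rule_thm[OF norm_add_rule_thm[OF a0 a1] a2] by (simp only: distrib_right)
    then have "\<bar>C * r powr (1 - a)\<bar> * norm ((N * ?p) *\<^sub>R ext_incl v + ((2 * ?p - 4 * \<beta> * t\<^sup>2 * ?q) / r\<^sup>2) *\<^sub>R ext_incl (ext_mult \<xi> (int_mult \<xi> v))
         + (4 * \<beta> * t * ?q) *\<^sub>R ext_mult e_last (ext_incl (int_mult \<xi> v)))
      \<le> \<bar>C * r powr (1 - a)\<bar> * ((\<bar>N\<bar> * K1 + (2 + 4 * \<beta>) * (K3 * K2 * K1) + 4 * \<beta> * (K3 * K1 * K4)) * (?p * norm v))"
      by (rule mult_left_mono) simp
    moreover have "norm (poisson_symbol a p \<xi> t v) = \<bar>C * r powr (1 - a)\<bar> * norm ((N * ?p) *\<^sub>R ext_incl v + ((2 * ?p - 4 * \<beta> * t\<^sup>2 * ?q) / r\<^sup>2) *\<^sub>R ext_incl (ext_mult \<xi> (int_mult \<xi> v))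
         + (4 * \<beta> * t * ?q) *\<^sub>R ext_mult e_last (ext_incl (int_mult \<xi> v)))"
      unfolding poisson_symbol_def Let_def \<beta>_def[symmetric] N_def[symmetric] C_def[symmetric] r_def[symmetric] norm_scaleR ..
    ultimately show ?thesis
      unfolding \<beta>_def[symmetric] r_def[symmetric] by (simp add: abs_mult mult_ac)
  qed
  with K0 show ?thesis using that by blast
qed

section \<open>Measurability and weighted bounds for the multiplier\<close>

lemma ext_mult_measurable [measurable]:
  assumes "f \<in> borel_measurable M" "g \<in> borel_measurable M"
  shows "(\<lambda>x. ext_mult (f x) (g x)) \<in> borel_measurable M"
  by (rule borel_measurable_continuous_Pair[OF assms]) (intro ext_mult.continuous_on continuous_intros)

lemma int_mult_measurable [measurable]:
  assumes "f \<in> borel_measurable M" "g \<in> borel_measurable M"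
  shows "(\<lambda>x. int_mult (f x) (g x)) \<in> borel_measurable M"
  by (rule borel_measurable_continuous_Pair[OF assms]) (intro int_mult.continuous_on continuous_intros)

lemma ext_incl_measurable [measurable]:
  assumes "f \<in> borel_measurable M"
  shows "(\<lambda>x. ext_incl (f x)) \<in> borel_measurable M"
  by (rule borel_measurable_continuous_on[OF linear_continuous_on[OF bounded_linear_ext_incl] assms])

definition poisson_multiplier ::
    "real \<Rightarrow> int \<Rightarrow> (real ^ ('m::{finite,linorder}) \<Rightarrow> complex ^ ('m set))
      \<Rightarrow> (real ^ ('m::{finite,linorder})) \<times> real \<Rightarrow> complex ^ ('m option set)" where
  "poisson_multiplier a p g x = poisson_symbol a p (fst x) (snd x) (g (fst x))"

lemma fst_snd_borel_measurable [measurable]: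
  "(fst :: 'a::euclidean_space \<times> 'b::euclidean_space \<Rightarrow> 'a) \<in> borel_measurable borel"
  "(snd :: 'a::euclidean_space \<times> 'b::euclidean_space \<Rightarrow> 'b) \<in> borel_measurable borel"
  by (intro borel_measurable_continuous_onI continuous_intros)+

lemma poisson_multiplier_measurable [measurable]:
  assumes [measurable]: "g \<in> borel_measurable borel"
  shows "poisson_multiplier a p g \<in> borel_measurable borel"
  unfolding poisson_multiplier_def[abs_def] poisson_symbol_def Let_def by measurable

text \<open>The first two factors, integrated over the last frequency, give a constant for every
  nonzero first component: by scaling the powers of its norm cancel.\<close>

lemma poisson_weight_integral:
  fixes a :: real
  assumes a: "a < 1"
  obtains c where "0 \<le> c" "\<And>q :: real ^ ('m::{finite,linorder}) \<Rightarrow> real. integrable lborel q \<Longrightarrow>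
      integrable lborel (\<lambda>x. norm (fst x) powr (1 - a) * ((snd x)\<^sup>2 + (norm (fst x))\<^sup>2) powr - ((2 - a) / 2) * q (fst x)) \<and>
      (LINT x|lborel. norm (fst x) powr (1 - a) * ((snd x)\<^sup>2 + (norm (fst x))\<^sup>2) powr - ((2 - a) / 2) * q (fst x)) = c * integral\<^sup>L lborel q"
proof -
  define \<nu> where "\<nu> = (1 - a) / 2"
  define \<beta> where "\<beta> = (2 - a) / 2"
  have \<nu>2: "1 - a = 2 * \<nu>" by (simp add: \<nu>_def)
  have \<beta>: "DIM(real) / 2 < \<beta>" and bd: "\<beta> - DIM(real) / 2 = \<nu>"
    using a by (simp_all add: \<nu>_def \<beta>_def field_simps)
  have \<beta>0: "0 < \<beta>" using a by (simp add: \<beta>_def)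
  \<comment> \<open>The value of the one-dimensional kernel transform at frequency 0, rescaled to
    parameter 1.\<close>
  define c where "c = pi powr (1 / 2) / Gamma \<beta> * bessel \<nu> 1 0"
  have "0 \<le> bessel \<nu> 1 0"
    unfolding bessel_def bessel_integrand_def by (intro integral_nonneg_AE AE_I2) simp
  then have c0: "0 \<le> c" using Gamma_real_pos[OF \<beta>0] by (simp add: c_def)
  have inner: "integrable lborel (\<lambda>t. norm \<xi> powr (2 * \<nu>) * (t\<^sup>2 + (norm \<xi>)\<^sup>2) powr - \<beta>)"
    "(LINT t|lborel. norm \<xi> powr (2 * \<nu>) * (t\<^sup>2 + (norm \<xi>)\<^sup>2) powr - \<beta>) = c" if \<xi>: "\<xi> \<noteq> 0" for \<xi> :: "(real, 'm) vec"
  proof -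
    have r: "0 < norm \<xi>" using \<xi> by simp
    have k: "integrable lborel (\<lambda>t::real. (t\<^sup>2 + (norm \<xi>)\<^sup>2) powr - \<beta>)" using integrable_kernel[OF \<beta> r] by simp
    show "integrable lborel (\<lambda>t. norm \<xi> powr (2 * \<nu>) * (t\<^sup>2 + (norm \<xi>)\<^sup>2) powr - \<beta>)"
      by (rule integrable_mult_right[OF k])
    have "complex_of_real (LINT t|lborel. (t\<^sup>2 + (norm \<xi>)\<^sup>2) powr - \<beta>) = (LINT t|lborel. complex_of_real ((t\<^sup>2 + (norm \<xi>)\<^sup>2) powr - \<beta>))"
      by (rule integral_of_real[OF k, symmetric])
    also have "\<dots> = of_real (pi powr (1 / 2) / Gamma \<beta> * bessel \<nu> (norm \<xi>) 0)"
      using fourier_kernel_0[OF \<beta> r, of 0] unfolding bd by simp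
    finally have "(LINT t|lborel. (t\<^sup>2 + (norm \<xi>)\<^sup>2) powr - \<beta>) = pi powr (1 / 2) / Gamma \<beta> * bessel \<nu> (norm \<xi>) 0"
      by (simp only: of_real_eq_iff)
    then show "(LINT t|lborel. norm \<xi> powr (2 * \<nu>) * (t\<^sup>2 + (norm \<xi>)\<^sup>2) powr - \<beta>) = c"
      using bessel_scale[OF r, of \<nu> 0] by (simp add: c_def)
  qed
  have "integrable lborel (\<lambda>x. norm (fst x) powr (1 - a) * ((snd x)\<^sup>2 + (norm (fst x))\<^sup>2) powr - \<beta> * q (fst x)) \<and>
      (LINT x|lborel. norm (fst x) powr (1 - a) * ((snd x)\<^sup>2 + (norm (fst x))\<^sup>2) powr - \<beta> * q (fst x)) = c * integral\<^sup>L lborel q"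
    if q: "integrable lborel q" for q :: "(real, 'm) vec \<Rightarrow> real"
  proof -
    have [measurable]: "q \<in> borel_measurable borel" using borel_measurable_integrable[OF q] by simp
    let ?f = "\<lambda>x :: (real, 'm) vec \<times> real. norm (fst x) powr (2 * \<nu>) * ((snd x)\<^sup>2 + (norm (fst x))\<^sup>2) powr - \<beta> * q (fst x)"
    have fm [measurable]: "?f \<in> borel_measurable (lborel \<Otimes>\<^sub>M lborel)"
      by measurable
    have ne: "AE \<xi> in lborel. \<xi> \<noteq> (0 :: (real, 'm) vec)" by (rule AE_lborel_singleton)
    have I: "(LINT t|lborel. norm (?f (\<xi>, t))) = c * \<bar>q \<xi>\<bar>" "integrable lborel (\<lambda>t. ?f (\<xi>, t))" "(LINT t|lborel. ?f (\<xi>, t)) = c * q \<xi>"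
      if \<xi>: "\<xi> \<noteq> 0" for \<xi>
      using inner[OF \<xi>] by (simp_all add: abs_mult)
    have fi: "integrable (lborel \<Otimes>\<^sub>M lborel) ?f"
    proof (rule lborel_pair.Fubini_integrable[OF fm])
      have ae: "AE \<xi> in lborel. c * \<bar>q \<xi>\<bar> = (LINT t|lborel. norm (?f (\<xi>, t)))"
        using ne by eventually_elim (rule I(1)[symmetric])
      show "integrable lborel (\<lambda>\<xi>. LINT t|lborel. norm (?f (\<xi>, t)))"
        by (rule integrable_cong_AE_imp[OF integrable_mult_right[OF integrable_abs[OF q], of c] _ ae]) measurable
      show "AE \<xi> in lborel. integrable lborel (\<lambda>t. ?f (\<xi>, t))"
        using ne by eventually_elim (rule I(2))
    qed
    have "integral\<^sup>L (lborel \<Otimes>\<^sub>M lborel) ?f = (LINT \<xi>|lborel. LINT t|lborel. ?f (\<xi>, t))"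
      by (rule lborel_pair.integral_fst'[OF fi, symmetric])
    also have "\<dots> = (LINT \<xi>|lborel. c * q \<xi>)"
    proof (rule integral_cong_AE)
      show "AE \<xi> in lborel. (LINT t|lborel. ?f (\<xi>, t)) = c * q \<xi>" using ne by eventually_elim (rule I(3))
    qed measurable
    finally show ?thesis using fi unfolding lborel_prod \<nu>2 by simp
  qed
  then show ?thesis using that c0 unfolding \<beta>_def by blast
qed

lemma norm_pair_powr: "norm x powr (2 * \<beta>) = ((snd x)\<^sup>2 + (norm (fst x))\<^sup>2) powr \<beta>" for x :: "'a::euclidean_space \<times> real"
proof -
  have "norm x = ((snd x)\<^sup>2 + (norm (fst x))\<^sup>2) powr (1 / 2)"
    by (cases x) (simp add: norm_Pair powr_half_sqrt add.commute)
  then show ?thesis by (simp add: powr_powr)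
qed

text \<open>Write \<open>w\<close> for the squared length of \<open>x\<close>. The squared symbol
  contains \<open>w powr - \<beta>\<close> twice, and the Sobolev weight
  \<open>norm x powr (2 - a)\<close> is \<open>w powr \<beta>\<close> and removes one copy;
  \<open>poisson_weight_integral\<close> integrates out the other. The second estimate is what makes
  the inverse transform of the multiplier a tempered distribution.\<close>

lemma poisson_multiplier_bounds:
  fixes a :: real and p :: int
  assumes a: "a < 1"
  obtains C where "0 \<le> C"
    "\<And>g :: real ^ ('m::{finite,linorder}) \<Rightarrow> complex ^ ('m set). g \<in> borel_measurable borel \<Longrightarrow>
      integrable lborel (\<lambda>\<xi>. norm \<xi> powr (1 - a) * (norm (g \<xi>))\<^sup>2) \<Longrightarrow>
      integrable lborel (\<lambda>x. norm x powr (2 - a) * (norm (poisson_multiplier a p g x))\<^sup>2) \<and>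
      (LINT x|lborel. norm x powr (2 - a) * (norm (poisson_multiplier a p g x))\<^sup>2) \<le> C * (LINT \<xi>|lborel. norm \<xi> powr (1 - a) * (norm (g \<xi>))\<^sup>2)"
    "\<And>(g :: real ^ ('m::{finite,linorder}) \<Rightarrow> complex ^ ('m set)) M. g \<in> borel_measurable borel \<Longrightarrow>
      integrable lborel (\<lambda>\<xi>. norm (g \<xi>) / (1 + norm \<xi>) ^ M) \<Longrightarrow>
      integrable lborel (\<lambda>x. norm (poisson_multiplier a p g x) / (1 + norm x) ^ M)"
proof -
  define \<beta> where "\<beta> = (2 - a) / 2"
  have \<beta>2: "2 - a = 2 * \<beta>" by (simp add: \<beta>_def)
  obtain K where K: "0 \<le> K" "\<And>(\<xi> :: (real, 'm) vec) t v.
    norm (poisson_symbol a p \<xi> t v) \<le> K * (norm \<xi> powr (1 - a) * (t\<^sup>2 + (norm \<xi>)\<^sup>2) powr - \<beta>) * norm v"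
    using poisson_symbol_bound[OF a, where p = p] unfolding \<beta>_def by blast
  obtain c where c: "0 \<le> c" "\<And>q :: (real, 'm) vec \<Rightarrow> real. integrable lborel q \<Longrightarrow>
      integrable lborel (\<lambda>x. norm (fst x) powr (1 - a) * ((snd x)\<^sup>2 + (norm (fst x))\<^sup>2) powr - \<beta> * q (fst x)) \<and>
      (LINT x|lborel. norm (fst x) powr (1 - a) * ((snd x)\<^sup>2 + (norm (fst x))\<^sup>2) powr - \<beta> * q (fst x)) = c * integral\<^sup>L lborel q"
    using poisson_weight_integral[OF a] unfolding \<beta>_def by blast
  have b: "norm (poisson_multiplier a p g x) \<le> K * (norm (fst x) powr (1 - a) * ((snd x)\<^sup>2 + (norm (fst x))\<^sup>2) powr - \<beta>) * norm (g (fst x))"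
    for g :: "(real, 'm) vec \<Rightarrow> complex ^ ('m set)" and x
    unfolding poisson_multiplier_def by (rule K(2))
  have 1: "integrable lborel (\<lambda>x. norm x powr (2 - a) * (norm (poisson_multiplier a p g x))\<^sup>2) \<and>
      (LINT x|lborel. norm x powr (2 - a) * (norm (poisson_multiplier a p g x))\<^sup>2) \<le> (K\<^sup>2 * c) * (LINT \<xi>|lborel. norm \<xi> powr (1 - a) * (norm (g \<xi>))\<^sup>2)"
    if [measurable]: "g \<in> borel_measurable borel" and gi: "integrable lborel (\<lambda>\<xi>. norm \<xi> powr (1 - a) * (norm (g \<xi>))\<^sup>2)"
    for g :: "(real, 'm) vec \<Rightarrow> complex ^ ('m set)"
  proof -
    let ?B = "\<lambda>x. norm (fst x) powr (1 - a) * ((snd x)\<^sup>2 + (norm (fst x))\<^sup>2) powr - \<beta> * (norm (fst x) powr (1 - a) * (norm (g (fst x)))\<^sup>2)"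
    note ci = c(2)[OF gi]
    have le: "norm x powr (2 - a) * (norm (poisson_multiplier a p g x))\<^sup>2 \<le> K\<^sup>2 * ?B x" for x
    proof -
      let ?w = "(snd x)\<^sup>2 + (norm (fst x))\<^sup>2"
      have "(norm (poisson_multiplier a p g x))\<^sup>2 \<le> (K * (norm (fst x) powr (1 - a) * ?w powr - \<beta>) * norm (g (fst x)))\<^sup>2"
        by (rule power_mono[OF b]) simp
      then have "norm x powr (2 - a) * (norm (poisson_multiplier a p g x))\<^sup>2 \<le> ?w powr \<beta> * (K * (norm (fst x) powr (1 - a) * ?w powr - \<beta>) * norm (g (fst x)))\<^sup>2"
        unfolding \<beta>2 norm_pair_powr by (rule mult_left_mono) simp
      also have "\<dots> = (?w powr \<beta> * ?w powr - \<beta>) * (K\<^sup>2 * ?B x)"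
        by (simp only: power_mult_distrib) (simp add: power2_eq_square mult_ac)
      \<comment> \<open>An inequality and not an equation, because the product of the two powers is
        0 at the origin.\<close>
      also have "\<dots> \<le> 1 * (K\<^sup>2 * ?B x)"
        by (intro mult_right_mono) (auto simp: powr_add[symmetric])
      finally show ?thesis by simp
    qed
    have Bi: "integrable lborel (\<lambda>x. K\<^sup>2 * ?B x)" using ci by (intro integrable_mult_right) blast
    have i: "integrable lborel (\<lambda>x. norm x powr (2 - a) * (norm (poisson_multiplier a p g x))\<^sup>2)"
      by (rule Bochner_Integration.integrable_bound[OF Bi]) (measurable, intro AE_I2, use order_trans[OF le abs_ge_self] in simp)
    have l: "(LINT x|lborel. norm x powr (2 - a) * (norm (poisson_multiplier a p g x))\<^sup>2) \<le> (LINT x|lborel. K\<^sup>2 * ?B x)"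
      by (rule integral_mono[OF i Bi le])
    have e: "(LINT x|lborel. K\<^sup>2 * ?B x) = (K\<^sup>2 * c) * (LINT \<xi>|lborel. norm \<xi> powr (1 - a) * (norm (g \<xi>))\<^sup>2)"
      unfolding integral_mult_right_zero[of _ "K\<^sup>2"] conjunct2[OF ci] by (simp only: mult.assoc)
    show ?thesis by (rule conjI[OF i l[unfolded e]])
  qed
  have 2: "integrable lborel (\<lambda>x. norm (poisson_multiplier a p g x) / (1 + norm x) ^ M)"
    if [measurable]: "g \<in> borel_measurable borel" and gi: "integrable lborel (\<lambda>\<xi>. norm (g \<xi>) / (1 + norm \<xi>) ^ M)"
    for g :: "(real, 'm) vec \<Rightarrow> complex ^ ('m set)" and M
  proof (rule Bochner_Integration.integrable_bound[OF integrable_mult_right[OF conjunct1[OF c(2)[OF gi]], of K]])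
    show "AE x in lborel. norm (norm (poisson_multiplier a p g x) / (1 + norm x) ^ M) \<le>
       norm (K * (norm (fst x) powr (1 - a) * ((snd x)\<^sup>2 + (norm (fst x))\<^sup>2) powr - \<beta> * (norm (g (fst x)) / (1 + norm (fst x)) ^ M)))"
    proof (intro AE_I2)
      fix x :: "(real, 'm) vec \<times> real"
      have "(1 + norm (fst x)) ^ M \<le> (1 + norm x) ^ M"
        by (intro power_mono) (use norm_fst_le[of "fst x" "snd x"] in auto)
      then have "norm (poisson_multiplier a p g x) / (1 + norm x) ^ M \<le>
         K * (norm (fst x) powr (1 - a) * ((snd x)\<^sup>2 + (norm (fst x))\<^sup>2) powr - \<beta>) * norm (g (fst x)) / (1 + norm (fst x)) ^ M"
        using K(1) by (intro frac_le b) (auto simp: add_pos_nonneg)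
      then show "norm (norm (poisson_multiplier a p g x) / (1 + norm x) ^ M) \<le>
       norm (K * (norm (fst x) powr (1 - a) * ((snd x)\<^sup>2 + (norm (fst x))\<^sup>2) powr - \<beta> * (norm (g (fst x)) / (1 + norm (fst x)) ^ M)))"
        using K(1) by (simp add: abs_mult mult_ac)
    qed
  qed measurable
  have C0: "0 \<le> K\<^sup>2 * c" using c(1) by simp
  show ?thesis by (rule that[OF C0 1 2])
qed

section \<open>The Poisson integral as an inverse Fourier transform\<close>

lemma vfourier_vfourier: "f \<in> schwartz \<Longrightarrow> vfourier (vfourier f) (- x) = f x"
  by (simp add: vfourier_def vec_eq_iff fourier_fourier schwartz_component)

lemma vfourier_eq:
  fixes G :: "'a::euclidean_space \<Rightarrow> complex ^ 'i::finite"
  assumes G: "integrable lborel G"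
  shows "integrable lborel (\<lambda>\<xi>. cis (x \<bullet> \<xi>) *s G \<xi>)"
    and "vfourier G (- x) = of_real ((2 * pi) powr (- real DIM('a) / 2)) *s (LINT \<xi>|lborel. cis (x \<bullet> \<xi>) *s G \<xi>)"
proof -
  show i: "integrable lborel (\<lambda>\<xi>. cis (x \<bullet> \<xi>) *s G \<xi>)"
    by (rule integrable_bounded_scale_vec[OF G, of _ 1]) simp_all
  have [measurable]: "(\<lambda>x. G x $ i) \<in> borel_measurable borel" for i
    using borel_measurable_integrable[OF integrable_component[OF G]] by simp
  show "vfourier G (- x) = of_real ((2 * pi) powr (- real DIM('a) / 2)) *s (LINT \<xi>|lborel. cis (x \<bullet> \<xi>) *s G \<xi>)"
  proof (subst vec_eq_iff, rule allI)
    fix j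
    show "vfourier G (- x) $ j = (of_real ((2 * pi) powr (- real DIM('a) / 2)) *s (LINT \<xi>|lborel. cis (x \<bullet> \<xi>) *s G \<xi>)) $ j"
      unfolding vector_smult_component integral_component[OF i]
      by (simp add: vfourier_def fourier_eq inner_commute[of _ x])
  qed
qed

text \<open>Fubini integrates the last frequency first, which turns the symbol into the profile; the
  remaining inverse transform in the tangential frequencies is the Poisson integral at that height.
  Both ingredients concern nonzero heights, hence the condition on \<open>snd x\<close>.\<close>

lemma poisson_integral_eq_vfourier:
  fixes f :: "real ^ ('m::{finite,linorder}) \<Rightarrow> complex ^ ('m set)" and a :: real and p :: int
  assumes f: "f \<in> schwartz" and deg: "\<And>y. f y \<in> ext_deg p"
    and a: "a < 1" and N: "real CARD('m) + 1 - 2 * real_of_int p - a \<noteq> 0"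
  shows "integrable lborel (poisson_multiplier a p (vfourier f))"
    and "snd x \<noteq> 0 \<Longrightarrow> poisson_integral a p f x = vfourier (poisson_multiplier a p (vfourier f)) (- x)"
proof -
  let ?F = "vfourier f"
  let ?G = "poisson_multiplier a p ?F"
  note F = vfourier_schwartz[OF f]
  have Fi: "integrable lborel ?F" by (rule schwartz_integrable[OF F])
  have Fm: "?F \<in> borel_measurable borel" by (rule schwartz_measurable[OF F])
  have Gm: "?G \<in> borel_measurable borel" using Fm by (rule poisson_multiplier_measurable)
  have F0: "integrable lborel (\<lambda>\<xi>. norm (?F \<xi>) / (1 + norm \<xi>) ^ 0)" using Fi by simp
  have "integrable lborel (\<lambda>x. norm (?G x) / (1 + norm x) ^ 0)"
  proof (rule poisson_multiplier_bounds[OF a, where 'm = 'm and p = p])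
    assume *: "\<And>(g :: (real, 'm) vec \<Rightarrow> complex ^ ('m set)) M. g \<in> borel_measurable borel \<Longrightarrow>
      integrable lborel (\<lambda>\<xi>. norm (g \<xi>) / (1 + norm \<xi>) ^ M) \<Longrightarrow>
      integrable lborel (\<lambda>x. norm (poisson_multiplier a p g x) / (1 + norm x) ^ M)"
    show ?thesis by (rule *[OF Fm F0])
  qed
  then show Gi: "integrable lborel ?G" using Gm by (simp add: integrable_norm_iff)
  have Fd: "?F \<xi> \<in> ext_deg p" for \<xi> by (rule vfourier_ext_deg[OF deg])
  assume sx: "snd x \<noteq> 0"
  obtain z s where x: "x = (z, s)" by (cases x)
  have s: "s \<noteq> 0" using sx by (simp add: x)
  have ff: "(\<lambda>y. vfourier ?F (- y)) = f" by (rule ext) (rule vfourier_vfourier[OF f])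
  note P = poisson_integral_fourier[OF Fi Fd a N s, of z, unfolded ff]
  note V = vfourier_eq[OF Gi, of x]
  have "integrable (lborel \<Otimes>\<^sub>M lborel) (\<lambda>\<xi>. cis (x \<bullet> \<xi>) *s ?G \<xi>)" using V(1) unfolding lborel_prod .
  note Vi = this
  have "(LINT \<xi>|lborel. cis (x \<bullet> \<xi>) *s ?G \<xi>) = (LINT \<xi>|lborel. LINT t|lborel. cis (x \<bullet> (\<xi>, t)) *s ?G (\<xi>, t))"
    using lborel_pair.integral_fst'[OF Vi] unfolding lborel_prod by simp
  also have "\<dots> = (LINT \<xi>|lborel. of_real (sqrt (2 * pi)) *s (cis (z \<bullet> \<xi>) *s poisson_profile a p s \<xi> (?F \<xi>)))"
  proof -
    have inner: "(LINT t|lborel. cis (x \<bullet> (\<xi>, t)) *s ?G (\<xi>, t)) = of_real (sqrt (2 * pi)) *s (cis (z \<bullet> \<xi>) *s poisson_profile a p s \<xi> (?F \<xi>))"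
      if \<xi>: "\<xi> \<noteq> 0" and i: "integrable lborel (\<lambda>t. cis (x \<bullet> (\<xi>, t)) *s ?G (\<xi>, t))" for \<xi>
    proof -
      have e: "cis (x \<bullet> (\<xi>, t)) *s ?G (\<xi>, t) = cis (z \<bullet> \<xi>) *s (cis (s * t) *s poisson_symbol a p \<xi> t (?F \<xi>))" for t
        by (simp add: x poisson_multiplier_def cis_mult[symmetric])
      have e': "cis (s * t) *s poisson_symbol a p \<xi> t (?F \<xi>) = cis (- (z \<bullet> \<xi>)) *s (cis (x \<bullet> (\<xi>, t)) *s ?G (\<xi>, t))" for t
        unfolding e by (simp add: vec_eq_iff cis_mult flip: mult.assoc)
      have i': "integrable lborel (\<lambda>t. cis (s * t) *s poisson_symbol a p \<xi> t (?F \<xi>))"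
        unfolding e' by (rule integrable_bounded_scale_vec[OF i, of _ 1]) simp_all
      show ?thesis
        unfolding e integral_vector_scalar_mult[OF i'] integral_poisson_symbol[OF a s \<xi>] by (simp add: mult.commute)
    qed
    have ae: "AE \<xi> in lborel. (LINT t|lborel. cis (x \<bullet> (\<xi>, t)) *s ?G (\<xi>, t)) = of_real (sqrt (2 * pi)) *s (cis (z \<bullet> \<xi>) *s poisson_profile a p s \<xi> (?F \<xi>))"
      using AE_lborel_singleton[of "0 :: (real, 'm) vec"] lborel_pair.AE_integrable_fst'[OF Vi]
      by eventually_elim (rule inner)
    have [measurable]: "bessel \<nu>' 1 \<in> borel_measurable borel" for \<nu>'
      unfolding bessel_def bessel_integrand_def by measurable
    note [measurable] = Fm
    have pm: "(\<lambda>\<xi>. of_real (sqrt (2 * pi)) *s (cis (z \<bullet> \<xi>) *s poisson_profile a p s \<xi> (?F \<xi>))) \<in> borel_measurable lborel"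
      unfolding poisson_profile_def Let_def by measurable
    show ?thesis
      by (rule integral_cong_AE[OF borel_measurable_integrable[OF lborel_pair.integrable_fst'[OF Vi]] pm ae])
  qed
  also have "\<dots> = of_real (sqrt (2 * pi)) *s (LINT \<xi>|lborel. cis (z \<bullet> \<xi>) *s poisson_profile a p s \<xi> (?F \<xi>))"
  \<comment> \<open>The scalar is nonzero, so the two integrands are integrable together, and
    otherwise both integrals are 0.\<close>
  proof (cases "integrable lborel (\<lambda>\<xi>. cis (z \<bullet> \<xi>) *s poisson_profile a p s \<xi> (?F \<xi>))")
    case False
    then have "\<not> integrable lborel (\<lambda>\<xi>. of_real (sqrt (2 * pi)) *s (cis (z \<bullet> \<xi>) *s poisson_profile a p s \<xi> (?F \<xi>)))"
      using integrable_bounded_scale_vec[of "\<lambda>\<xi>. complex_of_real (sqrt (2 * pi)) *s (cis (z \<bullet> \<xi>) *s poisson_profile a p s \<xi> (?F \<xi>))"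
         "\<lambda>_. 1 / complex_of_real (sqrt (2 * pi))" "1 / sqrt (2 * pi)"] by (auto simp: norm_divide)
    with False show ?thesis by (simp add: not_integrable_integral_eq)
  qed (rule integral_vector_scalar_mult)
  finally have "vfourier ?G (- x) = (of_real ((2 * pi) powr (- real DIM((real, 'm) vec \<times> real) / 2)) * of_real (sqrt (2 * pi))) *s
      (LINT \<xi>|lborel. cis (z \<bullet> \<xi>) *s poisson_profile a p s \<xi> (?F \<xi>))"
    unfolding V(2) by simp
  \<comment> \<open>The full transform has one dimension more than the tangential one, and the last
    frequency returns half a power of \<open>2 * pi\<close>.\<close>
  also have "complex_of_real ((2 * pi) powr (- real DIM((real, 'm) vec \<times> real) / 2)) * of_real (sqrt (2 * pi)) = of_real ((2 * pi) powr (- real CARD('m) / 2))"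
  proof -
    have "(2 * pi) powr (- real DIM((real, 'm) vec \<times> real) / 2) * (2 * pi) powr (1 / 2) = (2 * pi) powr (- real CARD('m) / 2)"
      by (subst powr_add[symmetric]) (simp add: field_simps)
    then show ?thesis unfolding of_real_mult[symmetric] by (simp add: powr_half_sqrt)
  qed
  finally show "poisson_integral a p f x = vfourier ?G (- x)"
    unfolding x P by simp
qed

section \<open>The extension of the Poisson transform\<close>

text \<open>The cylinder over a null set is a null set.\<close>

lemma AE_lebesgue_fst:
  assumes "AE x in lebesgue. P (x :: 'a::euclidean_space)"
  shows "AE x in lebesgue. P (fst (x :: 'a \<times> 'b::euclidean_space))"
proof -
  have "AE x in lborel. P x" using assms by (simp add: AE_completion_iff)
  then obtain N where N: "\<And>x. x \<in> space lborel - N \<Longrightarrow> P x" "N \<in> null_sets lborel" by (rule AE_E3) (rule that)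
  have Nb: "N \<in> sets borel" using null_setsD2[OF N(2)] by simp
  have "AE x in (lborel \<Otimes>\<^sub>M lborel). fst (x :: 'a \<times> 'b) \<notin> N"
  proof (rule lborel_pair.AE_pair_measure)
    show "{x \<in> space (lborel \<Otimes>\<^sub>M lborel). fst (x :: 'a \<times> 'b) \<notin> N} \<in> sets (lborel \<Otimes>\<^sub>M lborel)"
      using Nb by measurable
    show "AE x in lborel. AE y in lborel. fst (x, y :: 'b) \<notin> N"
      using AE_not_in[OF N(2)] by eventually_elim simp
  qed
  then have "AE x in lborel. P (fst (x :: 'a \<times> 'b))"
    unfolding lborel_prod by eventually_elim (use N(1) in simp)
  then show ?thesis by (rule AE_completion)
qed

text \<open>Completeness of Lebesgue measure: every subset of the exceptional null set is
  measurable.\<close>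

lemma lebesgue_measurable_cong_AE:
  fixes f g :: "'a::euclidean_space \<Rightarrow> 'b::topological_space"
  assumes f: "f \<in> borel_measurable lebesgue" and AE: "AE x in lebesgue. f x = g x"
  shows "g \<in> borel_measurable lebesgue"
proof (rule measurableI)
  fix A :: "'b set" assume A: "A \<in> sets borel"
  obtain N where N: "\<And>x. x \<in> space lebesgue - N \<Longrightarrow> f x = g x" "N \<in> null_sets lebesgue" using AE by (rule AE_E3) (rule that)
  have "f -` A \<inter> space lebesgue \<in> sets lebesgue" by (rule measurable_sets[OF f A])
  moreover have "N \<in> sets lebesgue" by (rule null_setsD2[OF N(2)])
  moreover have "g -` A \<inter> N \<in> sets lebesgue"
    using null_sets_completion_subset[OF _ N(2), of "g -` A \<inter> N"] by (auto simp: null_sets_def)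
  moreover have "g -` A \<inter> space lebesgue = (f -` A \<inter> space lebesgue - N) \<union> (g -` A \<inter> N)"
    using N(1) by auto
  ultimately show "g -` A \<inter> space lebesgue \<in> sets lebesgue" by (metis sets.Diff sets.Un)
qed simp

lemma inv_fourier_dist_cong:
  assumes [measurable]: "G \<in> borel_measurable borel" "G' \<in> borel_measurable borel" and AE: "AE \<xi> in lebesgue. G \<xi> = G' \<xi>"
  shows "inv_fourier_dist G = inv_fourier_dist G'"
proof
  fix \<phi> :: "'a \<Rightarrow> complex"
  show "inv_fourier_dist G \<phi> = inv_fourier_dist G' \<phi>"
  proof (cases "\<phi> \<in> schwartz")
    case True
    have [measurable]: "(\<lambda>\<xi>. fourier \<phi> (- \<xi>)) \<in> borel_measurable borel"
      by (rule schwartz_measurable[OF schwartz_reflect_fourier[OF True]])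
    have "(LINT \<xi>|lborel. fourier \<phi> (- \<xi>) *s G \<xi>) = (LINT \<xi>|lborel. fourier \<phi> (- \<xi>) *s G' \<xi>)"
      using AE unfolding AE_completion_iff by (intro integral_cong_AE) (measurable, auto)
    then show ?thesis using True by (simp add: inv_fourier_dist_def integral_completion)
  qed (simp add: inv_fourier_dist_def)
qed

text \<open>After a reflection the multiplication formula moves the transform from the test function
  to \<open>G\<close>.\<close>

lemma represented_by_inv_fourier_dist_integrable:
  fixes G :: "'a::euclidean_space \<Rightarrow> complex ^ 'i::finite"
  assumes G: "integrable lborel G"
  shows "represented_by (inv_fourier_dist G) (\<lambda>x. vfourier G (- x))"
proof -
  have Gi: "integrable lborel (\<lambda>x. G x $ i)" for i by (rule integrable_component[OF G])
  have Gm [measurable]: "G \<in> borel_measurable borel" using borel_measurable_integrable[OF G] by simp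
  have Gim [measurable]: "(\<lambda>x. G x $ i) \<in> borel_measurable borel" for i
    using borel_measurable_integrable[OF Gi] by simp
  have Fim [measurable]: "fourier (\<lambda>x. G x $ i) \<in> borel_measurable borel" for i by (rule fourier_measurable[OF Gim])
  have vm [measurable]: "(\<lambda>x. vfourier G (- x)) \<in> borel_measurable borel"
    by (rule measurable_vec) (simp add: vfourier_def)
  have int: "integrable lborel (\<lambda>x. \<phi> x *s vfourier G (- x))" if \<phi>: "\<phi> \<in> schwartz" for \<phi>
  proof (rule integrable_vec)
    fix i
    let ?B = "(2 * pi) powr (- real DIM('a) / 2) * (LINT x|lborel. norm (G x $ i))"
    have [measurable]: "\<phi> \<in> borel_measurable borel" by (rule schwartz_measurable[OF \<phi>])
    have le: "norm (\<phi> x * fourier (\<lambda>x. G x $ i) (- x)) \<le> norm (?B * norm (\<phi> x))" for x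
      using mult_right_mono[OF norm_fourier_le[OF Gi, of i "- x"] norm_ge_zero[of "\<phi> x"]]
      by (simp add: norm_mult abs_mult mult.commute)
    have "integrable lborel (\<lambda>x. \<phi> x * fourier (\<lambda>x. G x $ i) (- x))"
      by (rule Bochner_Integration.integrable_bound[OF integrable_mult_right[OF integrable_norm[OF schwartz_integrable[OF \<phi>]], of ?B]])
         (measurable, intro AE_I2 le)
    then show "integrable lborel (\<lambda>x. (\<phi> x *s vfourier G (- x)) $ i)" by (simp add: vfourier_def)
  qed
  have eq: "(LINT \<xi>|lborel. fourier \<phi> (- \<xi>) *s G \<xi>) = (LINT x|lborel. \<phi> x *s vfourier G (- x))" if \<phi>: "\<phi> \<in> schwartz" for \<phi>
  proof (subst vec_eq_iff, rule allI)
    fix i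
    have \<phi>m [measurable]: "\<phi> \<in> borel_measurable borel" by (rule schwartz_measurable[OF \<phi>])
    have \<phi>i: "integrable lborel (\<lambda>x. \<phi> (- x))"
      using lborel_integrable_real_affine_iff schwartz_integrable[OF schwartz_reflect[OF \<phi>]] by blast
    have Fi: "integrable lborel (\<lambda>\<xi>. fourier \<phi> (- \<xi>) *s G \<xi>)"
      by (rule integrable_bounded_scale_vec[OF G schwartz_measurable[OF schwartz_reflect_fourier[OF \<phi>]] norm_fourier_le[OF schwartz_integrable[OF \<phi>]]])
    have "(LINT \<xi>|lborel. fourier \<phi> (- \<xi>) *s G \<xi>) $ i = (LINT \<xi>|lborel. fourier (\<lambda>x. \<phi> (- x)) \<xi> * G \<xi> $ i)"
      unfolding integral_component[OF Fi] by (simp add: fourier_reflect)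
    also have "\<dots> = (LINT x|lborel. \<phi> (- x) * fourier (\<lambda>x. G x $ i) x)"
      by (rule fourier_multiplication[OF \<phi>i Gi])
    also have "\<dots> = (LINT x|lborel. \<phi> (- (0 + (-1) *\<^sub>R x)) * fourier (\<lambda>x. G x $ i) (0 + (-1) *\<^sub>R x))"
      by (rule lborel_integral_affine(2)[symmetric, of "\<lambda>x. \<phi> (- x) * fourier (\<lambda>x. G x $ i) x"]) simp_all
    also have "\<dots> = (LINT x|lborel. \<phi> x *s vfourier G (- x)) $ i"
      unfolding integral_component[OF int[OF \<phi>]] by (simp add: vfourier_def)
    finally show "(LINT \<xi>|lborel. fourier \<phi> (- \<xi>) *s G \<xi>) $ i = (LINT x|lborel. \<phi> x *s vfourier G (- x)) $ i" .
  qed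
  show ?thesis
    unfolding represented_by_def
  proof (intro conjI ballI ext)
    show "(\<lambda>x. vfourier G (- x)) \<in> borel_measurable lebesgue"
      using vm by (simp add: measurable_completion)
    show "integrable lebesgue (\<lambda>x. \<phi> x *s vfourier G (- x))" if "\<phi> \<in> schwartz" for \<phi>
      using int[OF that] schwartz_measurable[OF that] by (simp add: integrable_completion)
    show "inv_fourier_dist G \<phi> = fun_dist (\<lambda>x. vfourier G (- x)) \<phi>" for \<phi>
      using eq[of \<phi>] schwartz_measurable[of \<phi>] schwartz_measurable[OF schwartz_reflect_fourier, of \<phi>]
      by (simp add: inv_fourier_dist_def fun_dist_def integral_completion)
  qed
qed

text \<open>A Borel choice makes the multiplier built from it measurable on the product space. It
  depends on the distribution alone and therefore defines a map.\<close>

definition borel_fourier ::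
    "(('a::euclidean_space \<Rightarrow> complex) \<Rightarrow> complex ^ 'i) \<Rightarrow> 'a \<Rightarrow> complex ^ ('i::finite)" where
  "borel_fourier u = (SOME g. g \<in> borel_measurable borel \<and> (AE \<xi> in lebesgue. fourier_fun u \<xi> = g \<xi>))"

lemma borel_fourier:
  assumes u: "u \<in> hdot s V"
  shows "borel_fourier u \<in> borel_measurable borel" "represented_by (fourier_dist u) (borel_fourier u)"
proof -
  have r: "represented_by (fourier_dist u) (fourier_fun u)" by (rule hdot_represented[OF u])
  then have "fourier_fun u \<in> borel_measurable lebesgue" by (simp add: represented_by_def)
  then obtain g where "g \<in> borel_measurable borel \<and> (AE \<xi> in lebesgue. fourier_fun u \<xi> = g \<xi>)"
    using lebesgue_measurable_ex_borel by blast
  from someI[where P = "\<lambda>g. g \<in> borel_measurable borel \<and> (AE \<xi> in lebesgue. fourier_fun u \<xi> = g \<xi>)", OF this]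
  have b: "borel_fourier u \<in> borel_measurable borel" "AE \<xi> in lebesgue. fourier_fun u \<xi> = borel_fourier u \<xi>"
    unfolding borel_fourier_def by blast+
  show "borel_fourier u \<in> borel_measurable borel" by (rule b(1))
  show "represented_by (fourier_dist u) (borel_fourier u)"
    by (rule represented_by_cong[OF r _ b(2)]) (use b(1) in \<open>simp add: measurable_completion\<close>)
qed

text \<open>The degree is inherited at each frequency; the two estimates of
  \<open>poisson_multiplier_bounds\<close> give the Sobolev bound and temperedness.\<close>

lemma poisson_multiplier_hdot:
  fixes u :: "((real ^ 'm::{finite,linorder}) \<Rightarrow> complex) \<Rightarrow> complex ^ ('m set)"
  assumes a: "a < 1" and u: "u \<in> hdot ((1 - a) / 2) (ext_deg p)"
    and g: "represented_by (fourier_dist u) g" and gm [measurable]: "g \<in> borel_measurable borel"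
  shows "represented_by (fourier_dist (inv_fourier_dist (poisson_multiplier a p g))) (poisson_multiplier a p g)"
    and "inv_fourier_dist (poisson_multiplier a p g) \<in> hdot ((2 - a) / 2) (ext_deg p)"
proof -
  let ?T = "poisson_multiplier a p g" and ?M = "DIM((real, 'm) vec)"
  have s: "0 \<le> (1 - a) / 2" and e: "2 * ((1 - a) / 2) = 1 - a" and e': "2 * ((2 - a) / 2) = 2 - a" using a by (simp_all add: field_simps)
  have Tm [measurable]: "?T \<in> borel_measurable borel" by (rule poisson_multiplier_measurable[OF gm])
  have Tl: "?T \<in> borel_measurable lebesgue" using Tm by (simp add: measurable_completion)
  have wi: "integrable lborel (\<lambda>\<xi>. norm (g \<xi>) / (1 + norm \<xi>) ^ ?M)"
    using integrable_weight_of_sobolev[OF g s hdot_finite(1)[OF u g]] by (simp add: integrable_completion)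
  have gi: "integrable lborel (\<lambda>\<xi>. norm \<xi> powr (1 - a) * (norm (g \<xi>))\<^sup>2)"
    using hdot_finite(2)[OF u g] unfolding e by (simp add: integrable_completion)
  have Ti: "integrable lborel (\<lambda>x. norm x powr (2 - a) * (norm (?T x))\<^sup>2)" "integrable lborel (\<lambda>x. norm (?T x) / (1 + norm x) ^ ?M)"
    by (rule poisson_multiplier_bounds[OF a, where 'm = 'm and p = p], use gm gi wi in blast)+
  have Tw: "integrable lebesgue (\<lambda>x. norm (?T x) / (1 + norm x) ^ ?M)"
    using Ti(2) by (simp add: integrable_completion)
  show r: "represented_by (fourier_dist (inv_fourier_dist ?T)) ?T"
    by (rule represented_by_inv_fourier_dist[OF Tl Tw])
  have ut: "u \<in> tempered (ext_deg p)" using u by (simp add: hdot_def)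
  have "AE \<xi> in lebesgue. \<forall>I\<in>{I. int (card I) \<noteq> p}. g \<xi> $ I = 0"
    using represented_by_ext_deg[OF ut g] by (intro AE_finite_allI) auto
  then have "AE \<xi> in lebesgue. g \<xi> \<in> ext_deg p"
    by eventually_elim (auto simp: ext_deg_def)
  from AE_lebesgue_fst[OF this] have "AE x in lebesgue. ?T x \<in> ext_deg p"
    by eventually_elim (simp add: poisson_multiplier_def ext_deg_poisson_symbol)
  then have t: "inv_fourier_dist ?T \<in> tempered (ext_deg p)"
    by (rule inv_fourier_dist_tempered[OF Tl Tw])
  have "integrable lebesgue (\<lambda>x. norm x powr (2 * ((2 - a) / 2)) * (norm (?T x))\<^sup>2)"
    using Ti(1) unfolding e' by (simp add: integrable_completion)
  then have "(\<integral>\<^sup>+ x. ennreal (norm x powr (2 * ((2 - a) / 2)) * (norm (?T x))\<^sup>2) \<partial>lebesgue) < \<infinity>"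
    by (subst (asm) integrable_iff_bounded) simp
  then show "inv_fourier_dist ?T \<in> hdot ((2 - a) / 2) (ext_deg p)"
    unfolding hdot_def using t r by blast
qed

text \<open>The symbol respects differences, so the distance of two images is the norm of the image
  of a difference.\<close>

lemma poisson_multiplier_dist:
  fixes a :: real and p :: int
  assumes a: "a < 1"
  obtains C where "0 \<le> C"
    "\<And>u v :: ((real ^ 'm::{finite,linorder}) \<Rightarrow> complex) \<Rightarrow> complex ^ ('m set).
      u \<in> hdot ((1 - a) / 2) (ext_deg p) \<Longrightarrow> v \<in> hdot ((1 - a) / 2) (ext_deg p) \<Longrightarrow>
      hdot_dist ((2 - a) / 2) (inv_fourier_dist (poisson_multiplier a p (borel_fourier v)))
          (inv_fourier_dist (poisson_multiplier a p (borel_fourier u)))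
        \<le> C * hdot_dist ((1 - a) / 2) v u"
proof (rule poisson_multiplier_bounds[OF a, where 'm = 'm and p = p])
  fix C :: real
  assume C: "0 \<le> C"
    and bound: "\<And>g :: (real, 'm) vec \<Rightarrow> complex ^ ('m set). g \<in> borel_measurable borel \<Longrightarrow>
      integrable lborel (\<lambda>\<xi>. norm \<xi> powr (1 - a) * (norm (g \<xi>))\<^sup>2) \<Longrightarrow>
      integrable lborel (\<lambda>x. norm x powr (2 - a) * (norm (poisson_multiplier a p g x))\<^sup>2) \<and>
      (LINT x|lborel. norm x powr (2 - a) * (norm (poisson_multiplier a p g x))\<^sup>2) \<le> C * (LINT \<xi>|lborel. norm \<xi> powr (1 - a) * (norm (g \<xi>))\<^sup>2)"
  have "hdot_dist ((2 - a) / 2) (inv_fourier_dist (poisson_multiplier a p (borel_fourier v)))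
          (inv_fourier_dist (poisson_multiplier a p (borel_fourier u)))
        \<le> sqrt C * hdot_dist ((1 - a) / 2) v u"
    if u: "u \<in> hdot ((1 - a) / 2) (ext_deg p)" and v: "v \<in> hdot ((1 - a) / 2) (ext_deg p)"
    for u v :: "((real, 'm) vec \<Rightarrow> complex) \<Rightarrow> complex ^ ('m set)"
  proof -
    have e: "2 * ((1 - a) / 2) = 1 - a" "2 * ((2 - a) / 2) = 2 - a" by (simp_all add: field_simps)
    let ?D = "\<lambda>\<xi>. borel_fourier v \<xi> - borel_fourier u \<xi>"
    note gu = borel_fourier[OF u] and gv = borel_fourier[OF v]
    note [measurable] = gu(1) gv(1)
    have Dm [measurable]: "?D \<in> borel_measurable borel" by measurable
    have T [measurable]: "poisson_multiplier a p (borel_fourier v) \<in> borel_measurable borel"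
        "poisson_multiplier a p (borel_fourier u) \<in> borel_measurable borel"
      by (rule poisson_multiplier_measurable, measurable)+
    have Di: "integrable lborel (\<lambda>\<xi>. norm \<xi> powr (1 - a) * (norm (?D \<xi>))\<^sup>2)"
      using hdot_diff_integrable[OF v gv(2) u gu(2)] unfolding e by (simp add: integrable_completion)
    have D: "poisson_multiplier a p ?D x = poisson_multiplier a p (borel_fourier v) x - poisson_multiplier a p (borel_fourier u) x" for x
      unfolding poisson_multiplier_def by (rule poisson_symbol_diff)
    have "hdot_dist ((2 - a) / 2) (inv_fourier_dist (poisson_multiplier a p (borel_fourier v)))
          (inv_fourier_dist (poisson_multiplier a p (borel_fourier u)))
        = sqrt (LINT x|lborel. norm x powr (2 - a) * (norm (poisson_multiplier a p ?D x))\<^sup>2)"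
      unfolding hdot_dist_eq[OF poisson_multiplier_hdot(1)[OF a v gv(2,1)] poisson_multiplier_hdot(1)[OF a u gu(2,1)]] D e
      by (simp add: integral_completion)
    also have "\<dots> \<le> sqrt (C * (LINT \<xi>|lborel. norm \<xi> powr (1 - a) * (norm (?D \<xi>))\<^sup>2))"
      by (rule real_sqrt_le_mono[OF conjunct2[OF bound[OF Dm Di]]])
    also have "\<dots> = sqrt C * hdot_dist ((1 - a) / 2) v u"
      unfolding hdot_dist_eq[OF gv(2) gu(2)] real_sqrt_mult e by (simp add: integral_completion)
    finally show ?thesis .
  qed
  then show ?thesis using that[of "sqrt C"] C by simp
qed

text \<open>Existence of an extension, which gives the choice in \<open>poisson\<close> its
  properties. On Schwartz forms the inverse transform of the multiplier is the Poisson integral off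
  the hyperplane of height 0, a null set.\<close>

lemma is_poisson_extension_inv_fourier_dist:
  fixes a :: real and p :: int
  assumes a: "a < 1" and N: "real CARD('m::{finite,linorder}) + 1 - 2 * real_of_int p - a \<noteq> 0"
  shows "is_poisson_extension a p
    (\<lambda>u :: ((real, 'm) vec \<Rightarrow> complex) \<Rightarrow> complex ^ ('m set). inv_fourier_dist (poisson_multiplier a p (borel_fourier u)))"
  unfolding is_poisson_extension_def
proof (intro conjI ballI allI impI)
  fix u :: "((real, 'm) vec \<Rightarrow> complex) \<Rightarrow> complex ^ ('m set)"
  assume u: "u \<in> hdot ((1 - a) / 2) (ext_deg p)"
  show "inv_fourier_dist (poisson_multiplier a p (borel_fourier u)) \<in> hdot ((2 - a) / 2) (ext_deg p)"
    by (rule poisson_multiplier_hdot(2)[OF a u borel_fourier(2,1)[OF u]])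
  fix \<epsilon> :: real assume \<epsilon>: "0 < \<epsilon>"
  show "\<exists>\<delta>>0. \<forall>v\<in>hdot ((1 - a) / 2) (ext_deg p). hdot_dist ((1 - a) / 2) v u < \<delta> \<longrightarrow>
      hdot_dist ((2 - a) / 2) (inv_fourier_dist (poisson_multiplier a p (borel_fourier v)))
          (inv_fourier_dist (poisson_multiplier a p (borel_fourier u))) < \<epsilon>"
  proof (rule poisson_multiplier_dist[OF a, where 'm = 'm and p = p])
    fix C :: real
    assume C: "0 \<le> C" and bound: "\<And>u v :: ((real, 'm) vec \<Rightarrow> complex) \<Rightarrow> complex ^ ('m set).
      u \<in> hdot ((1 - a) / 2) (ext_deg p) \<Longrightarrow> v \<in> hdot ((1 - a) / 2) (ext_deg p) \<Longrightarrow>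
      hdot_dist ((2 - a) / 2) (inv_fourier_dist (poisson_multiplier a p (borel_fourier v)))
          (inv_fourier_dist (poisson_multiplier a p (borel_fourier u)))
        \<le> C * hdot_dist ((1 - a) / 2) v u"
    show ?thesis
    \<comment> \<open>Adding 1 avoids a division by 0 and makes the final estimate strict.\<close>
    proof (intro exI[of _ "\<epsilon> / (C + 1)"] conjI ballI impI)
      show "0 < \<epsilon> / (C + 1)" using C \<epsilon> by simp
      fix v :: "((real, 'm) vec \<Rightarrow> complex) \<Rightarrow> complex ^ ('m set)"
      assume v: "v \<in> hdot ((1 - a) / 2) (ext_deg p)" and d: "hdot_dist ((1 - a) / 2) v u < \<epsilon> / (C + 1)"
      have "C * hdot_dist ((1 - a) / 2) v u \<le> C * (\<epsilon> / (C + 1))"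
        using d C by (intro mult_left_mono) auto
      also have "\<dots> < \<epsilon>" using C \<epsilon> by (simp add: field_simps)
      finally show "hdot_dist ((2 - a) / 2) (inv_fourier_dist (poisson_multiplier a p (borel_fourier v)))
          (inv_fourier_dist (poisson_multiplier a p (borel_fourier u))) < \<epsilon>"
        by (rule le_less_trans[OF bound[OF u v]])
    qed
  qed
next
  fix f :: "(real, 'm) vec \<Rightarrow> complex ^ ('m set)"
  assume f: "f \<in> schwartz" and deg: "\<forall>y. f y \<in> ext_deg p"
  have s: "0 \<le> (1 - a) / 2" using a by simp
  have u: "fun_dist f \<in> hdot ((1 - a) / 2) (ext_deg p)" by (rule fun_dist_hdot[OF f _ s]) (use deg in blast)
  let ?g = "borel_fourier (fun_dist f)" and ?G = "poisson_multiplier a p (vfourier f)"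
  note g = borel_fourier[OF u]
  have Fm: "vfourier f \<in> borel_measurable borel" by (rule schwartz_measurable[OF vfourier_schwartz[OF f]])
  have "AE \<xi> in lebesgue. ?g \<xi> = vfourier f \<xi>"
    by (rule represented_by_AE_unique[OF g(2) represented_by_vfourier[OF f]])
  from AE_lebesgue_fst[OF this] have ae: "AE x in lebesgue. poisson_multiplier a p ?g x = ?G x"
    by eventually_elim (simp add: poisson_multiplier_def)
  have eq: "inv_fourier_dist (poisson_multiplier a p ?g) = inv_fourier_dist ?G"
    by (rule inv_fourier_dist_cong[OF poisson_multiplier_measurable[OF g(1)] poisson_multiplier_measurable[OF Fm] ae])
  have fd: "f y \<in> ext_deg p" for y using deg by blast
  note P = poisson_integral_eq_vfourier[OF f fd a N]
  have r: "represented_by (inv_fourier_dist ?G) (\<lambda>x. vfourier ?G (- x))"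
    by (rule represented_by_inv_fourier_dist_integrable[OF P(1)])
  have "AE x in (lborel \<Otimes>\<^sub>M lborel). snd (x :: (real, 'm) vec \<times> real) \<noteq> 0"
  proof (rule lborel_pair.AE_pair_measure)
    show "{x \<in> space (lborel \<Otimes>\<^sub>M lborel). snd (x :: (real, 'm) vec \<times> real) \<noteq> 0} \<in> sets (lborel \<Otimes>\<^sub>M lborel)"
      by measurable
    show "AE x in lborel. AE y in lborel. snd (x :: (real, 'm) vec, y :: real) \<noteq> 0"
      unfolding snd_conv by (intro AE_I2 AE_lborel_singleton)
  qed
  then have ae': "AE x in lebesgue. vfourier ?G (- x) = poisson_integral a p f x"
    unfolding lborel_prod by (intro AE_completion) (auto elim!: eventually_mono simp: P(2))
  show "represented_by (inv_fourier_dist (poisson_multiplier a p ?g)) (poisson_integral a p f)"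
    unfolding eq by (rule represented_by_cong[OF r lebesgue_measurable_cong_AE[OF _ ae'] ae'])
      (use r in \<open>simp add: represented_by_def\<close>)
qed

text \<open>With \<open>w\<close> the squared length of \<open>(\<xi>, t)\<close>, the power with
  exponent \<open>a - 4\<close> of the length is \<open>w powr - (\<beta> + 1)\<close>. Factoring it
  out leaves a factor \<open>w\<close> where the symbol has \<open>w powr - \<beta>\<close>;
  splitting that factor into two squares gives the bracket of the second component.\<close>

lemma poisson_symbol_decomposition:
  fixes \<xi> :: "real ^ ('m::{finite,linorder})" and u v g :: "complex ^ ('m set)" and a :: real and p :: int
  assumes \<xi>: "\<xi> \<noteq> 0" and u: "int_mult \<xi> u = 0" and v: "int_mult \<xi> v = 0"
    and g: "g = u + ext_mult (\<xi> /\<^sub>R norm \<xi>) v"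
  shows "poisson_symbol a p \<xi> t g =
    (sqrt 2 * Gamma ((2 - a) / 2) / ((real CARD('m) + 1 - 2 * real_of_int p - a) * Gamma ((1 - a) / 2))
        * norm \<xi> powr (1 - a) * norm (\<xi>, t) powr (a - 4)) *\<^sub>R
      (((real CARD('m) + 1 - 2 * real_of_int p - a) * (norm (\<xi>, t))\<^sup>2) *\<^sub>R ext_incl u
       + ((real CARD('m) + 1 - 2 * real_of_int p - a + 2) * (norm \<xi>)\<^sup>2
          + (real CARD('m) + 1 - 2 * real_of_int p + a - 2) * t\<^sup>2) *\<^sub>R
         ext_incl (ext_mult (\<xi> /\<^sub>R norm \<xi>) v)
       + (2 * (2 - a) * t * norm \<xi>) *\<^sub>R ext_mult e_last (ext_incl v))"
proof -
  define \<beta> where "\<beta> = (2 - a) / 2"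
  define W where "W = t\<^sup>2 + (norm \<xi>)\<^sup>2"
  define Q where "Q = W powr - (\<beta> + 1)"
  define N where "N = real CARD('m) + 1 - 2 * real_of_int p - a"
  define k where "k = sqrt 2 * Gamma \<beta> / (N * Gamma ((1 - a) / 2)) * norm \<xi> powr (1 - a)"
  define E where "E = ext_incl (ext_mult (\<xi> /\<^sub>R norm \<xi>) v)"
  have r: "norm \<xi> \<noteq> 0" using \<xi> by simp
  have W0: "0 < W" using \<xi> by (simp add: W_def add_nonneg_pos)
  have W2: "(norm (\<xi>, t))\<^sup>2 = W" by (simp add: norm_Pair W_def)
  have a4: "a - 4 = 2 * (- (\<beta> + 1))" by (simp add: \<beta>_def field_simps)
  have Qn: "norm (\<xi>, t) powr (a - 4) = Q"
    unfolding a4 norm_pair_powr by (simp add: Q_def W_def)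
  have Wb: "W powr - \<beta> = W * Q" using W0 by (simp add: Q_def powr_mult_base)
  note dec = ext_int_of_decomposition[OF u v \<xi> g]
  have i: "ext_incl g = ext_incl u + E" unfolding g E_def by (rule ext_incl_add)
  have e2: "ext_incl (ext_mult \<xi> (int_mult \<xi> g)) = (norm \<xi>)\<^sup>2 *\<^sub>R E"
    unfolding dec(2) E_def by (rule ext_incl_scaleR)
  have e3: "ext_mult e_last (ext_incl (int_mult \<xi> g)) = norm \<xi> *\<^sub>R ext_mult e_last (ext_incl v)"
    unfolding dec(1) ext_incl_scaleR by (rule ext_mult.scaleR_right)
  have alg: "k *\<^sub>R ((N * (W * Q)) *\<^sub>R (U + E) + ((2 * (W * Q) - 4 * \<beta> * t\<^sup>2 * Q) / (norm \<xi>)\<^sup>2) *\<^sub>R ((norm \<xi>)\<^sup>2 *\<^sub>R E)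
        + (4 * \<beta> * t * Q) *\<^sub>R (norm \<xi> *\<^sub>R L))
      = (k * Q) *\<^sub>R ((N * W) *\<^sub>R U + ((N + 2) * (norm \<xi>)\<^sup>2 + (N + 2 * a - 2) * t\<^sup>2) *\<^sub>R E + (2 * (2 - a) * t * norm \<xi>) *\<^sub>R L)"
    for U L :: "complex ^ ('m option set)"
  proof -
    have c1: "(2 * (W * Q) - 4 * \<beta> * t\<^sup>2 * Q) / (norm \<xi>)\<^sup>2 * (norm \<xi>)\<^sup>2 = 2 * (W * Q) - 4 * \<beta> * t\<^sup>2 * Q" using r by simp
    \<comment> \<open>As \<open>4 * \<beta>\<close> is \<open>4 - 2 * a\<close>, the coefficient of
      \<open>t\<^sup>2\<close> is \<open>N + 2 - (4 - 2 * a)\<close>.\<close>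
    have c2: "Q * ((N + 2) * (norm \<xi>)\<^sup>2 + (N + 2 * a - 2) * t\<^sup>2) = N * (W * Q) + (2 * (W * Q) - 4 * \<beta> * t\<^sup>2 * Q)"
      by (simp add: W_def \<beta>_def field_simps)
    have c3: "Q * (2 * (2 - a) * t * norm \<xi>) = 4 * \<beta> * t * Q * norm \<xi>" by (simp add: \<beta>_def field_simps)
    have c4: "Q * (N * W) = N * (W * Q)" by simp
    show ?thesis
      unfolding scaleR_scaleR[symmetric, of k Q] scaleR_add_right[of Q] scaleR_scaleR[of Q] c2 c3 c4 scaleR_scaleR[of "_ / _"] c1
        scaleR_scaleR[of "4 * \<beta> * t * Q"]
      by (simp only: scaleR_add_right scaleR_add_left add.assoc)
  qed
  have n: "real CARD('m) + 1 - 2 * real_of_int p + a - 2 = N + 2 * a - 2" by (simp add: N_def)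
  show ?thesis
    unfolding poisson_symbol_def Let_def
    unfolding \<beta>_def[symmetric] W_def[symmetric] N_def[symmetric] n W2 Qn Q_def[symmetric] Wb i e2 e3 E_def[symmetric] k_def[symmetric]
    by (rule alg)
qed

theorem theorem4p1:
  fixes n :: nat and p :: int and a :: real
    and f :: "(real ^ ('m::{finite,linorder}) \<Rightarrow> complex) \<Rightarrow> complex ^ ('m set)"
    and fhat fI fII :: "real ^ ('m::{finite,linorder}) \<Rightarrow> complex ^ ('m set)"
  assumes "n \<ge> 2" and "CARD('m) = n - 1"
    and "0 \<le> p" and "real_of_int p \<le> real n / 2"
    and "2 - real n + 2 * real_of_int p < a" and "a < 1"
    and "f \<in> hdot ((1 - a) / 2) (ext_deg p)"
    and "represented_by (fourier_dist f) fhat"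
    and "AE \<xi> in lebesgue.
           fI \<xi> \<in> ext_deg p \<and> fII \<xi> \<in> ext_deg (p - 1) \<and>
           int_mult \<xi> (fI \<xi>) = 0 \<and> int_mult \<xi> (fII \<xi>) = 0 \<and>
           fhat \<xi> = fI \<xi> + ext_mult (\<xi> /\<^sub>R norm \<xi>) (fII \<xi>)"
  shows "represented_by (fourier_dist (poisson a p f))
    (\<lambda>\<xi>. case \<xi> of (\<xi>', \<xi>n) \<Rightarrow>
      (sqrt 2 * Gamma ((2 - a) / 2) / ((real n - 2 * real_of_int p - a) * Gamma ((1 - a) / 2))
        * norm \<xi>' powr (1 - a) * norm \<xi> powr (a - 4)) *\<^sub>R
      (((real n - 2 * real_of_int p - a) * (norm \<xi>)\<^sup>2) *\<^sub>R ext_incl (fI \<xi>')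
       + ((real n - 2 * real_of_int p - a + 2) * (norm \<xi>')\<^sup>2
          + (real n - 2 * real_of_int p + a - 2) * \<xi>n\<^sup>2) *\<^sub>R
         ext_incl (ext_mult (\<xi>' /\<^sub>R norm \<xi>') (fII \<xi>'))
       + (2 * (2 - a) * \<xi>n * norm \<xi>') *\<^sub>R ext_mult e_last (ext_incl (fII \<xi>'))))"
proof -
  let ?F = "(\<lambda>\<xi>. case \<xi> of (\<xi>', \<xi>n) \<Rightarrow>
      (sqrt 2 * Gamma ((2 - a) / 2) / ((real n - 2 * real_of_int p - a) * Gamma ((1 - a) / 2))
        * norm \<xi>' powr (1 - a) * norm \<xi> powr (a - 4)) *\<^sub>R
      (((real n - 2 * real_of_int p - a) * (norm \<xi>)\<^sup>2) *\<^sub>R ext_incl (fI \<xi>')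
       + ((real n - 2 * real_of_int p - a + 2) * (norm \<xi>')\<^sup>2
          + (real n - 2 * real_of_int p + a - 2) * \<xi>n\<^sup>2) *\<^sub>R
         ext_incl (ext_mult (\<xi>' /\<^sub>R norm \<xi>') (fII \<xi>'))
       + (2 * (2 - a) * \<xi>n * norm \<xi>') *\<^sub>R ext_mult e_last (ext_incl (fII \<xi>'))))"
  note a = \<open>a < 1\<close>
  have n: "real n = real CARD('m) + 1" using \<open>n \<ge> 2\<close> \<open>CARD('m) = n - 1\<close> by simp
  \<comment> \<open>The lower bound on \<open>a\<close> makes this quantity larger than
    \<open>2 - 2 * a\<close>, which is positive.\<close>
  have N: "real CARD('m) + 1 - 2 * real_of_int p - a \<noteq> 0"
    using assms(5) a unfolding n by simp
  let ?Q = "\<lambda>u :: ((real, 'm) vec \<Rightarrow> complex) \<Rightarrow> complex ^ ('m set). inv_fourier_dist (poisson_multiplier a p (borel_fourier u))"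
  have Q: "is_poisson_extension a p ?Q" by (rule is_poisson_extension_inv_fourier_dist[OF a N])
  have P: "is_poisson_extension a p (poisson a p :: (((real, 'm) vec \<Rightarrow> complex) \<Rightarrow> complex ^ ('m set)) \<Rightarrow> _)"
    unfolding poisson_def by (rule someI[where P = "is_poisson_extension a p", OF Q])
  have f: "f \<in> hdot ((1 - a) / 2) (ext_deg p)" by (rule assms(7))
  have Pf: "poisson a p f \<in> hdot ((2 - a) / 2) (ext_deg p)"
    using P f by (auto simp: is_poisson_extension_def)
  have le: "a \<le> 1" using a by simp
  let ?T = "poisson_multiplier a p (borel_fourier f)"
  note g = borel_fourier[OF f] and r = hdot_represented[OF Pf]
  have ae: "AE x in lebesgue. fourier_fun (poisson a p f) x = ?T x"
    by (rule is_poisson_extension_unique[OF P Q le f r poisson_multiplier_hdot(1)[OF a f g(2,1)]])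
  have "AE \<xi> in lebesgue. borel_fourier f \<xi> = fhat \<xi>"
    by (rule represented_by_AE_unique[OF g(2) assms(8)])
  moreover have "AE \<xi> in lebesgue. \<xi> \<noteq> (0 :: (real, 'm) vec)"
    by (intro AE_completion AE_lborel_singleton)
  ultimately have "AE \<xi> in lebesgue. \<forall>t. poisson_symbol a p \<xi> t (borel_fourier f \<xi>) = ?F (\<xi>, t)"
    using assms(9)
  proof eventually_elim
    case (elim \<xi>)
    then show ?case
      using poisson_symbol_decomposition[of \<xi> "fI \<xi>" "fII \<xi>" "fhat \<xi>" a p] unfolding n by simp
  qed
  from AE_lebesgue_fst[OF this] have "AE x in lebesgue. ?T x = ?F x"
    by eventually_elim (simp add: poisson_multiplier_def split_beta)
  with ae have ae': "AE x in lebesgue. fourier_fun (poisson a p f) x = ?F x"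
    by eventually_elim (rule trans)
  \<comment> \<open>Measurability of the right-hand side is not read off from \<open>fI\<close> and
    \<open>fII\<close>; it comes from agreement almost everywhere with a measurable
    function.\<close>
  show ?thesis
    by (rule represented_by_cong[OF r lebesgue_measurable_cong_AE[OF _ ae'] ae'])
      (use r in \<open>simp add: represented_by_def\<close>)
qed

end
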